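(* Let $d=2$, let $E\subset[1,2]$ be nonempty, $\beta=\dim_{\mathrm M}E$ its upper Minkowski dimension and $\gamma=\dim_{\mathrm A}E$ its Assouad dimension. Let $\Delta_\beta$ be the closed triangle with vertices $P_1=(0,0)$, $P_{2,\beta}=(\frac1{1+\beta},\frac1{1+\beta})$, $P^{\mathrm{rad}}_{3,\beta}=(\frac2{3+\beta},\frac1{3+\beta})$, and let $P^{\mathrm{rad}}_{4,\gamma}=(\frac1{1+\gamma},\frac1{2(1+\gamma)})$. Then the following hold. (i) If $2\gamma-\beta<1$, then $\mathcal T_E^{\mathrm{rad}}=\Delta_\beta$ if and only if $\sup_{0<\delta<1}\delta^\beta N(E,\delta)<\infty$. (ii) If $2\gamma-\beta=1$, $\beta<1$ and $\sup_{0<\delta<1/2}\delta^\beta N(E,\delta)<\infty$, then $\Delta_\beta\setminus\{P^{\mathrm{rad}}_{3,\beta}\}\subset\mathcal T_E^{\mathrm{rad}}\subset\Delta_\beta$. (iii) If $2\gamma-\beta=1$ and $\sup_{0<\delta<1}\delta^\beta N(E,\delta)=\infty$, then $\mathcal T_E^{\mathrm{rad}}=\Delta_\beta\setminus[P_{2,\beta},P^{\mathrm{rad}}_{3,\beta}]$. (iv) If $2\gamma-\beta>1$, then $[P_1,P^{\mathrm{rad}}_{4,\gamma})\subset\mathcal T_E^{\mathrm{rad}}$. (v) If $\beta=1$ and $\sup_{0<\delta<1}\delta\log(\frac1\delta)N(E,\delta)=\infty$, then $M_E:L^p_{\mathrm{rad}}\to L^q$ is bounded if and only if $p>2$ and $p\le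 q\le2p$.
   Context: For $f\in L^1_{\mathrm{loc}}(\mathbb R^d)$ and $t>0$, $A_tf(x)$ is the average of $f$ over the sphere of radius $t$ centered at $x$ (with respect to normalized surface measure). For $E\subset[1,2]$, $M_Ef(x)=\sup_{t\in E}|A_tf(x)|$. $L^p_{\mathrm{rad}}\subset L^p(\mathbb R^d)$ is the space of radial $L^p$ functions. "$M_E:L^p_{\mathrm{rad}}\to L^q$ is bounded" means there is $C<\infty$ with $\|M_Ef\|_{L^q(\mathbb R^d)}\le C\|f\|_{L^p(\mathbb R^d)}$ for all $f\in L^p_{\mathrm{rad}}$. The radial type set is $\mathcal T_E^{\mathrm{rad}}=\{(\frac1p,\frac1q)\in[0,1]^2: M_E:L^p_{\mathrm{rad}}\to L^q\}$. For a set $F\subset[1,2]$ and $\delta\in(0,1)$, $N(F,\delta)$ is the minimum number of intervals of length $\delta$ required to cover $F$, and $\dim_{\mathrm M}E=\limsup_{\delta\to0}\frac{\log N(E,\delta)}{\log(1/\delta)}$. The Assouad dimension $\dim_{\mathrm A}E$ is the infimum of all $a>0$ for which there is $c\in(0,\infty)$ such that $N(E\cap J,\delta)\le c(|J|/\delta)^a$ for all $\delta\in(0,1)$ and all intervals $J\subset[1,2]$ with $|J|\ge\delta$. For points $P,Q$ in the plane, $[P,Q]$ is the closed line segment between them and $[P,Q)=[P,Q]\setminus\{Q\}$. *)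

theory Defs
  imports "HOL-Analysis.Analysis"
begin

section \<open>Circular means and maximal functions on the plane\<close>

text \<open>Normalized arc length on the unit circle.\<close>

definition circle_measure :: "(real^2) measure" where
  "circle_measure =
     distr (uniform_measure lborel {0..2 * pi}) borel (\<lambda>\<theta>. vector [cos \<theta>, sin \<theta>])"

definition circle_avg :: "real \<Rightarrow> (real^2 \<Rightarrow> complex) \<Rightarrow> real^2 \<Rightarrow> complex" where
  "circle_avg t f x = (\<integral>y. f (x + t *\<^sub>R y) \<partial>circle_measure)"

text \<open>
  The Bochner integral is \<open>0\<close> for a non-integrable function. As the supremum over \<open>t\<close> may be
  uncountable, this value must not enter it silently: where \<open>f\<close> is not absolutely integrable
  over the circle, the size of the average is taken to be \<open>\<infinity>\<close>. This is the correct value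
  for \<open>f \<ge> 0\<close>.
\<close>

definition circle_maximal :: "real set \<Rightarrow> (real^2 \<Rightarrow> complex) \<Rightarrow> real^2 \<Rightarrow> ennreal" where
  "circle_maximal E f x =
     (SUP t\<in>E. if integrable circle_measure (\<lambda>y. f (x + t *\<^sub>R y))
               then ennreal (norm (circle_avg t f x)) else \<infinity>)"

section \<open>Lebesgue norms and radial functions\<close>

text \<open>Intended for exponents \<open>a > 0\<close>.\<close>

definition ennreal_powr :: "ennreal \<Rightarrow> real \<Rightarrow> ennreal" where
  "ennreal_powr x a = (if x = \<infinity> then \<infinity> else ennreal (enn2real x powr a))"

text \<open>
  The \<open>L\<^sup>p\<close> norm of a function with values in \<open>[0,\<infinity>]\<close>, for \<open>1 \<le> p \<le> \<infinity>\<close>. The essential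
  supremum is written out because \<open>esssup\<close> of the library assigns \<open>\<infinity>\<close> to every
  non-measurable function.
\<close>

definition Lp_norm :: "'a measure \<Rightarrow> ennreal \<Rightarrow> ('a \<Rightarrow> ennreal) \<Rightarrow> ennreal" where
  "Lp_norm M p g =
     (if p = \<infinity> then Inf {c. AE x in M. g x \<le> c}
      else ennreal_powr (\<integral>\<^sup>+x. ennreal_powr (g x) (enn2real p) \<partial>M) (1 / enn2real p))"

definition radial :: "(real^2 \<Rightarrow> complex) \<Rightarrow> bool" where
  "radial f \<longleftrightarrow> (\<forall>x y. norm x = norm y \<longrightarrow> f x = f y)"

text \<open>
  Functions instead of classes modulo null sets: every class of radial \<open>L\<^sup>p\<close> functions has a
  Borel measurable representative that is radial everywhere. For such an \<open>f\<close> and \<open>t > 0\<close>, the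
  value of \<open>circle_avg t f x\<close> does not depend on the representative unless \<open>x = 0\<close>, because
  \<open>\<bar>x + t y\<bar>\<close> has an absolutely continuous distribution when \<open>x \<noteq> 0\<close>. Hence the maximal function
  is determined almost everywhere by the class, also for uncountable \<open>E\<close>.
\<close>

definition radial_Lp :: "ennreal \<Rightarrow> (real^2 \<Rightarrow> complex) set" where
  "radial_Lp p =
     {f. f \<in> borel_measurable borel \<and> radial f \<and> Lp_norm lborel p (\<lambda>x. ennreal (norm (f x))) < \<infinity>}"

definition radially_bounded :: "real set \<Rightarrow> ennreal \<Rightarrow> ennreal \<Rightarrow> bool" where
  "radially_bounded E p q \<longleftrightarrow>
     (\<exists>C::real. \<forall>f \<in> radial_Lp p.
        Lp_norm lborel q (circle_maximal E f)
          \<le> ennreal C * Lp_norm lborel p (\<lambda>x. ennreal (norm (f x))))"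

text \<open>\<open>1/\<infinity> = 0\<close> in \<^typ>\<open>ennreal\<close>, so the points lie in \<open>[0,1]\<^sup>2\<close>.\<close>

definition radial_type_set :: "real set \<Rightarrow> (real \<times> real) set" where
  "radial_type_set E =
     {(enn2real (1 / p), enn2real (1 / q)) | p q. 1 \<le> p \<and> 1 \<le> q \<and> radially_bounded E p q}"

section \<open>Covering numbers and dimensions of bounded sets of reals\<close>

text \<open>
  Closed intervals suffice, since every interval of length \<open>\<delta>\<close> lies in a closed one of the
  same length.
\<close>

definition covering_number :: "real set \<Rightarrow> real \<Rightarrow> nat" where
  "covering_number F \<delta> =
     (LEAST n. \<exists>A. finite A \<and> card A = n \<and> F \<subseteq> (\<Union>a\<in>A. {a..a + \<delta>}))"

definition upper_minkowski_dim :: "real set \<Rightarrow> ereal" where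
  "upper_minkowski_dim E =
     Limsup (at_right 0) (\<lambda>\<delta>. ereal (ln (real (covering_number E \<delta>)) / ln (1 / \<delta>)))"

text \<open>For subsets of \<open>[1,2]\<close>.\<close>

definition assouad_dim :: "real set \<Rightarrow> ereal" where
  "assouad_dim E =
     Inf {ereal a | a. 0 < a \<and>
       (\<exists>c>0. \<forall>\<delta>\<in>{0<..<1}. \<forall>J. is_interval J \<and> J \<subseteq> {1..2} \<and> \<delta> \<le> measure lborel J \<longrightarrow>
          real (covering_number (E \<inter> J) \<delta>) \<le> c * (measure lborel J / \<delta>) powr a)}"

end

(*
  In the variable v = |y|^2 the circular mean of a radial function at distance r from the origin
  becomes an integral of its profile against 1 / sqrt (((r + t)^2 - v) * (v - (r - t)^2)), and
  Lebesgue measure on the plane becomes pi dv. For exponents 1 < p <= q a three factor Hoelder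
  inequality turns the bound for the maximal function into a Schur test: it suffices to bound, for
  fixed v, the integral over r of the supremum over t of a power of the distance of v to the ends of
  the interval ((r - t)^2, (r + t)^2). Such a supremum is a negative power of the distance of
  r + sqrt v, r - sqrt v or sqrt v - r to E, and covering numbers control its integral: those of E
  for r >= 1/2, and for small r those of E in an interval of length comparable to r, which is where
  the Assouad dimension enters. On the line q = 2p all dyadic blocks in r contribute equally, and
  they are summed by Marcinkiewicz interpolation. For p > 2 the kernel is in L^p' and E plays no role.

  Necessity follows from indicator functions of annuli and of small balls, and at p = 2 from
  |x|^(-1) truncated near the origin.
*)

theory Submission
  imports Defs
begin

section \<open>Hoelder inequalities for extended nonnegative functions\<close>

text \<open>The Schur test has a parameter a: the share of the inverse square root singularity that
  enters the L^p' norm. The q-th power of the rest has exponent \<kappa> = (1 - a) q / 2.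
  Integrability of the first share means \<kappa> > q (2/p - 1) / 2; potentials of the distance to E
  need \<kappa> < 1 - \<beta> for large r and, on q = 2p, \<kappa> < 1 - \<gamma> for small r. Radii
  r close to t add q (2/p - 1) \<le> 1 - \<beta>, the side of the triangle through P2 and P3. On
  that side the lower limit for \<kappa> is (1 - \<beta>) / 2. It is below 1 - \<beta> if \<beta> <
  1, which is why the vertices are reached without logarithms, and below 1 - \<gamma> exactly if
  2\<gamma> - \<beta> < 1. If 2\<gamma> - \<beta> = 1, a geometric mean of local and global covering
  bounds still gives room away from q = 2p. The formal obstacle is that a supremum over an
  uncountable E need not be measurable, so each bound passes through a majorant free of t that is
  measurable in r and v. All kernels are nonnegative, which reduces interpolation to
  Hoelder.\<close>

lemma ennreal_powr_ennreal: "0 \<le> x \<Longrightarrow> ennreal_powr (ennreal x) a = ennreal (x powr a)"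
  by (simp add: ennreal_powr_def)

lemma ennreal_powr_top [simp]: "ennreal_powr top a = top"
  by (simp add: ennreal_powr_def)

lemma ennreal_powr_0 [simp]: "ennreal_powr 0 a = 0"
  by (simp add: ennreal_powr_def)

lemma ennreal_powr_mono: "0 \<le> a \<Longrightarrow> x \<le> y \<Longrightarrow> ennreal_powr x a \<le> ennreal_powr y a"
  by (cases x; cases y) (auto simp: ennreal_powr_ennreal top_unique intro!: ennreal_leI powr_mono2)

lemma ennreal_powr_eq_0_iff: "ennreal_powr x a = 0 \<longleftrightarrow> x = 0"
  by (cases x) (auto simp: ennreal_powr_ennreal)

lemma ennreal_powr_mult: "ennreal_powr (x * y) a = ennreal_powr x a * ennreal_powr y a"
proof (cases x; cases y)
  fix r s :: real assume "0 \<le> r" "x = ennreal r" "0 \<le> s" "y = ennreal s"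
  then show ?thesis
    by (simp add: ennreal_powr_ennreal powr_mult flip: ennreal_mult)
next
  fix r :: real assume "0 \<le> r" "x = ennreal r" "y = top"
  then show ?thesis
    by (cases "r = 0") (auto simp: ennreal_powr_ennreal ennreal_mult_top)
next
  fix r :: real assume "0 \<le> r" "y = ennreal r" "x = top"
  then show ?thesis
    by (cases "r = 0") (auto simp: ennreal_powr_ennreal ennreal_top_mult)
qed auto

lemma ennreal_powr_powr: "ennreal_powr (ennreal_powr x a) b = ennreal_powr x (a * b)"
  by (cases x) (auto simp: ennreal_powr_ennreal powr_powr)

lemma ennreal_powr_one [simp]: "ennreal_powr x 1 = x"
  by (cases x) (auto simp: ennreal_powr_ennreal)

lemma measurable_ennreal_powr [measurable]:
  assumes "f \<in> borel_measurable M"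
  shows "(\<lambda>x. ennreal_powr (f x) a) \<in> borel_measurable M"
proof -
  have "(\<lambda>x. ennreal_powr x a) \<in> borel_measurable borel"
    unfolding ennreal_powr_def by measurable
  then show ?thesis using assms by simp
qed

lemma ennreal_powr_add_le:
  assumes "0 \<le> a"
  shows "ennreal_powr (x + y) a \<le> ennreal (2 powr a) * (ennreal_powr x a + ennreal_powr y a)"
proof (cases "x \<le> y")
  case True
  have "ennreal_powr (x + y) a \<le> ennreal_powr (ennreal 2 * y) a"
    using True by (intro ennreal_powr_mono assms) (simp add: mult_2 add_mono ennreal_numeral)
  also have "\<dots> = ennreal (2 powr a) * ennreal_powr y a"
    unfolding ennreal_powr_mult by (subst ennreal_powr_ennreal) auto
  also have "\<dots> \<le> ennreal (2 powr a) * (ennreal_powr x a + ennreal_powr y a)"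
    by (intro mult_left_mono) auto
  finally show ?thesis .
next
  case False
  have "ennreal_powr (x + y) a \<le> ennreal_powr (ennreal 2 * x) a"
    using False by (intro ennreal_powr_mono assms) (simp add: mult_2 add_mono ennreal_numeral)
  also have "\<dots> = ennreal (2 powr a) * ennreal_powr x a"
    unfolding ennreal_powr_mult by (subst ennreal_powr_ennreal) auto
  also have "\<dots> \<le> ennreal (2 powr a) * (ennreal_powr x a + ennreal_powr y a)"
    by (intro mult_left_mono) auto
  finally show ?thesis .
qed

lemma ennreal_powr_Young:
  assumes "0 < u" "0 < v" "u + v = 1"
  shows "ennreal_powr x u * ennreal_powr y v \<le> ennreal u * x + ennreal v * y"
proof (cases x; cases y)
  fix r s :: real assume *: "0 \<le> r" "x = ennreal r" "0 \<le> s" "y = ennreal s"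
  have "r powr u * s powr v \<le> u * r + v * s"
    using Youngs_inequality_0[of u v r s] * assms by (cases "r = 0"; cases "s = 0") auto
  then show ?thesis
    using * assms by (simp add: ennreal_powr_ennreal ennreal_leI flip: ennreal_mult ennreal_plus)
qed (use assms in \<open>auto simp: ennreal_mult_top\<close>)

text \<open>Normalise both integrals and apply Young pointwise. Since 0 times infinity is 0, a
  vanishing integral must be treated before an infinite one.\<close>

lemma nn_integral_Holder:
  assumes [measurable]: "f \<in> borel_measurable M" "g \<in> borel_measurable M"
    and uv: "0 < u" "0 < v" "u + v = (1::real)"
  shows "(\<integral>\<^sup>+x. ennreal_powr (f x) u * ennreal_powr (g x) v \<partial>M)
    \<le> ennreal_powr (\<integral>\<^sup>+x. f x \<partial>M) u * ennreal_powr (\<integral>\<^sup>+x. g x \<partial>M) v"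
proof -
  let ?F = "\<integral>\<^sup>+x. f x \<partial>M" and ?G = "\<integral>\<^sup>+x. g x \<partial>M"
  consider "?F = 0" | "?G = 0" | "?F \<noteq> 0" "?G \<noteq> 0" "?F = top \<or> ?G = top"
    | a b where "0 < a" "0 < b" "?F = ennreal a" "?G = ennreal b"
    by (metis ennreal_0 ennreal_cases less_eq_real_def)
  then show ?thesis
  proof cases
    case 1
    then have "AE x in M. f x = 0"
      by (simp add: nn_integral_0_iff_AE)
    then have "(\<integral>\<^sup>+x. ennreal_powr (f x) u * ennreal_powr (g x) v \<partial>M) = 0"
      by (subst nn_integral_0_iff_AE) (auto elim!: eventually_mono)
    then show ?thesis by simp
  next
    case 2
    then have "AE x in M. g x = 0"
      by (simp add: nn_integral_0_iff_AE)
    then have "(\<integral>\<^sup>+x. ennreal_powr (f x) u * ennreal_powr (g x) v \<partial>M) = 0"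
      by (subst nn_integral_0_iff_AE) (auto elim!: eventually_mono)
    then show ?thesis by simp
  next
    case 3
    then have "ennreal_powr ?F u * ennreal_powr ?G v = top"
      by (auto simp: ennreal_mult_eq_top_iff ennreal_powr_eq_0_iff)
    then show ?thesis by simp
  next
    case 4
    let ?c = "ennreal (a powr u * b powr v)"
    have "ennreal_powr (f x) u * ennreal_powr (g x) v
        \<le> ?c * (ennreal (u / a) * f x + ennreal (v / b) * g x)" for x
    proof -
      have "ennreal_powr (f x) u * ennreal_powr (g x) v
         = ennreal_powr (ennreal a * (ennreal (1 / a) * f x)) u
           * ennreal_powr (ennreal b * (ennreal (1 / b) * g x)) v"
        using 4 by (simp flip: mult.assoc ennreal_mult)
      also have "\<dots> = ?c * (ennreal_powr (ennreal (1 / a) * f x) u * ennreal_powr (ennreal (1 / b) * g x) v)"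
        using 4 by (simp add: ennreal_powr_mult[of "ennreal a"] ennreal_powr_mult[of "ennreal b"]
            ennreal_powr_ennreal ennreal_mult ac_simps)
      also have "\<dots> \<le> ?c * (ennreal u * (ennreal (1 / a) * f x) + ennreal v * (ennreal (1 / b) * g x))"
        by (intro mult_left_mono ennreal_powr_Young uv) auto
      also have "\<dots> = ?c * (ennreal (u / a) * f x + ennreal (v / b) * g x)"
        using 4 uv by (simp flip: mult.assoc ennreal_mult)
      finally show ?thesis .
    qed
    then have "(\<integral>\<^sup>+x. ennreal_powr (f x) u * ennreal_powr (g x) v \<partial>M)
        \<le> (\<integral>\<^sup>+x. ?c * (ennreal (u / a) * f x + ennreal (v / b) * g x) \<partial>M)"
      by (intro nn_integral_mono)
    also have "\<dots> = ?c * (ennreal (u / a) * ?F + ennreal (v / b) * ?G)"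
      by (simp add: nn_integral_cmult nn_integral_add)
    also have "\<dots> = ?c"
      using 4 uv by (simp flip: ennreal_mult ennreal_plus)
    also have "\<dots> = ennreal_powr ?F u * ennreal_powr ?G v"
      using 4 by (simp add: ennreal_powr_ennreal ennreal_mult)
    finally show ?thesis .
  qed
qed

text \<open>Three factor Hoelder inequality for \<open>k\<^sub>1\<close>, \<open>k\<^sub>2 g\<^sup>p\<^sup>/\<^sup>q\<close>, \<open>g\<^sup>1\<^sup>-\<^sup>p\<^sup>/\<^sup>q\<close>.\<close>

lemma nn_integral_Schur_Holder:
  fixes k1 k2 g :: "'a \<Rightarrow> real"
  assumes [measurable]: "k1 \<in> borel_measurable M" "k2 \<in> borel_measurable M" "g \<in> borel_measurable M"
    and pos: "\<And>x. 0 \<le> k1 x" "\<And>x. 0 \<le> k2 x" "\<And>x. 0 \<le> g x"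
    and pq: "1 < p" "p \<le> q"
    and \<mu>: "(\<integral>\<^sup>+x. ennreal (g x powr p) \<partial>M) \<le> ennreal \<mu>" "0 < \<mu>"
  shows "ennreal_powr (\<integral>\<^sup>+x. ennreal (k1 x * k2 x * g x) \<partial>M) q
    \<le> ennreal_powr (\<integral>\<^sup>+x. ennreal (k1 x powr (p / (p - 1))) \<partial>M) (q * (1 - 1 / p))
      * ennreal (\<mu> powr (q / p - 1)) * (\<integral>\<^sup>+x. ennreal (k2 x powr q * g x powr p) \<partial>M)"
proof -
  let ?K = "\<integral>\<^sup>+x. ennreal (k1 x powr (p / (p - 1))) \<partial>M"
  let ?I = "\<integral>\<^sup>+x. ennreal (k2 x powr q * g x powr p) \<partial>M"
  have 1: "(\<integral>\<^sup>+x. ennreal (k1 x * k2 x * g x) \<partial>M)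
     = (\<integral>\<^sup>+x. ennreal_powr (ennreal (k1 x powr (p / (p - 1)))) (1 - 1 / p) *
          ennreal_powr (ennreal ((k2 x * g x) powr p)) (1 / p) \<partial>M)"
  proof (intro nn_integral_cong)
    fix x
    have "p / (p - 1) * (1 - 1 / p) = 1" using pq by (simp add: field_simps)
    then show "ennreal (k1 x * k2 x * g x) = ennreal_powr (ennreal (k1 x powr (p / (p - 1)))) (1 - 1 / p) *
          ennreal_powr (ennreal ((k2 x * g x) powr p)) (1 / p)"
      using pq pos by (simp add: ennreal_powr_ennreal powr_powr flip: ennreal_mult)
  qed
  also have "\<dots> \<le> ennreal_powr ?K (1 - 1 / p)
      * ennreal_powr (\<integral>\<^sup>+x. ennreal ((k2 x * g x) powr p) \<partial>M) (1 / p)"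
    using pq by (intro nn_integral_Holder) auto
  finally have A: "ennreal_powr (\<integral>\<^sup>+x. ennreal (k1 x * k2 x * g x) \<partial>M) q
      \<le> ennreal_powr (ennreal_powr ?K (1 - 1 / p)
      * ennreal_powr (\<integral>\<^sup>+x. ennreal ((k2 x * g x) powr p) \<partial>M) (1 / p)) q"
    using pq by (intro ennreal_powr_mono) auto
  \<comment> \<open>(k2 g)^p is the geometric mean of k2^q g^p and g^p with weights p/q and 1 - p/q,
    which allows a second use of Hoelder.\<close>
  have B: "(\<integral>\<^sup>+x. ennreal ((k2 x * g x) powr p) \<partial>M) \<le> ennreal_powr ?I (p / q) * ennreal (\<mu> powr (1 - p / q))"
  proof (cases "p = q")
    \<comment> \<open>The weight 1 - p/q is 0, outside the range of
      \<open>nn_integral_Holder\<close>; \<open>\<mu> powr 0\<close> is 1 because \<mu> > 0.\<close>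
    case True
    then show ?thesis using pos pq \<mu> by (simp add: powr_mult)
  next
    case False
    have "(\<integral>\<^sup>+x. ennreal ((k2 x * g x) powr p) \<partial>M) =
       (\<integral>\<^sup>+x. ennreal_powr (ennreal (k2 x powr q * g x powr p)) (p / q)
          * ennreal_powr (ennreal (g x powr p)) (1 - p / q) \<partial>M)"
    proof (intro nn_integral_cong)
      fix x
      have *: "g x powr (p * (p / q)) * g x powr (p * (1 - p / q)) = g x powr p"
        using pq by (simp add: right_diff_distrib flip: powr_add)
      have "ennreal_powr (ennreal (k2 x powr q * g x powr p)) (p / q) * ennreal_powr (ennreal (g x powr p)) (1 - p / q)
         = ennreal (k2 x powr p * (g x powr (p * (p / q)) * g x powr (p * (1 - p / q))))"
        using pos pq by (simp add: ennreal_powr_ennreal powr_powr powr_mult ac_simps flip: ennreal_mult)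
      then show "ennreal ((k2 x * g x) powr p) = ennreal_powr (ennreal (k2 x powr q * g x powr p)) (p / q)
          * ennreal_powr (ennreal (g x powr p)) (1 - p / q)"
        unfolding * using pos by (simp add: powr_mult)
    qed
    also have "\<dots> \<le> ennreal_powr ?I (p / q) * ennreal_powr (\<integral>\<^sup>+x. ennreal (g x powr p) \<partial>M) (1 - p / q)"
      using pq False by (intro nn_integral_Holder) auto
    also have "\<dots> \<le> ennreal_powr ?I (p / q) * ennreal_powr (ennreal \<mu>) (1 - p / q)"
      using pq \<mu> by (intro mult_left_mono ennreal_powr_mono) auto
    finally show ?thesis using \<mu> by (simp add: ennreal_powr_ennreal)
  qed
  have "ennreal_powr (ennreal_powr ?K (1 - 1 / p)
      * ennreal_powr (\<integral>\<^sup>+x. ennreal ((k2 x * g x) powr p) \<partial>M) (1 / p)) q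
     \<le> ennreal_powr (ennreal_powr ?K (1 - 1 / p)
      * ennreal_powr (ennreal_powr ?I (p / q) * ennreal (\<mu> powr (1 - p / q))) (1 / p)) q"
    using pq B by (intro ennreal_powr_mono mult_left_mono) auto
  also have "\<dots> = ennreal_powr ?K (q * (1 - 1 / p)) * ennreal (\<mu> powr (q / p - 1)) * ?I"
  proof -
    have "(1 - p / q) * ((1 / p) * q) = q / p - 1" "(p/q) * (1/p) * q = 1" using pq by (auto simp: field_simps)
    then show ?thesis
      using \<mu> pq by (simp add: ennreal_powr_mult ennreal_powr_powr ennreal_powr_ennreal powr_powr ac_simps)
  qed
  finally show ?thesis using A by (rule order_trans[rotated])
qed

section \<open>Circular means of radial functions\<close>

lemma nn_integral_lborel_by_cdf:
  fixes X :: "'a::euclidean_space \<Rightarrow> real" and w h :: "real \<Rightarrow> ennreal"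
  assumes [measurable]: "X \<in> borel_measurable borel" "w \<in> borel_measurable borel" "h \<in> borel_measurable borel"
    and cdf: "\<And>a. emeasure lborel {x. X x \<le> a} = (\<integral>\<^sup>+v. w v * indicator {..a} v \<partial>lborel)"
    and fin: "\<And>a. emeasure lborel {x. X x \<le> a} \<noteq> \<infinity>"
  shows "(\<integral>\<^sup>+x. h (X x) \<partial>lborel) = (\<integral>\<^sup>+v. w v * h v \<partial>lborel)"
proof -
  have eq: "distr lborel borel X = density lborel w"
  proof (rule measure_eqI_generator_eq[where E = "range atMost" and \<Omega> = UNIV and A = "\<lambda>i. {..real i}"])
    show "Int_stable (range atMost :: real set set)"
      by (auto simp: Int_stable_def)
    show "emeasure (distr lborel borel X) Y = emeasure (density lborel w) Y" if "Y \<in> range atMost" for Y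
      using that by (auto simp: emeasure_distr emeasure_density vimage_def cdf)
    show "sets (distr lborel borel X) = sigma_sets UNIV (range atMost)"
      by (simp add: borel_eq_atMost)
    show "sets (density lborel w) = sigma_sets UNIV (range atMost)"
      by (simp add: borel_eq_atMost)
    show "(\<Union>i. {..real i}) = UNIV"
      using real_arch_simple by auto
    show "emeasure (distr lborel borel X) {..real i} \<noteq> \<infinity>" for i
      using fin[of "real i"] by (simp add: emeasure_distr vimage_def)
  qed auto
  have "(\<integral>\<^sup>+x. h (X x) \<partial>lborel) = (\<integral>\<^sup>+v. h v \<partial>distr lborel borel X)"
    by (simp add: nn_integral_distr)
  also have "\<dots> = (\<integral>\<^sup>+v. w v * h v \<partial>lborel)"
    unfolding eq by (simp add: nn_integral_density)
  finally show ?thesis .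
qed

lemma emeasure_cball_plane:
  assumes "0 \<le> a"
  shows "emeasure lborel {x::real^2. norm x \<le> a} = ennreal (pi * a\<^sup>2)"
proof -
  have "{x::real^2. norm x \<le> a} = cball 0 a" by auto
  then show ?thesis using assms by (simp add: emeasure_cball unit_ball_vol_2)
qed

text \<open>A disc of squared radius a has area pi a, so |x|^2 has the constant density pi on the
  positive axis. This makes v = |x|^2 the convenient variable for profiles.\<close>

lemma nn_integral_norm_sq_plane:
  fixes h :: "real \<Rightarrow> ennreal"
  assumes [measurable]: "h \<in> borel_measurable borel"
  shows "(\<integral>\<^sup>+x. h ((norm (x::real^2))\<^sup>2) \<partial>lborel)
    = (\<integral>\<^sup>+v. ennreal pi * indicator {0<..} v * h v \<partial>lborel)"
proof (rule nn_integral_lborel_by_cdf)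
  have *: "emeasure lborel {x::real^2. (norm x)\<^sup>2 \<le> a} = ennreal (pi * max 0 a)" for a
  proof (cases "0 \<le> a")
    case True
    then have "{x::real^2. (norm x)\<^sup>2 \<le> a} = {x. norm x \<le> sqrt a}"
      by (auto simp: real_le_rsqrt real_le_lsqrt intro: order_trans[OF power_mono[of _ "sqrt a" 2]])
    then show ?thesis using True by (simp add: emeasure_cball_plane)
  next
    case False
    then have "{x::real^2. (norm x)\<^sup>2 \<le> a} = {}"
      by (auto simp: not_le) (smt (verit) zero_le_power2)
    then show ?thesis using False by simp
  qed
  show "emeasure lborel {x::real^2. (norm x)\<^sup>2 \<le> a}
      = (\<integral>\<^sup>+v. ennreal pi * indicator {0<..} v * indicator {..a} v \<partial>lborel)" for a
  proof -
    have "(\<integral>\<^sup>+v. ennreal pi * indicator {0<..} v * indicator {..a} v \<partial>lborel)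
       = (\<integral>\<^sup>+v. ennreal pi * indicator {0<..a} v \<partial>lborel)"
      by (intro nn_integral_cong) (auto split: split_indicator)
    also have "\<dots> = ennreal pi * emeasure lborel {0<..a}"
      by (simp add: nn_integral_cmult)
    also have "\<dots> = ennreal (pi * max 0 a)"
      by (cases "0 \<le> a") (auto simp: ennreal_mult)
    finally show ?thesis by (simp add: *)
  qed
  show "emeasure lborel {x::real^2. (norm x)\<^sup>2 \<le> a} \<noteq> \<infinity>" for a
    by (simp add: *)
qed auto

lemma nn_integral_norm_plane:
  fixes h :: "real \<Rightarrow> ennreal"
  assumes [measurable]: "h \<in> borel_measurable borel"
  shows "(\<integral>\<^sup>+x. h (norm (x::real^2)) \<partial>lborel)
    = (\<integral>\<^sup>+r. ennreal (2 * pi * r) * indicator {0<..} r * h r \<partial>lborel)"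
proof (rule nn_integral_lborel_by_cdf)
  have *: "emeasure lborel {x::real^2. norm x \<le> a} = ennreal (pi * (max 0 a)\<^sup>2)" for a
  proof (cases "0 \<le> a")
    case True
    then show ?thesis by (simp add: emeasure_cball_plane)
  next
    case False
    then have "{x::real^2. norm x \<le> a} = {}"
      by (auto simp: not_le) (smt (verit) norm_ge_zero)
    then show ?thesis using False by simp
  qed
  show "emeasure lborel {x::real^2. norm x \<le> a}
      = (\<integral>\<^sup>+r. ennreal (2 * pi * r) * indicator {0<..} r * indicator {..a} r \<partial>lborel)" for a
  proof (cases "0 \<le> a")
    case True
    have "(\<integral>\<^sup>+r. ennreal (2 * pi * r) * indicator {0<..} r * indicator {..a} r \<partial>lborel)
       = (\<integral>\<^sup>+r. ennreal (2 * pi * r) * indicator {0..a} r \<partial>lborel)"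
      by (intro nn_integral_cong) (auto split: split_indicator)
    also have "\<dots> = ennreal (pi * a\<^sup>2 - pi * 0\<^sup>2)"
      using True by (intro nn_integral_FTC_Icc) (auto intro!: derivative_eq_intros)
    finally show ?thesis using True by (simp add: *)
  next
    case False
    then have "(\<integral>\<^sup>+r. ennreal (2 * pi * r) * indicator {0<..} r * indicator {..a} r \<partial>lborel)
       = (\<integral>\<^sup>+r. 0 \<partial>(lborel::real measure))"
      by (intro nn_integral_cong) (auto split: split_indicator)
    with False show ?thesis by (simp add: *)
  qed
  show "emeasure lborel {x::real^2. norm x \<le> a} \<noteq> \<infinity>" for a
    by (simp add: *)
qed auto

section \<open>Circular means as integrals over the angle\<close>

lemma nn_integral_periodic_shift:
  fixes g :: "real \<Rightarrow> ennreal"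
  assumes [measurable]: "g \<in> borel_measurable borel"
    and per: "\<And>x. g (x + T) = g x" and "0 \<le> c" "c \<le> T"
  shows "(\<integral>\<^sup>+x. g (x - c) * indicator {0..T} x \<partial>lborel) = (\<integral>\<^sup>+x. g x * indicator {0..T} x \<partial>lborel)"
proof -
  have "(\<integral>\<^sup>+x. g (x - c) * indicator {0..T} x \<partial>lborel)
     = (\<integral>\<^sup>+x. g (x - c) * indicator {0..<c} x + g (x - c) * indicator {c..T} x \<partial>lborel)"
    using assms by (intro nn_integral_cong) (auto split: split_indicator)
  also have "\<dots> = (\<integral>\<^sup>+x. g (x - c) * indicator {0..<c} x \<partial>lborel)
      + (\<integral>\<^sup>+x. g (x - c) * indicator {c..T} x \<partial>lborel)"
    by (intro nn_integral_add) auto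
  also have "(\<integral>\<^sup>+x. g (x - c) * indicator {0..<c} x \<partial>lborel)
     = (\<integral>\<^sup>+x. g x * indicator {T - c..<T} x \<partial>lborel)"
  proof -
    have "g (c - T + 1 * x - c) = g x" for x
      using per[of "x - T"] by (simp add: algebra_simps)
    moreover have "indicator {0..<c} (c - T + 1 * x) = (indicator {T - c..<T} x :: ennreal)" for x
      by (auto split: split_indicator)
    ultimately show ?thesis
      by (subst nn_integral_real_affine[where c = 1 and t = "c - T"]) auto
  qed
  also have "(\<integral>\<^sup>+x. g (x - c) * indicator {c..T} x \<partial>lborel)
     = (\<integral>\<^sup>+x. g x * indicator {0..T - c} x \<partial>lborel)"
  proof -
    have "indicator {c..T} (c + 1 * x) = (indicator {0..T - c} x :: ennreal)" for x
      by (auto split: split_indicator)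
    then show ?thesis
      by (subst nn_integral_real_affine[where c = 1 and t = c]) auto
  qed
  also have "(\<integral>\<^sup>+x. g x * indicator {T - c..<T} x \<partial>lborel) + (\<integral>\<^sup>+x. g x * indicator {0..T - c} x \<partial>lborel)
     = (\<integral>\<^sup>+x. g x * indicator {T - c..<T} x + g x * indicator {0..T - c} x \<partial>lborel)"
    by (intro nn_integral_add[symmetric]) auto
  also have "\<dots> = (\<integral>\<^sup>+x. g x * indicator {0..T} x \<partial>lborel)"
  proof (intro nn_integral_cong_AE)
    \<comment> \<open>After the shifts the two pieces overlap at T - c and miss T.\<close>
    have "AE x in lborel. x \<notin> {T - c, T}"
      by (intro AE_not_in finite_imp_null_set_lborel) auto
    then show "AE x in lborel. g x * indicator {T - c..<T} x + g x * indicator {0..T - c} x = g x * indicator {0..T} x"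
      by eventually_elim (use assms in \<open>auto split: split_indicator\<close>)
  qed
  finally show ?thesis .
qed

lemma norm_vec2: "norm (x::real^2) = sqrt ((x$1)\<^sup>2 + (x$2)\<^sup>2)"
  by (simp add: norm_vec_def L2_set_def UNIV_2)

lemma measurable_vec2: "(\<lambda>\<theta>::real. vector [cos \<theta>, sin \<theta>] :: real^2) \<in> borel_measurable borel"
proof (rule borel_measurable_continuous_onI)
  have "(\<lambda>\<theta>::real. vector [cos \<theta>, sin \<theta>] :: real^2) = (\<lambda>\<theta>. \<chi> i. if i = 1 then cos \<theta> else sin \<theta>)"
    by (auto simp: vec_eq_iff forall_2)
  moreover have "continuous_on UNIV (\<lambda>\<theta>::real. (\<chi> i. if i = 1 then cos \<theta> else sin \<theta>) :: real^2)"
  proof (intro continuous_on_vec_lambda)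
    show "continuous_on UNIV (\<lambda>\<theta>::real. if i = 1 then cos \<theta> else sin \<theta>)" for i :: 2
      by (cases "i = 1") (auto intro!: continuous_at_imp_continuous_on)
  qed
  ultimately show "continuous_on UNIV (\<lambda>\<theta>::real. vector [cos \<theta>, sin \<theta>] :: real^2)" by (simp only:)
qed

lemma nn_integral_circle_radial:
  fixes h :: "real \<Rightarrow> ennreal" and x :: "real^2"
  assumes [measurable]: "h \<in> borel_measurable borel"
  shows "(\<integral>\<^sup>+y. h ((norm (x + t *\<^sub>R y))\<^sup>2) \<partial>circle_measure)
    = ennreal (1 / pi) * (\<integral>\<^sup>+\<theta>. h ((norm x)\<^sup>2 + t\<^sup>2 - 2 * norm x * t * cos \<theta>) * indicator {0..pi} \<theta> \<partial>lborel)"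
proof -
  let ?r = "norm x"
  let ?e = "\<lambda>\<theta>::real. vector [cos \<theta>, sin \<theta>] :: real^2"
  let ?g = "\<lambda>\<theta>. h (?r\<^sup>2 + t\<^sup>2 - 2 * ?r * t * cos \<theta>)"
  note measurable_vec2[measurable]
  \<comment> \<open>\<psi> is the direction of -x. With this sign, v = |x + t y|^2 increases with
    the angle from (r - t)^2 at 0 to (r + t)^2 at pi.\<close>
  obtain \<psi> where \<psi>: "0 \<le> \<psi>" "\<psi> < 2 * pi" "x $ 1 = - ?r * cos \<psi>" "x $ 2 = - ?r * sin \<psi>"
  proof (cases "x = 0")
    case True
    then show ?thesis using that[of 0] by simp
  next
    case False
    then have "(- x $ 1 / ?r)\<^sup>2 + (- x $ 2 / ?r)\<^sup>2 = 1"
      by (simp add: norm_vec2 power_divide sum_power2_eq_zero_iff vec_eq_iff forall_2 flip: add_divide_distrib)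
    from sincos_total_2pi[OF this] obtain \<psi> where
      "0 \<le> \<psi>" "\<psi> < 2 * pi" "- x $ 1 / ?r = cos \<psi>" "- x $ 2 / ?r = sin \<psi>" by metis
    then show ?thesis using False that[of \<psi>] by (simp add: field_simps)
  qed
  have nrm: "(norm (x + t *\<^sub>R ?e \<theta>))\<^sup>2 = ?r\<^sup>2 + t\<^sup>2 - 2 * ?r * t * cos (\<theta> - \<psi>)" for \<theta>
  proof -
    have "(norm (x + t *\<^sub>R ?e \<theta>))\<^sup>2 = (x$1 + t * cos \<theta>)\<^sup>2 + (x$2 + t * sin \<theta>)\<^sup>2"
      by (simp add: norm_vec2)
    also have "\<dots> = (?r\<^sup>2) * ((cos \<psi>)\<^sup>2 + (sin \<psi>)\<^sup>2) + t\<^sup>2 * ((cos \<theta>)\<^sup>2 + (sin \<theta>)\<^sup>2) - 2 * ?r * t * cos (\<theta> - \<psi>)"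
    proof -
      have "(- r * a + t * c)\<^sup>2 + (- r * b + t * d)\<^sup>2
          = r\<^sup>2 * (a\<^sup>2 + b\<^sup>2) + t\<^sup>2 * (c\<^sup>2 + d\<^sup>2) - 2 * r * t * (c * a + d * b)" for a b c d r :: real
        by (simp add: power2_eq_square algebra_simps)
      then show ?thesis unfolding \<psi>(3,4) cos_diff by blast
    qed
    finally show ?thesis by simp
  qed
  have cm: "emeasure lborel {0..2 * pi} = ennreal (2 * pi)" by simp
  have double: "z + z = ennreal 2 * z" for z :: ennreal
    by (simp add: mult_2)
  have "(\<integral>\<^sup>+y. h ((norm (x + t *\<^sub>R y))\<^sup>2) \<partial>circle_measure)
     = (\<integral>\<^sup>+\<theta>. h ((norm (x + t *\<^sub>R ?e \<theta>))\<^sup>2) * indicator {0..2*pi} \<theta> \<partial>lborel) / ennreal (2 * pi)"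
    unfolding circle_measure_def
    by (subst nn_integral_distr) (auto simp: nn_integral_uniform_measure cm)
  also have "(\<integral>\<^sup>+\<theta>. h ((norm (x + t *\<^sub>R ?e \<theta>))\<^sup>2) * indicator {0..2*pi} \<theta> \<partial>lborel)
     = (\<integral>\<^sup>+\<theta>. ?g (\<theta> - \<psi>) * indicator {0..2*pi} \<theta> \<partial>lborel)"
    by (simp add: nrm)
  also have "\<dots> = (\<integral>\<^sup>+\<theta>. ?g \<theta> * indicator {0..2*pi} \<theta> \<partial>lborel)"
    using \<psi> by (intro nn_integral_periodic_shift) auto
  also have "\<dots> = (\<integral>\<^sup>+\<theta>. ?g \<theta> * indicator {0..pi} \<theta> + ?g \<theta> * indicator {pi<..2*pi} \<theta> \<partial>lborel)"
    by (intro nn_integral_cong) (auto split: split_indicator)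
  also have "\<dots> = (\<integral>\<^sup>+\<theta>. ?g \<theta> * indicator {0..pi} \<theta> \<partial>lborel) + (\<integral>\<^sup>+\<theta>. ?g \<theta> * indicator {pi<..2*pi} \<theta> \<partial>lborel)"
    by (intro nn_integral_add) auto
  also have "(\<integral>\<^sup>+\<theta>. ?g \<theta> * indicator {pi<..2*pi} \<theta> \<partial>lborel) = (\<integral>\<^sup>+\<theta>. ?g \<theta> * indicator {0..<pi} \<theta> \<partial>lborel)"
  proof -
    have "indicator {pi<..2*pi} (2 * pi + (-1) * x) = (indicator {0..<pi} x :: ennreal)" for x
      by (auto split: split_indicator)
    moreover have "cos (2 * pi + (-1) * x) = cos x" for x
      using cos_periodic[of "-x"] by (simp add: add.commute)
    ultimately show ?thesis
      by (subst nn_integral_real_affine[where c = "-1" and t = "2 * pi"]) auto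
  qed
  also have "\<dots> = (\<integral>\<^sup>+\<theta>. ?g \<theta> * indicator {0..pi} \<theta> \<partial>lborel)"
  proof (intro nn_integral_cong_AE)
    have "AE x in lborel. x \<notin> {pi}" by (intro AE_not_in) auto
    then show "AE x in lborel. ?g x * indicator {0..<pi} x = ?g x * indicator {0..pi} x"
      by eventually_elim (auto split: split_indicator)
  qed
  also have "\<dots> + \<dots> = ennreal 2 * \<dots>"
    by (rule double)
  finally have eq: "(\<integral>\<^sup>+y. h ((norm (x + t *\<^sub>R y))\<^sup>2) \<partial>circle_measure)
     = ennreal 2 * (\<integral>\<^sup>+\<theta>. ?g \<theta> * indicator {0..pi} \<theta> \<partial>lborel) / ennreal (2 * pi)" .
  also have "\<dots> = (ennreal 2 * inverse (ennreal (2 * pi))) * (\<integral>\<^sup>+\<theta>. ?g \<theta> * indicator {0..pi} \<theta> \<partial>lborel)"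
    by (simp add: divide_ennreal_def ac_simps)
  also have "ennreal 2 * inverse (ennreal (2 * pi)) = ennreal (1 / pi)"
  proof -
    have "inverse (ennreal (2 * pi)) = ennreal (1 / (2 * pi))"
      by (subst inverse_ennreal) (auto simp: inverse_eq_divide)
    moreover have "ennreal 2 * ennreal (1 / (2 * pi)) = ennreal (2 * (1 / (2 * pi)))"
      by (rule ennreal_mult[symmetric]) auto
    ultimately show ?thesis by simp
  qed
  finally show ?thesis .
qed

text \<open>The density of v = r^2 + t^2 - 2 r t cos \<theta> when \<theta> runs through [0, pi]. By
  Heron's formula the square root is four times the area of the triangle with sides r, t and sqrt v,
  so the value is unchanged if r and sqrt v are exchanged.\<close>

definition circle_kernel :: "real \<Rightarrow> real \<Rightarrow> real \<Rightarrow> real" where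
  "circle_kernel t r v =
     indicator {(r - t)\<^sup>2<..<(r + t)\<^sup>2} v / sqrt (((r + t)\<^sup>2 - v) * (v - (r - t)\<^sup>2))"

lemma measurable_circle_kernel [measurable]: "circle_kernel t r \<in> borel_measurable borel"
  unfolding circle_kernel_def by measurable

lemma circle_kernel_nonneg: "0 \<le> circle_kernel t r v"
  by (auto simp: circle_kernel_def indicator_def)

lemma nn_integral_circle_kernel:
  fixes h :: "real \<Rightarrow> real"
  assumes [measurable]: "h \<in> borel_measurable borel" and h: "\<And>v. 0 \<le> h v" and rt: "0 < r" "0 < t"
  shows "(\<integral>\<^sup>+v. ennreal (circle_kernel t r v * h v) \<partial>lborel)
    = (\<integral>\<^sup>+\<theta>. ennreal (h (r\<^sup>2 + t\<^sup>2 - 2 * r * t * cos \<theta>)) * indicator {0..pi} \<theta> \<partial>lborel)"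
proof -
  let ?g = "\<lambda>\<theta>. r\<^sup>2 + t\<^sup>2 - 2 * r * t * cos \<theta>" and ?g' = "\<lambda>\<theta>. 2 * r * t * sin \<theta>"
  let ?f = "\<lambda>v. circle_kernel t r v * h v"
  have ends: "?g 0 = (r - t)\<^sup>2" "?g pi = (r + t)\<^sup>2"
    by (auto simp: power2_eq_square algebra_simps)
  have "(\<integral>\<^sup>+v. ennreal (?f v) \<partial>lborel) = (\<integral>\<^sup>+v. ?f v * indicator {?g 0..?g pi} v \<partial>lborel)"
    unfolding ends by (intro nn_integral_cong) (auto simp: circle_kernel_def split: split_indicator)
  also have "\<dots> = (\<integral>\<^sup>+\<theta>. ?f (?g \<theta>) * ?g' \<theta> * indicator {0..pi} \<theta> \<partial>lborel)"
    using rt by (intro nn_integral_substitution)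
      (auto simp: set_borel_measurable_def sin_ge_zero intro!: derivative_eq_intros continuous_intros)
  also have "\<dots> = (\<integral>\<^sup>+\<theta>. ennreal (h (?g \<theta>)) * indicator {0..pi} \<theta> \<partial>lborel)"
  proof (intro nn_integral_cong_AE)
    \<comment> \<open>At the angles 0 and pi the value of v is an end of the open interval, where
      the kernel is 0 by definition.\<close>
    have "AE x in lborel. x \<notin> {0, pi}" by (intro AE_not_in finite_imp_null_set_lborel) auto
    then show "AE \<theta> in lborel. ennreal (?f (?g \<theta>) * ?g' \<theta> * indicator {0..pi} \<theta>) = ennreal (h (?g \<theta>)) * indicator {0..pi} \<theta>"
    proof eventually_elim
      fix \<theta> :: real assume "\<theta> \<notin> {0, pi}"
      show "ennreal (?f (?g \<theta>) * ?g' \<theta> * indicator {0..pi} \<theta>) = ennreal (h (?g \<theta>)) * indicator {0..pi} \<theta>"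
      proof (cases "\<theta> \<in> {0..pi}")
        case True
        with \<open>\<theta> \<notin> {0, pi}\<close> have \<theta>: "0 < \<theta>" "\<theta> < pi" by auto
        have s: "0 < sin \<theta>" using \<theta> by (rule sin_gt_zero)
        have c: "cos \<theta> < 1" "-1 < cos \<theta>"
          using \<theta> cos_monotone_0_pi[of 0 \<theta>] cos_monotone_0_pi[of \<theta> pi] by auto
        have e1: "(r + t)\<^sup>2 - ?g \<theta> = 2 * r * t * (1 + cos \<theta>)" "?g \<theta> - (r - t)\<^sup>2 = 2 * r * t * (1 - cos \<theta>)"
          by (auto simp: power2_eq_square algebra_simps)
        have pos: "0 < (r + t)\<^sup>2 - ?g \<theta>" "0 < ?g \<theta> - (r - t)\<^sup>2"
          unfolding e1 using rt c by auto
        have "((r + t)\<^sup>2 - ?g \<theta>) * (?g \<theta> - (r - t)\<^sup>2) = (2 * r * t)\<^sup>2 * (1 - (cos \<theta>)\<^sup>2)"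
          unfolding e1 by (simp add: power2_eq_square algebra_simps)
        also have "\<dots> = (2 * r * t * sin \<theta>)\<^sup>2"
          by (simp add: power_mult_distrib sin_squared_eq)
        finally have "sqrt (((r + t)\<^sup>2 - ?g \<theta>) * (?g \<theta> - (r - t)\<^sup>2)) = 2 * r * t * sin \<theta>"
          using rt s by simp
        then have "circle_kernel t r (?g \<theta>) = 1 / (2 * r * t * sin \<theta>)"
          using pos by (simp add: circle_kernel_def)
        then show ?thesis using True rt s by simp
      qed auto
    qed
  qed
  finally show ?thesis .
qed

lemma nn_integral_circle_kernel_total:
  assumes "0 < r" "0 < t"
  shows "(\<integral>\<^sup>+v. ennreal (circle_kernel t r v) \<partial>lborel) = ennreal pi"
  using nn_integral_circle_kernel[of "\<lambda>_. 1" r t] assms by (simp add: nn_integral_cmult_indicator)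

section \<open>Majorants for maximal operators with a kernel\<close>

text \<open>G stands for the supremum over t, which need not be measurable in r. Up to the factor 2
  pi, r dr is planar measure for radial functions.\<close>

definition kernel_majorant ::
  "real set \<Rightarrow> (real \<Rightarrow> real \<Rightarrow> real \<Rightarrow> real) \<Rightarrow> real \<Rightarrow> (real \<Rightarrow> real) \<Rightarrow> real \<Rightarrow> bool" where
  "kernel_majorant E k q h C \<longleftrightarrow> (\<exists>G \<in> borel_measurable borel.
     (\<forall>r>0. \<forall>t\<in>E. ennreal_powr (\<integral>\<^sup>+v. ennreal (k t r v * h v) \<partial>lborel) q \<le> G r) \<and>
     (\<integral>\<^sup>+r. G r * ennreal r * indicator {0<..} r \<partial>lborel) \<le> ennreal C)"

text \<open>Stated for q-th powers and profiles of norm at most 1, because majorants then combine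
  linearly under sums and interpolation.\<close>

definition kernel_bound :: "real set \<Rightarrow> (real \<Rightarrow> real \<Rightarrow> real \<Rightarrow> real) \<Rightarrow> real \<Rightarrow> real \<Rightarrow> bool" where
  "kernel_bound E k p q \<longleftrightarrow> (\<exists>C. \<forall>h \<in> borel_measurable borel.
     (\<forall>v. 0 \<le> h v) \<longrightarrow> (\<integral>\<^sup>+v. ennreal (h v powr p) \<partial>lborel) \<le> 1 \<longrightarrow> kernel_majorant E k q h C)"

lemma kernel_majorantI:
  assumes "G \<in> borel_measurable borel"
    and "\<And>r t. 0 < r \<Longrightarrow> t \<in> E \<Longrightarrow> ennreal_powr (\<integral>\<^sup>+v. ennreal (k t r v * h v) \<partial>lborel) q \<le> G r"
    and "(\<integral>\<^sup>+r. G r * ennreal r * indicator {0<..} r \<partial>lborel) \<le> ennreal C"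
  shows "kernel_majorant E k q h C"
  unfolding kernel_majorant_def using assms by blast

lemma kernel_majorantE:
  assumes "kernel_majorant E k q h C"
  obtains G where "G \<in> borel_measurable borel"
    "\<And>r t. 0 < r \<Longrightarrow> t \<in> E \<Longrightarrow> ennreal_powr (\<integral>\<^sup>+v. ennreal (k t r v * h v) \<partial>lborel) q \<le> G r"
    "(\<integral>\<^sup>+r. G r * ennreal r * indicator {0<..} r \<partial>lborel) \<le> ennreal C"
  using assms unfolding kernel_majorant_def by blast

lemma kernel_majorant_mono: "kernel_majorant E k q h C \<Longrightarrow> C \<le> C' \<Longrightarrow> kernel_majorant E k q h C'"
  by (elim kernel_majorantE, rule kernel_majorantI) (auto intro: order_trans ennreal_leI)

lemma kernel_boundI:
  assumes "\<And>h. h \<in> borel_measurable borel \<Longrightarrow> (\<And>v. 0 \<le> h v) \<Longrightarrow>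
      (\<integral>\<^sup>+v. ennreal (h v powr p) \<partial>lborel) \<le> 1 \<Longrightarrow> kernel_majorant E k q h C"
  shows "kernel_bound E k p q"
  unfolding kernel_bound_def using assms by blast

lemma kernel_boundE:
  assumes "kernel_bound E k p q"
  obtains C where "0 < C" "\<And>h. h \<in> borel_measurable borel \<Longrightarrow> (\<And>v. 0 \<le> h v) \<Longrightarrow>
      (\<integral>\<^sup>+v. ennreal (h v powr p) \<partial>lborel) \<le> 1 \<Longrightarrow> kernel_majorant E k q h C"
proof -
  from assms obtain C where C: "\<forall>h \<in> borel_measurable borel.
     (\<forall>v. 0 \<le> h v) \<longrightarrow> (\<integral>\<^sup>+v. ennreal (h v powr p) \<partial>lborel) \<le> 1 \<longrightarrow> kernel_majorant E k q h C"
    unfolding kernel_bound_def by blast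
  show ?thesis
  proof (rule that)
    show "0 < max C 1" by simp
    show "kernel_majorant E k q h (max C 1)"
      if "h \<in> borel_measurable borel" "\<And>v. 0 \<le> h v" "(\<integral>\<^sup>+v. ennreal (h v powr p) \<partial>lborel) \<le> 1" for h
      by (rule kernel_majorant_mono[of E k q h C]) (use C that in simp_all)
  qed
qed

section \<open>Comparison, sums and interpolation of kernel bounds\<close>

lemma kernel_bound_mono:
  assumes k': "kernel_bound E k' p q" and q: "0 \<le> q" and c: "0 \<le> c"
    and meas [measurable]: "\<And>t r. k' t r \<in> borel_measurable borel"
    and le: "\<And>t r v. t \<in> E \<Longrightarrow> 0 < r \<Longrightarrow> k t r v \<le> c * k' t r v"
  shows "kernel_bound E k p q"
proof -
  from k' obtain C where "0 < C" and C: "\<And>h. h \<in> borel_measurable borel \<Longrightarrow> (\<And>v. 0 \<le> h v) \<Longrightarrow>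
      (\<integral>\<^sup>+v. ennreal (h v powr p) \<partial>lborel) \<le> 1 \<Longrightarrow> kernel_majorant E k' q h C"
    by (rule kernel_boundE) blast
  show ?thesis
  proof (rule kernel_boundI)
    fix h :: "real \<Rightarrow> real" assume h[measurable]: "h \<in> borel_measurable borel" and h0: "\<And>v. 0 \<le> h v"
      and h1: "(\<integral>\<^sup>+v. ennreal (h v powr p) \<partial>lborel) \<le> 1"
    from C[OF this] obtain G where G[measurable]: "G \<in> borel_measurable borel"
      and G1: "\<And>r t. 0 < r \<Longrightarrow> t \<in> E \<Longrightarrow> ennreal_powr (\<integral>\<^sup>+v. ennreal (k' t r v * h v) \<partial>lborel) q \<le> G r"
      and G2: "(\<integral>\<^sup>+r. G r * ennreal r * indicator {0<..} r \<partial>lborel) \<le> ennreal C" by (rule kernel_majorantE) blast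
    let ?c = "ennreal (c powr q)"
    show "kernel_majorant E k (q) h (c powr q * C)"
    proof (rule kernel_majorantI)
      fix r t :: real assume "0 < r" "t \<in> E"
      have "(\<integral>\<^sup>+v. ennreal (k t r v * h v) \<partial>lborel) \<le> (\<integral>\<^sup>+v. ennreal c * ennreal (k' t r v * h v) \<partial>lborel)"
        using le[OF \<open>t \<in> E\<close> \<open>0 < r\<close>] h0 c
        by (intro nn_integral_mono) (auto simp: ennreal_mult'[symmetric] mult.assoc[symmetric] intro!: ennreal_leI mult_right_mono)
      also have "\<dots> = ennreal c * (\<integral>\<^sup>+v. ennreal (k' t r v * h v) \<partial>lborel)"
        by (simp add: nn_integral_cmult)
      finally have "ennreal_powr (\<integral>\<^sup>+v. ennreal (k t r v * h v) \<partial>lborel) q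
        \<le> ennreal_powr (ennreal c * (\<integral>\<^sup>+v. ennreal (k' t r v * h v) \<partial>lborel)) q"
        using q by (intro ennreal_powr_mono)
      also have "\<dots> \<le> ?c * G r"
        using c G1[OF \<open>0 < r\<close> \<open>t \<in> E\<close>] by (simp add: ennreal_powr_mult ennreal_powr_ennreal mult_left_mono)
      finally show "ennreal_powr (\<integral>\<^sup>+v. ennreal (k t r v * h v) \<partial>lborel) q \<le> ?c * G r" .
    next
      have "(\<integral>\<^sup>+r. ?c * G r * ennreal r * indicator {0<..} r \<partial>lborel) = ?c * (\<integral>\<^sup>+r. G r * ennreal r * indicator {0<..} r \<partial>lborel)"
        by (simp add: nn_integral_cmult mult.assoc)
      also have "\<dots> \<le> ?c * ennreal C" by (intro mult_left_mono G2) auto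
      finally show "(\<integral>\<^sup>+r. ?c * G r * ennreal r * indicator {0<..} r \<partial>lborel) \<le> ennreal (c powr q * C)"
        by (simp add: ennreal_mult')
    qed auto
  qed
qed

lemma kernel_bound_add:
  assumes k1: "kernel_bound E k1 p q" and k2: "kernel_bound E k2 p q" and q: "0 \<le> q"
    and meas [measurable]: "\<And>t r. k1 t r \<in> borel_measurable borel" "\<And>t r. k2 t r \<in> borel_measurable borel"
    and nonneg: "\<And>t r v. 0 \<le> k1 t r v" "\<And>t r v. 0 \<le> k2 t r v"
  shows "kernel_bound E (\<lambda>t r v. k1 t r v + k2 t r v) p q"
proof -
  from k1 obtain C1 where "0 < C1" and C1: "\<And>h. h \<in> borel_measurable borel \<Longrightarrow> (\<And>v. 0 \<le> h v) \<Longrightarrow>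
      (\<integral>\<^sup>+v. ennreal (h v powr p) \<partial>lborel) \<le> 1 \<Longrightarrow> kernel_majorant E k1 q h C1"
    by (rule kernel_boundE) blast
  from k2 obtain C2 where "0 < C2" and C2: "\<And>h. h \<in> borel_measurable borel \<Longrightarrow> (\<And>v. 0 \<le> h v) \<Longrightarrow>
      (\<integral>\<^sup>+v. ennreal (h v powr p) \<partial>lborel) \<le> 1 \<Longrightarrow> kernel_majorant E k2 q h C2"
    by (rule kernel_boundE) blast
  show ?thesis
  proof (rule kernel_boundI)
    fix h :: "real \<Rightarrow> real" assume h[measurable]: "h \<in> borel_measurable borel" and h0: "\<And>v. 0 \<le> h v"
      and h1: "(\<integral>\<^sup>+v. ennreal (h v powr p) \<partial>lborel) \<le> 1"
    from C1[OF this] obtain G1 where G1[measurable]: "G1 \<in> borel_measurable borel"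
      and G11: "\<And>r t. 0 < r \<Longrightarrow> t \<in> E \<Longrightarrow> ennreal_powr (\<integral>\<^sup>+v. ennreal (k1 t r v * h v) \<partial>lborel) q \<le> G1 r"
      and G12: "(\<integral>\<^sup>+r. G1 r * ennreal r * indicator {0<..} r \<partial>lborel) \<le> ennreal C1" by (rule kernel_majorantE) blast
    from C2[OF h h0 h1] obtain G2 where G2[measurable]: "G2 \<in> borel_measurable borel"
      and G21: "\<And>r t. 0 < r \<Longrightarrow> t \<in> E \<Longrightarrow> ennreal_powr (\<integral>\<^sup>+v. ennreal (k2 t r v * h v) \<partial>lborel) q \<le> G2 r"
      and G22: "(\<integral>\<^sup>+r. G2 r * ennreal r * indicator {0<..} r \<partial>lborel) \<le> ennreal C2" by (rule kernel_majorantE) blast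
    let ?c = "ennreal (2 powr q)"
    show "kernel_majorant E (\<lambda>t r v. k1 t r v + k2 t r v) (q) h (2 powr q * (C1 + C2))"
    proof (rule kernel_majorantI)
      fix r t :: real assume rt: "0 < r" "t \<in> E"
      have "(\<integral>\<^sup>+v. ennreal ((k1 t r v + k2 t r v) * h v) \<partial>lborel)
        = (\<integral>\<^sup>+v. ennreal (k1 t r v * h v) \<partial>lborel) + (\<integral>\<^sup>+v. ennreal (k2 t r v * h v) \<partial>lborel)"
        using nonneg h0 by (subst nn_integral_add[symmetric]) (auto simp: distrib_right intro!: nn_integral_cong)
      also have "ennreal_powr \<dots> q \<le> ?c * (ennreal_powr (\<integral>\<^sup>+v. ennreal (k1 t r v * h v) \<partial>lborel) q
          + ennreal_powr (\<integral>\<^sup>+v. ennreal (k2 t r v * h v) \<partial>lborel) q)"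
        by (intro ennreal_powr_add_le q)
      also have "\<dots> \<le> ?c * (G1 r + G2 r)"
        using rt by (intro mult_left_mono add_mono G11 G21) auto
      finally show "ennreal_powr (\<integral>\<^sup>+v. ennreal ((k1 t r v + k2 t r v) * h v) \<partial>lborel) q \<le> ?c * (G1 r + G2 r)" .
    next
      have "(\<integral>\<^sup>+r. ?c * (G1 r + G2 r) * ennreal r * indicator {0<..} r \<partial>lborel)
        = ?c * ((\<integral>\<^sup>+r. G1 r * ennreal r * indicator {0<..} r \<partial>lborel) + (\<integral>\<^sup>+r. G2 r * ennreal r * indicator {0<..} r \<partial>lborel))"
        by (simp add: nn_integral_cmult nn_integral_add[symmetric] mult.assoc distrib_right)
      also have "\<dots> \<le> ?c * (ennreal C1 + ennreal C2)" by (intro mult_left_mono add_mono G12 G22) auto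
      finally show "(\<integral>\<^sup>+r. ?c * (G1 r + G2 r) * ennreal r * indicator {0<..} r \<partial>lborel) \<le> ennreal (2 powr q * (C1 + C2))"
        using \<open>0 < C1\<close> \<open>0 < C2\<close> by (simp add: ennreal_mult' ennreal_plus)
    qed auto
  qed
qed

text \<open>For a nonnegative kernel k h = (k f0)^(1 - \<theta>) (k f1)^\<theta> with f0 = h^(p/p0)
  and f1 = h^(p/p1), both of norm at most 1. Hoelder is applied for each t separately, so the
  supremum over t causes no difficulty.\<close>

lemma kernel_bound_interpolate:
  assumes b0: "kernel_bound E k p0 q0" and b1: "kernel_bound E k p1 q1"
    and pos: "0 < p0" "0 < p1" "0 < q0" "0 < q1" "0 < p" "0 < q" and \<theta>: "0 < \<theta>" "\<theta> < 1"
    and p: "1 / p = (1 - \<theta>) / p0 + \<theta> / p1" and q: "1 / q = (1 - \<theta>) / q0 + \<theta> / q1"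
    and meas [measurable]: "\<And>t r. k t r \<in> borel_measurable borel" and nonneg: "\<And>t r v. 0 \<le> k t r v"
  shows "kernel_bound E k p q"
proof -
  from b0 obtain C1 where "0 < C1" and C1: "\<And>h. h \<in> borel_measurable borel \<Longrightarrow> (\<And>v. 0 \<le> h v) \<Longrightarrow>
      (\<integral>\<^sup>+v. ennreal (h v powr p0) \<partial>lborel) \<le> 1 \<Longrightarrow> kernel_majorant E k q0 h C1"
    by (rule kernel_boundE) blast
  from b1 obtain C2 where "0 < C2" and C2: "\<And>h. h \<in> borel_measurable borel \<Longrightarrow> (\<And>v. 0 \<le> h v) \<Longrightarrow>
      (\<integral>\<^sup>+v. ennreal (h v powr p1) \<partial>lborel) \<le> 1 \<Longrightarrow> kernel_majorant E k q1 h C2"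
    by (rule kernel_boundE) blast
  \<comment> \<open>The exponents of the two majorants in the q-th power. They add up to 1 by the
    relation for q, so Young turns the product into a sum.\<close>
  define u v where "u = (1 - \<theta>) * q / q0" and "v = \<theta> * q / q1"
  have uv: "0 < u" "0 < v" "u + v = 1"
  proof -
    show "0 < u" "0 < v" using \<theta> pos by (auto simp: u_def v_def)
    have "u + v = q * ((1 - \<theta>) / q0 + \<theta> / q1)" by (simp add: u_def v_def algebra_simps)
    then show "u + v = 1" using pos by (simp flip: q)
  qed
  show ?thesis
  proof (rule kernel_boundI)
    fix h :: "real \<Rightarrow> real" assume h[measurable]: "h \<in> borel_measurable borel" and h0: "\<And>v. 0 \<le> h v"
      and h1: "(\<integral>\<^sup>+v. ennreal (h v powr p) \<partial>lborel) \<le> 1"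
    define f0 f1 where "f0 = (\<lambda>v. h v powr (p / p0))" and "f1 = (\<lambda>v. h v powr (p / p1))"
    have [measurable]: "f0 \<in> borel_measurable borel" "f1 \<in> borel_measurable borel"
      unfolding f0_def f1_def by measurable
    have f_nonneg: "0 \<le> f0 x" "0 \<le> f1 x" for x by (auto simp: f0_def f1_def)
    have "(\<integral>\<^sup>+v. ennreal (f0 v powr p0) \<partial>lborel) \<le> 1" "(\<integral>\<^sup>+v. ennreal (f1 v powr p1) \<partial>lborel) \<le> 1"
      using h1 pos by (auto simp: f0_def f1_def powr_powr)
    note le = this
    from C1[OF _ f_nonneg(1) le(1)] obtain G1 where [measurable]: "G1 \<in> borel_measurable borel"
      and G11: "\<And>r t. 0 < r \<Longrightarrow> t \<in> E \<Longrightarrow> ennreal_powr (\<integral>\<^sup>+v. ennreal (k t r v * f0 v) \<partial>lborel) q0 \<le> G1 r"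
      and G12: "(\<integral>\<^sup>+r. G1 r * ennreal r * indicator {0<..} r \<partial>lborel) \<le> ennreal C1"
      by (auto elim: kernel_majorantE)
    from C2[OF _ f_nonneg(2) le(2)] obtain G2 where [measurable]: "G2 \<in> borel_measurable borel"
      and G21: "\<And>r t. 0 < r \<Longrightarrow> t \<in> E \<Longrightarrow> ennreal_powr (\<integral>\<^sup>+v. ennreal (k t r v * f1 v) \<partial>lborel) q1 \<le> G2 r"
      and G22: "(\<integral>\<^sup>+r. G2 r * ennreal r * indicator {0<..} r \<partial>lborel) \<le> ennreal C2"
      by (auto elim: kernel_majorantE)
    show "kernel_majorant E k (q) h (u * C1 + v * C2)"
    proof (rule kernel_majorantI)
      fix r t :: real assume rt: "0 < r" "t \<in> E"
      let ?I0 = "\<integral>\<^sup>+v. ennreal (k t r v * f0 v) \<partial>lborel" and ?I1 = "\<integral>\<^sup>+v. ennreal (k t r v * f1 v) \<partial>lborel"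
      have eq: "k t r x * h x = (k t r x * f0 x) powr (1 - \<theta>) * (k t r x * f1 x) powr \<theta>" for x
      proof -
        have "p / p0 * (1 - \<theta>) + p / p1 * \<theta> = p * ((1 - \<theta>) / p0 + \<theta> / p1)" by (simp add: algebra_simps)
        also have "\<dots> = 1" using pos by (simp flip: p)
        finally have *: "p / p0 * (1 - \<theta>) + p / p1 * \<theta> = 1" .
        have "(k t r x * f0 x) powr (1 - \<theta>) * (k t r x * f1 x) powr \<theta>
          = (k t r x powr (1 - \<theta>) * k t r x powr \<theta>) * (h x powr (p / p0 * (1 - \<theta>)) * h x powr (p / p1 * \<theta>))"
          using nonneg f_nonneg by (simp add: powr_mult f0_def f1_def powr_powr)
        also have "\<dots> = k t r x * h x"
          using nonneg h0 by (simp add: powr_add[symmetric] * del: times_divide_eq_left)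
        finally show ?thesis by simp
      qed
      have "(\<integral>\<^sup>+v. ennreal (k t r v * h v) \<partial>lborel)
        = (\<integral>\<^sup>+v. ennreal_powr (ennreal (k t r v * f0 v)) (1 - \<theta>) * ennreal_powr (ennreal (k t r v * f1 v)) \<theta> \<partial>lborel)"
        using nonneg f_nonneg by (intro nn_integral_cong, subst eq)
          (simp add: ennreal_powr_ennreal ennreal_mult[of "_ powr _"])
      also have "\<dots> \<le> ennreal_powr ?I0 (1 - \<theta>) * ennreal_powr ?I1 \<theta>"
        using \<theta> by (intro nn_integral_Holder) auto
      finally have "ennreal_powr (\<integral>\<^sup>+v. ennreal (k t r v * h v) \<partial>lborel) q
          \<le> ennreal_powr (ennreal_powr ?I0 (1 - \<theta>) * ennreal_powr ?I1 \<theta>) q"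
        using pos by (intro ennreal_powr_mono) auto
      also have "\<dots> = ennreal_powr (ennreal_powr ?I0 q0) u * ennreal_powr (ennreal_powr ?I1 q1) v"
        using pos by (simp add: ennreal_powr_mult ennreal_powr_powr u_def v_def)
      also have "\<dots> \<le> ennreal_powr (G1 r) u * ennreal_powr (G2 r) v"
        using uv rt by (intro mult_mono ennreal_powr_mono G11 G21) auto
      also have "\<dots> \<le> ennreal u * G1 r + ennreal v * G2 r"
        by (intro ennreal_powr_Young uv)
      finally show "ennreal_powr (\<integral>\<^sup>+v. ennreal (k t r v * h v) \<partial>lborel) q \<le> ennreal u * G1 r + ennreal v * G2 r" .
    next
      have "(\<integral>\<^sup>+r. (ennreal u * G1 r + ennreal v * G2 r) * ennreal r * indicator {0<..} r \<partial>lborel)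
        = (\<integral>\<^sup>+r. ennreal u * (G1 r * ennreal r * indicator {0<..} r) + ennreal v * (G2 r * ennreal r * indicator {0<..} r) \<partial>lborel)"
        by (intro nn_integral_cong) (simp add: distrib_right mult.assoc)
      also have "\<dots> = ennreal u * (\<integral>\<^sup>+r. G1 r * ennreal r * indicator {0<..} r \<partial>lborel)
           + ennreal v * (\<integral>\<^sup>+r. G2 r * ennreal r * indicator {0<..} r \<partial>lborel)"
        by (simp add: nn_integral_cmult nn_integral_add)
      also have "\<dots> \<le> ennreal u * ennreal C1 + ennreal v * ennreal C2" by (intro mult_left_mono add_mono G12 G22) auto
      finally show "(\<integral>\<^sup>+r. (ennreal u * G1 r + ennreal v * G2 r) * ennreal r * indicator {0<..} r \<partial>lborel)
          \<le> ennreal (u * C1 + v * C2)"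
        using \<open>0 < C1\<close> \<open>0 < C2\<close> uv by (simp add: ennreal_mult' ennreal_plus)
    qed auto
  qed
qed

text \<open>Jensen's inequality for a kernel of mass pi, in other words interpolation with the
  trivial bound for bounded functions. It moves a point of the type set towards the origin.\<close>

lemma kernel_bound_circle_scale:
  assumes b: "kernel_bound E circle_kernel p q" and E: "\<And>t. t \<in> E \<Longrightarrow> 0 < t"
    and pos: "0 < p" "0 < q" and \<theta>: "0 < \<theta>" "\<theta> < 1"
  shows "kernel_bound E circle_kernel (p / \<theta>) (q / \<theta>)"
proof -
  from b obtain C where "0 < C" and C: "\<And>h. h \<in> borel_measurable borel \<Longrightarrow> (\<And>v. 0 \<le> h v) \<Longrightarrow>
      (\<integral>\<^sup>+v. ennreal (h v powr p) \<partial>lborel) \<le> 1 \<Longrightarrow> kernel_majorant E circle_kernel q h C"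
    by (rule kernel_boundE) blast
  let ?c = "pi powr ((1 - \<theta>) * (q / \<theta>))"
  show ?thesis
  proof (rule kernel_boundI)
    fix h :: "real \<Rightarrow> real" assume h[measurable]: "h \<in> borel_measurable borel" and h0: "\<And>v. 0 \<le> h v"
      and h1: "(\<integral>\<^sup>+v. ennreal (h v powr (p / \<theta>)) \<partial>lborel) \<le> 1"
    define f where "f = (\<lambda>v. h v powr (1 / \<theta>))"
    have f[measurable]: "f \<in> borel_measurable borel" unfolding f_def by measurable
    have f0: "0 \<le> f x" for x by (auto simp: f_def)
    have "(\<integral>\<^sup>+v. ennreal (f v powr p) \<partial>lborel) \<le> 1"
      using h1 by (simp add: f_def powr_powr)
    from C[OF f f0 this]
    obtain G where [measurable]: "G \<in> borel_measurable borel"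
      and G1: "\<And>r t. 0 < r \<Longrightarrow> t \<in> E \<Longrightarrow> ennreal_powr (\<integral>\<^sup>+v. ennreal (circle_kernel t r v * f v) \<partial>lborel) q \<le> G r"
      and G2: "(\<integral>\<^sup>+r. G r * ennreal r * indicator {0<..} r \<partial>lborel) \<le> ennreal C"
      by (rule kernel_majorantE) blast
    show "kernel_majorant E circle_kernel ((q / \<theta>)) h (?c * C)"
    proof (rule kernel_majorantI)
      fix r t :: real assume rt: "0 < r" "t \<in> E"
      let ?I = "\<integral>\<^sup>+v. ennreal (circle_kernel t r v * f v) \<partial>lborel"
      have eq: "circle_kernel t r x * h x = circle_kernel t r x powr (1 - \<theta>) * (circle_kernel t r x * f x) powr \<theta>" for x
        using circle_kernel_nonneg[of t r x] h0[of x] f0[of x] \<theta>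
        by (simp add: powr_mult f_def powr_powr powr_add[symmetric] mult.assoc[symmetric])
      have "(\<integral>\<^sup>+v. ennreal (circle_kernel t r v * h v) \<partial>lborel)
        = (\<integral>\<^sup>+v. ennreal_powr (ennreal (circle_kernel t r v)) (1 - \<theta>) * ennreal_powr (ennreal (circle_kernel t r v * f v)) \<theta> \<partial>lborel)"
        using circle_kernel_nonneg f0 by (intro nn_integral_cong, subst eq)
          (simp add: ennreal_powr_ennreal ennreal_mult[of "_ powr _"])
      also have "\<dots> \<le> ennreal_powr (\<integral>\<^sup>+v. ennreal (circle_kernel t r v) \<partial>lborel) (1 - \<theta>) * ennreal_powr ?I \<theta>"
        using \<theta> by (intro nn_integral_Holder) auto
      finally have "ennreal_powr (\<integral>\<^sup>+v. ennreal (circle_kernel t r v * h v) \<partial>lborel) (q / \<theta>)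
          \<le> ennreal_powr (ennreal_powr (ennreal pi) (1 - \<theta>) * ennreal_powr ?I \<theta>) (q / \<theta>)"
        using pos \<theta> nn_integral_circle_kernel_total[OF rt(1) E[OF rt(2)]] by (intro ennreal_powr_mono) auto
      also have "\<dots> = ennreal ?c * ennreal_powr ?I q"
        using pos \<theta> by (simp add: ennreal_powr_mult ennreal_powr_powr ennreal_powr_ennreal powr_powr)
      also have "\<dots> \<le> ennreal ?c * G r"
        using rt by (intro mult_left_mono G1) auto
      finally show "ennreal_powr (\<integral>\<^sup>+v. ennreal (circle_kernel t r v * h v) \<partial>lborel) (q / \<theta>) \<le> ennreal ?c * G r" .
    next
      have "(\<integral>\<^sup>+r. ennreal ?c * G r * ennreal r * indicator {0<..} r \<partial>lborel)
        = ennreal ?c * (\<integral>\<^sup>+r. G r * ennreal r * indicator {0<..} r \<partial>lborel)"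
        by (simp add: nn_integral_cmult mult.assoc)
      also have "\<dots> \<le> ennreal ?c * ennreal C" by (intro mult_left_mono G2) auto
      finally show "(\<integral>\<^sup>+r. ennreal ?c * G r * ennreal r * indicator {0<..} r \<partial>lborel) \<le> ennreal (?c * C)"
        using \<open>0 < C\<close> by (simp add: ennreal_mult')
    qed auto
  qed
qed

section \<open>From kernel bounds to the maximal function\<close>

lemma circle_maximal_le:
  assumes [measurable]: "f \<in> borel_measurable borel"
  shows "circle_maximal E f x \<le> (SUP t\<in>E. \<integral>\<^sup>+y. ennreal (norm (f (x + t *\<^sub>R y))) \<partial>circle_measure)"
  unfolding circle_maximal_def
proof (intro SUP_mono' )
  fix t
  have [measurable]: "(\<lambda>y. f (x + t *\<^sub>R y)) \<in> borel_measurable circle_measure"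
    unfolding circle_measure_def by measurable
  show "(if integrable circle_measure (\<lambda>y. f (x + t *\<^sub>R y)) then ennreal (norm (circle_avg t f x)) else \<infinity>)
    \<le> (\<integral>\<^sup>+y. ennreal (norm (f (x + t *\<^sub>R y))) \<partial>circle_measure)"
  proof (cases "integrable circle_measure (\<lambda>y. f (x + t *\<^sub>R y))")
    case True
    have "norm (circle_avg t f x) \<le> (\<integral>y. norm (f (x + t *\<^sub>R y)) \<partial>circle_measure)"
      unfolding circle_avg_def by (rule integral_norm_bound)
    then show ?thesis
      using True by (subst nn_integral_eq_integral) (auto intro!: ennreal_leI)
  next
    \<comment> \<open>For a measurable function, failure of integrability means that the integral of
      the norm is infinite, so the default value is dominated as well.\<close>
    case False
    then have "\<not> (\<integral>\<^sup>+y. ennreal (norm (f (x + t *\<^sub>R y))) \<partial>circle_measure) < top"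
      by (auto simp: integrable_iff_bounded)
    then have "(\<integral>\<^sup>+y. ennreal (norm (f (x + t *\<^sub>R y))) \<partial>circle_measure) = top"
      using top.not_eq_extremum by blast
    then show ?thesis by simp
  qed
qed

lemma radial_eq_on_axis:
  assumes "radial f"
  shows "f y = f (vector [sqrt ((norm y)\<^sup>2), 0])"
proof -
  have "norm y = norm (vector [sqrt ((norm y)\<^sup>2), 0] :: real^2)"
    by (simp add: norm_vec2)
  then show ?thesis using assms unfolding radial_def by blast
qed

lemma measurable_profile_vec: "(\<lambda>v::real. vector [sqrt v, 0] :: real^2) \<in> borel_measurable borel"
proof (rule borel_measurable_continuous_onI)
  have "(\<lambda>v::real. vector [sqrt v, 0] :: real^2) = (\<lambda>v. \<chi> i. if i = 1 then sqrt v else 0)"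
    by (auto simp: vec_eq_iff forall_2)
  moreover have "continuous_on UNIV (\<lambda>v::real. (\<chi> i. if i = 1 then sqrt v else 0) :: real^2)"
  proof (intro continuous_on_vec_lambda)
    show "continuous_on UNIV (\<lambda>v::real. if i = 1 then sqrt v else 0)" for i :: 2
      by (cases "i = 1") (auto intro!: continuous_at_imp_continuous_on isCont_real_sqrt)
  qed
  ultimately show "continuous_on UNIV (\<lambda>v::real. vector [sqrt v, 0] :: real^2)" by (simp only:)
qed

text \<open>\<open>sqrt\<close> is odd on the reals, so without the cut at 0 the profile of a radial
  function would be continued evenly to v < 0 and its integral over the line would be
  doubled.\<close>

definition profile :: "(real^2 \<Rightarrow> complex) \<Rightarrow> real \<Rightarrow> real" where
  "profile f v = indicator {0..} v * norm (f (vector [sqrt v, 0]))"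

lemma profile_nonneg: "0 \<le> profile f v"
  by (simp add: profile_def)

lemma measurable_profile:
  assumes [measurable]: "f \<in> borel_measurable borel"
  shows "profile f \<in> borel_measurable borel"
proof -
  note measurable_profile_vec[measurable]
  show ?thesis unfolding profile_def[abs_def] by measurable
qed

lemma norm_eq_profile: "radial f \<Longrightarrow> norm (f y) = profile f ((norm y)\<^sup>2)"
  unfolding profile_def by (subst radial_eq_on_axis) simp_all

lemma nn_integral_circle_profile:
  assumes f: "f \<in> borel_measurable borel" "radial f" and xt: "x \<noteq> 0" "0 < t"
  shows "(\<integral>\<^sup>+y. ennreal (norm (f (x + t *\<^sub>R y))) \<partial>circle_measure)
    = ennreal (1 / pi) * (\<integral>\<^sup>+v. ennreal (circle_kernel t (norm x) v * profile f v) \<partial>lborel)"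
proof -
  note measurable_profile[OF f(1), measurable]
  have "(\<integral>\<^sup>+y. ennreal (norm (f (x + t *\<^sub>R y))) \<partial>circle_measure)
    = ennreal (1 / pi) * (\<integral>\<^sup>+\<theta>. ennreal (profile f ((norm x)\<^sup>2 + t\<^sup>2 - 2 * norm x * t * cos \<theta>)) * indicator {0..pi} \<theta> \<partial>lborel)"
    unfolding norm_eq_profile[OF f(2)]
    by (rule nn_integral_circle_radial[where h = "\<lambda>v. ennreal (profile f v)"]) measurable
  then show ?thesis
    using xt nn_integral_circle_kernel[of "profile f" "norm x" t] by (simp add: profile_nonneg)
qed

lemma Lp_norm_real: "0 < p \<Longrightarrow> Lp_norm M (ennreal p) g = ennreal_powr (\<integral>\<^sup>+x. ennreal_powr (g x) p \<partial>M) (1 / p)"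
  by (simp add: Lp_norm_def)

lemma radially_bounded_if_kernel_bound:
  assumes b: "kernel_bound E circle_kernel p q" and E: "\<And>t. t \<in> E \<Longrightarrow> 0 < t" and pq: "0 < p" "0 < q"
  shows "radially_bounded E (ennreal p) (ennreal q)"
proof -
  from b obtain C where "0 < C" and C: "\<And>h. h \<in> borel_measurable borel \<Longrightarrow> (\<And>v. 0 \<le> h v) \<Longrightarrow>
      (\<integral>\<^sup>+v. ennreal (h v powr p) \<partial>lborel) \<le> 1 \<Longrightarrow> kernel_majorant E circle_kernel q h C"
    by (rule kernel_boundE) blast
  \<comment> \<open>2 pi comes from planar measure, 1 / pi from the normalisation of the
    mean.\<close>
  define D where "D = (2 * pi * C) powr (1 / q) / pi"
  have "0 < D" using \<open>0 < C\<close> by (simp add: D_def)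
  \<comment> \<open>c is any positive upper bound of the norm, so that \<phi> / c makes sense also
    if f vanishes almost everywhere.\<close>
  have main: "Lp_norm lborel (ennreal q) (circle_maximal E f) \<le> ennreal (D * c)"
    if f: "f \<in> radial_Lp (ennreal p)" and c: "0 < c" "Lp_norm lborel (ennreal p) (\<lambda>x. ennreal (norm (f x))) \<le> ennreal c" for f c
  proof -
    have [measurable]: "f \<in> borel_measurable borel" and rad: "radial f" using f by (auto simp: radial_Lp_def)
    define \<phi> where "\<phi> = profile f"
    have [measurable]: "\<phi> \<in> borel_measurable borel" unfolding \<phi>_def by (rule measurable_profile) measurable
    have \<phi>0: "0 \<le> \<phi> v" for v by (simp add: \<phi>_def profile_nonneg)
    have \<phi>: "norm (f y) = \<phi> ((norm y)\<^sup>2)" for y unfolding \<phi>_def by (rule norm_eq_profile[OF rad])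
    let ?I = "\<integral>\<^sup>+x. ennreal (norm (f x) powr p) \<partial>lborel"
    have "ennreal_powr ?I (1 / p) \<le> ennreal c"
      using c pq by (simp add: Lp_norm_real ennreal_powr_ennreal)
    then have "ennreal_powr (ennreal_powr ?I (1 / p)) p \<le> ennreal_powr (ennreal c) p"
      using pq by (intro ennreal_powr_mono) auto
    then have I: "?I \<le> ennreal (c powr p)"
      using pq c by (simp add: ennreal_powr_powr ennreal_powr_ennreal)
    have "ennreal pi * (\<integral>\<^sup>+v. ennreal (\<phi> v powr p) \<partial>lborel) = (\<integral>\<^sup>+v. ennreal pi * ennreal (\<phi> v powr p) \<partial>lborel)"
      by (simp add: nn_integral_cmult)
    also have "\<dots> = (\<integral>\<^sup>+v. ennreal pi * indicator {0<..} v * ennreal (\<phi> v powr p) \<partial>lborel)"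
    proof (intro nn_integral_cong_AE)
      have "AE v in lborel. v \<notin> {0::real}" by (intro AE_not_in finite_imp_null_set_lborel) auto
      then show "AE v in lborel. ennreal pi * ennreal (\<phi> v powr p) = ennreal pi * indicator {0<..} v * ennreal (\<phi> v powr p)"
        by eventually_elim (use pq in \<open>auto simp: \<phi>_def profile_def split: split_indicator\<close>)
    qed
    also have "\<dots> = (\<integral>\<^sup>+x. ennreal (\<phi> ((norm (x::real^2))\<^sup>2) powr p) \<partial>lborel)"
      by (rule nn_integral_norm_sq_plane[symmetric]) measurable
    also have "\<dots> \<le> ennreal (c powr p)" using I by (simp add: \<phi>)
    finally have I2: "ennreal pi * (\<integral>\<^sup>+v. ennreal (\<phi> v powr p) \<partial>lborel) \<le> ennreal (c powr p)" .
    define h where "h = (\<lambda>v. \<phi> v / c)"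
    have h[measurable]: "h \<in> borel_measurable borel" unfolding h_def by measurable
    have h0: "0 \<le> h v" for v using c \<phi>0 by (simp add: h_def)
    have "(\<integral>\<^sup>+v. ennreal (h v powr p) \<partial>lborel) = (\<integral>\<^sup>+v. ennreal (1 / c powr p) * ennreal (\<phi> v powr p) \<partial>lborel)"
      using c \<phi>0 by (intro nn_integral_cong) (simp add: h_def powr_divide flip: ennreal_mult)
    also have "\<dots> = ennreal (1 / c powr p) * (1 * (\<integral>\<^sup>+v. ennreal (\<phi> v powr p) \<partial>lborel))"
      by (simp add: nn_integral_cmult)
    \<comment> \<open>Planar measure is pi dv; the factor pi \<ge> 1 is given away.\<close>
    also have "\<dots> \<le> ennreal (1 / c powr p) * (ennreal pi * (\<integral>\<^sup>+v. ennreal (\<phi> v powr p) \<partial>lborel))"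
      using pi_ge_two by (intro mult_left_mono mult_right_mono) (auto simp del: ennreal_1 simp: ennreal_1[symmetric] intro!: ennreal_leI)
    also have "\<dots> \<le> ennreal (1 / c powr p) * ennreal (c powr p)"
      by (intro mult_left_mono I2) auto
    also have "\<dots> = 1" using c by (simp flip: ennreal_mult)
    finally have "(\<integral>\<^sup>+v. ennreal (h v powr p) \<partial>lborel) \<le> 1" .
    from C[OF h h0 this]
    obtain G where G[measurable]: "G \<in> borel_measurable borel"
      and G1: "\<And>r t. 0 < r \<Longrightarrow> t \<in> E \<Longrightarrow> ennreal_powr (\<integral>\<^sup>+v. ennreal (circle_kernel t r v * h v) \<partial>lborel) q \<le> G r"
      and G2: "(\<integral>\<^sup>+r. G r * ennreal r * indicator {0<..} r \<partial>lborel) \<le> ennreal C"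
      by (rule kernel_majorantE) blast
    let ?k = "ennreal ((c / pi) powr q)"
    have pt: "ennreal_powr (circle_maximal E f x) q \<le> ?k * G (norm x)" if x: "x \<noteq> 0" for x
    proof -
      have "circle_maximal E f x \<le> (SUP t\<in>E. \<integral>\<^sup>+y. ennreal (norm (f (x + t *\<^sub>R y))) \<partial>circle_measure)"
        by (rule circle_maximal_le) measurable
      also have "\<dots> \<le> ennreal_powr (?k * G (norm x)) (1 / q)"
      proof (rule SUP_least)
        fix t assume t: "t \<in> E"
        have "(\<integral>\<^sup>+y. ennreal (norm (f (x + t *\<^sub>R y))) \<partial>circle_measure)
          = ennreal (1 / pi) * (\<integral>\<^sup>+v. ennreal (circle_kernel t (norm x) v * \<phi> v) \<partial>lborel)"
          unfolding \<phi>_def using x E[OF t] rad by (intro nn_integral_circle_profile) measurable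
        also have "(\<integral>\<^sup>+v. ennreal (circle_kernel t (norm x) v * \<phi> v) \<partial>lborel)
           = (\<integral>\<^sup>+v. ennreal c * ennreal (circle_kernel t (norm x) v * h v) \<partial>lborel)"
          using c by (intro nn_integral_cong) (simp add: h_def ennreal_mult'[symmetric])
        also have "\<dots> = ennreal c * (\<integral>\<^sup>+v. ennreal (circle_kernel t (norm x) v * h v) \<partial>lborel)"
          by (simp add: nn_integral_cmult)
        finally have eq: "(\<integral>\<^sup>+y. ennreal (norm (f (x + t *\<^sub>R y))) \<partial>circle_measure)
           = ennreal (c / pi) * (\<integral>\<^sup>+v. ennreal (circle_kernel t (norm x) v * h v) \<partial>lborel)"
          using c by (simp add: mult.assoc[symmetric] ennreal_mult[symmetric])
        have "ennreal_powr (\<integral>\<^sup>+y. ennreal (norm (f (x + t *\<^sub>R y))) \<partial>circle_measure) q \<le> ?k * G (norm x)"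
          unfolding eq using c t x by (simp add: ennreal_powr_mult ennreal_powr_ennreal mult_left_mono G1)
        then have "ennreal_powr (ennreal_powr (\<integral>\<^sup>+y. ennreal (norm (f (x + t *\<^sub>R y))) \<partial>circle_measure) q) (1 / q)
          \<le> ennreal_powr (?k * G (norm x)) (1 / q)"
          using pq by (intro ennreal_powr_mono) auto
        then show "(\<integral>\<^sup>+y. ennreal (norm (f (x + t *\<^sub>R y))) \<partial>circle_measure) \<le> ennreal_powr (?k * G (norm x)) (1 / q)"
          using pq by (simp add: ennreal_powr_powr)
      qed
      finally have "ennreal_powr (circle_maximal E f x) q \<le> ennreal_powr (ennreal_powr (?k * G (norm x)) (1 / q)) q"
        using pq by (intro ennreal_powr_mono) auto
      then show ?thesis using pq by (simp add: ennreal_powr_powr)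
    qed
    have "(\<integral>\<^sup>+x. ennreal_powr (circle_maximal E f x) q \<partial>lborel) \<le> (\<integral>\<^sup>+x. ?k * G (norm (x::real^2)) \<partial>lborel)"
    proof (intro nn_integral_mono_AE)
      have "AE x in lborel. x \<notin> {0::real^2}" by (intro AE_not_in finite_imp_null_set_lborel) auto
      then show "AE x in lborel. ennreal_powr (circle_maximal E f x) q \<le> ?k * G (norm x)"
        by eventually_elim (use pt in auto)
    qed
    also have "\<dots> = ?k * (\<integral>\<^sup>+x. G (norm (x::real^2)) \<partial>lborel)" by (simp add: nn_integral_cmult)
    also have "(\<integral>\<^sup>+x. G (norm (x::real^2)) \<partial>lborel) = (\<integral>\<^sup>+r. ennreal (2 * pi * r) * indicator {0<..} r * G r \<partial>lborel)"
      by (rule nn_integral_norm_plane) measurable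
    also have "\<dots> = (\<integral>\<^sup>+r. ennreal (2 * pi) * (G r * ennreal r * indicator {0<..} r) \<partial>lborel)"
      by (intro nn_integral_cong) (auto simp: ennreal_mult' ac_simps split: split_indicator)
    also have "\<dots> = ennreal (2 * pi) * (\<integral>\<^sup>+r. (G r * ennreal r * indicator {0<..} r) \<partial>lborel)"
      by (simp add: nn_integral_cmult)
    also have "?k * \<dots> \<le> ?k * (ennreal (2 * pi) * ennreal C)"
      by (intro mult_left_mono G2) auto
    finally have "ennreal_powr (\<integral>\<^sup>+x. ennreal_powr (circle_maximal E f x) q \<partial>lborel) (1 / q)
       \<le> ennreal_powr (?k * (ennreal (2 * pi) * ennreal C)) (1 / q)"
      using pq by (intro ennreal_powr_mono) auto
    also have "\<dots> = ennreal_powr (ennreal ((c / pi) powr q * (2 * pi * C))) (1 / q)"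
      using \<open>0 < C\<close> by (simp add: ennreal_mult)
    also have "\<dots> = ennreal (((c / pi) powr q) powr (1 / q) * (2 * pi * C) powr (1 / q))"
      using c \<open>0 < C\<close> by (subst ennreal_powr_ennreal) (auto simp: powr_mult)
    also have "((c / pi) powr q) powr (1 / q) * (2 * pi * C) powr (1 / q) = D * c"
      using pq c by (simp add: powr_powr D_def)
    finally show ?thesis using pq by (simp add: Lp_norm_real)
  qed
  show ?thesis
    unfolding radially_bounded_def
  proof (intro exI ballI)
    fix f assume f: "f \<in> radial_Lp (ennreal p)"
    let ?N = "Lp_norm lborel (ennreal p) (\<lambda>x. ennreal (norm (f x)))"
    have "?N < \<infinity>" using f by (simp add: radial_Lp_def)
    then obtain n where n: "0 \<le> n" "?N = ennreal n" by (cases ?N) auto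
    show "Lp_norm lborel (ennreal q) (circle_maximal E f) \<le> ennreal D * ?N"
    \<comment> \<open>With c = n + e / D, the bound D c is D n + e.\<close>
    proof (rule ennreal_le_epsilon)
      fix e :: real assume "0 < e"
      have "Lp_norm lborel (ennreal q) (circle_maximal E f) \<le> ennreal (D * (n + e / D))"
        using n \<open>0 < e\<close> \<open>0 < D\<close> by (intro main[OF f]) (auto intro!: ennreal_leI add_nonneg_pos)
      also have "\<dots> = ennreal D * ?N + ennreal e"
        using n \<open>0 < e\<close> \<open>0 < D\<close> by (simp add: distrib_left ennreal_mult)
      finally show "Lp_norm lborel (ennreal q) (circle_maximal E f) \<le> ennreal D * ?N + ennreal e" .
    qed
  qed
qed

section \<open>Covering numbers and potentials of the distance\<close>

lemma covering_number_le:
  "finite A \<Longrightarrow> F \<subseteq> (\<Union>a\<in>A. {a..a + \<delta>}) \<Longrightarrow> covering_number F \<delta> \<le> card A"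
  unfolding covering_number_def by (rule Least_le) auto

lemma finite_cover_exists:
  fixes F :: "real set"
  assumes "F \<subseteq> {a..b}" "0 < \<delta>"
  shows "\<exists>A. finite A \<and> F \<subseteq> (\<Union>a\<in>A. {a..a + \<delta>})"
proof (intro exI conjI)
  let ?A = "(\<lambda>i. of_int i * \<delta>) ` {\<lfloor>a / \<delta>\<rfloor>..\<lfloor>b / \<delta>\<rfloor>}"
  show "finite ?A" by simp
  show "F \<subseteq> (\<Union>a\<in>?A. {a..a + \<delta>})"
  proof
    fix x assume "x \<in> F"
    then have x: "a \<le> x" "x \<le> b" using assms by auto
    let ?i = "\<lfloor>x / \<delta>\<rfloor>"
    have "?i \<in> {\<lfloor>a / \<delta>\<rfloor>..\<lfloor>b / \<delta>\<rfloor>}"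
      using x assms by (auto intro!: floor_mono divide_right_mono)
    moreover have "x \<in> {of_int ?i * \<delta>..of_int ?i * \<delta> + \<delta>}"
    proof -
      have "of_int ?i \<le> x / \<delta>" "x / \<delta> \<le> of_int ?i + 1" by linarith+
      then have "of_int ?i * \<delta> \<le> x" "x \<le> (of_int ?i + 1) * \<delta>"
        using assms by (simp_all only: pos_le_divide_eq pos_divide_le_eq)
      then show ?thesis by (simp add: distrib_right)
    qed
    ultimately show "x \<in> (\<Union>a\<in>?A. {a..a + \<delta>})" by blast
  qed
qed

lemma covering_number_attained:
  fixes F :: "real set"
  assumes "F \<subseteq> {a..b}" "0 < \<delta>"
  obtains A where "finite A" "card A = covering_number F \<delta>" "F \<subseteq> (\<Union>a\<in>A. {a..a + \<delta>})"
proof -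
  have "\<exists>A. finite A \<and> card A = covering_number F \<delta> \<and> F \<subseteq> (\<Union>a\<in>A. {a..a + \<delta>})"
    unfolding covering_number_def
    by (rule LeastI_ex) (use finite_cover_exists[OF assms] in blast)
  then show ?thesis using that by blast
qed

lemma covering_number_mono:
  fixes F :: "real set"
  assumes "F \<subseteq> G" "G \<subseteq> {a..b}" "0 < \<delta>" "\<delta> \<le> \<epsilon>"
  shows "covering_number F \<epsilon> \<le> covering_number G \<delta>"
proof -
  obtain A where A: "finite A" "card A = covering_number G \<delta>" "G \<subseteq> (\<Union>a\<in>A. {a..a + \<delta>})"
    using covering_number_attained assms by metis
  have "F \<subseteq> (\<Union>a\<in>A. {a..a + \<epsilon>})" using A assms by fastforce
  then show ?thesis using covering_number_le[of A F \<epsilon>] A by simp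
qed

lemma covering_number_le_1: "F \<subseteq> {a..a + \<delta>} \<Longrightarrow> covering_number F \<delta> \<le> 1"
  using covering_number_le[of "{a}" F \<delta>] by simp

lemma covering_number_pos:
  fixes F :: "real set"
  assumes "F \<noteq> {}" "F \<subseteq> {a..b}" "0 < \<delta>"
  shows "1 \<le> covering_number F \<delta>"
proof -
  obtain A where A: "finite A" "card A = covering_number F \<delta>" "F \<subseteq> (\<Union>a\<in>A. {a..a + \<delta>})"
    using covering_number_attained assms by metis
  then have "A \<noteq> {}" using assms by auto
  then show ?thesis using A card_gt_0_iff[of A] by linarith
qed

text \<open>Majorizes \<open>dist(x, T)\<^sup>-\<^sup>\<kappa>\<close> within distance \<open>\<rho>\<close> of \<open>T\<close>. It is a sum over indicator functions
  of open sets, so that it remains measurable when \<open>T\<close>, \<open>\<rho>\<close> and \<open>x\<close> move with parameters.\<close>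

definition dist_potential :: "real set \<Rightarrow> real \<Rightarrow> real \<Rightarrow> real \<Rightarrow> ennreal" where
  "dist_potential T \<kappa> \<rho> x =
     (\<Sum>k. ennreal ((\<rho> / 2 ^ Suc k) powr - \<kappa>) * indicator {x. \<exists>t\<in>T. \<bar>x - t\<bar> < 2 * \<rho> / 2 ^ k} x)"

lemma dyadic_scale:
  fixes d \<rho> :: real
  assumes "0 < d" "d \<le> \<rho>"
  obtains k :: nat where "\<rho> / 2 ^ Suc k < d" "d \<le> \<rho> / 2 ^ k"
proof -
  have lim: "\<exists>k. \<rho> / 2 ^ k < d"
  proof -
    obtain n where "\<rho> / d < 2 ^ n" using real_arch_pow[of 2 "\<rho> / d"] by auto
    then show ?thesis using assms by (intro exI[of _ n]) (simp add: field_simps)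
  qed
  define m where "m = (LEAST k. \<rho> / 2 ^ k < d)"
  have m: "\<rho> / 2 ^ m < d" unfolding m_def by (rule LeastI_ex[OF lim])
  then have "m \<noteq> 0" using assms by (intro notI) auto
  then obtain k where k: "m = Suc k" by (cases m) auto
  have "\<not> \<rho> / 2 ^ k < d" using not_less_Least[of k "\<lambda>k. \<rho> / 2 ^ k < d"] k unfolding m_def by simp
  then show ?thesis using that m k by auto
qed

lemma ennreal_term_le_suminf:
  fixes f :: "nat \<Rightarrow> ennreal"
  shows "f k \<le> (\<Sum>k. f k)"
  using sum_le_suminf[of f "{k}"] by simp

text \<open>The single term at the dyadic scale of |x - t| is large enough. The factor 2 in the
  radius turns |x - t| \<le> \<rho> / 2^k into the strict inequality that keeps the sets
  open.\<close>

lemma dist_potential_ge: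
  assumes "t \<in> T" "0 < \<bar>x - t\<bar>" "\<bar>x - t\<bar> \<le> \<rho>" "0 \<le> \<kappa>"
  shows "ennreal (\<bar>x - t\<bar> powr - \<kappa>) \<le> dist_potential T \<kappa> \<rho> x"
proof -
  obtain k where k: "\<rho> / 2 ^ Suc k < \<bar>x - t\<bar>" "\<bar>x - t\<bar> \<le> \<rho> / 2 ^ k"
    using dyadic_scale[OF assms(2,3)] by blast
  have \<rho>: "0 < \<rho>" using assms by linarith
  have "\<bar>x - t\<bar> powr - \<kappa> \<le> (\<rho> / 2 ^ Suc k) powr - \<kappa>"
    using k assms \<rho> by (intro powr_mono2') auto
  moreover have "\<bar>x - t\<bar> < 2 * \<rho> / 2 ^ k"
    by (rule order.strict_trans1[OF k(2)]) (use \<rho> in \<open>simp add: field_simps\<close>)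
  ultimately have "ennreal (\<bar>x - t\<bar> powr - \<kappa>)
      \<le> ennreal ((\<rho> / 2 ^ Suc k) powr - \<kappa>) * indicator {x. \<exists>t\<in>T. \<bar>x - t\<bar> < 2 * \<rho> / 2 ^ k} x"
    using assms(1) by (auto simp: indicator_def intro!: ennreal_leI)
  also have "\<dots> \<le> dist_potential T \<kappa> \<rho> x"
    unfolding dist_potential_def
    using ennreal_term_le_suminf[of "\<lambda>k. ennreal ((\<rho> / 2 ^ Suc k) powr - \<kappa>) * indicator {x. \<exists>t\<in>T. \<bar>x - t\<bar> < 2 * \<rho> / 2 ^ k} x" k]
    by simp
  finally show ?thesis .
qed

text \<open>At a point of T every term of the series is present, and the coefficients are unbounded.
  This serves for radii that belong to E, where the first Schur factor of the far kernel
  diverges.\<close>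

lemma dist_potential_eq_top:
  assumes "x \<in> T" "0 < \<rho>" "0 < \<kappa>"
  shows "dist_potential T \<kappa> \<rho> x = top"
proof (rule ccontr)
  assume "dist_potential T \<kappa> \<rho> x \<noteq> top"
  then obtain M where M: "0 \<le> M" "dist_potential T \<kappa> \<rho> x = ennreal M"
    by (cases "dist_potential T \<kappa> \<rho> x") auto
  \<comment> \<open>k is so large that the coefficient of level k is at least M + 1.\<close>
  obtain k where k: "\<rho> * (M + 1) powr (1 / \<kappa>) < 2 ^ k" using real_arch_pow[of 2] by force
  have "M + 1 = ((M + 1) powr (- 1 / \<kappa>)) powr - \<kappa>"
    using assms M by (simp add: powr_powr)
  also have "\<dots> \<le> (\<rho> / 2 ^ Suc k) powr - \<kappa>"
  proof (intro powr_mono2')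
    have "\<rho> / 2 ^ Suc k \<le> \<rho> / 2 ^ k" using assms by (intro divide_left_mono) auto
    also have "\<dots> \<le> 1 / (M + 1) powr (1 / \<kappa>)"
      using k M assms by (simp add: field_simps)
    also have "\<dots> = (M + 1) powr (- 1 / \<kappa>)" by (simp add: powr_minus_divide)
    finally show "\<rho> / 2 ^ Suc k \<le> (M + 1) powr (- 1 / \<kappa>)" .
  qed (use assms in auto)
  finally have "ennreal (M + 1) \<le> ennreal ((\<rho> / 2 ^ Suc k) powr - \<kappa>) * indicator {x. \<exists>t\<in>T. \<bar>x - t\<bar> < 2 * \<rho> / 2 ^ k} x"
    using assms by (auto simp: indicator_def intro!: ennreal_leI)
  also have "\<dots> \<le> dist_potential T \<kappa> \<rho> x"
    unfolding dist_potential_def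
    using ennreal_term_le_suminf[of "\<lambda>k. ennreal ((\<rho> / 2 ^ Suc k) powr - \<kappa>) * indicator {x. \<exists>t\<in>T. \<bar>x - t\<bar> < 2 * \<rho> / 2 ^ k} x" k]
    by simp
  finally show False using M by simp
qed

text \<open>Each interval of a cover at scale \<delta> grows by \<eta> on both sides.\<close>

lemma emeasure_neighbourhood_le:
  fixes T :: "real set"
  assumes "T \<subseteq> {a..b}" "0 < \<delta>" "0 < \<eta>"
  shows "emeasure lborel {x. \<exists>t\<in>T. \<bar>x - t\<bar> < \<eta>} \<le> ennreal (real (covering_number T \<delta>) * (\<delta> + 2 * \<eta>))"
proof -
  obtain A where A: "finite A" "card A = covering_number T \<delta>" "T \<subseteq> (\<Union>a\<in>A. {a..a + \<delta>})"
    using covering_number_attained assms by metis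
  have "{x. \<exists>t\<in>T. \<bar>x - t\<bar> < \<eta>} \<subseteq> (\<Union>a\<in>A. {a - \<eta>..a + \<delta> + \<eta>})"
  proof
    fix x assume "x \<in> {x. \<exists>t\<in>T. \<bar>x - t\<bar> < \<eta>}"
    then obtain t where t: "t \<in> T" "\<bar>x - t\<bar> < \<eta>" by auto
    then obtain a where "a \<in> A" "t \<in> {a..a + \<delta>}" using A by blast
    then show "x \<in> (\<Union>a\<in>A. {a - \<eta>..a + \<delta> + \<eta>})" using t by (intro UN_I[of a]) auto
  qed
  then have "emeasure lborel {x. \<exists>t\<in>T. \<bar>x - t\<bar> < \<eta>} \<le> emeasure lborel (\<Union>a\<in>A. {a - \<eta>..a + \<delta> + \<eta>})"
    using A by (intro emeasure_mono) auto
  also have "\<dots> \<le> (\<Sum>a\<in>A. emeasure lborel {a - \<eta>..a + \<delta> + \<eta>})"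
    using A by (intro emeasure_subadditive_finite) auto
  also have "\<dots> = (\<Sum>a\<in>A. ennreal (\<delta> + 2 * \<eta>))"
    using assms by (intro sum.cong) auto
  also have "\<dots> = ennreal (real (covering_number T \<delta>) * (\<delta> + 2 * \<eta>))"
    using A assms by (simp add: ennreal_mult' flip: ennreal_of_nat_eq_real_of_nat)
  finally show ?thesis .
qed

lemma open_neighbourhood: "open {x::real. \<exists>t\<in>T. \<bar>x - t\<bar> < \<eta>}"
proof -
  have "{x::real. \<exists>t\<in>T. \<bar>x - t\<bar> < \<eta>} = (\<Union>t\<in>T. {x. \<bar>x - t\<bar> < \<eta>})" by auto
  then show ?thesis by (auto intro!: open_Collect_less continuous_intros)
qed

text \<open>A geometric series over the levels with ratio c = 2^(\<kappa> + A - 1) and first term c.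
  At level k the covering scale is \<delta> = \<rho> / 2^(k+1) and the neighbourhood has radius 4
  \<rho> / 2^k = 8 \<delta>, so each covering interval grows to length 17 \<delta>.\<close>

definition potential_const :: "real \<Rightarrow> real \<Rightarrow> real" where
  "potential_const \<kappa> A = 17 * (2 powr (\<kappa> + A - 1) / (1 - 2 powr (\<kappa> + A - 1)))"

text \<open>Level k contributes 2^(k \<kappa>) times the measure of a neighbourhood of width about
  \<rho> / 2^k, and the sum converges because \<kappa> + A < 1. One function \<Psi> serves all
  subsets T' and all R in [\<rho>, 2 \<rho>], because for small radii both vary with the variable of
  integration; the radius 4 \<rho> / 2^k absorbs 2 R / 2^k.\<close>

lemma dist_potential_dominated:
  fixes T :: "real set"
  assumes T: "T \<subseteq> {a..b}" and \<rho>: "0 < \<rho>" and \<kappa>: "0 \<le> \<kappa>" "\<kappa> + A < 1" and Q: "0 \<le> Q"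
    and cov: "\<And>\<delta>. 0 < \<delta> \<Longrightarrow> \<delta> \<le> \<rho> \<Longrightarrow> real (covering_number T \<delta>) \<le> Q * (\<rho> / \<delta>) powr A"
  obtains \<Psi> where "\<Psi> \<in> borel_measurable borel"
    "\<And>T' R x. T' \<subseteq> T \<Longrightarrow> \<rho> \<le> R \<Longrightarrow> R \<le> 2 * \<rho> \<Longrightarrow> dist_potential T' \<kappa> R x \<le> \<Psi> x"
    "(\<integral>\<^sup>+x. \<Psi> x \<partial>lborel) \<le> ennreal (potential_const \<kappa> A * Q * \<rho> powr (1 - \<kappa>))"
proof
  let ?U = "\<lambda>k. {x. \<exists>t\<in>T. \<bar>x - t\<bar> < 4 * \<rho> / 2 ^ k}"
  let ?\<Psi> = "\<lambda>x. \<Sum>k. ennreal ((\<rho> / 2 ^ Suc k) powr - \<kappa>) * indicator (?U k) x"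
  have [measurable]: "?U k \<in> sets borel" for k
    using open_neighbourhood by (rule borel_open)
  show "?\<Psi> \<in> borel_measurable borel" by measurable
  show "dist_potential T' \<kappa> R x \<le> ?\<Psi> x" if "T' \<subseteq> T" "\<rho> \<le> R" "R \<le> 2 * \<rho>" for T' R x
    unfolding dist_potential_def
  proof (intro suminf_le mult_mono)
    fix k
    show "ennreal ((R / 2 ^ Suc k) powr - \<kappa>) \<le> ennreal ((\<rho> / 2 ^ Suc k) powr - \<kappa>)"
      using that \<rho> \<kappa> by (intro ennreal_leI powr_mono2' divide_right_mono) auto
    have "2 * R / 2 ^ k \<le> 4 * \<rho> / 2 ^ k" using that by (intro divide_right_mono) auto
    then show "indicator {x. \<exists>t\<in>T'. \<bar>x - t\<bar> < 2 * R / 2 ^ k} x \<le> (indicator (?U k) x :: ennreal)"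
      using that by (auto simp: indicator_def intro: order.strict_trans2)
  qed auto
  let ?c = "2 powr (\<kappa> + A - 1)"
  have c: "0 < ?c" "?c < 1" using \<kappa> by (auto simp: powr_less_one)
  have term_le: "ennreal ((\<rho> / 2 ^ Suc k) powr - \<kappa>) * emeasure lborel (?U k)
      \<le> ennreal (17 * Q * \<rho> powr (1 - \<kappa>) * ?c ^ Suc k)" for k
  proof -
    let ?d = "\<rho> / 2 ^ Suc k"
    have d: "0 < ?d" using \<rho> by simp
    have "?d \<le> \<rho> / 1" using \<rho> one_le_power[of "2::real" "Suc k"] by (intro divide_left_mono) auto
    then have N: "real (covering_number T ?d) \<le> Q * (\<rho> / ?d) powr A" using cov[OF d] by simp
    have "\<rho> / ?d = 2 powr real (Suc k)" using \<rho> by (subst powr_realpow) auto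
    then have N': "real (covering_number T ?d) \<le> Q * 2 powr (real (Suc k) * A)"
      using N by (simp only: powr_powr)
    have "emeasure lborel (?U k) \<le> ennreal (real (covering_number T ?d) * (?d + 2 * (4 * \<rho> / 2 ^ k)))"
      using \<rho> by (intro emeasure_neighbourhood_le[OF T]) auto
    also have "\<dots> \<le> ennreal (Q * 2 powr (real (Suc k) * A) * (17 * ?d))"
      using N' \<rho> Q by (intro ennreal_leI mult_mono) (auto simp: field_simps)
    finally have "ennreal (?d powr - \<kappa>) * emeasure lborel (?U k)
        \<le> ennreal (?d powr - \<kappa>) * ennreal (Q * 2 powr (real (Suc k) * A) * (17 * ?d))"
      by (intro mult_left_mono) auto
    also have "\<dots> = ennreal (17 * Q * 2 powr (real (Suc k) * A) * (?d powr - \<kappa> * ?d powr 1))"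
      using d \<rho> by (subst ennreal_mult'[symmetric]) (auto simp: ac_simps)
    also have "?d powr - \<kappa> * ?d powr 1 = ?d powr (1 - \<kappa>)" by (simp only: powr_add[symmetric]) simp
    also have "?d powr (1 - \<kappa>) = \<rho> powr (1 - \<kappa>) * 2 powr (- real (Suc k) * (1 - \<kappa>))"
    proof -
      have "2 powr (- real (Suc k)) = inverse (2 powr real (Suc k))" by (rule powr_minus)
      also have "2 powr real (Suc k) = 2 ^ Suc k" by (rule powr_realpow) simp
      finally have "?d = \<rho> * 2 powr (- real (Suc k))" by (simp only: divide_inverse)
      then have "?d powr (1 - \<kappa>) = (\<rho> * 2 powr (- real (Suc k))) powr (1 - \<kappa>)" by (rule arg_cong)
      also have "\<dots> = \<rho> powr (1 - \<kappa>) * (2 powr (- real (Suc k))) powr (1 - \<kappa>)"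
        by (rule powr_mult)
      finally show ?thesis by (simp only: powr_powr)
    qed
    also have "17 * Q * 2 powr (real (Suc k) * A) * (\<rho> powr (1 - \<kappa>) * 2 powr (- real (Suc k) * (1 - \<kappa>)))
      = 17 * Q * \<rho> powr (1 - \<kappa>) * (2 powr (real (Suc k) * A) * 2 powr (- real (Suc k) * (1 - \<kappa>)))"
      by (simp only: ac_simps)
    also have "2 powr (real (Suc k) * A) * 2 powr (- real (Suc k) * (1 - \<kappa>)) = ?c ^ Suc k"
      unfolding powr_add[symmetric] powr_realpow[OF c(1), symmetric] powr_powr
      by (simp add: algebra_simps)
    finally show ?thesis .
  qed
  have "(\<integral>\<^sup>+x. ?\<Psi> x \<partial>lborel) = (\<Sum>k. ennreal ((\<rho> / 2 ^ Suc k) powr - \<kappa>) * emeasure lborel (?U k))"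
    by (subst nn_integral_suminf) (auto simp: nn_integral_cmult_indicator)
  also have "\<dots> \<le> (\<Sum>k. ennreal (17 * Q * \<rho> powr (1 - \<kappa>) * ?c ^ Suc k))"
    by (intro suminf_le term_le) auto
  also have "\<dots> = ennreal (\<Sum>k. 17 * Q * \<rho> powr (1 - \<kappa>) * ?c ^ Suc k)"
    using c Q by (intro suminf_ennreal2 summable_mult) (auto simp: summable_geometric_iff)
  also have "(\<Sum>k. 17 * Q * \<rho> powr (1 - \<kappa>) * ?c ^ Suc k) = 17 * Q * \<rho> powr (1 - \<kappa>) * (?c * (\<Sum>k. ?c ^ k))"
    using c by (simp add: suminf_mult summable_geometric_iff)
  also have "\<dots> = potential_const \<kappa> A * Q * \<rho> powr (1 - \<kappa>)"
    using c by (subst suminf_geometric) (auto simp: potential_const_def)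
  finally show "(\<integral>\<^sup>+x. ?\<Psi> x \<partial>lborel) \<le> ennreal (potential_const \<kappa> A * Q * \<rho> powr (1 - \<kappa>))" .
qed

text \<open>For each k the set of admissible z is a union over t in E of open sets, hence open even
  for uncountable E.\<close>

lemma measurable_dist_potential:
  fixes S P R X :: "'z::topological_space \<Rightarrow> real"
  assumes cont [continuous_intros]: "continuous_on UNIV S" "continuous_on UNIV P" "continuous_on UNIV R" "continuous_on UNIV X"
  shows "(\<lambda>z. dist_potential {t\<in>E. \<bar>S z - t\<bar> < P z} \<kappa> (R z) (X z)) \<in> borel_measurable borel"
proof -
  let ?O = "\<lambda>k. {z. \<exists>t\<in>E. \<bar>S z - t\<bar> < P z \<and> \<bar>X z - t\<bar> < 2 * R z / 2 ^ k}"
  have [measurable]: "?O k \<in> sets borel" for k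
  proof -
    have eq: "?O k = (\<Union>t\<in>E. {z. \<bar>S z - t\<bar> < P z} \<inter> {z. \<bar>X z - t\<bar> < 2 * R z / 2 ^ k})" by auto
    show ?thesis
      unfolding eq by (intro borel_open open_UN ballI open_Int open_Collect_less continuous_intros) auto
  qed
  have [measurable]: "R \<in> borel_measurable borel" using cont by (intro borel_measurable_continuous_onI)
  have "dist_potential {t\<in>E. \<bar>S z - t\<bar> < P z} \<kappa> (R z) (X z)
     = (\<Sum>k. ennreal ((R z / 2 ^ Suc k) powr - \<kappa>) * indicator (?O k) z)" for z
    unfolding dist_potential_def by (intro suminf_cong arg_cong2[where f = "(*)"]) (auto simp: indicator_def)
  then show ?thesis by simp
qed

section \<open>The Schur test\<close>

lemma nn_integral_powr_from_0:
  assumes "c < 1" "0 < L"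
  shows "(\<integral>\<^sup>+x. ennreal (indicator {0<..L} x * x powr - c) \<partial>lborel) = ennreal (L powr (1 - c) / (1 - c))"
proof -
  have "((\<lambda>x. x powr - c) has_integral (L powr (- c + 1) / (- c + 1))) {0..L}"
    using assms by (intro has_integral_powr_from_0) auto
  then have "((\<lambda>x. if x \<in> {0..L} then x powr - c else 0) has_integral (L powr (1 - c) / (1 - c))) UNIV"
    by (subst has_integral_restrict) (simp_all add: add.commute)
  moreover have "(\<lambda>x. if x \<in> {0..L} then x powr - c else 0) = (\<lambda>x. indicator {0<..L} x * x powr - c)"
    by (auto simp: indicator_def fun_eq_iff)
  ultimately have "((\<lambda>x. indicator {0<..L} x * x powr - c) has_integral (L powr (1 - c) / (1 - c))) UNIV"
    by simp
  then show ?thesis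
    by (intro nn_integral_has_integral_lborel) auto
qed

lemma nn_integral_powr_to_top:
  assumes "1 < c" "0 < L"
  shows "(\<integral>\<^sup>+x. ennreal (indicator {L<..} x * x powr - c) \<partial>lborel) = ennreal (L powr (1 - c) / (c - 1))"
proof -
  have "((\<lambda>x. x powr - c) has_integral - (L powr (- c + 1)) / (- c + 1)) {L..}"
    using assms by (intro has_integral_powr_to_inf) auto
  also have "- (L powr (- c + 1)) / (- c + 1) = L powr (1 - c) / (c - 1)"
    using assms by (simp add: field_simps)
  finally have "((\<lambda>x. if x \<in> {L..} then x powr - c else 0) has_integral (L powr (1 - c) / (c - 1))) UNIV"
    by (subst has_integral_restrict) simp_all
  moreover have "(\<lambda>x. if x \<in> {L..} then x powr - c else 0) = (\<lambda>x. indicator {L..} x * x powr - c)"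
    by (auto simp: indicator_def fun_eq_iff)
  ultimately have "((\<lambda>x. indicator {L..} x * x powr - c) has_integral (L powr (1 - c) / (c - 1))) UNIV"
    by simp
  then have "(\<integral>\<^sup>+x. ennreal (indicator {L..} x * x powr - c) \<partial>lborel) = ennreal (L powr (1 - c) / (c - 1))"
    by (intro nn_integral_has_integral_lborel) auto
  moreover have "(\<integral>\<^sup>+x. ennreal (indicator {L..} x * x powr - c) \<partial>lborel)
      = (\<integral>\<^sup>+x. ennreal (indicator {L<..} x * x powr - c) \<partial>lborel)"
  proof (intro nn_integral_cong_AE)
    have "AE x in lborel. x \<notin> {L}" by (intro AE_not_in finite_imp_null_set_lborel) auto
    then show "AE x in lborel. ennreal (indicator {L..} x * x powr - c) = ennreal (indicator {L<..} x * x powr - c)"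
      by eventually_elim (auto simp: indicator_def)
  qed
  ultimately show ?thesis by simp
qed

lemma nn_integral_reflect:
  fixes f :: "real \<Rightarrow> ennreal"
  assumes [measurable]: "f \<in> borel_measurable borel"
  shows "(\<integral>\<^sup>+x. f (c - x) \<partial>lborel) = (\<integral>\<^sup>+x. f x \<partial>lborel)"
  using nn_integral_real_affine[of f "-1" c] by simp

lemma nn_integral_shift:
  fixes f :: "real \<Rightarrow> ennreal"
  assumes [measurable]: "f \<in> borel_measurable borel"
  shows "(\<integral>\<^sup>+x. f (x + c) \<partial>lborel) = (\<integral>\<^sup>+x. f x \<partial>lborel)"
  using nn_integral_real_affine[of f 1 c] by (simp add: add.commute)

text \<open>W is free of t, so the supremum has disappeared before v is integrated. The third
  Hoelder factor is at most 1 by the normalisation of h, and Fubini leaves the integral of W in r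
  for fixed v.\<close>

lemma kernel_bound_Schur:
  fixes W :: "real \<Rightarrow> real \<Rightarrow> ennreal" and k1 k2 :: "real \<Rightarrow> real \<Rightarrow> real \<Rightarrow> real"
  assumes pq: "1 < p" "p \<le> q"
    and [measurable]: "\<And>t r. k1 t r \<in> borel_measurable borel" "\<And>t r. k2 t r \<in> borel_measurable borel"
    and nonneg: "\<And>t r v. 0 \<le> k1 t r v" "\<And>t r v. 0 \<le> k2 t r v"
    and W [measurable]: "(\<lambda>z. W (fst z) (snd z)) \<in> borel_measurable borel"
    and k: "\<And>t r v. t \<in> E \<Longrightarrow> 0 < r \<Longrightarrow> k t r v \<le> k1 t r v * k2 t r v"
    and dom: "\<And>t r v. t \<in> E \<Longrightarrow> 0 < r \<Longrightarrow>
      ennreal_powr (\<integral>\<^sup>+v. ennreal (k1 t r v powr (p / (p - 1))) \<partial>lborel) (q * (1 - 1 / p)) * ennreal (k2 t r v powr q) \<le> W r v"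
    and int: "\<And>v. (\<integral>\<^sup>+r. W r v * ennreal r * indicator {0<..} r \<partial>lborel) \<le> ennreal C"
  shows "kernel_bound E k p q"
proof (rule kernel_boundI)
  fix h :: "real \<Rightarrow> real" assume h[measurable]: "h \<in> borel_measurable borel" and h0: "\<And>v. 0 \<le> h v"
    and h1: "(\<integral>\<^sup>+v. ennreal (h v powr p) \<partial>lborel) \<le> 1"
  have W'[measurable]: "(\<lambda>z. W (fst z) (snd z)) \<in> borel_measurable (borel \<Otimes>\<^sub>M borel)"
    using W by (simp add: borel_prod)
  have [measurable]: "(\<lambda>v. W r v) \<in> borel_measurable borel" for r
    using measurable_compose[OF _ W', of "\<lambda>v. (r, v)"] by simp
  have [measurable]: "(\<lambda>r. W r v) \<in> borel_measurable borel" for v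
    using measurable_compose[OF _ W', of "\<lambda>r. (r, v)"] by simp
  show "kernel_majorant E k q h C"
  proof (rule kernel_majorantI)
    show "(\<lambda>r. \<integral>\<^sup>+v. W (fst (r, v)) (snd (r, v)) * ennreal (h v powr p) \<partial>lborel) \<in> borel_measurable borel"
      by measurable
  next
    fix r t :: real assume rt: "0 < r" "t \<in> E"
    let ?K = "ennreal_powr (\<integral>\<^sup>+v. ennreal (k1 t r v powr (p / (p - 1))) \<partial>lborel) (q * (1 - 1 / p))"
    have "(\<integral>\<^sup>+v. ennreal (k t r v * h v) \<partial>lborel) \<le> (\<integral>\<^sup>+v. ennreal (k1 t r v * k2 t r v * h v) \<partial>lborel)"
      using k[OF rt(2,1)] h0 by (intro nn_integral_mono ennreal_leI mult_right_mono) auto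
    then have "ennreal_powr (\<integral>\<^sup>+v. ennreal (k t r v * h v) \<partial>lborel) q
      \<le> ennreal_powr (\<integral>\<^sup>+v. ennreal (k1 t r v * k2 t r v * h v) \<partial>lborel) q"
      using pq by (intro ennreal_powr_mono) auto
    also have "\<dots> \<le> ?K * ennreal (1 powr (q / p - 1)) * (\<integral>\<^sup>+v. ennreal (k2 t r v powr q * h v powr p) \<partial>lborel)"
      using pq h1 nonneg h0 by (intro nn_integral_Schur_Holder) auto
    also have "\<dots> = (\<integral>\<^sup>+v. ?K * ennreal (k2 t r v powr q) * ennreal (h v powr p) \<partial>lborel)"
      by (simp add: nn_integral_cmult[symmetric] ennreal_mult mult.assoc)
    also have "\<dots> \<le> (\<integral>\<^sup>+v. W (fst (r, v)) (snd (r, v)) * ennreal (h v powr p) \<partial>lborel)"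
      using dom[OF rt(2,1)] by (intro nn_integral_mono) (auto intro: mult_right_mono)
    finally show "ennreal_powr (\<integral>\<^sup>+v. ennreal (k t r v * h v) \<partial>lborel) q
      \<le> (\<integral>\<^sup>+v. W (fst (r, v)) (snd (r, v)) * ennreal (h v powr p) \<partial>lborel)" .
  next
    have "(\<integral>\<^sup>+r. (\<integral>\<^sup>+v. W (fst (r, v)) (snd (r, v)) * ennreal (h v powr p) \<partial>lborel) * ennreal r * indicator {0<..} r \<partial>lborel)
       = (\<integral>\<^sup>+r. (\<integral>\<^sup>+v. (W (fst (r, v)) (snd (r, v)) * ennreal (h v powr p)) * (ennreal r * indicator {0<..} r) \<partial>lborel) \<partial>lborel)"
      by (intro nn_integral_cong, subst nn_integral_multc, measurable) (simp add: mult.assoc)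
    also have "\<dots> = (\<integral>\<^sup>+v. (\<integral>\<^sup>+r. (W (fst (r, v)) (snd (r, v)) * ennreal (h v powr p)) * (ennreal r * indicator {0<..} r) \<partial>lborel) \<partial>lborel)"
      by (rule lborel_pair.Fubini') measurable
    also have "\<dots> = (\<integral>\<^sup>+v. ennreal (h v powr p) * (\<integral>\<^sup>+r. W r v * ennreal r * indicator {0<..} r \<partial>lborel) \<partial>lborel)"
      by (intro nn_integral_cong) (simp add: nn_integral_cmult[symmetric] ac_simps)
    also have "\<dots> \<le> (\<integral>\<^sup>+v. ennreal (h v powr p) * ennreal C \<partial>lborel)"
      by (intro nn_integral_mono mult_left_mono int) auto
    also have "\<dots> = (\<integral>\<^sup>+v. ennreal (h v powr p) \<partial>lborel) * ennreal C"
      by (simp add: nn_integral_multc)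
    also have "\<dots> \<le> 1 * ennreal C"
      by (intro mult_right_mono h1) auto
    finally show "(\<integral>\<^sup>+r. (\<integral>\<^sup>+v. W (fst (r, v)) (snd (r, v)) * ennreal (h v powr p) \<partial>lborel) * ennreal r * indicator {0<..} r \<partial>lborel) \<le> ennreal C"
      by simp
  qed
qed

text \<open>The kernel is split according to the nearer end of \<open>((r - t)\<^sup>2, (r + t)\<^sup>2)\<close>, an interval of
  length \<open>4rt\<close>; \<open>edge_dist\<close> is the distance to that end.\<close>

definition edge_dist :: "bool \<Rightarrow> real \<Rightarrow> real \<Rightarrow> real \<Rightarrow> real" where
  "edge_dist outer t r v = (if outer then (r + t)\<^sup>2 - v else v - (r - t)\<^sup>2)"

definition edge_set :: "bool \<Rightarrow> real \<Rightarrow> real \<Rightarrow> real set" where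
  "edge_set outer t r = {v. 0 < edge_dist outer t r v \<and> edge_dist outer t r v \<le> 2 * r * t}"

text \<open>The two distances of v to the ends add up to 4 r t. On \<open>edge_set\<close> the
  larger one is at least 2 r t and is replaced by 2 r t.\<close>

definition edge_kernel :: "bool \<Rightarrow> real \<Rightarrow> real \<Rightarrow> real \<Rightarrow> real" where
  "edge_kernel outer t r v =
     indicator (edge_set outer t r) v * (2 * r * t * edge_dist outer t r v) powr (-1/2)"

lemma measurable_edge [measurable]:
  "edge_dist outer t r \<in> borel_measurable borel" "edge_set outer t r \<in> sets borel"
  "edge_kernel outer t r \<in> borel_measurable borel"
proof -
  show 1[measurable]: "edge_dist outer t r \<in> borel_measurable borel"
    unfolding edge_dist_def by (cases outer) auto
  show [measurable]: "edge_set outer t r \<in> sets borel"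
    unfolding edge_set_def by measurable
  show "edge_kernel outer t r \<in> borel_measurable borel"
    unfolding edge_kernel_def by measurable
qed

lemma edge_kernel_nonneg: "0 \<le> edge_kernel outer t r v"
  by (simp add: edge_kernel_def)

lemma circle_kernel_le_edge:
  assumes rt: "0 < r" "0 < t"
  shows "circle_kernel t r v \<le> edge_kernel True t r v + edge_kernel False t r v"
proof (cases "v \<in> {(r - t)\<^sup>2<..<(r + t)\<^sup>2}")
  case True
  let ?x = "(r + t)\<^sup>2 - v" and ?y = "v - (r - t)\<^sup>2"
  have xy: "0 < ?x" "0 < ?y" "?x + ?y = 4 * r * t"
    using True by (auto simp: power2_eq_square algebra_simps)
  have pow: "1 / sqrt (a * b) = (a * b) powr (-1/2)" if "0 < a" "0 < b" for a b :: real
    using that by (simp add: powr_minus_divide powr_half_sqrt)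
  have K: "circle_kernel t r v = (?x * ?y) powr (-1/2)"
    using True xy by (simp add: circle_kernel_def pow)
  show ?thesis
  proof (cases "?x \<le> 2 * r * t")
    case x: True
    have "(?x * ?y) powr (-1/2) \<le> (2 * r * t * ?x) powr (-1/2)"
    proof (intro powr_mono2')
      have "2 * r * t \<le> ?y" using xy x by linarith
      then show "2 * r * t * ?x \<le> ?x * ?y" using xy by (simp add: mult.commute mult_left_mono)
      show "0 < 2 * r * t * ?x" using rt xy by simp
    qed auto
    also have "\<dots> = edge_kernel True t r v"
      using xy x by (simp add: edge_kernel_def edge_set_def edge_dist_def)
    finally show ?thesis using edge_kernel_nonneg[of False t r v] by (simp add: K)
  next
    case x: False
    then have y: "?y \<le> 2 * r * t" using xy by linarith
    have "(?x * ?y) powr (-1/2) \<le> (2 * r * t * ?y) powr (-1/2)"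
    proof (intro powr_mono2')
      have "2 * r * t \<le> ?x" using x by linarith
      then show "2 * r * t * ?y \<le> ?x * ?y" using xy by (intro mult_right_mono) auto
      show "0 < 2 * r * t * ?y" using rt xy by simp
    qed auto
    also have "\<dots> = edge_kernel False t r v"
      using xy y by (simp add: edge_kernel_def edge_set_def edge_dist_def)
    finally show ?thesis using edge_kernel_nonneg[of True t r v] by (simp add: K)
  qed
next
  case False
  then have "circle_kernel t r v = 0" by (simp add: circle_kernel_def)
  then show ?thesis using edge_kernel_nonneg[of True t r v] edge_kernel_nonneg[of False t r v] by simp
qed

section \<open>Hoelder estimate at one end of the interval\<close>

lemma nn_integral_edge_powr:
  assumes "c < 1" "0 < r" "0 < t"
  shows "(\<integral>\<^sup>+v. ennreal (indicator (edge_set outer t r) v * edge_dist outer t r v powr - c) \<partial>lborel)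
    = ennreal ((2 * r * t) powr (1 - c) / (1 - c))"
proof -
  let ?f = "\<lambda>x. ennreal (indicator {0<..2 * r * t} x * x powr - c)"
  have f: "ennreal (indicator (edge_set outer t r) v * edge_dist outer t r v powr - c) = ?f (edge_dist outer t r v)" for v
    by (simp add: edge_set_def indicator_def)
  have "(\<integral>\<^sup>+v. ?f (edge_dist outer t r v) \<partial>lborel) = (\<integral>\<^sup>+x. ?f x \<partial>lborel)"
    using nn_integral_reflect[of ?f "(r + t)\<^sup>2"] nn_integral_shift[of ?f "- (r - t)\<^sup>2"]
    by (cases outer) (simp_all add: edge_dist_def)
  then show ?thesis
    using assms by (simp add: f nn_integral_powr_from_0)
qed

text \<open>The first Schur factor integrates to (2 r t)^(1 - a p'/2 - p'/2) / (1 - a p'/2), which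
  is raised to the power q / p'. The power of 4 bounds the power of 2 t, a number in [2, 4].\<close>

definition edge_const :: "real \<Rightarrow> real \<Rightarrow> real \<Rightarrow> real" where
  "edge_const a p q = 4 powr \<bar>(1 - a) * q / 2 - q / p\<bar> * (1 / (1 - a * (p / (p - 1)) / 2)) powr (q * (1 - 1 / p))"

lemma edge_const_nonneg: "0 \<le> edge_const a p q"
  by (simp add: edge_const_def)

text \<open>With d the edge distance, d^(-1/2) is split into d^(-a/2), whose p'-th power is
  integrable because a p' < 2, and d^(-(1 - a)/2), whose q-th power has the exponent -\<kappa>. The
  bound \<mu> stays free because truncation at a height depending on r will change the norm of
  g.\<close>

lemma edge_estimate:
  fixes g :: "real \<Rightarrow> real"
  assumes pq: "1 < p" "p \<le> q" and a: "a * (p / (p - 1)) < 2"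
    and t: "1 \<le> t" "t \<le> 2" and r: "0 < r"
    and [measurable]: "g \<in> borel_measurable borel" and g: "\<And>v. 0 \<le> g v"
    and \<mu>: "(\<integral>\<^sup>+v. ennreal (g v powr p) \<partial>lborel) \<le> ennreal \<mu>" "0 < \<mu>"
  shows "ennreal_powr (\<integral>\<^sup>+v. ennreal (edge_kernel outer t r v * g v) \<partial>lborel) q
    \<le> ennreal (edge_const a p q * r powr ((1 - a) * q / 2 - q / p) * \<mu> powr (q / p - 1)) *
      (\<integral>\<^sup>+v. ennreal (indicator (edge_set outer t r) v * edge_dist outer t r v powr - ((1 - a) * q / 2) * g v powr p) \<partial>lborel)"
proof -
  let ?I = "indicator (edge_set outer t r) :: real \<Rightarrow> real" and ?d = "edge_dist outer t r"
  define p' where "p' = p / (p - 1)"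
  let ?\<kappa> = "(1 - a) * q / 2"
  let ?k1 = "\<lambda>v. ?I v * ((2 * r * t) powr (-1/2) * ?d v powr (- a / 2))"
  let ?k2 = "\<lambda>v. ?I v * ?d v powr (- (1 - a) / 2)"
  have rt: "0 < 2 * r * t" using r t by simp
  have p': "0 < p'" "p' * (1 - 1 / p) = 1" using pq by (auto simp: p'_def field_simps)
  have ap: "a * p' / 2 < 1" using a by (simp flip: p'_def)
  have "(\<integral>\<^sup>+v. ennreal (?k1 v powr p') \<partial>lborel)
    = (\<integral>\<^sup>+v. ennreal ((2 * r * t) powr (- p' / 2)) * ennreal (?I v * ?d v powr - (a * p' / 2)) \<partial>lborel)"
    using rt p' by (intro nn_integral_cong)
      (auto simp: indicator_def powr_mult powr_powr ennreal_mult[symmetric] algebra_simps)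
  also have "\<dots> = ennreal ((2 * r * t) powr (- p' / 2)) * ennreal ((2 * r * t) powr (1 - a * p' / 2) / (1 - a * p' / 2))"
    using ap r t by (subst nn_integral_cmult, measurable, subst nn_integral_edge_powr) auto
  also have "\<dots> = ennreal ((2 * r * t) powr (1 - a * p' / 2 - p' / 2) * (1 / (1 - a * p' / 2)))"
  proof -
    have "(2 * r * t) powr (1 - a * p' / 2 - p' / 2) = (2 * r * t) powr (- p' / 2) * (2 * r * t) powr (1 - a * p' / 2)"
      unfolding powr_add[symmetric] by (rule arg_cong) simp
    then show ?thesis using ap by (subst ennreal_mult[symmetric]) auto
  qed
  finally have I0: "(\<integral>\<^sup>+v. ennreal (?k1 v powr p') \<partial>lborel)
     = ennreal ((2 * r * t) powr (1 - a * p' / 2 - p' / 2) * (1 / (1 - a * p' / 2)))" .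
  have pw: "ennreal_powr (ennreal (z powr c * w)) e = ennreal (z powr (c * e) * w powr e)"
    if "0 \<le> w" for z w c e :: real
    using that by (simp add: ennreal_powr_ennreal powr_mult powr_powr)
  have I1: "ennreal_powr (\<integral>\<^sup>+v. ennreal (?k1 v powr p') \<partial>lborel) (q * (1 - 1 / p))
     = ennreal ((2 * r * t) powr ((1 - a * p' / 2 - p' / 2) * (q * (1 - 1 / p))) * (1 / (1 - a * p' / 2)) powr (q * (1 - 1 / p)))"
    unfolding I0 using ap by (intro pw) auto
  \<comment> \<open>By p' (1 - 1/p) = 1 the exponent of 2 r t becomes q (1 - 1/p) - a q / 2 - q /
    2.\<close>
  have e: "(1 - a * p' / 2 - p' / 2) * (q * (1 - 1 / p)) = ?\<kappa> - q / p"
  proof -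
    have "(1 - a * p' / 2 - p' / 2) * (q * y) = q * y - (a / 2) * q * (p' * y) - q / 2 * (p' * y)" for y
      by (simp add: field_simps)
    from this[of "1 - 1 / p"]
    have "(1 - a * p' / 2 - p' / 2) * (q * (1 - 1 / p)) = q * (1 - 1 / p) - (a / 2) * q * 1 - q / 2 * 1"
      unfolding p'(2) .
    also have "\<dots> = ?\<kappa> - q / p" by (simp add: field_simps)
    finally show ?thesis .
  qed
  have "(2 * r * t) powr (?\<kappa> - q / p) = r powr (?\<kappa> - q / p) * (2 * t) powr (?\<kappa> - q / p)"
    using powr_mult[of r "2 * t"] by (simp add: ac_simps)
  also have "\<dots> \<le> r powr (?\<kappa> - q / p) * 4 powr \<bar>?\<kappa> - q / p\<bar>"
  proof (intro mult_left_mono)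
    have "(2 * t) powr (?\<kappa> - q / p) \<le> (2 * t) powr \<bar>?\<kappa> - q / p\<bar>"
      using t by (intro powr_mono) auto
    also have "\<dots> \<le> 4 powr \<bar>?\<kappa> - q / p\<bar>" using t by (intro powr_mono2) auto
    finally show "(2 * t) powr (?\<kappa> - q / p) \<le> 4 powr \<bar>?\<kappa> - q / p\<bar>" .
  qed auto
  finally have "(2 * r * t) powr (?\<kappa> - q / p) * (1 / (1 - a * p' / 2)) powr (q * (1 - 1 / p))
      \<le> r powr (?\<kappa> - q / p) * 4 powr \<bar>?\<kappa> - q / p\<bar> * (1 / (1 - a * p' / 2)) powr (q * (1 - 1 / p))"
    by (intro mult_right_mono) auto
  also have "\<dots> = edge_const a p q * r powr (?\<kappa> - q / p)"
    by (simp add: edge_const_def p'_def)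
  finally have I2: "ennreal_powr (\<integral>\<^sup>+v. ennreal (?k1 v powr p') \<partial>lborel) (q * (1 - 1 / p))
     \<le> ennreal (edge_const a p q * r powr (?\<kappa> - q / p))"
    unfolding I1 e by (rule ennreal_leI)
  have "edge_kernel outer t r v = ?k1 v * ?k2 v" for v
  proof (cases "v \<in> edge_set outer t r")
    case True
    then have "0 < ?d v" by (simp add: edge_set_def)
    have "?d v powr (-1/2) = ?d v powr (- a / 2) * ?d v powr (- (1 - a) / 2)"
      by (simp add: powr_add[symmetric] field_simps)
    then show ?thesis using True by (simp add: edge_kernel_def powr_mult)
  qed (simp add: edge_kernel_def)
  then have "ennreal_powr (\<integral>\<^sup>+v. ennreal (edge_kernel outer t r v * g v) \<partial>lborel) q
     = ennreal_powr (\<integral>\<^sup>+v. ennreal (?k1 v * ?k2 v * g v) \<partial>lborel) q" by simp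
  also have "\<dots> \<le> ennreal_powr (\<integral>\<^sup>+v. ennreal (?k1 v powr p') \<partial>lborel) (q * (1 - 1 / p))
       * ennreal (\<mu> powr (q / p - 1)) * (\<integral>\<^sup>+v. ennreal (?k2 v powr q * g v powr p) \<partial>lborel)"
    unfolding p'_def using pq \<mu> g by (intro nn_integral_Schur_Holder) auto
  also have "\<dots> \<le> ennreal (edge_const a p q * r powr (?\<kappa> - q / p)) * ennreal (\<mu> powr (q / p - 1))
       * (\<integral>\<^sup>+v. ennreal (?k2 v powr q * g v powr p) \<partial>lborel)"
    by (intro mult_right_mono I2) auto
  also have "(\<integral>\<^sup>+v. ennreal (?k2 v powr q * g v powr p) \<partial>lborel)
    = (\<integral>\<^sup>+v. ennreal (?I v * ?d v powr - ?\<kappa> * g v powr p) \<partial>lborel)"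
  proof (intro nn_integral_cong)
    fix v
    have "- (1 - a) / 2 * q = - ?\<kappa>" by (simp add: field_simps)
    then show "ennreal (?k2 v powr q * g v powr p) = ennreal (?I v * ?d v powr - ?\<kappa> * g v powr p)"
      by (cases "v \<in> edge_set outer t r") (simp_all only: indicator_simps powr_powr mult_1, simp)
  qed
  finally show ?thesis
    by (simp add: ennreal_mult[symmetric] edge_const_nonneg)
qed


text \<open>The Schur test for one edge, with the first factor already integrated into a power of r.
  D restricts r to the range where W is a majorant.\<close>

lemma kernel_bound_edge:
  fixes W :: "real \<Rightarrow> real \<Rightarrow> ennreal"
  assumes pq: "1 < p" "p \<le> q" and a: "a * (p / (p - 1)) < 2" and \<kappa>: "\<kappa> = (1 - a) * q / 2"
    and E: "E \<subseteq> {1..2}" and D [measurable]: "D \<in> sets borel"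
    and W [measurable]: "(\<lambda>z. W (fst z) (snd z)) \<in> borel_measurable borel"
    and dom: "\<And>t r v. t \<in> E \<Longrightarrow> 0 < r \<Longrightarrow> r \<in> D \<Longrightarrow> v \<in> edge_set outer t r \<Longrightarrow>
       ennreal (r powr (\<kappa> - q / p) * edge_dist outer t r v powr - \<kappa>) \<le> W r v"
    and int: "\<And>v. (\<integral>\<^sup>+r. W r v * ennreal r * indicator ({0<..} \<inter> D) r \<partial>lborel) \<le> ennreal C"
    and C: "0 \<le> C"
  shows "kernel_bound E (\<lambda>t r v. indicator D r * edge_kernel outer t r v) p q"
proof (rule kernel_boundI)
  fix h :: "real \<Rightarrow> real" assume h[measurable]: "h \<in> borel_measurable borel" and h0: "\<And>v. 0 \<le> h v"
    and h1: "(\<integral>\<^sup>+v. ennreal (h v powr p) \<partial>lborel) \<le> 1"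
  let ?c = "ennreal (edge_const a p q)"
  let ?W = "\<lambda>r v. ?c * W r v * indicator D r"
  have W'[measurable]: "(\<lambda>z. W (fst z) (snd z)) \<in> borel_measurable (borel \<Otimes>\<^sub>M borel)"
    using W by (simp add: borel_prod)
  have [measurable]: "(\<lambda>v. W r v) \<in> borel_measurable borel" for r
    using measurable_compose[OF _ W', of "\<lambda>v. (r, v)"] by simp
  have [measurable]: "(\<lambda>r. W r v) \<in> borel_measurable borel" for v
    using measurable_compose[OF _ W', of "\<lambda>r. (r, v)"] by simp
  show "kernel_majorant E (\<lambda>t r v. indicator D r * edge_kernel outer t r v) q h (edge_const a p q * C)"
  proof (rule kernel_majorantI)
    show "(\<lambda>r. \<integral>\<^sup>+v. (?c * W (fst (r, v)) (snd (r, v)) * indicator D r) * ennreal (h v powr p) \<partial>lborel) \<in> borel_measurable borel"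
      by measurable
  next
    fix r t :: real assume rt: "0 < r" "t \<in> E"
    then have t: "1 \<le> t" "t \<le> 2" using E by auto
    show "ennreal_powr (\<integral>\<^sup>+v. ennreal (indicator D r * edge_kernel outer t r v * h v) \<partial>lborel) q
      \<le> (\<integral>\<^sup>+v. (?c * W (fst (r, v)) (snd (r, v)) * indicator D r) * ennreal (h v powr p) \<partial>lborel)"
    proof (cases "r \<in> D")
      case True
      have "ennreal_powr (\<integral>\<^sup>+v. ennreal (edge_kernel outer t r v * h v) \<partial>lborel) q
      \<le> ennreal (edge_const a p q * r powr (\<kappa> - q / p) * 1 powr (q / p - 1)) *
      (\<integral>\<^sup>+v. ennreal (indicator (edge_set outer t r) v * edge_dist outer t r v powr - \<kappa> * h v powr p) \<partial>lborel)"
        unfolding \<kappa> using pq a t rt h0 h1 by (intro edge_estimate) auto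
      also have "\<dots> = (\<integral>\<^sup>+v. ?c * (ennreal (r powr (\<kappa> - q / p)) * ennreal (indicator (edge_set outer t r) v * edge_dist outer t r v powr - \<kappa> * h v powr p)) \<partial>lborel)"
        by (simp add: nn_integral_cmult ennreal_mult edge_const_nonneg mult.assoc)
      also have "\<dots> \<le> (\<integral>\<^sup>+v. (?c * W (fst (r, v)) (snd (r, v)) * indicator D r) * ennreal (h v powr p) \<partial>lborel)"
      proof (intro nn_integral_mono)
        fix v
        show "?c * (ennreal (r powr (\<kappa> - q / p)) * ennreal (indicator (edge_set outer t r) v * edge_dist outer t r v powr - \<kappa> * h v powr p))
          \<le> (?c * W (fst (r, v)) (snd (r, v)) * indicator D r) * ennreal (h v powr p)"
        proof (cases "v \<in> edge_set outer t r")
          case v: True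
          have "?c * (ennreal (r powr (\<kappa> - q / p) * edge_dist outer t r v powr - \<kappa>) * ennreal (h v powr p))
             \<le> ?c * (W r v * ennreal (h v powr p))"
            by (intro mult_left_mono mult_right_mono dom rt True v) auto
          then show ?thesis using v True by (simp add: ennreal_mult mult.assoc)
        qed auto
      qed
      finally show ?thesis using True by simp
    qed auto
  next
    have "(\<integral>\<^sup>+r. (\<integral>\<^sup>+v. (?c * W (fst (r, v)) (snd (r, v)) * indicator D r) * ennreal (h v powr p) \<partial>lborel) * ennreal r * indicator {0<..} r \<partial>lborel)
       = (\<integral>\<^sup>+r. (\<integral>\<^sup>+v. ((?c * W (fst (r, v)) (snd (r, v)) * indicator D r) * ennreal (h v powr p)) * (ennreal r * indicator {0<..} r) \<partial>lborel) \<partial>lborel)"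
      by (intro nn_integral_cong, subst nn_integral_multc, measurable) (simp add: mult.assoc)
    also have "\<dots> = (\<integral>\<^sup>+v. (\<integral>\<^sup>+r. ((?c * W (fst (r, v)) (snd (r, v)) * indicator D r) * ennreal (h v powr p)) * (ennreal r * indicator {0<..} r) \<partial>lborel) \<partial>lborel)"
      by (rule lborel_pair.Fubini') measurable
    also have "\<dots> = (\<integral>\<^sup>+v. ?c * (ennreal (h v powr p) * (\<integral>\<^sup>+r. W r v * ennreal r * indicator ({0<..} \<inter> D) r \<partial>lborel)) \<partial>lborel)"
      by (intro nn_integral_cong) (simp add: nn_integral_cmult[symmetric] ac_simps indicator_inter_arith)
    also have "\<dots> \<le> (\<integral>\<^sup>+v. ?c * (ennreal (h v powr p) * ennreal C) \<partial>lborel)"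
      by (intro nn_integral_mono mult_left_mono int) auto
    also have "\<dots> = (\<integral>\<^sup>+v. ennreal (h v powr p) \<partial>lborel) * (?c * ennreal C)"
      by (subst nn_integral_multc[symmetric], measurable) (simp add: ac_simps)
    also have "\<dots> \<le> 1 * (?c * ennreal C)"
      by (intro mult_right_mono h1) auto
    finally show "(\<integral>\<^sup>+r. (\<integral>\<^sup>+v. (?c * W (fst (r, v)) (snd (r, v)) * indicator D r) * ennreal (h v powr p) \<partial>lborel) * ennreal r * indicator {0<..} r \<partial>lborel) \<le> ennreal (edge_const a p q * C)"
      using C by (simp add: ennreal_mult edge_const_nonneg)
  qed
qed

section \<open>Large radii\<close>

text \<open>For \<delta> \<ge> 1 a single interval covers E; the range up to 5 admits potentials of
  radius sqrt v with v \<le> 25.\<close>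

definition covering_bound :: "real set \<Rightarrow> real \<Rightarrow> bool" where
  "covering_bound E b \<longleftrightarrow>
     (\<exists>C\<ge>0. \<forall>\<delta>. 0 < \<delta> \<and> \<delta> \<le> 5 \<longrightarrow> real (covering_number E \<delta>) \<le> C * \<delta> powr - b)"

lemma potential_const_nonneg: "\<kappa> + A < 1 \<Longrightarrow> 0 \<le> potential_const \<kappa> A"
  by (simp add: potential_const_def powr_less_one less_imp_le)

lemma measurable_dist_potential_full:
  fixes R X :: "'z::topological_space \<Rightarrow> real"
  assumes "E \<subseteq> {1..2}" "continuous_on UNIV R" "continuous_on UNIV X"
  shows "(\<lambda>z. dist_potential E \<kappa> (R z) (X z)) \<in> borel_measurable borel"
proof -
  \<comment> \<open>The constant window of radius 3 about 0 contains E, so the statement with moving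
    windows applies.\<close>
  have "{t \<in> E. \<bar>0 - t\<bar> < 3} = E" using assms(1) by force
  moreover have "(\<lambda>z. dist_potential {t \<in> E. \<bar>0 - t\<bar> < 3} \<kappa> (R z) (X z)) \<in> borel_measurable borel"
    by (rule measurable_dist_potential) (use assms in auto)
  ultimately show ?thesis by simp
qed

text \<open>With \<rho>^-b moved into the constant, the global count \<delta>^-b takes the local
  form (\<rho> / \<delta>)^b.\<close>

lemma nn_integral_dist_potential_le:
  assumes E: "E \<subseteq> {1..2}" and b: "covering_bound E b" and \<kappa>: "0 \<le> \<kappa>" "\<kappa> + b < 1"
  obtains C where "0 \<le> C" "\<And>\<rho>. 0 < \<rho> \<Longrightarrow> \<rho> \<le> 5 \<Longrightarrow>
    (\<integral>\<^sup>+x. dist_potential E \<kappa> \<rho> x \<partial>lborel) \<le> ennreal (C * \<rho> powr (1 - \<kappa> - b))"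
proof -
  from b obtain C where C: "0 \<le> C"
    "\<And>\<delta>. 0 < \<delta> \<Longrightarrow> \<delta> \<le> 5 \<Longrightarrow> real (covering_number E \<delta>) \<le> C * \<delta> powr - b"
    unfolding covering_bound_def by blast
  show ?thesis
  proof (rule that[of "potential_const \<kappa> b * C"])
    show "0 \<le> potential_const \<kappa> b * C" using C \<kappa> by (simp add: potential_const_nonneg)
    fix \<rho> :: real assume \<rho>: "0 < \<rho>" "\<rho> \<le> 5"
    have cov: "real (covering_number E \<delta>) \<le> (C * \<rho> powr - b) * (\<rho> / \<delta>) powr b" if "0 < \<delta>" "\<delta> \<le> \<rho>" for \<delta>
    proof -
      have "\<delta> powr - b = \<rho> powr - b * (\<rho> / \<delta>) powr b"
        using that \<rho> by (simp add: powr_divide powr_minus field_simps)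
      then show ?thesis using C(2)[of \<delta>] that \<rho> by (simp add: mult.assoc)
    qed
    obtain \<Psi> where \<Psi>: "\<Psi> \<in> borel_measurable borel"
      "\<And>T' R x. T' \<subseteq> E \<Longrightarrow> \<rho> \<le> R \<Longrightarrow> R \<le> 2 * \<rho> \<Longrightarrow> dist_potential T' \<kappa> R x \<le> \<Psi> x"
      "(\<integral>\<^sup>+x. \<Psi> x \<partial>lborel) \<le> ennreal (potential_const \<kappa> b * (C * \<rho> powr - b) * \<rho> powr (1 - \<kappa>))"
      by (rule dist_potential_dominated[OF E \<rho>(1) \<kappa> _ cov]) (use C in auto)
    have "(\<integral>\<^sup>+x. dist_potential E \<kappa> \<rho> x \<partial>lborel) \<le> (\<integral>\<^sup>+x. \<Psi> x \<partial>lborel)"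
      using \<rho> by (intro nn_integral_mono \<Psi>(2)) auto
    also note \<Psi>(3)
    also have "potential_const \<kappa> b * (C * \<rho> powr - b) * \<rho> powr (1 - \<kappa>) = potential_const \<kappa> b * C * \<rho> powr (1 - \<kappa> - b)"
      using powr_add[of \<rho> "- b" "1 - \<kappa>"] by (simp add: ac_simps)
    finally show "(\<integral>\<^sup>+x. dist_potential E \<kappa> \<rho> x \<partial>lborel) \<le> ennreal (potential_const \<kappa> b * C * \<rho> powr (1 - \<kappa> - b))" .
  qed
qed

text \<open>An outer edge distance of at most 2 r t means v \<ge> r^2 + t^2. The factorisation turns
  the distance measured in v into the distance of sqrt v - r to t, times a factor comparable to r +
  t.\<close>

lemma edge_outerD:
  assumes "v \<in> edge_set True t r" "0 < r" "0 < t"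
  shows "0 < v" "r \<le> sqrt v" "t \<le> sqrt v" "sqrt v < r + t" "edge_dist True t r v = (r + t - sqrt v) * (r + t + sqrt v)"
proof -
  have v: "v < (r + t)\<^sup>2" "r\<^sup>2 + t\<^sup>2 \<le> v"
    using assms by (auto simp: edge_set_def edge_dist_def power2_eq_square algebra_simps)
  show "0 < v" using v assms by (smt (verit) zero_less_power)
  show "r \<le> sqrt v" "t \<le> sqrt v" using v by (auto intro!: real_le_rsqrt intro: order_trans[rotated])
  show "sqrt v < r + t" using v assms by (intro real_less_lsqrt) auto
  show "edge_dist True t r v = (r + t - sqrt v) * (r + t + sqrt v)"
  proof -
    have "(r + t - sqrt v) * (r + t + sqrt v) = (r + t)\<^sup>2 - (sqrt v)\<^sup>2"
      by (simp add: power2_eq_square algebra_simps)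
    then show ?thesis using \<open>0 < v\<close> by (simp add: edge_dist_def)
  qed
qed

text \<open>Now v \<le> r^2 + t^2. The second factor sqrt v + |r - t| may be small when r is near t,
  which is why middle radii need their own argument.\<close>

lemma edge_innerD:
  assumes "v \<in> edge_set False t r" "0 < r" "0 < t"
  shows "0 < v" "\<bar>r - t\<bar> < sqrt v" "v \<le> r\<^sup>2 + t\<^sup>2" "sqrt v \<le> r + t"
    "edge_dist False t r v = (sqrt v - \<bar>r - t\<bar>) * (sqrt v + \<bar>r - t\<bar>)"
proof -
  have v: "(r - t)\<^sup>2 < v" "v \<le> r\<^sup>2 + t\<^sup>2"
    using assms by (auto simp: edge_set_def edge_dist_def power2_eq_square algebra_simps)
  show "0 < v" using v(1) by (rule order.strict_trans1[rotated]) simp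
  show "v \<le> r\<^sup>2 + t\<^sup>2" by fact
  show "\<bar>r - t\<bar> < sqrt v" using v by (intro real_less_rsqrt) simp
  have "v \<le> (r + t)\<^sup>2" using v(2) assms by (rule_tac order_trans) (auto simp: power2_sum)
  then show "sqrt v \<le> r + t" using assms by (intro real_le_lsqrt) auto
  have "(sqrt v - \<bar>r - t\<bar>) * (sqrt v + \<bar>r - t\<bar>) = (sqrt v)\<^sup>2 - \<bar>r - t\<bar>\<^sup>2"
    by (simp add: power2_eq_square algebra_simps)
  then show "edge_dist False t r v = (sqrt v - \<bar>r - t\<bar>) * (sqrt v + \<bar>r - t\<bar>)"
    using \<open>0 < v\<close> by (simp add: edge_dist_def)
qed

lemma edge_set_sqrt_dist:
  assumes "v \<in> edge_set outer t r" "0 < r" "0 < t"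
  shows "\<bar>sqrt v - r\<bar> \<le> t"
proof (cases outer)
  case True
  with edge_outerD[of v t r] assms show ?thesis by auto
next
  case False
  with edge_innerD[of v t r] assms show ?thesis by auto
qed

text \<open>q \<ge> p makes the weight r^(-q/p) r = r^(1 - q/p) bounded for r \<ge> 1/2.\<close>

lemma nn_integral_weight_le:
  fixes P :: "real \<Rightarrow> ennreal"
  assumes P: "P \<in> borel_measurable borel" "(\<integral>\<^sup>+r. P r \<partial>lborel) \<le> ennreal M" and M: "0 \<le> M" and c: "0 \<le> c"
    and pq: "0 < p" "p \<le> q" and D: "D \<subseteq> {1/2..}"
  shows "(\<integral>\<^sup>+r. ennreal (c * r powr (- q / p)) * P r * ennreal r * indicator ({0<..} \<inter> D) r \<partial>lborel)
    \<le> ennreal (c * 2 powr (q / p - 1) * M)"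
proof -
  have "(\<integral>\<^sup>+r. ennreal (c * r powr (- q / p)) * P r * ennreal r * indicator ({0<..} \<inter> D) r \<partial>lborel)
     \<le> (\<integral>\<^sup>+r. ennreal (c * 2 powr (q / p - 1)) * P r \<partial>lborel)"
  proof (intro nn_integral_mono)
    fix r
    show "ennreal (c * r powr (- q / p)) * P r * ennreal r * indicator ({0<..} \<inter> D) r
      \<le> ennreal (c * 2 powr (q / p - 1)) * P r"
    proof (cases "r \<in> D")
      case True
      then have r: "1/2 \<le> r" using D by auto
      have "r powr (- q / p) * r = r powr - (q / p - 1)"
        using r powr_add[of r "- q / p" 1] by simp
      also have "\<dots> \<le> (1/2) powr - (q / p - 1)"
        using r pq by (intro powr_mono2') auto
      also have "\<dots> = 2 powr (q / p - 1)"
      proof -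
        have "(1/2::real) = 2 powr - 1" by simp
        then have "(1/2) powr - (q / p - 1) = (2 powr - 1) powr - (q / p - 1)" by (simp only:)
        also have "\<dots> = 2 powr (- 1 * - (q / p - 1))" by (rule powr_powr)
        finally show ?thesis by simp
      qed
      finally have "c * r powr (- q / p) * r \<le> c * 2 powr (q / p - 1)"
        using c by (simp add: mult.assoc mult_left_mono)
      then have "ennreal (c * r powr (- q / p)) * ennreal r \<le> ennreal (c * 2 powr (q / p - 1))"
        using r c by (simp add: ennreal_mult[symmetric] ennreal_leI)
      then have "(ennreal (c * r powr (- q / p)) * ennreal r) * P r \<le> ennreal (c * 2 powr (q / p - 1)) * P r"
        by (intro mult_right_mono) auto
      then show ?thesis using True r by (simp add: ac_simps)
    qed auto
  qed
  also have "\<dots> = ennreal (c * 2 powr (q / p - 1)) * (\<integral>\<^sup>+r. P r \<partial>lborel)"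
    using P by (simp add: nn_integral_cmult)
  also have "\<dots> \<le> ennreal (c * 2 powr (q / p - 1)) * ennreal M"
    by (intro mult_left_mono P) auto
  finally show ?thesis using c M by (simp add: ennreal_mult)
qed

text \<open>a = 1 puts the whole singularity into the L^p' factor, which is possible as p' < 2. What
  remains is the support |r - sqrt v| \<le> t \<le> 2, an interval of length 4 in r.\<close>

lemma kernel_bound_large_gt_2:
  assumes E: "E \<subseteq> {1..2}" and pq: "2 < p" "p \<le> q"
  shows "kernel_bound E (\<lambda>t r v. indicator {1/2..} r * edge_kernel outer t r v) p q"
proof (rule kernel_bound_edge[where a = 1 and \<kappa> = 0
      and W = "\<lambda>r v. ennreal (1 * r powr (- q / p)) * indicator {z. \<bar>fst z - sqrt (snd z)\<bar> \<le> 2} (r, v)"])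
  show "1 * (p / (p - 1)) < 2" using pq by (simp add: field_simps)
  have "closed {z::real \<times> real. \<bar>fst z - sqrt (snd z)\<bar> \<le> 2}"
    by (intro closed_Collect_le continuous_intros)
  then have [measurable]: "{z::real \<times> real. \<bar>fst z - sqrt (snd z)\<bar> \<le> 2} \<in> sets borel" by (rule borel_closed)
  have [measurable]: "(fst :: real \<times> real \<Rightarrow> real) \<in> borel_measurable borel"
    by (intro borel_measurable_continuous_onI continuous_intros)
  show "(\<lambda>z. ennreal (1 * fst z powr (- q / p)) * indicator {z. \<bar>fst z - sqrt (snd z)\<bar> \<le> 2} (fst z, snd z)) \<in> borel_measurable borel"
    by simp
  show "ennreal (r powr (0 - q / p) * edge_dist outer t r v powr - 0)
      \<le> ennreal (1 * r powr (- q / p)) * indicator {z. \<bar>fst z - sqrt (snd z)\<bar> \<le> 2} (r, v)"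
    if "t \<in> E" "0 < r" "v \<in> edge_set outer t r" for t r v
  proof -
    have "\<bar>sqrt v - r\<bar> \<le> t" using that E by (intro edge_set_sqrt_dist[of v outer]) auto
    moreover have "t \<le> 2" using that E by auto
    ultimately have "\<bar>r - sqrt v\<bar> \<le> 2" by linarith
    then show ?thesis using that by (auto simp: edge_set_def)
  qed
  show "(\<integral>\<^sup>+r. ennreal (1 * r powr (- q / p)) * indicator {z. \<bar>fst z - sqrt (snd z)\<bar> \<le> 2} (r, v) * ennreal r
      * indicator ({0<..} \<inter> {1/2..}) r \<partial>lborel) \<le> ennreal (1 * 2 powr (q / p - 1) * 4)" for v
  proof (rule nn_integral_weight_le)
    have eq: "indicator {z. \<bar>fst z - sqrt (snd z)\<bar> \<le> 2} (r, v) = indicator {sqrt v - 2..sqrt v + 2} r" for r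
      by (auto simp: indicator_def)
    show "(\<lambda>r. indicator {z. \<bar>fst z - sqrt (snd z)\<bar> \<le> 2} (r, v) :: ennreal) \<in> borel_measurable borel"
      unfolding eq by simp
    show "(\<integral>\<^sup>+r. indicator {z. \<bar>fst z - sqrt (snd z)\<bar> \<le> 2} (r, v) \<partial>lborel) \<le> ennreal 4"
      unfolding eq by simp
  qed (use pq in auto)
qed (use assms in auto)

text \<open>The factor r + t + sqrt v \<ge> r cancels r^\<kappa>. The other factor is the distance
  of sqrt v - r to t, which is at most t \<le> 2 because sqrt v \<ge> r.\<close>

lemma kernel_bound_outer_large:
  assumes E: "E \<subseteq> {1..2}" and pq: "1 < p" "p \<le> q" and a: "a * (p / (p - 1)) < 2" and b: "covering_bound E b"
    and \<kappa>: "\<kappa> = (1 - a) * q / 2" "0 \<le> \<kappa>" "\<kappa> + b < 1"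
  shows "kernel_bound E (\<lambda>t r v. indicator {1/2..} r * edge_kernel True t r v) p q"
proof -
  obtain C where C: "0 \<le> C" "\<And>\<rho>. 0 < \<rho> \<Longrightarrow> \<rho> \<le> 5 \<Longrightarrow>
    (\<integral>\<^sup>+x. dist_potential E \<kappa> \<rho> x \<partial>lborel) \<le> ennreal (C * \<rho> powr (1 - \<kappa> - b))"
    using nn_integral_dist_potential_le[OF E b \<kappa>(2,3)] by blast
  show ?thesis
  proof (rule kernel_bound_edge[OF pq a \<kappa>(1) E,
        where W = "\<lambda>r v. ennreal (1 * r powr (- q / p)) * dist_potential E \<kappa> 2 (sqrt v - r)"])
    have [measurable]: "(fst :: real \<times> real \<Rightarrow> real) \<in> borel_measurable borel"
      by (intro borel_measurable_continuous_onI continuous_intros)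
    have [measurable]: "(\<lambda>z. dist_potential E \<kappa> 2 (sqrt (snd z) - fst z)) \<in> borel_measurable borel"
      by (intro measurable_dist_potential_full E continuous_intros)
    show "(\<lambda>z. ennreal (1 * fst z powr (- q / p)) * dist_potential E \<kappa> 2 (sqrt (snd z) - fst z)) \<in> borel_measurable borel"
      by measurable
    show "ennreal (r powr (\<kappa> - q / p) * edge_dist True t r v powr - \<kappa>)
      \<le> ennreal (1 * r powr (- q / p)) * dist_potential E \<kappa> 2 (sqrt v - r)"
      if t: "t \<in> E" and r: "0 < r" and v: "v \<in> edge_set True t r" for t r v
    proof -
      have t': "1 \<le> t" "t \<le> 2" using t E by auto
      note D = edge_outerD[OF v r, of]
      have d: "0 < r + t - sqrt v" "r + t - sqrt v \<le> 2" "r \<le> r + t + sqrt v"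
        using D t' r by auto
      have "edge_dist True t r v powr - \<kappa> = (r + t - sqrt v) powr - \<kappa> * (r + t + sqrt v) powr - \<kappa>"
        using D t' by (simp add: powr_mult)
      also have "\<dots> \<le> (r + t - sqrt v) powr - \<kappa> * r powr - \<kappa>"
        using d r \<kappa> by (intro mult_left_mono powr_mono2') auto
      finally have "r powr (\<kappa> - q / p) * edge_dist True t r v powr - \<kappa>
         \<le> r powr (\<kappa> - q / p) * ((r + t - sqrt v) powr - \<kappa> * r powr - \<kappa>)"
        by (intro mult_left_mono) auto
      also have "\<dots> = (r powr (\<kappa> - q / p) * r powr - \<kappa>) * (r + t - sqrt v) powr - \<kappa>" by simp
      also have "r powr (\<kappa> - q / p) * r powr - \<kappa> = r powr (- q / p)" by (simp add: powr_add[symmetric])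
      also have "(r + t - sqrt v) = \<bar>(sqrt v - r) - t\<bar>" using d by simp
      finally have "ennreal (r powr (\<kappa> - q / p) * edge_dist True t r v powr - \<kappa>)
         \<le> ennreal (r powr (- q / p)) * ennreal (\<bar>(sqrt v - r) - t\<bar> powr - \<kappa>)"
        by (simp add: ennreal_mult[symmetric] ennreal_leI)
      also have "\<dots> \<le> ennreal (r powr (- q / p)) * dist_potential E \<kappa> 2 (sqrt v - r)"
        using d t \<kappa> by (intro mult_left_mono dist_potential_ge) auto
      finally show ?thesis by simp
    qed
    show "(\<integral>\<^sup>+r. ennreal (1 * r powr (- q / p)) * dist_potential E \<kappa> 2 (sqrt v - r) * ennreal r
      * indicator ({0<..} \<inter> {1/2..}) r \<partial>lborel) \<le> ennreal (1 * 2 powr (q / p - 1) * (C * 2 powr (1 - \<kappa> - b)))" for v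
    proof (rule nn_integral_weight_le)
      show "(\<lambda>r. dist_potential E \<kappa> 2 (sqrt v - r)) \<in> borel_measurable borel"
        by (intro measurable_dist_potential_full E continuous_intros)
      have "(\<integral>\<^sup>+r. dist_potential E \<kappa> 2 (sqrt v - r) \<partial>lborel) = (\<integral>\<^sup>+r. dist_potential E \<kappa> 2 r \<partial>lborel)"
        by (intro nn_integral_reflect measurable_dist_potential_full E continuous_intros)
      then show "(\<integral>\<^sup>+r. dist_potential E \<kappa> 2 (sqrt v - r) \<partial>lborel) \<le> ennreal (C * 2 powr (1 - \<kappa> - b))"
        using C(2)[of 2] by simp
    qed (use pq C in auto)
  qed (use C in auto)
qed

text \<open>For r \<ge> 4 and t \<le> 2 one has |r - t| \<ge> r / 2, so again one factor compensates
  r^\<kappa>. The other is at most 2 t \<le> 4, the radius of the potential.\<close>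

lemma kernel_bound_inner_large:
  assumes E: "E \<subseteq> {1..2}" and pq: "1 < p" "p \<le> q" and a: "a * (p / (p - 1)) < 2" and b: "covering_bound E b"
    and \<kappa>: "\<kappa> = (1 - a) * q / 2" "0 \<le> \<kappa>" "\<kappa> + b < 1"
  shows "kernel_bound E (\<lambda>t r v. indicator {4..} r * edge_kernel False t r v) p q"
proof -
  obtain C where C: "0 \<le> C" "\<And>\<rho>. 0 < \<rho> \<Longrightarrow> \<rho> \<le> 5 \<Longrightarrow>
    (\<integral>\<^sup>+x. dist_potential E \<kappa> \<rho> x \<partial>lborel) \<le> ennreal (C * \<rho> powr (1 - \<kappa> - b))"
    using nn_integral_dist_potential_le[OF E b \<kappa>(2,3)] by blast
  show ?thesis
  proof (rule kernel_bound_edge[OF pq a \<kappa>(1) E,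
        where W = "\<lambda>r v. ennreal (2 powr \<kappa> * r powr (- q / p)) * dist_potential E \<kappa> 4 (r - sqrt v)"])
    have [measurable]: "(fst :: real \<times> real \<Rightarrow> real) \<in> borel_measurable borel"
      by (intro borel_measurable_continuous_onI continuous_intros)
    have [measurable]: "(\<lambda>z. dist_potential E \<kappa> 4 (fst z - sqrt (snd z))) \<in> borel_measurable borel"
      by (intro measurable_dist_potential_full E continuous_intros)
    show "(\<lambda>z. ennreal (2 powr \<kappa> * fst z powr (- q / p)) * dist_potential E \<kappa> 4 (fst z - sqrt (snd z))) \<in> borel_measurable borel"
      by measurable
    show "ennreal (r powr (\<kappa> - q / p) * edge_dist False t r v powr - \<kappa>)
      \<le> ennreal (2 powr \<kappa> * r powr (- q / p)) * dist_potential E \<kappa> 4 (r - sqrt v)"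
      if t: "t \<in> E" and r: "0 < r" "r \<in> {4..}" and v: "v \<in> edge_set False t r" for t r v
    proof -
      have t': "1 \<le> t" "t \<le> 2" using t E by auto
      note D = edge_innerD[OF v r(1), of]
      have d: "0 < sqrt v - \<bar>r - t\<bar>" "sqrt v - \<bar>r - t\<bar> \<le> 4" "r / 2 \<le> sqrt v + \<bar>r - t\<bar>"
        using D t' r by auto
      have "edge_dist False t r v powr - \<kappa> = (sqrt v - \<bar>r - t\<bar>) powr - \<kappa> * (sqrt v + \<bar>r - t\<bar>) powr - \<kappa>"
        using D t' by (simp add: powr_mult)
      also have "\<dots> \<le> (sqrt v - \<bar>r - t\<bar>) powr - \<kappa> * (r / 2) powr - \<kappa>"
        using d r \<kappa> by (intro mult_left_mono powr_mono2') auto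
      also have "(r / 2) powr - \<kappa> = 2 powr \<kappa> * r powr - \<kappa>" by (simp add: powr_divide powr_minus field_simps)
      finally have "r powr (\<kappa> - q / p) * edge_dist False t r v powr - \<kappa>
         \<le> r powr (\<kappa> - q / p) * ((sqrt v - \<bar>r - t\<bar>) powr - \<kappa> * (2 powr \<kappa> * r powr - \<kappa>))"
        by (intro mult_left_mono) auto
      also have "\<dots> = 2 powr \<kappa> * (r powr (\<kappa> - q / p) * r powr - \<kappa>) * (sqrt v - \<bar>r - t\<bar>) powr - \<kappa>" by simp
      also have "r powr (\<kappa> - q / p) * r powr - \<kappa> = r powr (- q / p)" by (simp add: powr_add[symmetric])
      also have "(sqrt v - \<bar>r - t\<bar>) = \<bar>(r - sqrt v) - t\<bar>" using d r t' by simp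
      finally have "ennreal (r powr (\<kappa> - q / p) * edge_dist False t r v powr - \<kappa>)
         \<le> ennreal (2 powr \<kappa> * r powr (- q / p)) * ennreal (\<bar>(r - sqrt v) - t\<bar> powr - \<kappa>)"
        by (simp add: ennreal_mult[symmetric] ennreal_leI)
      also have "\<dots> \<le> ennreal (2 powr \<kappa> * r powr (- q / p)) * dist_potential E \<kappa> 4 (r - sqrt v)"
        using d t t' r \<kappa> by (intro mult_left_mono dist_potential_ge) auto
      finally show ?thesis .
    qed
    show "(\<integral>\<^sup>+r. ennreal (2 powr \<kappa> * r powr (- q / p)) * dist_potential E \<kappa> 4 (r - sqrt v) * ennreal r
      * indicator ({0<..} \<inter> {4..}) r \<partial>lborel) \<le> ennreal (2 powr \<kappa> * 2 powr (q / p - 1) * (C * 4 powr (1 - \<kappa> - b)))" for v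
    proof (rule nn_integral_weight_le)
      show "(\<lambda>r. dist_potential E \<kappa> 4 (r - sqrt v)) \<in> borel_measurable borel"
        by (intro measurable_dist_potential_full E continuous_intros)
      have "(\<integral>\<^sup>+r. dist_potential E \<kappa> 4 (r - sqrt v) \<partial>lborel) = (\<integral>\<^sup>+r. dist_potential E \<kappa> 4 r \<partial>lborel)"
        using nn_integral_shift[of "dist_potential E \<kappa> 4" "- sqrt v"]
          measurable_dist_potential_full[OF E, of "\<lambda>_. 4" "\<lambda>x. x" \<kappa>] by simp
      then show "(\<integral>\<^sup>+r. dist_potential E \<kappa> 4 (r - sqrt v) \<partial>lborel) \<le> ennreal (C * 4 powr (1 - \<kappa> - b))"
        using C(2)[of 4] by simp
    qed (use pq C in auto)
  qed (use C in auto)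
qed

section \<open>Middle radii\<close>

lemma nn_integral_middle_le:
  fixes P :: "real \<Rightarrow> ennreal"
  assumes [measurable]: "P \<in> borel_measurable borel" and P: "(\<integral>\<^sup>+r. P r \<partial>lborel) \<le> ennreal M"
    and "0 \<le> M" "0 \<le> c"
  shows "(\<integral>\<^sup>+r. (indicator {1/2..<4} r * (ennreal c * P r)) * ennreal r * indicator {0<..} r \<partial>lborel)
    \<le> ennreal (4 * c * M)"
proof -
  have "(\<integral>\<^sup>+r. (indicator {1/2..<4} r * (ennreal c * P r)) * ennreal r * indicator {0<..} r \<partial>lborel)
     \<le> (\<integral>\<^sup>+r. ennreal (4 * c) * P r \<partial>lborel)"
  proof (intro nn_integral_mono)
    fix r :: real
    show "(indicator {1/2..<4} r * (ennreal c * P r)) * ennreal r * indicator {0<..} r \<le> ennreal (4 * c) * P r"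
    proof (cases "r \<in> {1/2..<4}")
      case True
      have "ennreal r * (ennreal c * P r) \<le> ennreal 4 * (ennreal c * P r)"
        using True by (intro mult_right_mono ennreal_leI) auto
      also have "\<dots> = ennreal (4 * c) * P r"
        using assms by (simp add: ennreal_mult mult.assoc)
      finally show ?thesis using True by (simp add: ac_simps)
    qed auto
  qed
  also have "\<dots> = ennreal (4 * c) * (\<integral>\<^sup>+r. P r \<partial>lborel)" by (simp add: nn_integral_cmult)
  also have "\<dots> \<le> ennreal (4 * c) * ennreal M" by (intro mult_left_mono P) auto
  finally show ?thesis using assms by (simp add: ennreal_mult)
qed

text \<open>The range where sqrt v is comparable to |r - t|, with the singularity still at the edge
  (r - t)^2. The factor (2 r t)^(-1/2) is dropped since 2 r t \<ge> 1, and v \<le> 25 holds because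
  r < 4 and t \<le> 2.\<close>

definition near_kernel :: "real \<Rightarrow> real \<Rightarrow> real \<Rightarrow> real" where
  "near_kernel t r v = indicator {1/2..<4} r *
     (indicator {(r - t)\<^sup>2<..2 * (r - t)\<^sup>2} v * indicator {..25} v * (v - (r - t)\<^sup>2) powr (-1/2))"

text \<open>Here v - (r - t)^2 \<ge> v / 2, so the edge is harmless and the kernel behaves like
  v^(-1/2), singular at v = 0.\<close>

definition far_kernel :: "real \<Rightarrow> real \<Rightarrow> real \<Rightarrow> real" where
  "far_kernel t r v = indicator {1/2..<4} r *
     (indicator {2 * (r - t)\<^sup>2<..25} v * (v - (r - t)\<^sup>2) powr (-1/2))"

lemma measurable_near_far [measurable]:
  "near_kernel t r \<in> borel_measurable borel" "far_kernel t r \<in> borel_measurable borel"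
  unfolding near_kernel_def far_kernel_def by measurable

lemma near_far_nonneg: "0 \<le> near_kernel t r v" "0 \<le> far_kernel t r v"
  by (auto simp: near_kernel_def far_kernel_def)

lemma edge_kernel_le_near_far:
  assumes "0 < r" "1 \<le> t" "t \<le> 2"
  shows "indicator {1/2..<4} r * edge_kernel False t r v \<le> near_kernel t r v + far_kernel t r v"
proof (cases "r \<in> {1/2..<4} \<and> v \<in> edge_set False t r")
  case True
  then have r: "1/2 \<le> r" "r < 4" and v: "v \<in> edge_set False t r" by auto
  let ?d = "v - (r - t)\<^sup>2"
  have d: "0 < ?d" using v by (simp add: edge_set_def edge_dist_def)
  have "v \<le> r\<^sup>2 + t\<^sup>2" using edge_innerD(3)[OF v] assms by simp
  also have "\<dots> \<le> 4\<^sup>2 + 2\<^sup>2" using r assms by (intro add_mono power_mono) auto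
  finally have v25: "v \<le> 25" by simp
  have "1 \<le> 2 * r * t" using r assms mult_mono[of "1/2" r 1 t] by simp
  then have "(2 * r * t * ?d) powr (-1/2) \<le> ?d powr (-1/2)"
    using d by (intro powr_mono2') auto
  then have "edge_kernel False t r v \<le> ?d powr (-1/2)"
    using v by (simp add: edge_kernel_def edge_dist_def)
  also have "\<dots> \<le> near_kernel t r v + far_kernel t r v"
    using r d v25 by (auto simp: near_kernel_def far_kernel_def indicator_def)
  finally show ?thesis using r by simp
next
  case False
  then show ?thesis using near_far_nonneg[of t r v] by (auto simp: edge_kernel_def indicator_def)
qed

text \<open>Put u = |r - t|. The first factor is integrated over an interval of length u^2 and gives
  u^y, and u < sqrt v. What remains are powers of sqrt v and of sqrt v - u, the distance to t of r -
  sqrt v or r + sqrt v. Integration in r leaves sqrt v to the power e, and \<open>crit\<close> says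
  e \<ge> 0.\<close>

lemma kernel_bound_near:
  assumes E: "E \<subseteq> {1..2}" and pq: "1 < p" "p \<le> q" and a: "a < 2 - 2 / p" and b: "covering_bound E b"
    and \<kappa>: "\<kappa> = (1 - a) * q / 2" "0 \<le> \<kappa>" "\<kappa> + b < 1" and crit: "q * (2 / p - 1) \<le> 1 - b"
  shows "kernel_bound E near_kernel p q"
proof -
  define p' where "p' = p / (p - 1)"
  have p': "0 < p'" "p' * (1 - 1 / p) = 1" using pq by (auto simp: p'_def field_simps)
  define c where "c = a * p' / 2"
  have c: "c < 1"
  proof -
    have "a * p' < (2 - 2 / p) * p'" using a p' by (intro mult_strict_right_mono) auto
    also have "(2 - 2 / p) * p' = 2 * (p' * (1 - 1 / p))" by (simp add: algebra_simps)
    finally show ?thesis unfolding p'(2) by (simp add: c_def)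
  qed
  \<comment> \<open>The exponent of u after integrating the first factor; it is nonnegative because
    a < 2 - 2/p.\<close>
  define y where "y = q * (2 - 2 / p - a)"
  have y: "0 \<le> y" using a pq by (simp add: y_def)
  have cy: "2 * (1 - c) * (q * (1 - 1 / p)) = y"
  proof -
    have "2 * (1 - c) * (q * z) = q * 2 * z - a * q * (p' * z)" for z
      by (simp add: c_def algebra_simps)
    from this[of "1 - 1 / p"] show ?thesis unfolding p'(2) by (simp add: y_def algebra_simps)
  qed
  define K where "K = (1 / (1 - c)) powr (q * (1 - 1 / p))"
  have K: "0 \<le> K" by (simp add: K_def)
  obtain C where C: "0 \<le> C" "\<And>\<rho>. 0 < \<rho> \<Longrightarrow> \<rho> \<le> 5 \<Longrightarrow>
    (\<integral>\<^sup>+x. dist_potential E \<kappa> \<rho> x \<partial>lborel) \<le> ennreal (C * \<rho> powr (1 - \<kappa> - b))"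
    using nn_integral_dist_potential_le[OF E b \<kappa>(2,3)] by blast
  define e where "e = 1 - b - q * (2 / p - 1)"
  have e: "0 \<le> e" using crit by (simp add: e_def)
  let ?S = "\<lambda>t r. {(r - t)\<^sup>2<..2 * (r - t)\<^sup>2} :: real set"
  let ?k1 = "\<lambda>t r v. indicator {1/2..<4} r * (indicator (?S t r) v * (v - (r - t)\<^sup>2) powr (- a / 2)) :: real"
  let ?k2 = "\<lambda>t r v. indicator {1/2..<4} r * (indicator (?S t r) v * indicator {..25} v * (v - (r - t)\<^sup>2) powr (- (1 - a) / 2)) :: real"
  let ?P = "\<lambda>r v. dist_potential E \<kappa> (sqrt v) (r - sqrt v) + dist_potential E \<kappa> (sqrt v) (r + sqrt v)"
  let ?W = "\<lambda>r v. indicator {1/2..<4} r * (ennreal (indicator {0<..25} v * (K * sqrt v powr (y - \<kappa>))) * ?P r v)"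
  show ?thesis
  proof (rule kernel_bound_Schur[OF pq, where ?k1.0 = ?k1 and ?k2.0 = ?k2 and W = ?W])
    show "?k1 t r \<in> borel_measurable borel" "?k2 t r \<in> borel_measurable borel" for t r by measurable
    show "0 \<le> ?k1 t r v" "0 \<le> ?k2 t r v" for t r v by auto
    have [measurable]: "(fst :: real \<times> real \<Rightarrow> real) \<in> borel_measurable borel" "(snd :: real \<times> real \<Rightarrow> real) \<in> borel_measurable borel"
      by (intro borel_measurable_continuous_onI continuous_intros)+
    have [measurable]: "(\<lambda>z. dist_potential E \<kappa> (sqrt (snd z)) (fst z - sqrt (snd z))) \<in> borel_measurable borel"
      "(\<lambda>z. dist_potential E \<kappa> (sqrt (snd z)) (fst z + sqrt (snd z))) \<in> borel_measurable borel"
      by (intro measurable_dist_potential_full E continuous_intros)+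
    show "(\<lambda>z. ?W (fst z) (snd z)) \<in> borel_measurable borel"
      by measurable
    show "near_kernel t r v \<le> ?k1 t r v * ?k2 t r v" for t r v
    proof -
      have "(v - (r - t)\<^sup>2) powr (-1/2) = (v - (r - t)\<^sup>2) powr (- a / 2) * (v - (r - t)\<^sup>2) powr (- (1 - a) / 2)"
        by (simp add: powr_add[symmetric] field_simps)
      then show ?thesis by (auto simp: near_kernel_def indicator_def)
    qed
  next
    fix t r v :: real assume t: "t \<in> E" and r: "0 < r"
    show "ennreal_powr (\<integral>\<^sup>+v. ennreal (?k1 t r v powr (p / (p - 1))) \<partial>lborel) (q * (1 - 1 / p)) * ennreal (?k2 t r v powr q) \<le> ?W r v"
    proof (cases "r \<in> {1/2..<4} \<and> v \<in> ?S t r \<and> v \<le> 25")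
      case False
      then have "?k2 t r v = 0" by (auto simp: indicator_def)
      then have "ennreal (?k2 t r v powr q) = 0" by (simp only: powr_0 ennreal_0)
      then show ?thesis by (simp only: mult_zero_right zero_le)
    next
      case True
      define u where "u = \<bar>r - t\<bar>"
      have u2: "(r - t)\<^sup>2 = u\<^sup>2" by (simp add: u_def)
      have v: "u\<^sup>2 < v" "v \<le> 2 * u\<^sup>2" "v \<le> 25" and r': "1/2 \<le> r" "r < 4" using True u2 by auto
      have u: "0 < u" using v by (cases "u = 0") (auto simp: u_def)
      have v0: "0 < v" using v(1) by (rule order.strict_trans1[rotated]) simp
      have us: "u < sqrt v" using v by (intro real_less_rsqrt) auto
      have "(\<integral>\<^sup>+v. ennreal (?k1 t r v powr p') \<partial>lborel) = (\<integral>\<^sup>+v. ennreal (indicator {0<..u\<^sup>2} (v + - u\<^sup>2) * (v + - u\<^sup>2) powr - c) \<partial>lborel)"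
        using r' p' by (intro nn_integral_cong) (auto simp: u2 indicator_def powr_powr c_def)
      also have "\<dots> = ennreal ((u\<^sup>2) powr (1 - c) / (1 - c))"
        using nn_integral_shift[of "\<lambda>x. ennreal (indicator {0<..u\<^sup>2} x * x powr - c)" "- u\<^sup>2"] c u
        by (simp add: nn_integral_powr_from_0)
      also have "(u\<^sup>2) powr (1 - c) / (1 - c) = u powr (2 * (1 - c)) * (1 / (1 - c))"
      proof -
        have "u\<^sup>2 = u powr 2" using u by (simp add: powr_numeral)
        then show ?thesis by (simp add: powr_powr)
      qed
      finally have I: "(\<integral>\<^sup>+v. ennreal (?k1 t r v powr p') \<partial>lborel) = ennreal (u powr (2 * (1 - c)) * (1 / (1 - c)))" .
      have "ennreal_powr (\<integral>\<^sup>+v. ennreal (?k1 t r v powr p') \<partial>lborel) (q * (1 - 1 / p))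
         = ennreal ((u powr (2 * (1 - c)) * (1 / (1 - c))) powr (q * (1 - 1 / p)))"
        unfolding I using c by (intro ennreal_powr_ennreal) auto
      also have "(u powr (2 * (1 - c)) * (1 / (1 - c))) powr (q * (1 - 1 / p)) = u powr y * K"
        unfolding powr_mult powr_powr cy K_def ..
      finally have J: "ennreal_powr (\<integral>\<^sup>+v. ennreal (?k1 t r v powr p') \<partial>lborel) (q * (1 - 1 / p)) = ennreal (u powr y * K)" .
      have "?k2 t r v powr q = (v - u\<^sup>2) powr - \<kappa>"
      proof -
        have "- (1 - a) / 2 * q = - \<kappa>" by (simp add: \<kappa> field_simps)
        then show ?thesis using v r' by (simp add: u2 powr_powr)
      qed
      also have "v - u\<^sup>2 = (sqrt v - u) * (sqrt v + u)" using v0 by (simp add: algebra_simps power2_eq_square)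
      also have "\<dots> powr - \<kappa> = (sqrt v - u) powr - \<kappa> * (sqrt v + u) powr - \<kappa>" by (rule powr_mult)
      also have "\<dots> \<le> (sqrt v - u) powr - \<kappa> * sqrt v powr - \<kappa>"
        using u v0 \<kappa> by (intro mult_left_mono powr_mono2') auto
      finally have k2: "?k2 t r v powr q \<le> (sqrt v - u) powr - \<kappa> * sqrt v powr - \<kappa>" .
      have "u powr y * K * ?k2 t r v powr q \<le> sqrt v powr y * K * ((sqrt v - u) powr - \<kappa> * sqrt v powr - \<kappa>)"
        using us u y K by (intro mult_mono k2 powr_mono2) auto
      also have "\<dots> = K * (sqrt v powr y * sqrt v powr - \<kappa>) * (sqrt v - u) powr - \<kappa>" by simp
      also have "sqrt v powr y * sqrt v powr - \<kappa> = sqrt v powr (y - \<kappa>)" by (simp add: powr_add[symmetric])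
      finally have main: "ennreal (u powr y * K) * ennreal (?k2 t r v powr q)
         \<le> ennreal (K * sqrt v powr (y - \<kappa>)) * ennreal ((sqrt v - u) powr - \<kappa>)"
        using K by (simp add: ennreal_mult[symmetric] ennreal_leI)
      have "ennreal ((sqrt v - u) powr - \<kappa>) \<le> ?P r v"
      \<comment> \<open>The sign of r - t decides whether t is compared with r - sqrt v or with r +
        sqrt v; \<open>?P\<close> contains both potentials.\<close>
      proof (cases "t \<le> r")
        case True
        then have eq: "sqrt v - u = \<bar>(r - sqrt v) - t\<bar>" using us by (simp add: u_def)
        have "ennreal ((sqrt v - u) powr - \<kappa>) \<le> dist_potential E \<kappa> (sqrt v) (r - sqrt v)"
          unfolding eq using t \<kappa> us u by (intro dist_potential_ge) (auto simp flip: eq)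
        then show ?thesis by (rule order_trans) simp
      next
        case False
        then have eq: "sqrt v - u = \<bar>(r + sqrt v) - t\<bar>" using us by (simp add: u_def)
        have "ennreal ((sqrt v - u) powr - \<kappa>) \<le> dist_potential E \<kappa> (sqrt v) (r + sqrt v)"
          unfolding eq using t \<kappa> us u by (intro dist_potential_ge) (auto simp flip: eq)
        then show ?thesis by (rule order_trans) simp
      qed
      then have "ennreal (K * sqrt v powr (y - \<kappa>)) * ennreal ((sqrt v - u) powr - \<kappa>)
         \<le> ennreal (K * sqrt v powr (y - \<kappa>)) * ?P r v"
        by (intro mult_left_mono) auto
      also have "\<dots> = ?W r v" using r' v v0 by simp
      finally show ?thesis using main J unfolding p'_def[symmetric] by (simp only:)
    qed
  next
    fix v :: real
    show "(\<integral>\<^sup>+r. ?W r v * ennreal r * indicator {0<..} r \<partial>lborel) \<le> ennreal (4 * K * (2 * C) * 5 powr e)"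
    proof (cases "v \<in> {0<..25}")
      case True
      then have s: "0 < sqrt v" "sqrt v \<le> 5" using real_sqrt_le_mono[of v 25] by auto
      have [measurable]: "(\<lambda>x. dist_potential E \<kappa> (sqrt v) x) \<in> borel_measurable borel"
        by (intro measurable_dist_potential_full E continuous_intros)
      have "(\<integral>\<^sup>+r. ?P r v \<partial>lborel) = (\<integral>\<^sup>+r. dist_potential E \<kappa> (sqrt v) (r - sqrt v) \<partial>lborel)
          + (\<integral>\<^sup>+r. dist_potential E \<kappa> (sqrt v) (r + sqrt v) \<partial>lborel)"
        by (intro nn_integral_add) measurable
      also have "\<dots> = (\<integral>\<^sup>+r. dist_potential E \<kappa> (sqrt v) r \<partial>lborel) + (\<integral>\<^sup>+r. dist_potential E \<kappa> (sqrt v) r \<partial>lborel)"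
        using nn_integral_shift[of "dist_potential E \<kappa> (sqrt v)" "sqrt v"]
          nn_integral_shift[of "dist_potential E \<kappa> (sqrt v)" "- sqrt v"] by simp
      also have "\<dots> \<le> ennreal (C * sqrt v powr (1 - \<kappa> - b)) + ennreal (C * sqrt v powr (1 - \<kappa> - b))"
        by (intro add_mono C s)
      also have "\<dots> = ennreal (2 * C * sqrt v powr (1 - \<kappa> - b))"
        using C by (simp add: ennreal_plus[symmetric] del: ennreal_plus)
      finally have P: "(\<integral>\<^sup>+r. ?P r v \<partial>lborel) \<le> ennreal (2 * C * sqrt v powr (1 - \<kappa> - b))" .
      have "(\<integral>\<^sup>+r. ?W r v * ennreal r * indicator {0<..} r \<partial>lborel)
         \<le> ennreal (4 * (indicator {0<..25} v * (K * sqrt v powr (y - \<kappa>))) * (2 * C * sqrt v powr (1 - \<kappa> - b)))"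
        using K C by (intro nn_integral_middle_le P) auto
      also have "4 * (indicator {0<..25} v * (K * sqrt v powr (y - \<kappa>))) * (2 * C * sqrt v powr (1 - \<kappa> - b))
         = 4 * K * (2 * C) * (sqrt v powr (y - \<kappa>) * sqrt v powr (1 - \<kappa> - b))"
        using True by simp
      also have "sqrt v powr (y - \<kappa>) * sqrt v powr (1 - \<kappa> - b) = sqrt v powr e"
      proof -
        have "y - \<kappa> + (1 - \<kappa> - b) = e" using pq by (simp add: y_def \<kappa> e_def field_simps)
        then show ?thesis by (simp add: powr_add[symmetric])
      qed
      also have "ennreal (4 * K * (2 * C) * sqrt v powr e) \<le> ennreal (4 * K * (2 * C) * 5 powr e)"
        using s e K C by (intro ennreal_leI mult_left_mono powr_mono2) auto
      finally show ?thesis .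
    qed simp
  qed
qed

text \<open>The opposite choice of a: as v > 2 u^2, where u = |r - t|, the first factor has to be
  integrable at infinity, so a must exceed 2 - 2/p. The excess \<tau> / q avoids a logarithm and
  leaves u^-\<tau>, controlled by the potential of E at r. It cancels from the final exponent of
  sqrt v, which is again e.\<close>

lemma kernel_bound_far:
  assumes E: "E \<subseteq> {1..2}" and pq: "1 < p" "p \<le> q" and b: "covering_bound E b" "b < 1"
    and crit: "q * (2 / p - 1) \<le> 1 - b"
  shows "kernel_bound E far_kernel p q"
proof -
  define p' where "p' = p / (p - 1)"
  have p': "0 < p'" "p' * (1 - 1 / p) = 1" using pq by (auto simp: p'_def field_simps)
  \<comment> \<open>Any positive number with \<tau> + b < 1 would do.\<close>
  define \<tau> where "\<tau> = (1 - b) / 2"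
  have \<tau>: "0 < \<tau>" "\<tau> + b < 1" using b by (auto simp: \<tau>_def field_simps)
  define a where "a = 2 - 2 / p + \<tau> / q"
  define c where "c = a * p' / 2"
  have c: "1 < c"
  proof -
    have "2 * (p' * (1 - 1 / p)) = (2 - 2 / p) * p'" by (simp add: algebra_simps)
    also have "\<dots> < a * p'" using \<tau> pq p' by (intro mult_strict_right_mono) (auto simp: a_def)
    finally show ?thesis unfolding p'(2) by (simp add: c_def)
  qed
  have cy: "2 * (1 - c) * (q * (1 - 1 / p)) = - \<tau>"
  proof -
    have "2 * (1 - c) * (q * z) = q * 2 * z - a * q * (p' * z)" for z
      by (simp add: c_def algebra_simps)
    from this[of "1 - 1 / p"] show ?thesis unfolding p'(2) using pq by (simp add: a_def field_simps)
  qed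
  define \<kappa> where "\<kappa> = (1 - a) * q / 2"
  define K where "K = (2 powr (1 - c) / (c - 1)) powr (q * (1 - 1 / p)) * 2 powr (q / 2)"
  have K: "0 < K" using c by (simp add: K_def)
  obtain C where C: "0 \<le> C" "\<And>\<rho>. 0 < \<rho> \<Longrightarrow> \<rho> \<le> 5 \<Longrightarrow>
    (\<integral>\<^sup>+x. dist_potential E \<tau> \<rho> x \<partial>lborel) \<le> ennreal (C * \<rho> powr (1 - \<tau> - b))"
    using nn_integral_dist_potential_le[OF E b(1)] \<tau> by (metis less_imp_le)
  define e where "e = 1 - b - q * (2 / p - 1)"
  have e: "0 \<le> e" using crit by (simp add: e_def)
  let ?k1 = "\<lambda>t r v. indicator {1/2..<4} r * (indicator {2 * (r - t)\<^sup>2<..} v * v powr (- a / 2)) :: real"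
  let ?k2 = "\<lambda>t r v. indicator {1/2..<4} r * (indicator {2 * (r - t)\<^sup>2<..25} v * (sqrt 2 * v powr (- (1 - a) / 2))) :: real"
  let ?P = "\<lambda>r v. dist_potential E \<tau> (sqrt v) r"
  let ?W = "\<lambda>r v. indicator {1/2..<4} r * (ennreal (indicator {0<..25} v * (K * v powr - \<kappa>)) * ?P r v)"
  show ?thesis
  proof (rule kernel_bound_Schur[OF pq, where ?k1.0 = ?k1 and ?k2.0 = ?k2 and W = ?W])
    show "?k1 t r \<in> borel_measurable borel" "?k2 t r \<in> borel_measurable borel" for t r by measurable
    show "0 \<le> ?k1 t r v" "0 \<le> ?k2 t r v" for t r v by auto
    have [measurable]: "(fst :: real \<times> real \<Rightarrow> real) \<in> borel_measurable borel" "(snd :: real \<times> real \<Rightarrow> real) \<in> borel_measurable borel"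
      by (intro borel_measurable_continuous_onI continuous_intros)+
    have [measurable]: "(\<lambda>z. dist_potential E \<tau> (sqrt (snd z)) (fst z)) \<in> borel_measurable borel"
      by (intro measurable_dist_potential_full E continuous_intros)+
    show "(\<lambda>z. ?W (fst z) (snd z)) \<in> borel_measurable borel"
      by measurable
    show "far_kernel t r v \<le> ?k1 t r v * ?k2 t r v" for t r v
    proof (cases "r \<in> {1/2..<4} \<and> v \<in> {2 * (r - t)\<^sup>2<..25}")
      case True
      then have "0 < v" by (intro order.strict_trans1[of 0 "2 * (r - t)\<^sup>2" v]) auto
      with True have v: "0 < v" "v / 2 \<le> v - (r - t)\<^sup>2" by auto
      have "(v - (r - t)\<^sup>2) powr (-1/2) \<le> (v / 2) powr (-1/2)"
        using v by (intro powr_mono2') auto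
      also have "\<dots> = sqrt 2 * v powr (-1/2)"
        using v by (simp add: powr_minus_divide powr_half_sqrt real_sqrt_divide)
      also have "v powr (-1/2) = v powr (- a / 2) * v powr (- (1 - a) / 2)"
        by (simp add: powr_add[symmetric] field_simps)
      finally show ?thesis using True by (simp add: far_kernel_def ac_simps)
    qed (auto simp: far_kernel_def indicator_def)
  next
    fix t r v :: real assume t: "t \<in> E" and r: "0 < r"
    show "ennreal_powr (\<integral>\<^sup>+v. ennreal (?k1 t r v powr (p / (p - 1))) \<partial>lborel) (q * (1 - 1 / p)) * ennreal (?k2 t r v powr q) \<le> ?W r v"
    proof (cases "r \<in> {1/2..<4} \<and> v \<in> {2 * (r - t)\<^sup>2<..25}")
      case False
      then have "?k2 t r v = 0" by (auto simp: indicator_def)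
      then have "ennreal (?k2 t r v powr q) = 0" by (simp only: powr_0 ennreal_0)
      then show ?thesis by (simp only: mult_zero_right zero_le)
    next
      case True
      define u where "u = \<bar>r - t\<bar>"
      have u2: "(r - t)\<^sup>2 = u\<^sup>2" by (simp add: u_def)
      have v: "2 * u\<^sup>2 < v" "v \<le> 25" and r': "1/2 \<le> r" "r < 4" using True u2 by auto
      have v0: "0 < v" using v(1) by (rule order.strict_trans1[rotated]) simp
      have "0 \<le> u" by (simp add: u_def)
      have "u\<^sup>2 < v" using v(1) by (rule order.strict_trans1[rotated]) simp
      then have us: "u < sqrt v" by (intro real_less_rsqrt)
      show ?thesis
      proof (cases "u = 0")
        \<comment> \<open>For r = t the first factor diverges, but the potential of E at r is
          infinite too.\<close>
        case True
        then have "t = r" by (simp add: u_def)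
        then have "?P r v = top" using t v0 \<tau> by (intro dist_potential_eq_top) auto
        then have "?W r v = top" using r' v v0 K by (simp add: ennreal_mult_top)
        then show ?thesis by simp
      next
        case False
        then have u: "0 < u" using \<open>0 \<le> u\<close> by simp
        have "(\<integral>\<^sup>+v. ennreal (?k1 t r v powr p') \<partial>lborel) = (\<integral>\<^sup>+v. ennreal (indicator {2 * u\<^sup>2<..} v * v powr - c) \<partial>lborel)"
          using r' p' by (intro nn_integral_cong) (auto simp: u2 indicator_def powr_powr c_def)
        also have "\<dots> = ennreal ((2 * u\<^sup>2) powr (1 - c) / (c - 1))"
          using c u by (intro nn_integral_powr_to_top) auto
        also have "(2 * u\<^sup>2) powr (1 - c) / (c - 1) = u powr (2 * (1 - c)) * (2 powr (1 - c) / (c - 1))"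
        proof -
          have "u\<^sup>2 = u powr 2" using u by (simp add: powr_numeral)
          then show ?thesis by (simp add: powr_powr powr_mult)
        qed
        finally have I: "(\<integral>\<^sup>+v. ennreal (?k1 t r v powr p') \<partial>lborel) = ennreal (u powr (2 * (1 - c)) * (2 powr (1 - c) / (c - 1)))" .
        have "ennreal_powr (\<integral>\<^sup>+v. ennreal (?k1 t r v powr p') \<partial>lborel) (q * (1 - 1 / p))
           = ennreal ((u powr (2 * (1 - c)) * (2 powr (1 - c) / (c - 1))) powr (q * (1 - 1 / p)))"
          unfolding I using c by (intro ennreal_powr_ennreal) auto
        also have "(u powr (2 * (1 - c)) * (2 powr (1 - c) / (c - 1))) powr (q * (1 - 1 / p))
            = u powr - \<tau> * (2 powr (1 - c) / (c - 1)) powr (q * (1 - 1 / p))"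
          unfolding powr_mult powr_powr cy ..
        finally have J: "ennreal_powr (\<integral>\<^sup>+v. ennreal (?k1 t r v powr p') \<partial>lborel) (q * (1 - 1 / p))
          = ennreal (u powr - \<tau> * (2 powr (1 - c) / (c - 1)) powr (q * (1 - 1 / p)))" .
        have k2: "?k2 t r v powr q = 2 powr (q / 2) * v powr - \<kappa>"
        proof -
          have "- (1 - a) / 2 * q = - \<kappa>" by (simp add: \<kappa>_def field_simps)
          moreover have "sqrt 2 powr q = 2 powr (q / 2)" by (simp add: powr_half_sqrt[symmetric] powr_powr)
          ultimately show ?thesis using v r' by (simp add: u2 powr_powr powr_mult)
        qed
        have "ennreal (u powr - \<tau> * (2 powr (1 - c) / (c - 1)) powr (q * (1 - 1 / p))) * ennreal (?k2 t r v powr q)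
           = ennreal (K * v powr - \<kappa>) * ennreal (u powr - \<tau>)"
          unfolding k2 K_def by (simp add: ennreal_mult[symmetric] ac_simps)
        also have "\<dots> \<le> ennreal (K * v powr - \<kappa>) * ?P r v"
          unfolding u_def using t \<tau> us u by (intro mult_left_mono dist_potential_ge) (auto simp: u_def)
        also have "\<dots> = ?W r v" using r' v v0 by simp
        finally show ?thesis using J unfolding p'_def[symmetric] by simp
      qed
    qed
  next
    fix v :: real
    show "(\<integral>\<^sup>+r. ?W r v * ennreal r * indicator {0<..} r \<partial>lborel) \<le> ennreal (4 * K * C * 5 powr e)"
    proof (cases "v \<in> {0<..25}")
      case True
      then have s: "0 < sqrt v" "sqrt v \<le> 5" using real_sqrt_le_mono[of v 25] by auto
      have "(\<integral>\<^sup>+r. ?W r v * ennreal r * indicator {0<..} r \<partial>lborel)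
         \<le> ennreal (4 * (indicator {0<..25} v * (K * v powr - \<kappa>)) * (C * sqrt v powr (1 - \<tau> - b)))"
        using K C s by (intro nn_integral_middle_le C measurable_dist_potential_full E continuous_intros) auto
      also have "4 * (indicator {0<..25} v * (K * v powr - \<kappa>)) * (C * sqrt v powr (1 - \<tau> - b))
         = 4 * K * C * (sqrt v powr (- 2 * \<kappa>) * sqrt v powr (1 - \<tau> - b))"
      proof -
        have "v powr - \<kappa> = sqrt v powr (- 2 * \<kappa>)"
          using True by (simp add: powr_half_sqrt[symmetric] powr_powr)
        then show ?thesis using True by simp
      qed
      also have "sqrt v powr (- 2 * \<kappa>) * sqrt v powr (1 - \<tau> - b) = sqrt v powr e"
      proof -
        have "- 2 * \<kappa> + (1 - \<tau> - b) = e" using pq by (simp add: a_def \<kappa>_def e_def field_simps)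
        then show ?thesis by (simp only: powr_add[symmetric])
      qed
      also have "ennreal (4 * K * C * sqrt v powr e) \<le> ennreal (4 * K * C * 5 powr e)"
        using s e K C by (intro ennreal_leI mult_left_mono powr_mono2) auto
      finally show ?thesis .
    qed simp
  qed
qed

section \<open>Small radii\<close>

lemma nn_integral_cover_le:
  fixes f :: "real \<Rightarrow> ennreal"
  assumes [measurable]: "f \<in> borel_measurable borel" "\<And>k::nat. T k \<in> sets borel" and cov: "S \<subseteq> (\<Union>k. T k)"
  shows "(\<integral>\<^sup>+r. f r * indicator S r \<partial>lborel) \<le> (\<Sum>k. \<integral>\<^sup>+r. f r * indicator (T k) r \<partial>lborel)"
proof -
  have "f r * indicator S r \<le> (\<Sum>k. f r * indicator (T k) r)" for r
  proof (cases "r \<in> S")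
    case True
    then obtain k where "r \<in> T k" using cov by blast
    then show ?thesis
      using True ennreal_term_le_suminf[of "\<lambda>k. f r * indicator (T k) r" k] by simp
  qed simp
  then have "(\<integral>\<^sup>+r. f r * indicator S r \<partial>lborel) \<le> (\<integral>\<^sup>+r. (\<Sum>k. f r * indicator (T k) r) \<partial>lborel)"
    by (intro nn_integral_mono)
  also have "\<dots> = (\<Sum>k. \<integral>\<^sup>+r. f r * indicator (T k) r \<partial>lborel)"
    by (intro nn_integral_suminf) measurable
  finally show ?thesis .
qed

lemma suminf_geometric_scale:
  assumes "0 \<le> c" "0 \<le> x" "x < 1"
  shows "(\<Sum>k. ennreal (c * x ^ k)) = ennreal (c / (1 - x))"
proof -
  have "(\<Sum>k. ennreal (c * x ^ k)) = ennreal (\<Sum>k. c * x ^ k)"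
    using assms by (intro suminf_ennreal2 summable_mult) (auto simp: summable_geometric_iff)
  also have "(\<Sum>k. c * x ^ k) = c * (1 / (1 - x))"
    using assms by (simp add: suminf_mult suminf_geometric summable_geometric_iff)
  finally show ?thesis by simp
qed

text \<open>On one block r^y and \<rho>^y agree up to the factor 2^|y|. A block with \<rho> > 1 lies
  above 1/2, so its part with r < 1/2 is empty and the hypothesis is needed for \<rho> \<le> 1
  only.\<close>

lemma dyadic_block_le:
  fixes W :: "real \<Rightarrow> ennreal"
  assumes [measurable]: "W \<in> borel_measurable borel" and C: "0 \<le> C"
    and W: "\<And>\<rho>. 0 < \<rho> \<Longrightarrow> \<rho> \<le> 1 \<Longrightarrow>
      (\<integral>\<^sup>+r. W r * indicator ({\<rho>/2<..\<rho>} \<inter> {..<1/2}) r \<partial>lborel) \<le> ennreal (C * \<rho> powr e)"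
    and \<rho>: "0 < \<rho>"
  shows "(\<integral>\<^sup>+r. ennreal (r powr y) * W r * indicator ({\<rho>/2<..\<rho>} \<inter> {..<1/2}) r \<partial>lborel)
    \<le> ennreal (2 powr \<bar>y\<bar> * C * \<rho> powr (y + e))"
proof (cases "\<rho> \<le> 1")
  case True
  have "(\<integral>\<^sup>+r. ennreal (r powr y) * W r * indicator ({\<rho>/2<..\<rho>} \<inter> {..<1/2}) r \<partial>lborel)
    \<le> (\<integral>\<^sup>+r. ennreal (2 powr \<bar>y\<bar> * \<rho> powr y) * (W r * indicator ({\<rho>/2<..\<rho>} \<inter> {..<1/2}) r) \<partial>lborel)"
  proof (intro nn_integral_mono)
    fix r
    show "ennreal (r powr y) * W r * indicator ({\<rho>/2<..\<rho>} \<inter> {..<1/2}) r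
      \<le> ennreal (2 powr \<bar>y\<bar> * \<rho> powr y) * (W r * indicator ({\<rho>/2<..\<rho>} \<inter> {..<1/2}) r)"
    proof (cases "r \<in> {\<rho>/2<..\<rho>} \<inter> {..<1/2}")
      case True
      then have r: "\<rho> / 2 < r" "r \<le> \<rho>" by auto
      have "r powr y \<le> 2 powr \<bar>y\<bar> * \<rho> powr y"
      proof (cases "0 \<le> y")
        case True
        have "r powr y \<le> 1 * \<rho> powr y" using r \<rho> True by (simp add: powr_mono2)
        also have "\<dots> \<le> 2 powr \<bar>y\<bar> * \<rho> powr y" by (intro mult_right_mono) (auto simp: ge_one_powr_ge_zero)
        finally show ?thesis .
      next
        case False
        have "r powr y \<le> (\<rho> / 2) powr y" using r \<rho> False by (intro powr_mono2') auto
        also have "\<dots> = 2 powr \<bar>y\<bar> * \<rho> powr y" using False by (simp add: powr_divide powr_minus field_simps)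
        finally show ?thesis .
      qed
      then have "ennreal (r powr y) * W r \<le> ennreal (2 powr \<bar>y\<bar> * \<rho> powr y) * W r"
        by (intro mult_right_mono ennreal_leI) auto
      then show ?thesis using True by simp
    qed simp
  qed
  also have "\<dots> = ennreal (2 powr \<bar>y\<bar> * \<rho> powr y) * (\<integral>\<^sup>+r. W r * indicator ({\<rho>/2<..\<rho>} \<inter> {..<1/2}) r \<partial>lborel)"
    by (simp add: nn_integral_cmult)
  also have "\<dots> \<le> ennreal (2 powr \<bar>y\<bar> * \<rho> powr y) * ennreal (C * \<rho> powr e)"
    by (intro mult_left_mono W \<rho> True) auto
  also have "\<dots> = ennreal (2 powr \<bar>y\<bar> * C * \<rho> powr (y + e))"
    using C by (simp add: ennreal_mult[symmetric] powr_add ac_simps)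
  finally show ?thesis .
next
  case False
  then have "{\<rho>/2<..\<rho>} \<inter> {..<1/2} = {}" by auto
  then show ?thesis by simp
qed

text \<open>The blocks at R / 2^k form a geometric series because y + e > 0; the one at R
  dominates.\<close>

lemma nn_integral_dyadic_below:
  fixes W :: "real \<Rightarrow> ennreal"
  assumes [measurable]: "W \<in> borel_measurable borel" and C: "0 \<le> C"
    and W: "\<And>\<rho>. 0 < \<rho> \<Longrightarrow> \<rho> \<le> 1 \<Longrightarrow>
      (\<integral>\<^sup>+r. W r * indicator ({\<rho>/2<..\<rho>} \<inter> {..<1/2}) r \<partial>lborel) \<le> ennreal (C * \<rho> powr e)"
    and R: "0 < R" and z: "0 < y + e"
  shows "(\<integral>\<^sup>+r. ennreal (r powr y) * W r * indicator ({0<..R} \<inter> {..<1/2}) r \<partial>lborel)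
    \<le> ennreal (2 powr \<bar>y\<bar> * C / (1 - 2 powr - \<bar>y + e\<bar>) * R powr (y + e))"
proof -
  let ?x = "2 powr - \<bar>y + e\<bar>"
  have x: "0 \<le> ?x" "?x < 1" using z by (auto intro!: powr_less_one)
  have "(\<integral>\<^sup>+r. ennreal (r powr y) * W r * indicator ({0<..R} \<inter> {..<1/2}) r \<partial>lborel)
     \<le> (\<Sum>k. \<integral>\<^sup>+r. ennreal (r powr y) * W r * indicator ({R / 2 ^ k / 2<..R / 2 ^ k} \<inter> {..<1/2}) r \<partial>lborel)"
  proof (intro nn_integral_cover_le subsetI)
    fix r assume r: "r \<in> {0<..R} \<inter> {..<1/2}"
    then obtain k where "R / 2 ^ Suc k < r" "r \<le> R / 2 ^ k" using dyadic_scale[of r R] by auto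
    then show "r \<in> (\<Union>k. {R / 2 ^ k / 2<..R / 2 ^ k} \<inter> {..<1/2})"
      using r by (intro UN_I[of k]) (auto simp: field_simps)
  qed auto
  also have "\<dots> \<le> (\<Sum>k. ennreal (2 powr \<bar>y\<bar> * C * R powr (y + e) * ?x ^ k))"
  proof (intro suminf_le)
    fix k
    have eq: "(R / 2 ^ k) powr (y + e) = R powr (y + e) * ?x ^ k"
    proof -
      have "R / 2 ^ k = R * 2 powr (- real k)" by (simp add: powr_minus powr_realpow divide_inverse)
      then have "(R / 2 ^ k) powr (y + e) = R powr (y + e) * 2 powr (- real k * (y + e))"
        by (simp only: powr_mult powr_powr)
      also have "2 powr (- real k * (y + e)) = ?x ^ k"
        using z by (subst powr_realpow[symmetric]) (auto simp: powr_powr algebra_simps)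
      finally show ?thesis .
    qed
    show "(\<integral>\<^sup>+r. ennreal (r powr y) * W r * indicator ({R / 2 ^ k / 2<..R / 2 ^ k} \<inter> {..<1/2}) r \<partial>lborel)
      \<le> ennreal (2 powr \<bar>y\<bar> * C * R powr (y + e) * ?x ^ k)"
      using dyadic_block_le[OF _ C W, of "R / 2 ^ k" y] R unfolding eq by (simp add: mult.assoc)
  qed auto
  also have "\<dots> = ennreal (2 powr \<bar>y\<bar> * C * R powr (y + e) / (1 - ?x))"
    using x C by (intro suminf_geometric_scale) auto
  finally show ?thesis by simp
qed

text \<open>The blocks now run upwards from R, and y + e < 0 makes the lowest one dominate.\<close>

lemma nn_integral_dyadic_above:
  fixes W :: "real \<Rightarrow> ennreal"
  assumes [measurable]: "W \<in> borel_measurable borel" and C: "0 \<le> C"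
    and W: "\<And>\<rho>. 0 < \<rho> \<Longrightarrow> \<rho> \<le> 1 \<Longrightarrow>
      (\<integral>\<^sup>+r. W r * indicator ({\<rho>/2<..\<rho>} \<inter> {..<1/2}) r \<partial>lborel) \<le> ennreal (C * \<rho> powr e)"
    and R: "0 < R" and z: "y + e < 0"
  shows "(\<integral>\<^sup>+r. ennreal (r powr y) * W r * indicator ({R<..} \<inter> {..<1/2}) r \<partial>lborel)
    \<le> ennreal (2 powr \<bar>y\<bar> * C / (1 - 2 powr - \<bar>y + e\<bar>) * R powr (y + e))"
proof -
  let ?x = "2 powr - \<bar>y + e\<bar>"
  have x: "0 \<le> ?x" "?x < 1" using z by (auto intro!: powr_less_one)
  have "(\<integral>\<^sup>+r. ennreal (r powr y) * W r * indicator ({R<..} \<inter> {..<1/2}) r \<partial>lborel)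
     \<le> (\<Sum>k. \<integral>\<^sup>+r. ennreal (r powr y) * W r * indicator ({R * 2 ^ k / 2<..R * 2 ^ k} \<inter> {..<1/2}) r \<partial>lborel)"
  proof (intro nn_integral_cover_le subsetI)
    fix r assume r: "r \<in> {R<..} \<inter> {..<1/2}"
    have ex: "\<exists>k. r \<le> R * 2 ^ k"
    proof -
      obtain n where "r / R < 2 ^ n" using real_arch_pow[of 2 "r / R"] by auto
      then show ?thesis using R by (intro exI[of _ n]) (simp add: field_simps)
    qed
    define m where "m = (LEAST k. r \<le> R * 2 ^ k)"
    have m: "r \<le> R * 2 ^ m" unfolding m_def by (rule LeastI_ex[OF ex])
    have "m \<noteq> 0" using m r by (intro notI) auto
    then obtain k where k: "m = Suc k" by (cases m) auto
    have "\<not> r \<le> R * 2 ^ k" using not_less_Least[of k "\<lambda>k. r \<le> R * 2 ^ k"] k unfolding m_def by simp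
    then show "r \<in> (\<Union>k. {R * 2 ^ k / 2<..R * 2 ^ k} \<inter> {..<1/2})"
      using r m k by (intro UN_I[of m]) auto
  qed auto
  also have "\<dots> \<le> (\<Sum>k. ennreal (2 powr \<bar>y\<bar> * C * R powr (y + e) * ?x ^ k))"
  proof (intro suminf_le)
    fix k
    have eq: "(R * 2 ^ k) powr (y + e) = R powr (y + e) * ?x ^ k"
    proof -
      have "R * 2 ^ k = R * 2 powr (real k)" by (simp add: powr_realpow)
      then have "(R * 2 ^ k) powr (y + e) = R powr (y + e) * 2 powr (real k * (y + e))"
        by (simp only: powr_mult powr_powr)
      also have "2 powr (real k * (y + e)) = ?x ^ k"
        using z by (subst powr_realpow[symmetric]) (auto simp: powr_powr algebra_simps)
      finally show ?thesis .
    qed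
    show "(\<integral>\<^sup>+r. ennreal (r powr y) * W r * indicator ({R * 2 ^ k / 2<..R * 2 ^ k} \<inter> {..<1/2}) r \<partial>lborel)
      \<le> ennreal (2 powr \<bar>y\<bar> * C * R powr (y + e) * ?x ^ k)"
      using dyadic_block_le[OF _ C W, of "R * 2 ^ k" y] R unfolding eq by (simp add: mult.assoc)
  qed auto
  also have "\<dots> = ennreal (2 powr \<bar>y\<bar> * C * R powr (y + e) / (1 - ?x))"
    using x C by (intro suminf_geometric_scale) auto
  finally show ?thesis by simp
qed

text \<open>l is the loss against the scale invariant power \<rho>^(1 - \<kappa>). It is 0 if E is
  counted inside intervals of length about \<rho>, and positive if global covering numbers
  enter.\<close>

definition dyadic_majorant ::
  "real set \<Rightarrow> bool \<Rightarrow> real \<Rightarrow> real \<Rightarrow> (real \<Rightarrow> real \<Rightarrow> ennreal) \<Rightarrow> real \<Rightarrow> bool" where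
  "dyadic_majorant E outer \<kappa> l W C \<longleftrightarrow>
     (\<lambda>z. W (fst z) (snd z)) \<in> borel_measurable borel \<and> 0 \<le> C \<and>
     (\<forall>t\<in>E. \<forall>r. \<forall>v\<in>edge_set outer t r. 0 < r \<longrightarrow> r < 1/2 \<longrightarrow> ennreal (edge_dist outer t r v powr - \<kappa>) \<le> W r v) \<and>
     (\<forall>v \<rho>. 0 < \<rho> \<longrightarrow> \<rho> \<le> 1 \<longrightarrow>
        (\<integral>\<^sup>+r. W r v * indicator ({\<rho>/2<..\<rho>} \<inter> {..<1/2}) r \<partial>lborel) \<le> ennreal (C * \<rho> powr (1 - \<kappa> - l)))"

lemma dyadic_majorant_0: "dyadic_majorant E outer 0 0 (\<lambda>r v. 1) 1"
  unfolding dyadic_majorant_def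
proof (intro conjI ballI allI impI)
  fix \<rho> :: real assume \<rho>: "0 < \<rho>"
  have "(\<integral>\<^sup>+r. 1 * indicator ({\<rho>/2<..\<rho>} \<inter> {..<1/2}) r \<partial>lborel) \<le> (\<integral>\<^sup>+r. indicator {\<rho>/2<..\<rho>} r \<partial>lborel)"
    by (intro nn_integral_mono) (auto simp: indicator_def)
  also have "\<dots> \<le> ennreal (1 * \<rho> powr (1 - 0 - 0))" using \<rho> by (simp add: ennreal_leI)
  finally show "(\<integral>\<^sup>+r. 1 * indicator ({\<rho>/2<..\<rho>} \<inter> {..<1/2}) r \<partial>lborel) \<le> ennreal (1 * \<rho> powr (1 - 0 - 0))" .
qed (auto simp: edge_set_def)

text \<open>The common form of two counts: (A, l) = (a, 0) for a above the Assouad dimension, and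
  (A, l) = (b, b) for a global covering bound with exponent b.\<close>

definition local_covering_bound :: "real set \<Rightarrow> real \<Rightarrow> real \<Rightarrow> bool" where
  "local_covering_bound E A l \<longleftrightarrow> (\<exists>C\<ge>0. \<forall>s \<rho> \<delta>. 0 < \<delta> \<and> \<delta> \<le> \<rho> \<and> \<rho> \<le> 2 \<longrightarrow>
     real (covering_number (E \<inter> {s - \<rho>..s + \<rho>}) \<delta>) \<le> C * (\<rho> / \<delta>) powr A * \<rho> powr - l)"

text \<open>For r < 1/2 and t \<ge> 1 both edges force |sqrt v - t| < 2 r, so only points of E near
  sqrt v contribute. \<open>X\<close> is the point whose distance to t is the small factor of the
  edge distance; the other factor is at least 1/2.\<close>

lemma dyadic_majorant_exists:
  assumes E: "E \<subseteq> {1..2}" and loc: "local_covering_bound E A l" and \<kappa>: "0 \<le> \<kappa>" "\<kappa> + A < 1"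
  obtains W C where "dyadic_majorant E outer \<kappa> l W C"
proof -
  from loc obtain C0 where C0: "0 \<le> C0"
    "\<And>s \<rho> \<delta>. 0 < \<delta> \<Longrightarrow> \<delta> \<le> \<rho> \<Longrightarrow> \<rho> \<le> 2 \<Longrightarrow>
      real (covering_number (E \<inter> {s - \<rho>..s + \<rho>}) \<delta>) \<le> C0 * (\<rho> / \<delta>) powr A * \<rho> powr - l"
    unfolding local_covering_bound_def by blast
  define X where "X = (\<lambda>r v. if outer then sqrt v - r else sqrt v + r)"
  define W where "W = (\<lambda>r v. ennreal (2 powr \<kappa>) * dist_potential {t\<in>E. \<bar>sqrt v - t\<bar> < 2 * r} \<kappa> (2 * r) (X r v))"
  define C where "C = 2 powr \<kappa> * (potential_const \<kappa> A * (C0 * 2 powr (A - l)))"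
  have contX: "continuous_on UNIV (\<lambda>z. X (fst z) (snd z))"
    unfolding X_def by (cases outer) (auto intro!: continuous_intros)
  have Wmeas: "(\<lambda>z. W (fst z) (snd z)) \<in> borel_measurable borel"
  proof -
    have [measurable]: "(\<lambda>z. dist_potential {t\<in>E. \<bar>sqrt (snd z) - t\<bar> < 2 * fst z} \<kappa> (2 * fst z) (X (fst z) (snd z))) \<in> borel_measurable borel"
      by (intro measurable_dist_potential contX continuous_intros)
    show ?thesis unfolding W_def by measurable
  qed
  have "dyadic_majorant E outer \<kappa> l W C"
    unfolding dyadic_majorant_def
  proof (intro conjI ballI allI impI Wmeas)
    show "0 \<le> C" using C0 \<kappa> by (simp add: C_def potential_const_nonneg)
  next
    fix t r v assume t: "t \<in> E" and v: "v \<in> edge_set outer t r" and r: "0 < r" "r < 1/2"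
    have t': "1 \<le> t" "t \<le> 2" using t E by auto
    have two: "1 \<le> 2 powr \<kappa>" using \<kappa> by (simp add: ge_one_powr_ge_zero)
    have "edge_dist outer t r v powr - \<kappa> \<le> 2 powr \<kappa> * \<bar>X r v - t\<bar> powr - \<kappa> \<and> \<bar>sqrt v - t\<bar> < 2 * r
       \<and> 0 < \<bar>X r v - t\<bar> \<and> \<bar>X r v - t\<bar> \<le> 2 * r"
    proof (cases outer)
      case True
      with v have v: "v \<in> edge_set True t r" by simp
      note D = edge_outerD[OF v r(1), of]
      have X: "\<bar>X r v - t\<bar> = r + t - sqrt v" using D t' True by (simp add: X_def)
      have "edge_dist True t r v powr - \<kappa> = (r + t - sqrt v) powr - \<kappa> * (r + t + sqrt v) powr - \<kappa>"
        using D t' by (simp add: powr_mult)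
      also have "\<dots> \<le> (r + t - sqrt v) powr - \<kappa> * 1 powr - \<kappa>"
        using D r t' \<kappa> by (intro mult_left_mono powr_mono2') auto
      also have "\<dots> \<le> 2 powr \<kappa> * (r + t - sqrt v) powr - \<kappa>"
        using two by (simp add: mult_le_cancel_right1)
      finally show ?thesis unfolding X using True D r t' by auto
    next
      case False
      with v have v: "v \<in> edge_set False t r" by simp
      note D = edge_innerD[OF v r(1), of]
      have X: "\<bar>X r v - t\<bar> = sqrt v - \<bar>r - t\<bar>" using D t' r False by (simp add: X_def)
      have "edge_dist False t r v powr - \<kappa> = (sqrt v - \<bar>r - t\<bar>) powr - \<kappa> * (sqrt v + \<bar>r - t\<bar>) powr - \<kappa>"
        using D t' by (simp add: powr_mult)
      also have "\<dots> \<le> (sqrt v - \<bar>r - t\<bar>) powr - \<kappa> * (1/2) powr - \<kappa>"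
        using D r t' \<kappa> by (intro mult_left_mono powr_mono2') auto
      also have "\<dots> = 2 powr \<kappa> * (sqrt v - \<bar>r - t\<bar>) powr - \<kappa>"
        by (simp add: powr_divide powr_minus field_simps)
      finally show ?thesis unfolding X using False D r t' by auto
    qed
    then have le: "edge_dist outer t r v powr - \<kappa> \<le> 2 powr \<kappa> * \<bar>X r v - t\<bar> powr - \<kappa>"
      and near: "\<bar>sqrt v - t\<bar> < 2 * r" "0 < \<bar>X r v - t\<bar>" "\<bar>X r v - t\<bar> \<le> 2 * r" by auto
    have "ennreal (edge_dist outer t r v powr - \<kappa>) \<le> ennreal (2 powr \<kappa>) * ennreal (\<bar>X r v - t\<bar> powr - \<kappa>)"
      using le by (simp add: ennreal_mult[symmetric] ennreal_leI)
    also have "\<dots> \<le> W r v"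
      unfolding W_def using near t \<kappa> by (intro mult_left_mono dist_potential_ge) auto
    finally show "ennreal (edge_dist outer t r v powr - \<kappa>) \<le> W r v" .
  next
    fix v \<rho> :: real assume \<rho>: "0 < \<rho>" "\<rho> \<le> 1"
    \<comment> \<open>On the block the windows have radius 2 r \<le> 2 \<rho>; the largest of them
      gives one \<Psi> for all r.\<close>
    let ?T = "E \<inter> {sqrt v - 2 * \<rho>..sqrt v + 2 * \<rho>}"
    let ?Q = "C0 * 2 powr (A - l) * \<rho> powr - l"
    have T: "?T \<subseteq> {1..2}" using E by auto
    have cov: "real (covering_number ?T \<delta>) \<le> ?Q * (\<rho> / \<delta>) powr A" if "0 < \<delta>" "\<delta> \<le> \<rho>" for \<delta>
    proof -
      have "real (covering_number ?T \<delta>) \<le> C0 * (2 * \<rho> / \<delta>) powr A * (2 * \<rho>) powr - l"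
        using C0(2)[of \<delta> "2 * \<rho>" "sqrt v"] that \<rho> by simp
      also have "(2 * \<rho> / \<delta>) powr A = 2 powr A * (\<rho> / \<delta>) powr A"
        using powr_mult[of 2 "\<rho> / \<delta>" A] by simp
      also have "(2 * \<rho>) powr - l = 2 powr - l * \<rho> powr - l" by (rule powr_mult)
      also have "C0 * (2 powr A * (\<rho> / \<delta>) powr A) * (2 powr - l * \<rho> powr - l)
         = C0 * (2 powr A * 2 powr - l) * \<rho> powr - l * (\<rho> / \<delta>) powr A" by (simp only: ac_simps)
      also have "2 powr A * 2 powr - l = 2 powr (A - l)" by (simp add: powr_add[symmetric])
      finally show ?thesis .
    qed
    obtain \<Psi> where \<Psi>[measurable]: "\<Psi> \<in> borel_measurable borel"
      and \<Psi>1: "\<And>T' R x. T' \<subseteq> ?T \<Longrightarrow> \<rho> \<le> R \<Longrightarrow> R \<le> 2 * \<rho> \<Longrightarrow> dist_potential T' \<kappa> R x \<le> \<Psi> x"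
      and \<Psi>2: "(\<integral>\<^sup>+x. \<Psi> x \<partial>lborel) \<le> ennreal (potential_const \<kappa> A * ?Q * \<rho> powr (1 - \<kappa>))"
      by (rule dist_potential_dominated[OF T \<rho>(1) \<kappa> _ cov]) (use C0 in auto)
    have [measurable]: "(\<lambda>r. X r v) \<in> borel_measurable borel" unfolding X_def by measurable
    have "(\<integral>\<^sup>+r. W r v * indicator ({\<rho>/2<..\<rho>} \<inter> {..<1/2}) r \<partial>lborel) \<le> (\<integral>\<^sup>+r. ennreal (2 powr \<kappa>) * \<Psi> (X r v) \<partial>lborel)"
    proof (intro nn_integral_mono)
      fix r
      show "W r v * indicator ({\<rho>/2<..\<rho>} \<inter> {..<1/2}) r \<le> ennreal (2 powr \<kappa>) * \<Psi> (X r v)"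
      proof (cases "r \<in> {\<rho>/2<..\<rho>}")
        case True
        have "W r v \<le> ennreal (2 powr \<kappa>) * \<Psi> (X r v)"
          unfolding W_def using True by (intro mult_left_mono \<Psi>1) auto
        then show ?thesis by (auto simp: indicator_def)
      qed (auto simp: indicator_def)
    qed
    also have "\<dots> = ennreal (2 powr \<kappa>) * (\<integral>\<^sup>+r. \<Psi> (X r v) \<partial>lborel)" by (simp add: nn_integral_cmult)
    also have "(\<integral>\<^sup>+r. \<Psi> (X r v) \<partial>lborel) = (\<integral>\<^sup>+r. \<Psi> r \<partial>lborel)"
      using nn_integral_reflect[OF \<Psi>, of "sqrt v"] nn_integral_shift[OF \<Psi>, of "sqrt v"]
      by (cases outer) (auto simp: X_def add.commute)
    also have "ennreal (2 powr \<kappa>) * \<dots> \<le> ennreal (2 powr \<kappa>) * ennreal (potential_const \<kappa> A * ?Q * \<rho> powr (1 - \<kappa>))"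
      by (intro mult_left_mono \<Psi>2) auto
    also have "\<dots> = ennreal (C * (\<rho> powr - l * \<rho> powr (1 - \<kappa>)))"
      using C0 \<kappa> by (simp add: ennreal_mult[symmetric] potential_const_nonneg C_def ac_simps)
    also have "\<rho> powr - l * \<rho> powr (1 - \<kappa>) = \<rho> powr (1 - \<kappa> - l)" by (simp add: powr_add[symmetric])
    finally show "(\<integral>\<^sup>+r. W r v * indicator ({\<rho>/2<..\<rho>} \<inter> {..<1/2}) r \<partial>lborel) \<le> ennreal (C * \<rho> powr (1 - \<kappa> - l))" .
  qed
  then show ?thesis by (rule that)
qed

text \<open>The block at \<rho> contributes \<rho>^(y + e) with y + e = 2 - l - q/p, so the sum over
  the blocks converges if q/p < 2 - l.\<close>

lemma kernel_bound_small:
  assumes E: "E \<subseteq> {1..2}" and pq: "1 < p" "p \<le> q" and a: "a * (p / (p - 1)) < 2" and \<kappa>: "\<kappa> = (1 - a) * q / 2"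
    and W: "dyadic_majorant E outer \<kappa> l W C" and l: "q / p < 2 - l"
  shows "kernel_bound E (\<lambda>t r v. indicator {..<1/2} r * edge_kernel outer t r v) p q"
proof -
  define y where "y = \<kappa> - q / p + 1"
  define e where "e = 1 - \<kappa> - l"
  have C: "0 \<le> C" and W1: "\<And>t r v. t \<in> E \<Longrightarrow> 0 < r \<Longrightarrow> r < 1/2 \<Longrightarrow> v \<in> edge_set outer t r \<Longrightarrow> ennreal (edge_dist outer t r v powr - \<kappa>) \<le> W r v"
    and W2: "\<And>v \<rho>. 0 < \<rho> \<Longrightarrow> \<rho> \<le> 1 \<Longrightarrow>
        (\<integral>\<^sup>+r. W r v * indicator ({\<rho>/2<..\<rho>} \<inter> {..<1/2}) r \<partial>lborel) \<le> ennreal (C * \<rho> powr e)"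
    and Wm: "(\<lambda>z. W (fst z) (snd z)) \<in> borel_measurable borel"
    using W unfolding dyadic_majorant_def e_def by blast+
  have [measurable]: "(\<lambda>r. W r v) \<in> borel_measurable borel" for v
    using measurable_compose[OF _ Wm[folded borel_prod], of "\<lambda>r. (r, v)"] by simp
  let ?C = "2 powr \<bar>y\<bar> * C / (1 - 2 powr - \<bar>y + e\<bar>) * 1 powr (y + e)"
  have z: "0 < y + e" using l by (simp add: y_def e_def)
  show ?thesis
  proof (rule kernel_bound_edge[OF pq a \<kappa> E, where W = "\<lambda>r v. ennreal (r powr (\<kappa> - q / p)) * W r v" and C = ?C])
    have [measurable]: "(fst :: real \<times> real \<Rightarrow> real) \<in> borel_measurable borel"
      by (intro borel_measurable_continuous_onI continuous_intros)
    show "(\<lambda>z. ennreal (fst z powr (\<kappa> - q / p)) * W (fst z) (snd z)) \<in> borel_measurable borel"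
      using Wm by measurable
    show "ennreal (r powr (\<kappa> - q / p) * edge_dist outer t r v powr - \<kappa>) \<le> ennreal (r powr (\<kappa> - q / p)) * W r v"
      if "t \<in> E" "0 < r" "r \<in> {..<1/2}" "v \<in> edge_set outer t r" for t r v
      using that by (simp add: ennreal_mult mult_left_mono W1)
    show "0 \<le> ?C" using C z by (auto intro!: divide_nonneg_nonneg simp: powr_less_one less_imp_le)
    show "(\<integral>\<^sup>+r. ennreal (r powr (\<kappa> - q / p)) * W r v * ennreal r * indicator ({0<..} \<inter> {..<1/2}) r \<partial>lborel) \<le> ennreal ?C" for v
    proof -
      have "(\<integral>\<^sup>+r. ennreal (r powr (\<kappa> - q / p)) * W r v * ennreal r * indicator ({0<..} \<inter> {..<1/2}) r \<partial>lborel)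
        = (\<integral>\<^sup>+r. ennreal (r powr y) * W r v * indicator ({0<..1} \<inter> {..<1/2}) r \<partial>lborel)"
      proof (intro nn_integral_cong)
        fix r
        show "ennreal (r powr (\<kappa> - q / p)) * W r v * ennreal r * indicator ({0<..} \<inter> {..<1/2}) r
          = ennreal (r powr y) * W r v * indicator ({0<..1} \<inter> {..<1/2}) r"
        proof (cases "0 < r \<and> r < 1/2")
          case True
          then have "ennreal (r powr y) = ennreal (r powr (\<kappa> - q / p)) * ennreal r"
            by (simp add: y_def powr_add ennreal_mult)
          then show ?thesis using True by (simp add: ac_simps)
        qed (auto simp: indicator_def)
      qed
      also have "\<dots> \<le> ennreal ?C" by (rule nn_integral_dyadic_below[OF _ C W2 _ z]) auto
      finally show ?thesis .
    qed
  qed auto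
qed

section \<open>The endpoint line and the full kernel\<close>

text \<open>Marcinkiewicz interpolation between \<open>L\<^sup>p\<close> bounds on the dyadic blocks in \<open>r\<close>: since the norm
  of the block at \<open>r\<close> scales like \<open>r\<^sup>-\<^sup>1\<^sup>/\<^sup>p\<close>, the function is cut at this height.\<close>

definition height_cut :: "bool \<Rightarrow> real \<Rightarrow> (real \<Rightarrow> real) \<Rightarrow> real \<Rightarrow> real \<Rightarrow> real" where
  "height_cut up p h r v = (if (r powr (- 1 / p) < h v) = up then h v else 0)"

lemma height_cut_add: "height_cut True p h r v + height_cut False p h r v = h v"
  by (simp add: height_cut_def)

text \<open>The values kept lie on that side of r^(-1/p) where h^(p0 - p) is at most its value at
  this height.\<close>

lemma height_cut_powr_le:
  assumes p: "0 < p" "0 < p0" "p0 \<noteq> p" and up: "up \<longleftrightarrow> p0 < p" and r: "0 < r" and h: "0 \<le> h v"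
  shows "height_cut up p h r v powr p0 \<le> r powr (1 - p0 / p) * h v powr p"
proof (cases "height_cut up p h r v = 0")
  case True
  then show ?thesis by simp
next
  case False
  then have c: "height_cut up p h r v = h v" "(r powr (- 1 / p) < h v) = up" and "h v \<noteq> 0"
    by (auto simp: height_cut_def split: if_splits)
  then have hv: "0 < h v" using h by simp
  have "h v powr (p0 - p) \<le> (r powr (- 1 / p)) powr (p0 - p)"
  proof (cases up)
    case True
    then show ?thesis using c up r p by (intro powr_mono2') auto
  next
    case False
    then show ?thesis using c up r p hv by (intro powr_mono2) auto
  qed
  also have "(r powr (- 1 / p)) powr (p0 - p) = r powr (1 - p0 / p)"
  proof -
    have "- 1 / p * (p0 - p) = 1 - p0 / p" using p by (simp add: field_simps)
    then show ?thesis by (simp only: powr_powr)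
  qed
  finally have "h v powr (p0 - p) * h v powr p \<le> r powr (1 - p0 / p) * h v powr p"
    by (intro mult_right_mono) auto
  then show ?thesis using c hv by (simp add: powr_add[symmetric])
qed

text \<open>The edge estimate is used at p0 instead of p, with target exponent 2 p. For fixed v the
  cut in height is a cut of r at R = h^-p. The block sum has exponent z = p0/p - 1, whose sign makes
  it converge on the side that is kept; it amounts to R^z, and h^p0 R^z = h^p.\<close>

lemma height_cut_block_bound:
  assumes E: "E \<subseteq> {1..2}" and p: "1 < p" "1 < p0" "p0 \<noteq> p" "p0 \<le> 2 * p" and up: "up \<longleftrightarrow> p0 < p"
    and a: "a * (p0 / (p0 - 1)) < 2" and \<kappa>: "\<kappa> = (1 - a) * p" and W: "dyadic_majorant E outer \<kappa> 0 W C"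
    and h [measurable]: "h \<in> borel_measurable borel" and h0: "\<And>v. 0 \<le> h v"
    and h1: "(\<integral>\<^sup>+v. ennreal (h v powr p) \<partial>lborel) \<le> 1"
  obtains G where "G \<in> borel_measurable borel"
    "\<And>t r. t \<in> E \<Longrightarrow> 0 < r \<Longrightarrow> r < 1/2 \<Longrightarrow>
      ennreal_powr (\<integral>\<^sup>+v. ennreal (edge_kernel outer t r v * height_cut up p h r v) \<partial>lborel) (2 * p) \<le> G r"
    "(\<integral>\<^sup>+r. G r * ennreal r * indicator ({0<..} \<inter> {..<1/2}) r \<partial>lborel)
      \<le> ennreal (edge_const a p0 (2 * p) * (2 powr \<bar>\<kappa> - 2 + p0 / p\<bar> * C / (1 - 2 powr - \<bar>p0 / p - 1\<bar>)))"
proof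
  define y where "y = \<kappa> - 2 + p0 / p"
  define e where "e = 1 - \<kappa>"
  define z where "z = p0 / p - 1"
  have yz: "y + e = z" by (simp add: y_def e_def z_def)
  define M where "M = 2 powr \<bar>y\<bar> * C / (1 - 2 powr - \<bar>z\<bar>)"
  define c where "c = edge_const a p0 (2 * p)"
  have c: "0 \<le> c" by (simp add: c_def edge_const_nonneg)
  have C: "0 \<le> C" and W1: "\<And>t r v. t \<in> E \<Longrightarrow> 0 < r \<Longrightarrow> r < 1/2 \<Longrightarrow> v \<in> edge_set outer t r \<Longrightarrow> ennreal (edge_dist outer t r v powr - \<kappa>) \<le> W r v"
    and W2: "\<And>v \<rho>. 0 < \<rho> \<Longrightarrow> \<rho> \<le> 1 \<Longrightarrow>
        (\<integral>\<^sup>+r. W r v * indicator ({\<rho>/2<..\<rho>} \<inter> {..<1/2}) r \<partial>lborel) \<le> ennreal (C * \<rho> powr e)"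
    and Wm: "(\<lambda>z. W (fst z) (snd z)) \<in> borel_measurable borel"
    using W unfolding dyadic_majorant_def e_def by (auto simp del: enn2real_eq_0_iff)
  have W'[measurable]: "(\<lambda>z. W (fst z) (snd z)) \<in> borel_measurable (borel \<Otimes>\<^sub>M borel)"
    using Wm by (simp add: borel_prod)
  have [measurable]: "(\<lambda>v. W r v) \<in> borel_measurable borel" for r
    using measurable_compose[OF _ W', of "\<lambda>v. (r, v)"] by simp
  have [measurable]: "(\<lambda>r. W r v) \<in> borel_measurable borel" for v
    using measurable_compose[OF _ W', of "\<lambda>r. (r, v)"] by simp
  have cutm[measurable]: "(\<lambda>z. height_cut up p h (fst z) (snd z)) \<in> borel_measurable (borel \<Otimes>\<^sub>M borel)"
    unfolding height_cut_def by measurable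
  have [measurable]: "(\<lambda>v. height_cut up p h r v) \<in> borel_measurable borel" for r
    unfolding height_cut_def by measurable
  have [measurable]: "(\<lambda>r. height_cut up p h r v) \<in> borel_measurable borel" for v
    unfolding height_cut_def by measurable
  let ?g = "\<lambda>r v. height_cut up p h r v"
  let ?G = "\<lambda>r. \<integral>\<^sup>+v. ennreal (c * r powr (y - 1)) * W (fst (r, v)) (snd (r, v)) * ennreal (height_cut up p h (fst (r, v)) (snd (r, v)) powr p0) \<partial>lborel"
  have g0: "0 \<le> ?g r v" for r v using h0 by (simp add: height_cut_def)
  show "?G \<in> borel_measurable borel" by measurable
  show "ennreal_powr (\<integral>\<^sup>+v. ennreal (edge_kernel outer t r v * ?g r v) \<partial>lborel) (2 * p) \<le> ?G r"
    if t: "t \<in> E" and r: "0 < r" "r < 1/2" for t r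
  proof -
    define \<mu> where "\<mu> = r powr (1 - p0 / p)"
    have "(\<integral>\<^sup>+v. ennreal (?g r v powr p0) \<partial>lborel) \<le> (\<integral>\<^sup>+v. ennreal \<mu> * ennreal (h v powr p) \<partial>lborel)"
      using p r h0 unfolding \<mu>_def ennreal_mult[OF powr_ge_zero powr_ge_zero, symmetric]
      by (intro nn_integral_mono ennreal_leI height_cut_powr_le up) auto
    also have "\<dots> = ennreal \<mu> * (\<integral>\<^sup>+v. ennreal (h v powr p) \<partial>lborel)" by (simp add: nn_integral_cmult)
    also have "\<dots> \<le> ennreal \<mu> * 1" by (intro mult_left_mono h1) auto
    finally have \<mu>: "(\<integral>\<^sup>+v. ennreal (?g r v powr p0) \<partial>lborel) \<le> ennreal \<mu>" by simp
    have \<kappa>': "(1 - a) * (2 * p) / 2 = \<kappa>" by (simp add: \<kappa>)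
    have "ennreal_powr (\<integral>\<^sup>+v. ennreal (edge_kernel outer t r v * ?g r v) \<partial>lborel) (2 * p)
      \<le> ennreal (edge_const a p0 (2 * p) * r powr ((1 - a) * (2 * p) / 2 - 2 * p / p0) * \<mu> powr (2 * p / p0 - 1)) *
      (\<integral>\<^sup>+v. ennreal (indicator (edge_set outer t r) v * edge_dist outer t r v powr - ((1 - a) * (2 * p) / 2) * ?g r v powr p0) \<partial>lborel)"
      using t E by (intro edge_estimate p a r g0 \<mu>) (auto simp: \<mu>_def r less_imp_neq[OF r(1), symmetric])
    also have "r powr ((1 - a) * (2 * p) / 2 - 2 * p / p0) = r powr (\<kappa> - 2 * p / p0)" unfolding \<kappa>' ..
    also have "edge_const a p0 (2 * p) * r powr (\<kappa> - 2 * p / p0) * \<mu> powr (2 * p / p0 - 1) = c * r powr (y - 1)"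
    proof -
      \<comment> \<open>The powers of r from the kernel and from \<mu> combine to r^(y - 1); one
        more factor r is supplied by the measure r dr.\<close>
      have "\<kappa> - 2 * p / p0 + (1 - p0 / p) * (2 * p / p0 - 1) = y - 1" using p by (simp add: y_def field_simps)
      then show ?thesis by (simp add: \<mu>_def powr_powr c_def mult.assoc powr_add[symmetric])
    qed
    also have "ennreal (c * r powr (y - 1)) * (\<integral>\<^sup>+v. ennreal (indicator (edge_set outer t r) v * edge_dist outer t r v powr - ((1 - a) * (2 * p) / 2) * ?g r v powr p0) \<partial>lborel)
      = (\<integral>\<^sup>+v. ennreal (c * r powr (y - 1)) * ennreal (indicator (edge_set outer t r) v * edge_dist outer t r v powr - \<kappa> * ?g r v powr p0) \<partial>lborel)"
      unfolding \<kappa>' by (subst nn_integral_cmult) auto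
    also have "\<dots> \<le> ?G r"
    proof (intro nn_integral_mono)
      fix v
      show "ennreal (c * r powr (y - 1)) * ennreal (indicator (edge_set outer t r) v * edge_dist outer t r v powr - \<kappa> * ?g r v powr p0)
        \<le> ennreal (c * r powr (y - 1)) * W (fst (r, v)) (snd (r, v)) * ennreal (?g (fst (r, v)) (snd (r, v)) powr p0)"
      proof (cases "v \<in> edge_set outer t r")
        case True
        have "ennreal (edge_dist outer t r v powr - \<kappa>) * ennreal (?g r v powr p0) \<le> W r v * ennreal (?g r v powr p0)"
          by (intro mult_right_mono W1 t r True) auto
        then show ?thesis using True by (simp add: ennreal_mult mult.assoc mult_left_mono)
      qed simp
    qed
    finally show ?thesis .
  qed
  have inner: "(\<integral>\<^sup>+r. ennreal (c * r powr (y - 1)) * W r v * ennreal (?g r v powr p0) * (ennreal r * indicator ({0<..} \<inter> {..<1/2}) r) \<partial>lborel)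
     \<le> ennreal (c * M) * ennreal (h v powr p)" for v
  proof (cases "h v = 0")
    case True
    then have "?g r v = 0" for r by (simp add: height_cut_def)
    then show ?thesis using True by simp
  next
    case False
    then have hv: "0 < h v" using h0[of v] by simp
    define R where "R = h v powr - p"
    define T where "T = (if up then {R<..} else {0<..R})"
    have R: "0 < R" using hv by (simp add: R_def)
    have [measurable]: "T \<in> sets borel" by (simp add: T_def)
    \<comment> \<open>The height condition read as a condition on r for fixed v, needed after
      Fubini.\<close>
    have iff: "r powr (- 1 / p) < h v \<longleftrightarrow> R < r" if "0 < r" for r
    proof -
      have "R < r \<longleftrightarrow> r powr (- 1 / p) < R powr (- 1 / p)"
      proof
        assume "R < r" then show "r powr (- 1 / p) < R powr (- 1 / p)"
          using R p by (intro powr_less_mono2_neg) auto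
      next
        assume *: "r powr (- 1 / p) < R powr (- 1 / p)"
        show "R < r"
        proof (rule ccontr)
          assume "\<not> R < r"
          then have "R powr (- 1 / p) \<le> r powr (- 1 / p)" using that p by (intro powr_mono2') auto
          with * show False by simp
        qed
      qed
      also have "R powr (- 1 / p) = h v" using hv p by (simp add: R_def powr_powr)
      finally show ?thesis by simp
    qed
    have "(\<integral>\<^sup>+r. ennreal (c * r powr (y - 1)) * W r v * ennreal (?g r v powr p0) * (ennreal r * indicator ({0<..} \<inter> {..<1/2}) r) \<partial>lborel)
      = (\<integral>\<^sup>+r. ennreal (c * h v powr p0) * (ennreal (r powr y) * W r v * indicator (T \<inter> {..<1/2}) r) \<partial>lborel)"
    proof (intro nn_integral_cong)
      fix r
      show "ennreal (c * r powr (y - 1)) * W r v * ennreal (?g r v powr p0) * (ennreal r * indicator ({0<..} \<inter> {..<1/2}) r)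
        = ennreal (c * h v powr p0) * (ennreal (r powr y) * W r v * indicator (T \<inter> {..<1/2}) r)"
      proof (cases "0 < r \<and> r < 1/2")
        case True
        have g: "?g r v powr p0 = h v powr p0 * indicator T r"
          using True R iff[of r] by (auto simp: height_cut_def T_def indicator_def)
        have "c * r powr (y - 1) * (h v powr p0 * indicator T r) * r = c * h v powr p0 * (r powr y * indicator T r)"
          using True powr_add[of r "y - 1" 1] by simp
        then have "ennreal (c * r powr (y - 1)) * (ennreal (?g r v powr p0) * ennreal r)
          = ennreal (c * h v powr p0) * (ennreal (r powr y) * ennreal (indicator T r))"
          using c True unfolding g by (simp add: ennreal_mult[symmetric] mult.assoc)
        then have "W r v * (ennreal (c * r powr (y - 1)) * (ennreal (?g r v powr p0) * ennreal r))
          = W r v * (ennreal (c * h v powr p0) * (ennreal (r powr y) * ennreal (indicator T r)))" by simp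
        moreover have "ennreal (indicator T r) = indicator (T \<inter> {..<1/2}) r" using True by (simp add: indicator_def)
        ultimately show ?thesis using True by (simp add: ac_simps)
      qed (use R in \<open>auto simp: indicator_def T_def\<close>)
    qed
    also have "\<dots> = ennreal (c * h v powr p0) * (\<integral>\<^sup>+r. ennreal (r powr y) * W r v * indicator (T \<inter> {..<1/2}) r \<partial>lborel)"
      by (subst nn_integral_cmult) auto
    also have "(\<integral>\<^sup>+r. ennreal (r powr y) * W r v * indicator (T \<inter> {..<1/2}) r \<partial>lborel) \<le> ennreal (M * R powr z)"
    proof (cases up)
      case True
      then have "y + e < 0" using up p by (simp add: yz z_def)
      from nn_integral_dyadic_above[OF _ C W2 R this] True show ?thesis
        by (simp add: T_def M_def yz)
    next
      case False
      then have "0 < y + e" using up p by (simp add: yz z_def)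
      from nn_integral_dyadic_below[OF _ C W2 R this] False show ?thesis
        by (simp add: T_def M_def yz)
    qed
    also have "ennreal (c * h v powr p0) * ennreal (M * R powr z) = ennreal (c * M * (h v powr p0 * R powr z))"
      using c by (subst ennreal_mult'[symmetric]) (auto simp: ac_simps)
    also have "h v powr p0 * R powr z = h v powr p"
    proof -
      have "p0 + - p * z = p" using p by (simp add: z_def field_simps)
      then show ?thesis by (simp add: R_def powr_powr powr_add[symmetric])
    qed
    also have "ennreal (c * M * h v powr p) = ennreal (c * M) * ennreal (h v powr p)"
      by (rule ennreal_mult'') simp
    finally show ?thesis by (simp add: mult_left_mono)
  qed
  have "(\<integral>\<^sup>+r. ?G r * ennreal r * indicator ({0<..} \<inter> {..<1/2}) r \<partial>lborel)
    = (\<integral>\<^sup>+r. (\<integral>\<^sup>+v. ennreal (c * r powr (y - 1)) * W (fst (r, v)) (snd (r, v)) * ennreal (?g (fst (r, v)) (snd (r, v)) powr p0)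
        * (ennreal r * indicator ({0<..} \<inter> {..<1/2}) r) \<partial>lborel) \<partial>lborel)"
    by (intro nn_integral_cong, subst nn_integral_multc, measurable) (simp add: mult.assoc)
  also have "\<dots> = (\<integral>\<^sup>+v. (\<integral>\<^sup>+r. ennreal (c * r powr (y - 1)) * W (fst (r, v)) (snd (r, v)) * ennreal (?g (fst (r, v)) (snd (r, v)) powr p0)
        * (ennreal r * indicator ({0<..} \<inter> {..<1/2}) r) \<partial>lborel) \<partial>lborel)"
    by (rule lborel_pair.Fubini') measurable
  also have "\<dots> \<le> (\<integral>\<^sup>+v. ennreal (c * M) * ennreal (h v powr p) \<partial>lborel)"
    using inner by (intro nn_integral_mono) simp
  also have "\<dots> = ennreal (c * M) * (\<integral>\<^sup>+v. ennreal (h v powr p) \<partial>lborel)" by (simp add: nn_integral_cmult)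
  also have "\<dots> \<le> ennreal (c * M) * 1" by (intro mult_left_mono h1) auto
  finally show "(\<integral>\<^sup>+r. ?G r * ennreal r * indicator ({0<..} \<inter> {..<1/2}) r \<partial>lborel)
      \<le> ennreal (edge_const a p0 (2 * p) * (2 powr \<bar>\<kappa> - 2 + p0 / p\<bar> * C / (1 - 2 powr - \<bar>p0 / p - 1\<bar>)))"
    by (simp add: c_def M_def y_def z_def)
qed

text \<open>Tall values are estimated at some p1 < p, low values at 2 p. The condition that d^(-a/2)
  has an integrable p1'-th power reads p1 > 2 / (2 - a) and survives slightly below p; 2 p is the
  largest source exponent allowed for the target exponent 2 p.\<close>

lemma kernel_bound_small_endpoint:
  assumes E: "E \<subseteq> {1..2}" and p: "1 < p" and a: "a < 2 - 2 / p" and \<kappa>: "\<kappa> = (1 - a) * p"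
    and W: "dyadic_majorant E outer \<kappa> 0 W C"
  shows "kernel_bound E (\<lambda>t r v. indicator {..<1/2} r * edge_kernel outer t r v) p (2 * p)"
proof -
  have a2: "a < 2" using a p by (smt (verit) divide_pos_pos)
  define m where "m = max 1 (2 / (2 - a))"
  have "2 / (2 - a) < p"
  proof -
    have "2 / p < 2 - a" using a by simp
    then show ?thesis using p a2 by (simp add: field_simps)
  qed
  then have m: "m < p" using p by (simp add: m_def)
  define p1 where "p1 = (m + p) / 2"
  have p1: "1 < p1" "p1 < p" "2 / (2 - a) < p1" using m by (auto simp: p1_def m_def)
  have cond: "a * (x / (x - 1)) < 2" if "1 < x" "2 / (2 - a) < x" for x
  proof -
    have "2 < x * (2 - a)" using that a2 by (simp add: field_simps)
    then have "a * x < 2 * (x - 1)" by (simp add: algebra_simps)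
    then show ?thesis using that by (simp add: field_simps)
  qed
  define M where "M = (\<lambda>p0. edge_const a p0 (2 * p) * (2 powr \<bar>\<kappa> - 2 + p0 / p\<bar> * C / (1 - 2 powr - \<bar>p0 / p - 1\<bar>)))"
  have C: "0 \<le> C" using W by (simp add: dyadic_majorant_def)
  have M: "0 \<le> M p0" if "p0 \<noteq> p" for p0
    using C that p unfolding M_def
    by (intro mult_nonneg_nonneg divide_nonneg_nonneg edge_const_nonneg) (auto simp: powr_less_one less_imp_le)
  show ?thesis
  proof (rule kernel_boundI)
    fix h :: "real \<Rightarrow> real" assume h[measurable]: "h \<in> borel_measurable borel" and h0: "\<And>v. 0 \<le> h v"
      and h1: "(\<integral>\<^sup>+v. ennreal (h v powr p) \<partial>lborel) \<le> 1"
    obtain G1 where [measurable]: "G1 \<in> borel_measurable borel"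
      and G11: "\<And>t r. t \<in> E \<Longrightarrow> 0 < r \<Longrightarrow> r < 1/2 \<Longrightarrow>
      ennreal_powr (\<integral>\<^sup>+v. ennreal (edge_kernel outer t r v * height_cut True p h r v) \<partial>lborel) (2 * p) \<le> G1 r"
      and G12: "(\<integral>\<^sup>+r. G1 r * ennreal r * indicator ({0<..} \<inter> {..<1/2}) r \<partial>lborel) \<le> ennreal (M p1)"
      unfolding M_def
      by (rule height_cut_block_bound[OF E p p1(1) _ _ _ cond \<kappa> W h h0 h1, of True]) (use p1 in auto)
    obtain G2 where [measurable]: "G2 \<in> borel_measurable borel"
      and G21: "\<And>t r. t \<in> E \<Longrightarrow> 0 < r \<Longrightarrow> r < 1/2 \<Longrightarrow>
      ennreal_powr (\<integral>\<^sup>+v. ennreal (edge_kernel outer t r v * height_cut False p h r v) \<partial>lborel) (2 * p) \<le> G2 r"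
      and G22: "(\<integral>\<^sup>+r. G2 r * ennreal r * indicator ({0<..} \<inter> {..<1/2}) r \<partial>lborel) \<le> ennreal (M (2 * p))"
      unfolding M_def
      by (rule height_cut_block_bound[OF E p _ _ _ _ cond \<kappa> W h h0 h1, of "2 * p" False]) (use p p1 in auto)
    let ?c = "ennreal (2 powr (2 * p))"
    let ?G = "\<lambda>r. ?c * (G1 r + G2 r) * indicator {..<1/2} r"
    show "kernel_majorant E (\<lambda>t r v. indicator {..<1/2} r * edge_kernel outer t r v) (2 * p) h (2 powr (2 * p) * (M p1 + M (2 * p)))"
    proof (rule kernel_majorantI)
      show "?G \<in> borel_measurable borel" by measurable
    next
      fix r t :: real assume rt: "0 < r" "t \<in> E"
      show "ennreal_powr (\<integral>\<^sup>+v. ennreal (indicator {..<1/2} r * edge_kernel outer t r v * h v) \<partial>lborel) (2 * p) \<le> ?G r"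
      proof (cases "r < 1/2")
        case True
        have [measurable]: "(\<lambda>v. height_cut up p h r v) \<in> borel_measurable borel" for up
          unfolding height_cut_def by measurable
        have nn: "0 \<le> height_cut up p h r v" for up v using h0 by (simp add: height_cut_def)
        have "(\<integral>\<^sup>+v. ennreal (indicator {..<1/2} r * edge_kernel outer t r v * h v) \<partial>lborel)
          = (\<integral>\<^sup>+v. ennreal (edge_kernel outer t r v * height_cut True p h r v) + ennreal (edge_kernel outer t r v * height_cut False p h r v) \<partial>lborel)"
          using True nn edge_kernel_nonneg
          by (intro nn_integral_cong) (simp add: ennreal_plus[symmetric] distrib_left[symmetric] height_cut_add del: ennreal_plus)
        also have "\<dots> = (\<integral>\<^sup>+v. ennreal (edge_kernel outer t r v * height_cut True p h r v) \<partial>lborel)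
           + (\<integral>\<^sup>+v. ennreal (edge_kernel outer t r v * height_cut False p h r v) \<partial>lborel)"
          by (intro nn_integral_add) measurable
        finally have "ennreal_powr (\<integral>\<^sup>+v. ennreal (indicator {..<1/2} r * edge_kernel outer t r v * h v) \<partial>lborel) (2 * p)
          \<le> ?c * (ennreal_powr (\<integral>\<^sup>+v. ennreal (edge_kernel outer t r v * height_cut True p h r v) \<partial>lborel) (2 * p)
            + ennreal_powr (\<integral>\<^sup>+v. ennreal (edge_kernel outer t r v * height_cut False p h r v) \<partial>lborel) (2 * p))"
          using p by (simp only:) (intro ennreal_powr_add_le, simp)
        also have "\<dots> \<le> ?c * (G1 r + G2 r)"
          by (intro mult_left_mono add_mono G11 G21 rt True) auto
        finally show ?thesis using True by simp
      qed simp
    next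
      have "(\<integral>\<^sup>+r. ?G r * ennreal r * indicator {0<..} r \<partial>lborel)
        = (\<integral>\<^sup>+r. ?c * (G1 r * ennreal r * indicator ({0<..} \<inter> {..<1/2}) r + G2 r * ennreal r * indicator ({0<..} \<inter> {..<1/2}) r) \<partial>lborel)"
        by (intro nn_integral_cong) (auto simp: indicator_def distrib_right mult.assoc)
      also have "\<dots> = ?c * ((\<integral>\<^sup>+r. G1 r * ennreal r * indicator ({0<..} \<inter> {..<1/2}) r \<partial>lborel)
          + (\<integral>\<^sup>+r. G2 r * ennreal r * indicator ({0<..} \<inter> {..<1/2}) r \<partial>lborel))"
        by (subst nn_integral_cmult, measurable, subst nn_integral_add) auto
      also have "\<dots> \<le> ?c * (ennreal (M p1) + ennreal (M (2 * p)))"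
        by (intro mult_left_mono add_mono G12 G22) auto
      finally show "(\<integral>\<^sup>+r. ?G r * ennreal r * indicator {0<..} r \<partial>lborel) \<le> ennreal (2 powr (2 * p) * (M p1 + M (2 * p)))"
        using M[of p1] M[of "2 * p"] p p1 by (simp add: ennreal_mult ennreal_plus)
    qed
  qed
qed

section \<open>Assembly of the kernel bounds\<close>

lemma kernel_bound_circle_if_pieces:
  assumes E: "E \<subseteq> {1..2}" and q: "0 \<le> q"
    and small: "\<And>outer. kernel_bound E (\<lambda>t r v. indicator {..<1/2} r * edge_kernel outer t r v) p q"
    and large: "\<And>outer. kernel_bound E (\<lambda>t r v. indicator {1/2..} r * edge_kernel outer t r v) p q"
  shows "kernel_bound E circle_kernel p q"
proof (rule kernel_bound_mono[OF kernel_bound_add[OF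
      kernel_bound_add[OF small[of True] large[of True] q] kernel_bound_add[OF small[of False] large[of False] q] q] q, where c = 1])
  fix t r v :: real assume t: "t \<in> E" and r: "0 < r"
  have "circle_kernel t r v \<le> edge_kernel True t r v + edge_kernel False t r v"
    using t E by (intro circle_kernel_le_edge r) auto
  then show "circle_kernel t r v \<le> 1 * (indicator {..<1/2} r * edge_kernel True t r v + indicator {1/2..} r * edge_kernel True t r v
      + (indicator {..<1/2} r * edge_kernel False t r v + indicator {1/2..} r * edge_kernel False t r v))"
    by (auto simp: indicator_def)
qed (auto simp: edge_kernel_nonneg)

lemma kernel_bound_gt_2:
  assumes E: "E \<subseteq> {1..2}" and p: "2 < p" and q: "q = p \<or> q = 2 * p"
  shows "kernel_bound E circle_kernel p q"
proof (rule kernel_bound_circle_if_pieces[OF E])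
  show "0 \<le> q" using p q by auto
  show "kernel_bound E (\<lambda>t r v. indicator {1/2..} r * edge_kernel outer t r v) p q" for outer
    using p q by (intro kernel_bound_large_gt_2 E) auto
  show "kernel_bound E (\<lambda>t r v. indicator {..<1/2} r * edge_kernel outer t r v) p q" for outer
    using q
  proof
    assume [simp]: "q = p"
    show ?thesis
      by (rule kernel_bound_small[OF E _ _ _ _ dyadic_majorant_0, where a = 1]) (use p in \<open>auto simp: field_simps\<close>)
  next
    assume [simp]: "q = 2 * p"
    show ?thesis unfolding \<open>q = 2 * p\<close>
      by (rule kernel_bound_small_endpoint[OF E _ _ _ dyadic_majorant_0, where a = 1]) (use p in \<open>auto simp: field_simps\<close>)
  qed
qed

lemma kernel_bound_large_lt_2:
  assumes E: "E \<subseteq> {1..2}" and pq: "1 < p" "p \<le> q" and a: "a < 2 - 2 / p" and b: "covering_bound E b" "b < 1"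
    and \<kappa>: "\<kappa> = (1 - a) * q / 2" "0 \<le> \<kappa>" "\<kappa> + b < 1" and crit: "q * (2 / p - 1) \<le> 1 - b"
  shows "kernel_bound E (\<lambda>t r v. indicator {1/2..} r * edge_kernel outer t r v) p q"
proof (cases outer)
  have q: "0 \<le> q" using pq by simp
  have a': "a * (p / (p - 1)) < 2"
  proof -
    have "a * p < 2 * (p - 1)" using a pq mult_strict_right_mono[of a "2 - 2 / p" p] by (simp add: algebra_simps)
    then show ?thesis using pq by (simp add: field_simps)
  qed
  case True
  then show ?thesis using kernel_bound_outer_large[OF E pq a' b(1) \<kappa>] by simp
next
  have q: "0 \<le> q" using pq by simp
  have a': "a * (p / (p - 1)) < 2"
  proof -
    have "a * p < 2 * (p - 1)" using a pq mult_strict_right_mono[of a "2 - 2 / p" p] by (simp add: algebra_simps)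
    then show ?thesis using pq by (simp add: field_simps)
  qed
  case False
  show ?thesis
  proof (rule kernel_bound_mono[OF kernel_bound_add[OF kernel_bound_inner_large[OF E pq a' b(1) \<kappa>]
        kernel_bound_add[OF kernel_bound_near[OF E pq a b(1) \<kappa> crit] kernel_bound_far[OF E pq b crit] q] q] q, where c = 1])
    fix t r v :: real assume t: "t \<in> E" and r: "0 < r"
    have "indicator {1/2..<4} r * edge_kernel False t r v \<le> near_kernel t r v + far_kernel t r v"
      using t E by (intro edge_kernel_le_near_far r) auto
    moreover have "indicator {1/2..} r * edge_kernel False t r v
        = indicator {4..} r * edge_kernel False t r v + indicator {1/2..<4} r * edge_kernel False t r v"
      by (auto simp: indicator_def)
    ultimately show "indicator {1/2..} r * edge_kernel outer t r v
        \<le> 1 * (indicator {4..} r * edge_kernel False t r v + (near_kernel t r v + far_kernel t r v))"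
      using False by simp
  qed (auto simp: edge_kernel_nonneg near_far_nonneg)
qed

text \<open>The first Schur factor is integrable for \<kappa> > k0, the potentials for \<kappa> < 1
  - b and \<kappa> < 1 - A. By \<open>crit\<close> the number k0 is at most (1 - b) / 2, and the
  hypothesis on A keeps it below 1 - A, so \<kappa> can be chosen halfway and a is computed from
  it.\<close>

lemma kernel_bound_lt_2:
  assumes E: "E \<subseteq> {1..2}" and pq: "1 < p" "p < 2" "p \<le> q" and b: "covering_bound E b" "b < 1"
    and crit: "q * (2 / p - 1) \<le> 1 - b"
    and loc: "local_covering_bound E A l" "q * (2 / p - 1) / 2 < 1 - A"
    and l: "q / p < 2 - l \<or> q = 2 * p \<and> l = 0"
  shows "kernel_bound E circle_kernel p q"
proof -
  define k0 where "k0 = q * (2 / p - 1) / 2"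
  have k0: "0 < k0" "k0 < 1 - b" "k0 < 1 - A"
  proof -
    show "0 < k0" using pq by (simp add: k0_def field_simps)
    have "2 * k0 \<le> 1 - b" using crit by (simp add: k0_def)
    then show "k0 < 1 - b" using b by linarith
    show "k0 < 1 - A" using loc(2) by (simp add: k0_def)
  qed
  define \<kappa> where "\<kappa> = (k0 + min (1 - b) (1 - A)) / 2"
  have \<kappa>: "k0 < \<kappa>" "\<kappa> < 1 - b" "\<kappa> < 1 - A" using k0 by (auto simp: \<kappa>_def)
  define a where "a = 1 - 2 * \<kappa> / q"
  have a\<kappa>: "\<kappa> = (1 - a) * q / 2" using pq by (simp add: a_def)
  have a: "a < 2 - 2 / p"
  proof -
    have "2 / p - 1 = 2 * k0 / q" using pq by (simp add: k0_def)
    also have "\<dots> < 2 * \<kappa> / q" using \<kappa> pq by (intro divide_strict_right_mono) auto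
    finally show ?thesis by (simp add: a_def)
  qed
  have a': "a * (p / (p - 1)) < 2"
  proof -
    have "a * p < 2 * (p - 1)" using a pq mult_strict_right_mono[of a "2 - 2 / p" p] by (simp add: algebra_simps)
    then show ?thesis using pq by (simp add: field_simps)
  qed
  show ?thesis
  proof (rule kernel_bound_circle_if_pieces[OF E])
    show "0 \<le> q" using pq by simp
    show "kernel_bound E (\<lambda>t r v. indicator {1/2..} r * edge_kernel outer t r v) p q" for outer
      by (rule kernel_bound_large_lt_2[OF E pq(1,3) a b a\<kappa> _ _ crit]) (use \<kappa> k0 in auto)
    show "kernel_bound E (\<lambda>t r v. indicator {..<1/2} r * edge_kernel outer t r v) p q" for outer
    proof -
      obtain W C where W: "dyadic_majorant E outer \<kappa> l W C"
        by (rule dyadic_majorant_exists[OF E loc(1), of \<kappa> outer]) (use \<kappa> k0 in auto)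
      from l show ?thesis
      proof
        assume "q / p < 2 - l"
        then show ?thesis by (rule kernel_bound_small[OF E pq(1,3) a' a\<kappa> W])
      next
        assume *: "q = 2 * p \<and> l = 0"
        then have "\<kappa> = (1 - a) * p" using a\<kappa> by simp
        with kernel_bound_small_endpoint[OF E pq(1) a this] W * show ?thesis by blast
      qed
    qed
  qed
qed

section \<open>Finite sets and dimensions\<close>

text \<open>The symmetry of the kernel in r and sqrt v turns the integral against r dr into half an
  integral in w = r^2, of mass pi. The substitution is made by comparing the two forms of polar
  coordinates.\<close>

lemma nn_integral_circle_kernel_swap:
  assumes t: "0 < t"
  shows "(\<integral>\<^sup>+r. ennreal (circle_kernel t r v) * ennreal r * indicator {0<..} r \<partial>lborel) \<le> ennreal (pi / 2)"
proof (cases "0 < v")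
  case False
  have "circle_kernel t r v = 0" for r
  proof -
    have "v \<notin> {(r - t)\<^sup>2<..<(r + t)\<^sup>2}"
      using False zero_le_power2[of "r - t"] by (simp only: greaterThanLessThan_iff) linarith
    then show ?thesis by (simp add: circle_kernel_def)
  qed
  then show ?thesis by simp
next
  case True
  define s where "s = sqrt v"
  have s: "0 < s" "v = s\<^sup>2" using True by (auto simp: s_def)
  define F where "F = (\<lambda>w. ennreal (circle_kernel t s w))"
  have [measurable]: "F \<in> borel_measurable borel" unfolding F_def by measurable
  have le: "circle_kernel t r v \<le> circle_kernel t s (r\<^sup>2)" if r: "0 < r" for r
  proof (cases "v \<in> {(r - t)\<^sup>2<..<(r + t)\<^sup>2}")
    case True
    then have "\<bar>r - t\<bar>\<^sup>2 < s\<^sup>2" "s\<^sup>2 < (r + t)\<^sup>2" using s by auto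
    then have "\<bar>r - t\<bar> < s" "s < r + t"
      using s r t power_less_imp_less_base[of "\<bar>r - t\<bar>" 2 s] power_less_imp_less_base[of s 2 "r + t"] by auto
    then have "\<bar>s - t\<bar> < r" "r < s + t" by auto
    then have "\<bar>s - t\<bar>\<^sup>2 < r\<^sup>2" "r\<^sup>2 < (s + t)\<^sup>2"
      using r power_strict_mono[of "\<bar>s - t\<bar>" r 2] power_strict_mono[of r "s + t" 2] by auto
    then have m: "r\<^sup>2 \<in> {(s - t)\<^sup>2<..<(s + t)\<^sup>2}" by auto
    have "((r + t)\<^sup>2 - v) * (v - (r - t)\<^sup>2) = ((s + t)\<^sup>2 - r\<^sup>2) * (r\<^sup>2 - (s - t)\<^sup>2)"
      unfolding s(2) by (simp add: power2_eq_square algebra_simps)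
    then show ?thesis using True m by (simp add: circle_kernel_def)
  next
    case False
    then show ?thesis using circle_kernel_nonneg[of t s "r\<^sup>2"] by (simp add: circle_kernel_def)
  qed
  have "ennreal (2 * pi) * (\<integral>\<^sup>+r. ennreal (circle_kernel t r v) * ennreal r * indicator {0<..} r \<partial>lborel)
     \<le> ennreal (2 * pi) * (\<integral>\<^sup>+r. F (r\<^sup>2) * ennreal r * indicator {0<..} r \<partial>lborel)"
    unfolding F_def by (intro mult_left_mono nn_integral_mono) (auto simp: indicator_def intro!: mult_right_mono ennreal_leI le)
  also have "\<dots> = (\<integral>\<^sup>+r. ennreal (2 * pi * r) * indicator {0<..} r * F (r\<^sup>2) \<partial>lborel)"
  proof (subst nn_integral_cmult[symmetric], measurable, intro nn_integral_cong)
    fix r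
    have "ennreal (2 * pi * r) = ennreal (2 * pi) * ennreal r" by (rule ennreal_mult') simp
    then show "ennreal (2 * pi) * (F (r\<^sup>2) * ennreal r * indicator {0<..} r) = ennreal (2 * pi * r) * indicator {0<..} r * F (r\<^sup>2)"
      by (simp only: ac_simps)
  qed
  also have "\<dots> = (\<integral>\<^sup>+x. F ((norm (x::real^2))\<^sup>2) \<partial>lborel)"
    by (rule nn_integral_norm_plane[symmetric]) measurable
  also have "\<dots> = (\<integral>\<^sup>+w. ennreal pi * indicator {0<..} w * F w \<partial>lborel)"
    by (rule nn_integral_norm_sq_plane) measurable
  also have "\<dots> \<le> (\<integral>\<^sup>+w. ennreal pi * F w \<partial>lborel)"
    by (intro nn_integral_mono mult_right_mono) (auto simp: indicator_def)
  also have "\<dots> = ennreal pi * ennreal pi"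
    using nn_integral_circle_kernel_total[OF s(1) t] by (simp add: nn_integral_cmult F_def)
  finally have *: "ennreal (2 * pi) * (\<integral>\<^sup>+r. ennreal (circle_kernel t r v) * ennreal r * indicator {0<..} r \<partial>lborel) \<le> ennreal pi * ennreal pi" .
  let ?I = "\<integral>\<^sup>+r. ennreal (circle_kernel t r v) * ennreal r * indicator {0<..} r \<partial>lborel"
  have "?I = ennreal (1 / (2 * pi)) * (ennreal (2 * pi) * ?I)"
    by (simp add: mult.assoc[symmetric] ennreal_mult[symmetric])
  also have "\<dots> \<le> ennreal (1 / (2 * pi)) * (ennreal pi * ennreal pi)" by (intro mult_left_mono *) auto
  also have "\<dots> = ennreal (pi / 2)" by (simp add: ennreal_mult[symmetric])
  finally show ?thesis .
qed

text \<open>The vertex (1, 1), which occurs for \<beta> = 0 and is out of reach of the Schur test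
  with p > 1. A supremum over finitely many t is at most the sum, and each mean is bounded on L^1 by
  the symmetry of the kernel.\<close>

lemma kernel_bound_finite:
  assumes fin: "finite E" and E: "\<And>t. t \<in> E \<Longrightarrow> 0 < t"
  shows "kernel_bound E circle_kernel 1 1"
proof (rule kernel_boundI)
  fix h :: "real \<Rightarrow> real" assume h[measurable]: "h \<in> borel_measurable borel" and h0: "\<And>v. 0 \<le> h v"
    and h1': "(\<integral>\<^sup>+v. ennreal (h v powr 1) \<partial>lborel) \<le> 1"
  have h1: "(\<integral>\<^sup>+v. ennreal (h v) \<partial>lborel) \<le> 1" using h1' h0 by simp
  have [measurable]: "(\<lambda>z. circle_kernel t (fst z) (snd z)) \<in> borel_measurable (borel \<Otimes>\<^sub>M borel)" for t
  proof -
    have "circle_kernel t r v = (if (r - t)\<^sup>2 < v \<and> v < (r + t)\<^sup>2 then 1 / sqrt (((r + t)\<^sup>2 - v) * (v - (r - t)\<^sup>2)) else 0)" for r v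
      by (simp add: circle_kernel_def)
    then show ?thesis by simp
  qed
  let ?G = "\<lambda>t r. \<integral>\<^sup>+v. ennreal (circle_kernel t (fst (r, v)) (snd (r, v)) * h v) \<partial>lborel"
  show "kernel_majorant E circle_kernel 1 h (real (card E) * (pi / 2))"
  proof (rule kernel_majorantI)
    show "(\<lambda>r. \<Sum>t\<in>E. ?G t r) \<in> borel_measurable borel" by measurable
    show "ennreal_powr (\<integral>\<^sup>+v. ennreal (circle_kernel t r v * h v) \<partial>lborel) 1 \<le> (\<Sum>t\<in>E. ?G t r)" if "t \<in> E" for t r
      using member_le_sum[of t E "\<lambda>t. ?G t r"] that fin by simp
    have one: "(\<integral>\<^sup>+r. ?G t r * ennreal r * indicator {0<..} r \<partial>lborel) \<le> ennreal (pi / 2)" if t: "t \<in> E" for t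
    proof -
      have "(\<integral>\<^sup>+r. ?G t r * ennreal r * indicator {0<..} r \<partial>lborel)
        = (\<integral>\<^sup>+r. (\<integral>\<^sup>+v. ennreal (circle_kernel t (fst (r, v)) (snd (r, v)) * h v) * (ennreal r * indicator {0<..} r) \<partial>lborel) \<partial>lborel)"
        by (intro nn_integral_cong, subst nn_integral_multc, measurable) (simp add: mult.assoc)
      also have "\<dots> = (\<integral>\<^sup>+v. (\<integral>\<^sup>+r. ennreal (circle_kernel t (fst (r, v)) (snd (r, v)) * h v) * (ennreal r * indicator {0<..} r) \<partial>lborel) \<partial>lborel)"
        by (rule lborel_pair.Fubini') measurable
      also have "\<dots> = (\<integral>\<^sup>+v. ennreal (h v) * (\<integral>\<^sup>+r. ennreal (circle_kernel t r v) * ennreal r * indicator {0<..} r \<partial>lborel) \<partial>lborel)"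
      proof (intro nn_integral_cong)
        fix v
        have [measurable]: "(\<lambda>r. circle_kernel t r v) \<in> borel_measurable borel"
          using measurable_compose[of "\<lambda>r. (r, v)" borel "borel \<Otimes>\<^sub>M borel" "\<lambda>z. circle_kernel t (fst z) (snd z)"] by simp
        show "(\<integral>\<^sup>+r. ennreal (circle_kernel t (fst (r, v)) (snd (r, v)) * h v) * (ennreal r * indicator {0<..} r) \<partial>lborel)
          = ennreal (h v) * (\<integral>\<^sup>+r. ennreal (circle_kernel t r v) * ennreal r * indicator {0<..} r \<partial>lborel)"
          using h0[of v] circle_kernel_nonneg
          by (subst nn_integral_cmult[symmetric]) (auto simp: ennreal_mult ac_simps intro!: nn_integral_cong)
      qed
      also have "\<dots> \<le> (\<integral>\<^sup>+v. ennreal (h v) * ennreal (pi / 2) \<partial>lborel)"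
        by (intro nn_integral_mono mult_left_mono nn_integral_circle_kernel_swap E t) auto
      also have "\<dots> = (\<integral>\<^sup>+v. ennreal (h v) \<partial>lborel) * ennreal (pi / 2)" by (simp add: nn_integral_multc)
      also have "\<dots> \<le> 1 * ennreal (pi / 2)" by (intro mult_right_mono h1) auto
      finally show ?thesis by simp
    qed
    have "(\<integral>\<^sup>+r. (\<Sum>t\<in>E. ?G t r) * ennreal r * indicator {0<..} r \<partial>lborel)
      = (\<integral>\<^sup>+r. (\<Sum>t\<in>E. ?G t r * ennreal r * indicator {0<..} r) \<partial>lborel)"
      by (simp add: sum_distrib_right)
    also have "\<dots> = (\<Sum>t\<in>E. \<integral>\<^sup>+r. ?G t r * ennreal r * indicator {0<..} r \<partial>lborel)"
      by (intro nn_integral_sum) measurable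
    also have "\<dots> \<le> (\<Sum>t\<in>E. ennreal (pi / 2))" by (intro sum_mono one)
    also have "\<dots> = ennreal (real (card E) * (pi / 2))"
      by (subst ennreal_mult) (auto simp: ennreal_of_nat_eq_real_of_nat)
    finally show "(\<integral>\<^sup>+r. (\<Sum>t\<in>E. ?G t r) * ennreal r * indicator {0<..} r \<partial>lborel) \<le> ennreal (real (card E) * (pi / 2))" .
  qed
qed

section \<open>Covering bounds from suprema and dimensions\<close>

lemma covering_boundI:
  assumes E: "E \<subseteq> {1..2}" and d: "0 < d" and b: "0 \<le> b"
    and le: "\<And>\<delta>. 0 < \<delta> \<Longrightarrow> \<delta> < d \<Longrightarrow> real (covering_number E \<delta>) \<le> C * \<delta> powr - b"
  shows "covering_bound E b"
  unfolding covering_bound_def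
proof (intro exI conjI allI impI)
  define n where "n = real (covering_number E (d / 2))"
  let ?C = "max C (n * 5 powr b)"
  show "0 \<le> ?C" by (simp add: n_def le_max_iff_disj)
  fix \<delta> :: real assume \<delta>: "0 < \<delta> \<and> \<delta> \<le> 5"
  show "real (covering_number E \<delta>) \<le> ?C * \<delta> powr - b"
  proof (cases "\<delta> < d")
    case True
    then have "real (covering_number E \<delta>) \<le> C * \<delta> powr - b" using le \<delta> by simp
    also have "\<dots> \<le> ?C * \<delta> powr - b" by (intro mult_right_mono) auto
    finally show ?thesis .
  next
    case False
    \<comment> \<open>From d on the count is at most the one at d / 2, and (5 / \<delta>)^b \<ge>
      1.\<close>
    then have "real (covering_number E \<delta>) \<le> n * 1"
      using d covering_number_mono[OF order_refl E, of "d / 2" \<delta>] by (simp add: n_def)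
    also have "n * 1 = n * (5 powr b * 5 powr - b)" by (simp only: powr_add[symmetric]) simp
    also have "\<dots> \<le> n * (5 powr b * \<delta> powr - b)"
      using \<delta> b by (intro mult_left_mono powr_mono2') (auto simp: n_def)
    also have "\<dots> = n * 5 powr b * \<delta> powr - b" by (rule mult.assoc[symmetric])
    also have "\<dots> \<le> ?C * \<delta> powr - b" by (intro mult_right_mono) auto
    finally show ?thesis .
  qed
qed

lemma covering_bound_if_SUP_finite:
  assumes E: "E \<subseteq> {1..2}" and d: "0 < d" and b: "0 \<le> b"
    and fin: "(SUP \<delta>\<in>{0<..<d}. ereal (\<delta> powr b * real (covering_number E \<delta>))) < \<infinity>"
  shows "covering_bound E b"
proof -
  obtain n :: nat where n: "(SUP \<delta>\<in>{0<..<d}. ereal (\<delta> powr b * real (covering_number E \<delta>))) < ereal (real n)"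
    using fin less_PInf_Ex_of_nat by (auto simp only: less_le)
  show ?thesis
  proof (rule covering_boundI[OF E d b, of "real n"])
    fix \<delta> :: real assume \<delta>: "0 < \<delta>" "\<delta> < d"
    have "ereal (\<delta> powr b * real (covering_number E \<delta>)) \<le> (SUP \<delta>\<in>{0<..<d}. ereal (\<delta> powr b * real (covering_number E \<delta>)))"
      using \<delta> by (intro SUP_upper) auto
    then have "ereal (\<delta> powr b * real (covering_number E \<delta>)) < ereal (real n)" using n by (rule order.strict_trans1)
    then have "\<delta> powr b * real (covering_number E \<delta>) \<le> real n" by simp
    then show "real (covering_number E \<delta>) \<le> real n * \<delta> powr - b"
      using \<delta> by (simp add: powr_minus field_simps)
  qed
qed

lemma SUP_finite_if_le:
  assumes "\<And>\<delta>. \<delta> \<in> S \<Longrightarrow> f \<delta> \<le> (C::real)"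
  shows "(SUP \<delta>\<in>S. ereal (f \<delta>)) < \<infinity>"
proof -
  have "(SUP \<delta>\<in>S. ereal (f \<delta>)) \<le> ereal C" by (intro SUP_least) (simp add: assms)
  then show ?thesis by (rule order.strict_trans1) simp
qed

lemma covering_number_le_if_gt_dim:
  assumes E: "E \<noteq> {}" "E \<subseteq> {1..2}" and beta: "upper_minkowski_dim E < ereal b"
  obtains d where "0 < d" "d \<le> 1" "\<And>\<delta>. 0 < \<delta> \<Longrightarrow> \<delta> < d \<Longrightarrow> real (covering_number E \<delta>) \<le> \<delta> powr - b"
proof -
  have "eventually (\<lambda>\<delta>. ereal (ln (real (covering_number E \<delta>)) / ln (1 / \<delta>)) < ereal b) (at_right 0)"
    using beta unfolding upper_minkowski_dim_def by (rule Limsup_lessD)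
  then obtain d where d: "0 < d" "\<And>\<delta>. 0 < \<delta> \<Longrightarrow> \<delta> < d \<Longrightarrow> ln (real (covering_number E \<delta>)) / ln (1 / \<delta>) < b"
    unfolding eventually_at_right_field by auto
  show ?thesis
  proof (rule that[of "min d 1"])
    fix \<delta> :: real assume \<delta>: "0 < \<delta>" "\<delta> < min d 1"
    have N: "1 \<le> real (covering_number E \<delta>)" using covering_number_pos[OF E \<delta>(1)] by simp
    have "0 < ln (1 / \<delta>)" using \<delta> by (simp add: ln_div)
    then have "ln (real (covering_number E \<delta>)) < b * ln (1 / \<delta>)" using d(2)[of \<delta>] \<delta> by (simp add: field_simps)
    also have "\<dots> = ln (\<delta> powr - b)" using \<delta> by (simp add: ln_powr ln_div)
    finally show "real (covering_number E \<delta>) \<le> \<delta> powr - b" using N \<delta> by (subst (asm) ln_less_cancel_iff) auto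
  qed (use d in auto)
qed

text \<open>A limes superior yields large covering numbers at arbitrarily small scales, not at all
  small scales.\<close>

lemma covering_number_ge_if_lt_dim:
  assumes E: "E \<noteq> {}" "E \<subseteq> {1..2}" and beta: "ereal b < upper_minkowski_dim E" and d: "0 < d"
  obtains \<delta> where "0 < \<delta>" "\<delta> < d" "\<delta> < 1" "\<delta> powr - b \<le> real (covering_number E \<delta>)"
proof -
  have "\<exists>\<delta>. 0 < \<delta> \<and> \<delta> < min d 1 \<and> \<delta> powr - b \<le> real (covering_number E \<delta>)"
  proof (rule ccontr)
    assume neg: "\<not> ?thesis"
    have "eventually (\<lambda>\<delta>. ereal (ln (real (covering_number E \<delta>)) / ln (1 / \<delta>)) \<le> ereal b) (at_right 0)"
      unfolding eventually_at_right_field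
    proof (intro exI conjI allI impI)
      show "0 < min d 1" using d by simp
      fix \<delta> :: real assume \<delta>: "0 < \<delta>" "\<delta> < min d 1"
      have N: "1 \<le> real (covering_number E \<delta>)" using covering_number_pos[OF E \<delta>(1)] by simp
      have "real (covering_number E \<delta>) < \<delta> powr - b" using neg \<delta> by (auto simp: not_le)
      then have "ln (real (covering_number E \<delta>)) < ln (\<delta> powr - b)" using N \<delta> by (subst ln_less_cancel_iff) auto
      also have "\<dots> = b * ln (1 / \<delta>)" using \<delta> by (simp add: ln_powr ln_div)
      finally show "ereal (ln (real (covering_number E \<delta>)) / ln (1 / \<delta>)) \<le> ereal b"
        using \<delta> by (simp add: ln_div field_simps)
    qed
    then have "upper_minkowski_dim E \<le> ereal b"
      unfolding upper_minkowski_dim_def by (rule Limsup_bounded)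
    with beta show False by simp
  qed
  then show ?thesis using that by auto
qed

text \<open>A negative exponent would push the covering number of a nonempty set below 1.\<close>

lemma upper_minkowski_dim_nonneg:
  assumes E: "E \<noteq> {}" "E \<subseteq> {1..2}"
  shows "0 \<le> upper_minkowski_dim E"
proof (rule ccontr)
  assume "\<not> ?thesis"
  then have "upper_minkowski_dim E < ereal 0" by (simp add: zero_ereal_def)
  then obtain b where b: "upper_minkowski_dim E < ereal b" "ereal b < 0"
    using ereal_dense2 by (metis zero_ereal_def)
  from covering_number_le_if_gt_dim[OF E b(1)] obtain d where d: "0 < d" "d \<le> 1"
    "\<And>\<delta>. 0 < \<delta> \<Longrightarrow> \<delta> < d \<Longrightarrow> real (covering_number E \<delta>) \<le> \<delta> powr - b" by blast
  have "real (covering_number E (d / 2)) \<le> (d / 2) powr - b" using d by simp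
  also have "\<dots> < 1"
  proof -
    have "0 < - b" using b(2) by (simp add: zero_ereal_def)
    then show ?thesis using d powr_less_mono2[of "- b" "d / 2" 1] by simp
  qed
  finally show False using covering_number_pos[OF E, of "d / 2"] d by simp
qed

lemma covering_bound_if_gt_dim:
  assumes E: "E \<noteq> {}" "E \<subseteq> {1..2}" and beta: "upper_minkowski_dim E < ereal b"
  shows "covering_bound E b"
proof -
  have "0 < ereal b" using upper_minkowski_dim_nonneg[OF E] beta by (rule order.strict_trans1)
  then have "0 \<le> b" by simp
  from covering_number_le_if_gt_dim[OF E beta] obtain d where "0 < d"
    "\<And>\<delta>. 0 < \<delta> \<Longrightarrow> \<delta> < d \<Longrightarrow> real (covering_number E \<delta>) \<le> \<delta> powr - b" by blast
  then show ?thesis by (intro covering_boundI[OF E(2) _ \<open>0 \<le> b\<close>, of d 1]) auto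
qed

lemma assouad_dimD:
  assumes E: "E \<subseteq> {1..2}" and gamma: "assouad_dim E < ereal a"
  shows "0 < a" "local_covering_bound E a 0" "covering_bound E a"
proof -
  from gamma obtain a' c where a': "0 < a'" "a' < a" and c: "0 < c"
    and cov: "\<And>\<delta> J. 0 < \<delta> \<Longrightarrow> \<delta> < 1 \<Longrightarrow> is_interval J \<Longrightarrow> J \<subseteq> {1..2} \<Longrightarrow> \<delta> \<le> measure lborel J \<Longrightarrow>
       real (covering_number (E \<inter> J) \<delta>) \<le> c * (measure lborel J / \<delta>) powr a'"
    unfolding assouad_dim_def Inf_less_iff by auto
  show "0 < a" using a' by simp
  show "covering_bound E a"
  proof (rule covering_boundI[OF E, of 1 _ c])
    fix \<delta> :: real assume \<delta>: "0 < \<delta>" "\<delta> < 1"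
    have "real (covering_number (E \<inter> {1..2}) \<delta>) \<le> c * (measure lborel {1..2::real} / \<delta>) powr a'"
      using \<delta> by (intro cov) (auto simp: is_interval_cc)
    also have "\<dots> \<le> c * (1 / \<delta>) powr a" using c \<delta> a' by (simp add: powr_mono)
    also have "(1 / \<delta>) powr a = \<delta> powr - a" using \<delta> by (simp add: powr_divide powr_minus field_simps)
    also have "E \<inter> {1..2} = E" using E by auto
    finally show "real (covering_number E \<delta>) \<le> c * \<delta> powr - a" .
  qed (use a' in auto)
  show "local_covering_bound E a 0"
    unfolding local_covering_bound_def
  proof (intro exI conjI allI impI)
    let ?C = "max 1 (c * 2 powr a)"
    show "0 \<le> ?C" by simp
    fix s \<rho> \<delta> :: real assume "0 < \<delta> \<and> \<delta> \<le> \<rho> \<and> \<rho> \<le> 2"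
    then have \<delta>: "0 < \<delta>" "\<delta> \<le> \<rho>" "\<rho> \<le> 2" by auto
    \<comment> \<open>The Assouad dimension speaks of intervals inside [1, 2], so the window is cut
      to it. If the cut is shorter than \<delta>, or if \<delta> \<ge> 1, one interval
      suffices.\<close>
    let ?J = "{max 1 (s - \<rho>)..min 2 (s + \<rho>)}"
    have EJ: "E \<inter> {s - \<rho>..s + \<rho>} = E \<inter> ?J" using E by auto
    have mJ: "measure lborel {u..v} = (if u \<le> v then v - u else 0)" for u v :: real by simp
    have r: "1 \<le> (\<rho> / \<delta>) powr a" using \<delta> a' by (intro ge_one_powr_ge_zero) auto
    have "real (covering_number (E \<inter> ?J) \<delta>) \<le> ?C * (\<rho> / \<delta>) powr a"
    proof (cases "\<delta> < 1 \<and> \<delta> \<le> measure lborel ?J")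
      case True
      have m: "measure lborel ?J \<le> 2 * \<rho>" using \<delta> by (subst mJ) auto
      have "real (covering_number (E \<inter> ?J) \<delta>) \<le> c * (measure lborel ?J / \<delta>) powr a'"
        using True \<delta> by (intro cov) (auto simp: is_interval_cc)
      also have "\<dots> \<le> c * (2 * \<rho> / \<delta>) powr a'"
        using c \<delta> a' m by (intro mult_left_mono powr_mono2 divide_right_mono) auto
      also have "\<dots> \<le> c * (2 * \<rho> / \<delta>) powr a"
        using c \<delta> a' by (intro mult_left_mono powr_mono) (auto simp: field_simps)
      also have "(2 * \<rho> / \<delta>) powr a = 2 powr a * (\<rho> / \<delta>) powr a" using powr_mult[of 2 "\<rho> / \<delta>" a] by simp
      also have "c * \<dots> \<le> ?C * (\<rho> / \<delta>) powr a" by (simp add: mult.assoc[symmetric] mult_right_mono)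
      finally show ?thesis .
    next
      case False
      have "covering_number (E \<inter> ?J) \<delta> \<le> 1"
      proof (cases "\<delta> < 1")
        case True
        with False have "measure lborel ?J < \<delta>" by simp
        then have "min 2 (s + \<rho>) \<le> max 1 (s - \<rho>) + \<delta>"
          using \<open>0 < \<delta>\<close> by (subst (asm) mJ) (auto split: if_splits)
        then show ?thesis by (intro covering_number_le_1[of _ "max 1 (s - \<rho>)"]) auto
      next
        case False
        then show ?thesis using E by (intro covering_number_le_1[of _ 1]) auto
      qed
      then have "real (covering_number (E \<inter> ?J) \<delta>) \<le> 1" by simp
      also have "\<dots> \<le> 1 * (\<rho> / \<delta>) powr a" using r by simp
      also have "\<dots> \<le> ?C * (\<rho> / \<delta>) powr a" by (intro mult_right_mono) auto
      finally show ?thesis .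
    qed
    then show "real (covering_number (E \<inter> {s - \<rho>..s + \<rho>}) \<delta>) \<le> ?C * (\<rho> / \<delta>) powr a * \<rho> powr - 0"
      using \<delta> by (simp only: EJ) simp
  qed
qed

lemma minkowski_le_assouad:
  assumes E: "E \<noteq> {}" "E \<subseteq> {1..2}"
  shows "upper_minkowski_dim E \<le> assouad_dim E"
proof (rule ccontr)
  assume "\<not> ?thesis"
  then have "assouad_dim E < upper_minkowski_dim E" by simp
  then obtain a where a: "assouad_dim E < ereal a" "ereal a < upper_minkowski_dim E" using ereal_dense2 by blast
  then obtain b where b: "ereal a < ereal b" "ereal b < upper_minkowski_dim E" using ereal_dense2 by blast
  from assouad_dimD(3)[OF E(2) a(1)] obtain C where C: "0 \<le> C"
    "\<And>\<delta>. 0 < \<delta> \<Longrightarrow> \<delta> \<le> 5 \<Longrightarrow> real (covering_number E \<delta>) \<le> C * \<delta> powr - a"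
    unfolding covering_bound_def by blast
  \<comment> \<open>Chosen so that C d^(b - a) = C / (C + 1) < 1.\<close>
  define d where "d = (1 / (C + 1)) powr (1 / (b - a))"
  have ab: "0 < b - a" using b by simp
  have "0 < d" using C by (simp add: d_def)
  from covering_number_ge_if_lt_dim[OF E b(2) this] obtain \<delta> where \<delta>: "0 < \<delta>" "\<delta> < d" "\<delta> < 1"
    "\<delta> powr - b \<le> real (covering_number E \<delta>)" by blast
  have "\<delta> powr - b \<le> C * \<delta> powr - a" using \<delta> C(2)[of \<delta>] by simp
  then have "\<delta> powr - b * \<delta> powr b \<le> C * \<delta> powr - a * \<delta> powr b" by (intro mult_right_mono) auto
  then have "1 \<le> C * \<delta> powr (b - a)" using \<delta> by (simp add: powr_add[symmetric] mult.assoc)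
  also have "\<dots> \<le> C * d powr (b - a)" using \<delta> ab C by (intro mult_left_mono powr_mono2) auto
  also have "d powr (b - a) = 1 / (C + 1)" using ab C by (simp add: d_def powr_powr)
  finally show False using C by (simp add: field_simps)
qed

text \<open>Counting all of E instead of its part in the window costs \<rho>^-b.\<close>

lemma local_covering_bound_global:
  assumes E: "E \<subseteq> {1..2}" and b: "covering_bound E b"
  shows "local_covering_bound E b b"
proof -
  from b obtain C where C: "0 \<le> C"
    "\<And>\<delta>. 0 < \<delta> \<Longrightarrow> \<delta> \<le> 5 \<Longrightarrow> real (covering_number E \<delta>) \<le> C * \<delta> powr - b"
    unfolding covering_bound_def by blast
  show ?thesis
    unfolding local_covering_bound_def
  proof (intro exI[of _ C] conjI allI impI C(1))
    fix s \<rho> \<delta> :: real assume \<delta>: "0 < \<delta> \<and> \<delta> \<le> \<rho> \<and> \<rho> \<le> 2"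
    have "real (covering_number (E \<inter> {s - \<rho>..s + \<rho>}) \<delta>) \<le> real (covering_number E \<delta>)"
      using \<delta> covering_number_mono[of "E \<inter> {s - \<rho>..s + \<rho>}" E 1 2 \<delta> \<delta>] E by simp
    also have "\<dots> \<le> C * \<delta> powr - b" using \<delta> by (intro C) auto
    also have "\<delta> powr - b = (\<rho> / \<delta>) powr b * \<rho> powr - b"
      using \<delta> by (simp add: powr_divide powr_minus field_simps)
    finally show "real (covering_number (E \<inter> {s - \<rho>..s + \<rho>}) \<delta>) \<le> C * (\<rho> / \<delta>) powr b * \<rho> powr - b"
      by (simp add: mult.assoc)
  qed
qed

text \<open>The same number is bounded in two ways; the geometric mean of the bounds has linearly
  interpolated exponents.\<close>

lemma local_covering_bound_interpolate:
  assumes 1: "local_covering_bound E A l" and 2: "local_covering_bound E A' l'" and \<theta>: "0 < \<theta>" "\<theta> < 1"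
  shows "local_covering_bound E ((1 - \<theta>) * A + \<theta> * A') ((1 - \<theta>) * l + \<theta> * l')"
proof -
  from 1 obtain C where C: "0 \<le> C" "\<And>s \<rho> \<delta>. 0 < \<delta> \<and> \<delta> \<le> \<rho> \<and> \<rho> \<le> 2 \<Longrightarrow>
     real (covering_number (E \<inter> {s - \<rho>..s + \<rho>}) \<delta>) \<le> C * (\<rho> / \<delta>) powr A * \<rho> powr - l"
    unfolding local_covering_bound_def by blast
  from 2 obtain C' where C': "0 \<le> C'" "\<And>s \<rho> \<delta>. 0 < \<delta> \<and> \<delta> \<le> \<rho> \<and> \<rho> \<le> 2 \<Longrightarrow>
     real (covering_number (E \<inter> {s - \<rho>..s + \<rho>}) \<delta>) \<le> C' * (\<rho> / \<delta>) powr A' * \<rho> powr - l'"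
    unfolding local_covering_bound_def by blast
  show ?thesis
    unfolding local_covering_bound_def
  proof (intro exI[of _ "C powr (1 - \<theta>) * C' powr \<theta>"] conjI allI impI)
    fix s \<rho> \<delta> :: real assume \<delta>: "0 < \<delta> \<and> \<delta> \<le> \<rho> \<and> \<rho> \<le> 2"
    let ?N = "real (covering_number (E \<inter> {s - \<rho>..s + \<rho>}) \<delta>)"
    have "?N = ?N powr (1 - \<theta>) * ?N powr \<theta>" by (simp add: powr_add[symmetric])
    also have "\<dots> \<le> (C * (\<rho> / \<delta>) powr A * \<rho> powr - l) powr (1 - \<theta>) * (C' * (\<rho> / \<delta>) powr A' * \<rho> powr - l') powr \<theta>"
      using \<theta> by (intro mult_mono powr_mono2 C C' \<delta>) auto
    also have "\<dots> = C powr (1 - \<theta>) * C' powr \<theta> * ((\<rho> / \<delta>) powr (A * (1 - \<theta>)) * (\<rho> / \<delta>) powr (A' * \<theta>))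
        * (\<rho> powr (- l * (1 - \<theta>)) * \<rho> powr (- l' * \<theta>))"
      by (simp only: powr_mult powr_powr) (simp only: ac_simps)
    also have "\<dots> = C powr (1 - \<theta>) * C' powr \<theta> * (\<rho> / \<delta>) powr ((1 - \<theta>) * A + \<theta> * A') * \<rho> powr - ((1 - \<theta>) * l + \<theta> * l')"
      unfolding powr_add[symmetric] by (simp add: algebra_simps)
    finally show "?N \<le> C powr (1 - \<theta>) * C' powr \<theta> * (\<rho> / \<delta>) powr ((1 - \<theta>) * A + \<theta> * A') * \<rho> powr - ((1 - \<theta>) * l + \<theta> * l')" .
  qed simp
qed

text \<open>Intervals shorter than the least gap between n points cover at most one of them each, so
  n is at most the constant.\<close>

lemma finite_if_covering_bound_0:
  assumes E: "E \<subseteq> {1..2}" and b: "covering_bound E 0"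
  shows "finite E"
proof (rule ccontr)
  assume inf: "infinite E"
  from b obtain C where C: "\<And>\<delta>. 0 < \<delta> \<Longrightarrow> \<delta> \<le> 5 \<Longrightarrow> real (covering_number E \<delta>) \<le> C * \<delta> powr - 0"
    unfolding covering_bound_def by blast
  obtain n :: nat where n: "C < real n" using reals_Archimedean2 by blast
  obtain F where F: "finite F" "card F = n" "F \<subseteq> E" using infinite_arbitrarily_large[OF inf] by blast
  \<comment> \<open>The element 1 provides a minimum when there are no two distinct points and keeps
    d within the range of the covering bound.\<close>
  let ?D = "insert 1 ((\<lambda>(x, y). \<bar>x - y\<bar>) ` {(x, y) \<in> F \<times> F. x \<noteq> y})"
  define d where "d = Min ?D"
  have finD: "finite ?D" using F by (intro finite.insertI finite_imageI) (auto intro: finite_subset[of _ "F \<times> F"])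
  have "d \<in> ?D" unfolding d_def using finD by (intro Min_in) auto
  then have "0 < d" by auto
  have d1: "d \<le> 1" unfolding d_def using finD by (intro Min_le) auto
  have sep: "d \<le> \<bar>x - y\<bar>" if "x \<in> F" "y \<in> F" "x \<noteq> y" for x y
    unfolding d_def using finD that by (intro Min_le) auto
  obtain A where A: "finite A" "card A = covering_number E (d / 2)" "E \<subseteq> (\<Union>a\<in>A. {a..a + d / 2})"
    using covering_number_attained[OF E, of "d / 2"] \<open>0 < d\<close> by auto
  have "\<forall>x\<in>F. \<exists>a\<in>A. x \<in> {a..a + d / 2}" using A F by blast
  then obtain g where g: "\<And>x. x \<in> F \<Longrightarrow> g x \<in> A \<and> x \<in> {g x..g x + d / 2}" by metis
  have "inj_on g F"
  proof (rule inj_onI, rule ccontr)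
    fix x y assume xy: "x \<in> F" "y \<in> F" "g x = g y" "x \<noteq> y"
    then have "g y \<le> x" "x \<le> g y + d / 2" "g y \<le> y" "y \<le> g y + d / 2"
      using g[of x] g[of y] by auto
    then have "\<bar>x - y\<bar> \<le> d / 2" unfolding abs_le_iff by linarith
    then show False using sep[of x y] xy \<open>0 < d\<close> by auto
  qed
  then have "card F \<le> card A" using g A by (intro card_inj_on_le[of g]) auto
  then have "real n \<le> real (covering_number E (d / 2))" using F A by simp
  also have "\<dots> \<le> C" using C[of "d / 2"] \<open>0 < d\<close> d1 by simp
  finally show False using n by simp
qed

section \<open>Necessary conditions\<close>

lemma circle_maximal_profile_ge:
  fixes g :: "real \<Rightarrow> real"
  assumes [measurable]: "g \<in> borel_measurable borel" and g: "\<And>v. 0 \<le> g v" "\<And>v. g v \<le> M" and t: "t \<in> E"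
  shows "ennreal (1 / pi) * (\<integral>\<^sup>+\<theta>. ennreal (g ((norm x)\<^sup>2 + t\<^sup>2 - 2 * norm x * t * cos \<theta>)) * indicator {0..pi} \<theta> \<partial>lborel)
    \<le> circle_maximal E (\<lambda>x. complex_of_real (g ((norm x)\<^sup>2))) x"
proof -
  let ?f = "\<lambda>x::real^2. complex_of_real (g ((norm x)\<^sup>2))"
  let ?g = "\<lambda>y. g ((norm (x + t *\<^sub>R y))\<^sup>2)"
  have [measurable]: "?g \<in> borel_measurable circle_measure" unfolding circle_measure_def by measurable
  have "(\<integral>\<^sup>+y. ennreal (?g y) \<partial>circle_measure) \<le> (\<integral>\<^sup>+y. ennreal M \<partial>circle_measure)"
    using g by (intro nn_integral_mono ennreal_leI) auto
  also have "\<dots> = ennreal (1 / pi) * (\<integral>\<^sup>+\<theta>. ennreal M * indicator {0..pi} \<theta> \<partial>lborel)"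
    using nn_integral_circle_radial[of "\<lambda>_. ennreal M" x t] by simp
  also have "\<dots> < \<infinity>" by (simp add: nn_integral_cmult_indicator ennreal_mult_less_top)
  finally have fin: "(\<integral>\<^sup>+y. ennreal (?g y) \<partial>circle_measure) < \<infinity>" .
  have int: "integrable circle_measure ?g"
    using fin g by (intro integrableI_bounded) auto
  have int': "integrable circle_measure (\<lambda>y. ?f (x + t *\<^sub>R y))"
    using int by simp
  have "circle_avg t ?f x = complex_of_real (\<integral>y. ?g y \<partial>circle_measure)"
    unfolding circle_avg_def by simp
  then have "ennreal (norm (circle_avg t ?f x)) = ennreal (\<integral>y. ?g y \<partial>circle_measure)"
    using g by (simp add: integral_nonneg_AE)
  also have "\<dots> = (\<integral>\<^sup>+y. ennreal (?g y) \<partial>circle_measure)"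
    using int g by (intro nn_integral_eq_integral[symmetric]) auto
  also have "\<dots> = ennreal (1 / pi) * (\<integral>\<^sup>+\<theta>. ennreal (g ((norm x)\<^sup>2 + t\<^sup>2 - 2 * norm x * t * cos \<theta>)) * indicator {0..pi} \<theta> \<partial>lborel)"
    by (rule nn_integral_circle_radial[where h = "\<lambda>v. ennreal (g v)"]) measurable
  finally show ?thesis
    unfolding circle_maximal_def using int' by (intro SUP_upper2[OF t]) simp
qed

lemma enn2real_inverse_exponent:
  fixes p :: ennreal
  assumes "1 \<le> p"
  obtains "p = \<infinity>" "enn2real (1 / p) = 0" | p0 where "1 \<le> p0" "p = ennreal p0" "enn2real (1 / p) = 1 / p0"
proof (cases p)
  case (real r)
  then have r: "1 \<le> r" using assms by (simp add: ennreal_1[symmetric] del: ennreal_1)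
  have "1 / p = ennreal (1 / r)"
    using divide_ennreal[of 1 r] r real by simp
  then have "enn2real (1 / p) = 1 / r" using r by simp
  then show ?thesis using that(2)[of r] r real by simp
next
  case top
  then show ?thesis using that(1) by (simp add: ennreal_divide_top)
qed

lemma Lp_norm_indicator_le:
  assumes p: "1 \<le> p" and S: "S \<in> sets M" "emeasure M S = ennreal m" and m: "0 < m"
  shows "Lp_norm M p (indicator S) \<le> ennreal (m powr enn2real (1 / p))"
  using p
proof (cases rule: enn2real_inverse_exponent)
  case 1
  have "Inf {c. AE x in M. indicator S x \<le> c} \<le> (1::ennreal)"
    by (intro Inf_lower) (auto simp: indicator_def)
  then show ?thesis using 1 m by (simp add: Lp_norm_def)
next
  case (2 p0)
  have "ennreal_powr (indicator S x) p0 = indicator S x" for x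
    using ennreal_powr_ennreal[of 1 p0] by (simp add: indicator_def)
  then show ?thesis using 2 S m by (simp add: Lp_norm_real ennreal_powr_ennreal)
qed

text \<open>Chebyshev's inequality, by monotonicity of the integral alone because a maximal function
  may fail to be measurable. For q = \<infinity> it is enough that S has positive measure.\<close>

lemma Lp_norm_ge:
  assumes q: "1 \<le> q" and S: "S \<in> sets M" "ennreal m \<le> emeasure M S" and m: "0 < m" and c: "0 < c"
    and g: "\<And>x. x \<in> S \<Longrightarrow> ennreal c \<le> g x"
  shows "ennreal (c * m powr enn2real (1 / q)) \<le> Lp_norm M q g"
  using q
proof (cases rule: enn2real_inverse_exponent)
  case 1
  have "ennreal c \<le> Inf {c. AE x in M. g x \<le> c}"
  proof (rule Inf_greatest, rule ccontr)
    fix c' assume c': "c' \<in> {c. AE x in M. g x \<le> c}" "\<not> ennreal c \<le> c'"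
    then have "AE x in M. g x \<le> c'" by simp
    then have "AE x in M. x \<notin> S"
      by (rule eventually_mono) (use c'(2) g in \<open>meson order_trans\<close>)
    then have "emeasure M S = 0" using AE_iff_measurable[of S M "\<lambda>x. x \<notin> S"] S sets.sets_into_space[OF S(1)] by auto
    then show False using S m by simp
  qed
  then show ?thesis using 1 m by (simp add: Lp_norm_def)
next
  case (2 q0)
  have "ennreal (c powr q0) * ennreal m \<le> ennreal (c powr q0) * emeasure M S"
    by (intro mult_left_mono S) auto
  also have "\<dots> = (\<integral>\<^sup>+x. ennreal (c powr q0) * indicator S x \<partial>M)" using S by (simp add: nn_integral_cmult_indicator)
  also have "\<dots> \<le> (\<integral>\<^sup>+x. ennreal_powr (g x) q0 \<partial>M)"
  proof (intro nn_integral_mono)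
    fix x
    show "ennreal (c powr q0) * indicator S x \<le> ennreal_powr (g x) q0"
    proof (cases "x \<in> S")
      case True
      then have "ennreal_powr (ennreal c) q0 \<le> ennreal_powr (g x) q0"
        using g 2 by (intro ennreal_powr_mono) auto
      then show ?thesis using True c by (simp add: ennreal_powr_ennreal)
    qed simp
  qed
  finally have "ennreal_powr (ennreal (c powr q0) * ennreal m) (1 / q0) \<le> ennreal_powr (\<integral>\<^sup>+x. ennreal_powr (g x) q0 \<partial>M) (1 / q0)"
    using 2 by (intro ennreal_powr_mono) auto
  moreover have "ennreal_powr (ennreal (c powr q0) * ennreal m) (1 / q0) = ennreal (c * m powr (1 / q0))"
    using 2 c m by (simp add: ennreal_mult[symmetric] ennreal_powr_ennreal powr_mult powr_powr)
  ultimately show ?thesis using 2 by (simp add: Lp_norm_real)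
qed

lemma radial_profile: "radial (\<lambda>x. complex_of_real (g ((norm x)\<^sup>2)))"
  unfolding radial_def by metis

text \<open>The test function is the indicator of the points with squared radius in I, and S is a
  set where some mean is at least c. The constant C is common to all scales, so exponents can be
  compared.\<close>

lemma radially_bounded_test:
  assumes rb: "radially_bounded E p q" and p: "1 \<le> p" and q: "1 \<le> q"
  obtains C where "0 < C"
    "\<And>I (S::(real^2) set) c mi mo. I \<in> sets borel \<Longrightarrow> S \<in> sets lborel \<Longrightarrow>
       emeasure lborel {x::real^2. (norm x)\<^sup>2 \<in> I} = ennreal mi \<Longrightarrow> 0 < mi \<Longrightarrow>
       ennreal mo \<le> emeasure lborel S \<Longrightarrow> 0 < mo \<Longrightarrow> 0 < c \<Longrightarrow>
       (\<And>x. x \<in> S \<Longrightarrow> \<exists>t\<in>E. ennreal c \<le> ennreal (1 / pi) *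
          (\<integral>\<^sup>+\<theta>. indicator I ((norm x)\<^sup>2 + t\<^sup>2 - 2 * norm x * t * cos \<theta>) * indicator {0..pi} \<theta> \<partial>lborel)) \<Longrightarrow>
       c * mo powr enn2real (1 / q) \<le> C * mi powr enn2real (1 / p)"
proof -
  obtain C0 where C0: "\<And>f. f \<in> radial_Lp p \<Longrightarrow>
      Lp_norm lborel q (circle_maximal E f) \<le> ennreal C0 * Lp_norm lborel p (\<lambda>x. ennreal (norm (f x)))"
    using rb unfolding radially_bounded_def by blast
  define C where "C = max C0 1"
  have C: "0 < C" by (simp add: C_def)
  show ?thesis
  proof (rule that[OF C])
    fix I :: "real set" and S :: "(real^2) set" and c mi mo :: real
    assume I[measurable]: "I \<in> sets borel" and S: "S \<in> sets lborel"
      and mi: "emeasure lborel {x::real^2. (norm x)\<^sup>2 \<in> I} = ennreal mi" "0 < mi"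
      and mo: "ennreal mo \<le> emeasure lborel S" "0 < mo" and c: "0 < c"
      and test: "\<And>x. x \<in> S \<Longrightarrow> \<exists>t\<in>E. ennreal c \<le> ennreal (1 / pi) *
          (\<integral>\<^sup>+\<theta>. indicator I ((norm x)\<^sup>2 + t\<^sup>2 - 2 * norm x * t * cos \<theta>) * indicator {0..pi} \<theta> \<partial>lborel)"
    let ?g = "indicator I :: real \<Rightarrow> real"
    let ?f = "\<lambda>x::real^2. complex_of_real (?g ((norm x)\<^sup>2))"
    let ?S = "{x::real^2. (norm x)\<^sup>2 \<in> I}"
    have Sm: "?S \<in> sets lborel"
    proof -
      have "(\<lambda>x::real^2. (norm x)\<^sup>2) -` I \<inter> space borel \<in> sets borel" by (rule measurable_sets) measurable
      then show ?thesis by (simp add: vimage_def)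
    qed
    have nf: "(\<lambda>x. ennreal (norm (?f x))) = indicator ?S" by (auto simp: fun_eq_iff indicator_def)
    have N: "Lp_norm lborel p (\<lambda>x. ennreal (norm (?f x))) \<le> ennreal (mi powr enn2real (1 / p))"
      unfolding nf by (rule Lp_norm_indicator_le[OF p Sm mi])
    have fL: "?f \<in> radial_Lp p"
      unfolding radial_Lp_def using order.strict_trans1[OF N, of \<infinity>] by (auto simp: radial_profile)
    have "ennreal (c * mo powr enn2real (1 / q)) \<le> Lp_norm lborel q (circle_maximal E ?f)"
    proof (rule Lp_norm_ge[OF q S mo c])
      fix x assume "x \<in> S"
      then obtain t where t: "t \<in> E" "ennreal c \<le> ennreal (1 / pi) *
          (\<integral>\<^sup>+\<theta>. indicator I ((norm x)\<^sup>2 + t\<^sup>2 - 2 * norm x * t * cos \<theta>) * indicator {0..pi} \<theta> \<partial>lborel)"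
        using test by blast
      have gm: "?g \<in> borel_measurable borel" by simp
      have "ennreal (1 / pi) * (\<integral>\<^sup>+\<theta>. ennreal (?g ((norm x)\<^sup>2 + t\<^sup>2 - 2 * norm x * t * cos \<theta>)) * indicator {0..pi} \<theta> \<partial>lborel)
        \<le> circle_maximal E ?f x"
        by (rule circle_maximal_profile_ge[OF gm _ _ t(1), of 1]) (auto simp: indicator_def)
      with t(2) show "ennreal c \<le> circle_maximal E ?f x"
        by (simp add: ennreal_indicator)
    qed
    also have "\<dots> \<le> ennreal C0 * Lp_norm lborel p (\<lambda>x. ennreal (norm (?f x)))" by (rule C0[OF fL])
    also have "\<dots> \<le> ennreal C * ennreal (mi powr enn2real (1 / p))"
      by (intro mult_mono N ennreal_leI) (auto simp: C_def)
    also have "\<dots> = ennreal (C * mi powr enn2real (1 / p))" using C by (simp add: ennreal_mult)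
    finally show "c * mo powr enn2real (1 / q) \<le> C * mi powr enn2real (1 / p)"
      using C by (subst (asm) ennreal_le_iff) auto
  qed
qed

lemma exponent_le_0_if_bounded:
  fixes e K :: real
  assumes "\<And>d. 0 < d \<Longrightarrow> \<exists>\<delta>. 0 < \<delta> \<and> \<delta> < d \<and> \<delta> powr - e \<le> K"
  shows "e \<le> 0"
proof (rule ccontr)
  assume "\<not> e \<le> 0"
  then have e: "0 < e" by simp
  \<comment> \<open>The threshold is the point where \<delta>^-e equals |K| + 1.\<close>
  obtain \<delta> where \<delta>: "0 < \<delta>" "\<delta> < (\<bar>K\<bar> + 1) powr (- 1 / e)" "\<delta> powr - e \<le> K"
    using assms[of "(\<bar>K\<bar> + 1) powr (- 1 / e)"] by (auto simp: add_nonneg_eq_0_iff)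
  have "\<bar>K\<bar> + 1 = ((\<bar>K\<bar> + 1) powr (- 1 / e)) powr - e" using e by (simp add: powr_powr)
  also have "\<dots> \<le> \<delta> powr - e" using \<delta> e by (intro powr_mono2') auto
  finally show False using \<delta> by simp
qed

section \<open>Areas and arcs for the test functions\<close>

lemma emeasure_annulus:
  assumes "0 \<le> u" "u \<le> w"
  shows "emeasure lborel {x::real^2. (norm x)\<^sup>2 \<in> {u..w}} = ennreal (pi * (w - u))"
proof -
  have Sm: "{x::real^2. (norm x)\<^sup>2 \<in> {u..w}} \<in> sets lborel" by simp
  have "emeasure lborel {x::real^2. (norm x)\<^sup>2 \<in> {u..w}} = (\<integral>\<^sup>+x. indicator {x::real^2. (norm x)\<^sup>2 \<in> {u..w}} x \<partial>lborel)"
    using Sm by (subst nn_integral_indicator) auto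
  also have "\<dots> = (\<integral>\<^sup>+x. indicator {u..w} ((norm (x::real^2))\<^sup>2) \<partial>lborel)"
    by (intro nn_integral_cong) (auto simp: indicator_def)
  also have "\<dots> = (\<integral>\<^sup>+v. ennreal pi * indicator {0<..} v * indicator {u..w} v \<partial>lborel)"
    by (rule nn_integral_norm_sq_plane) measurable
  also have "\<dots> = (\<integral>\<^sup>+v. ennreal pi * indicator {u..w} v \<partial>lborel)"
  proof (intro nn_integral_cong_AE)
    have "AE v in lborel. v \<notin> {0::real}" by (intro AE_not_in finite_imp_null_set_lborel) auto
    then show "AE v in lborel. ennreal pi * indicator {0<..} v * indicator {u..w} v = ennreal pi * indicator {u..w} v"
      by eventually_elim (use assms in \<open>auto simp: indicator_def\<close>)
  qed
  also have "\<dots> = ennreal (pi * (w - u))"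
    using assms by (simp add: nn_integral_cmult_indicator ennreal_mult)
  finally show ?thesis .
qed

lemma law_of_cosines_bounds:
  fixes r t \<theta> :: real
  assumes "0 \<le> r" "0 \<le> t"
  shows "(r - t)\<^sup>2 \<le> r\<^sup>2 + t\<^sup>2 - 2 * r * t * cos \<theta>" "r\<^sup>2 + t\<^sup>2 - 2 * r * t * cos \<theta> \<le> (r + t)\<^sup>2"
    "r\<^sup>2 + t\<^sup>2 - 2 * r * t * cos \<theta> \<le> (r - t)\<^sup>2 + r * t * \<theta>\<^sup>2"
proof -
  have eq: "r\<^sup>2 + t\<^sup>2 - 2 * r * t * cos \<theta> = (r - t)\<^sup>2 + (2 * r * t) * (1 - cos \<theta>)"
    "r\<^sup>2 + t\<^sup>2 - 2 * r * t * cos \<theta> = (r + t)\<^sup>2 - (2 * r * t) * (1 + cos \<theta>)"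
    by (simp_all add: power2_eq_square algebra_simps)
  have rt: "0 \<le> 2 * r * t" using assms by simp
  show "(r - t)\<^sup>2 \<le> r\<^sup>2 + t\<^sup>2 - 2 * r * t * cos \<theta>"
    unfolding eq(1) using rt cos_le_one[of \<theta>] by simp
  have "0 \<le> 1 + cos \<theta>" using cos_ge_minus_one[of \<theta>] by linarith
  then show "r\<^sup>2 + t\<^sup>2 - 2 * r * t * cos \<theta> \<le> (r + t)\<^sup>2"
    unfolding eq(2) using rt by simp
  have "1 - cos \<theta> = 2 * (sin (\<theta> / 2))\<^sup>2" using cos_double_sin[of "\<theta> / 2"] by simp
  also have "\<bar>sin (\<theta> / 2)\<bar> \<le> \<bar>\<theta> / 2\<bar>" by (rule abs_sin_x_le_abs_x)
  then have "(sin (\<theta> / 2))\<^sup>2 \<le> (\<theta> / 2)\<^sup>2" by (rule abs_le_square_iff[THEN iffD1])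
  finally have "1 - cos \<theta> \<le> \<theta>\<^sup>2 / 2" by (simp add: power_divide)
  then have "(2 * r * t) * (1 - cos \<theta>) \<le> (2 * r * t) * (\<theta>\<^sup>2 / 2)" using rt by (rule mult_left_mono)
  then show "r\<^sup>2 + t\<^sup>2 - 2 * r * t * cos \<theta> \<le> (r - t)\<^sup>2 + r * t * \<theta>\<^sup>2" unfolding eq(1) by simp
qed

lemma full_circle_avg:
  assumes "\<And>\<theta>. \<theta> \<in> {0..pi} \<Longrightarrow> F \<theta> \<in> I"
  shows "ennreal 1 \<le> ennreal (1 / pi) * (\<integral>\<^sup>+\<theta>. indicator I (F \<theta>) * indicator {0..pi} \<theta> \<partial>lborel)"
proof -
  have "(\<integral>\<^sup>+\<theta>. indicator I (F \<theta>) * indicator {0..pi} \<theta> \<partial>lborel) = (\<integral>\<^sup>+\<theta>. indicator {0..pi} \<theta> \<partial>lborel)"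
    using assms by (intro nn_integral_cong) (auto simp: indicator_def)
  also have "\<dots> = ennreal pi" by simp
  finally show ?thesis by (simp add: ennreal_mult[symmetric])
qed

text \<open>An annulus of radius R and width 6 has measure of order R, and the means of its
  indicator are 1 on the annulus of width 2 because t \<le> 2. Letting R = 1 / \<delta> grow
  compares R^(1/q) with R^(1/p).\<close>

lemma necessary_q_ge_p:
  assumes E: "E \<noteq> {}" "E \<subseteq> {1..2}" and rb: "radially_bounded E p q" and p: "1 \<le> p" and q: "1 \<le> q"
  shows "enn2real (1 / q) \<le> enn2real (1 / p)"
proof -
  define a b where "a = enn2real (1 / p)" and "b = enn2real (1 / q)"
  obtain C where C: "0 < C" and test: "\<And>I (S::(real^2) set) c mi mo. I \<in> sets borel \<Longrightarrow> S \<in> sets lborel \<Longrightarrow>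
       emeasure lborel {x::real^2. (norm x)\<^sup>2 \<in> I} = ennreal mi \<Longrightarrow> 0 < mi \<Longrightarrow>
       ennreal mo \<le> emeasure lborel S \<Longrightarrow> 0 < mo \<Longrightarrow> 0 < c \<Longrightarrow>
       (\<And>x. x \<in> S \<Longrightarrow> \<exists>t\<in>E. ennreal c \<le> ennreal (1 / pi) *
          (\<integral>\<^sup>+\<theta>. indicator I ((norm x)\<^sup>2 + t\<^sup>2 - 2 * norm x * t * cos \<theta>) * indicator {0..pi} \<theta> \<partial>lborel)) \<Longrightarrow>
       c * mo powr b \<le> C * mi powr a"
    unfolding a_def b_def by (rule radially_bounded_test[OF rb p q]) blast
  obtain t where "t \<in> E" using E by blast
  with E have t: "t \<in> E" "1 \<le> t" "t \<le> 2" by auto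
  have "b - a \<le> 0"
  proof (rule exponent_le_0_if_bounded)
    fix d :: real assume "0 < d"
    \<comment> \<open>The bound 1/3 keeps the inner radius R - 3 nonnegative.\<close>
    define \<delta> where "\<delta> = min (d / 2) (1/3)"
    have \<delta>: "0 < \<delta>" "\<delta> < d" "\<delta> \<le> 1/3" using \<open>0 < d\<close> by (auto simp: \<delta>_def)
    define R where "R = 1 / \<delta>"
    have R: "3 \<le> R" using \<delta> by (simp add: R_def field_simps)
    have sq: "x\<^sup>2 \<le> y\<^sup>2" if "0 \<le> x" "x \<le> y" for x y :: real using that by (rule power_mono[rotated])
    have "1 * (4 * pi * R) powr b \<le> C * (12 * pi * R) powr a"
    proof (rule test[of "{(R - 3)\<^sup>2..(R + 3)\<^sup>2}" "{x. (norm x)\<^sup>2 \<in> {(R - 1)\<^sup>2..(R + 1)\<^sup>2}}"])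
      have "emeasure lborel {x::real^2. (norm x)\<^sup>2 \<in> {(R - 3)\<^sup>2..(R + 3)\<^sup>2}} = ennreal (pi * ((R + 3)\<^sup>2 - (R - 3)\<^sup>2))"
        using R by (intro emeasure_annulus sq) auto
      also have "pi * ((R + 3)\<^sup>2 - (R - 3)\<^sup>2) = 12 * pi * R" by (simp add: power2_eq_square algebra_simps)
      finally show "emeasure lborel {x::real^2. (norm x)\<^sup>2 \<in> {(R - 3)\<^sup>2..(R + 3)\<^sup>2}} = ennreal (12 * pi * R)" .
      have "emeasure lborel {x::real^2. (norm x)\<^sup>2 \<in> {(R - 1)\<^sup>2..(R + 1)\<^sup>2}} = ennreal (pi * ((R + 1)\<^sup>2 - (R - 1)\<^sup>2))"
        using R by (intro emeasure_annulus sq) auto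
      also have "pi * ((R + 1)\<^sup>2 - (R - 1)\<^sup>2) = 4 * pi * R" by (simp add: power2_eq_square algebra_simps)
      finally show "ennreal (4 * pi * R) \<le> emeasure lborel {x::real^2. (norm x)\<^sup>2 \<in> {(R - 1)\<^sup>2..(R + 1)\<^sup>2}}" by simp
      fix x :: "real^2" assume x: "x \<in> {x. (norm x)\<^sup>2 \<in> {(R - 1)\<^sup>2..(R + 1)\<^sup>2}}"
      then have "R - 1 \<le> norm x" "norm x \<le> R + 1" using R by (auto intro: power2_le_imp_le)
      then have n: "R - 3 \<le> norm x - t" "norm x + t \<le> R + 3" using t by auto
      show "\<exists>t\<in>E. ennreal 1 \<le> ennreal (1 / pi) *
          (\<integral>\<^sup>+\<theta>. indicator {(R - 3)\<^sup>2..(R + 3)\<^sup>2} ((norm x)\<^sup>2 + t\<^sup>2 - 2 * norm x * t * cos \<theta>) * indicator {0..pi} \<theta> \<partial>lborel)"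
      proof (intro bexI[OF _ t(1)] full_circle_avg)
        fix \<theta>
        have "(R - 3)\<^sup>2 \<le> (norm x - t)\<^sup>2" "(norm x + t)\<^sup>2 \<le> (R + 3)\<^sup>2"
          using n R t by (auto intro!: sq)
        then show "(norm x)\<^sup>2 + t\<^sup>2 - 2 * norm x * t * cos \<theta> \<in> {(R - 3)\<^sup>2..(R + 3)\<^sup>2}"
          using law_of_cosines_bounds[of "norm x" t \<theta>] t by auto
      qed
    qed (use R in auto)
    also have "(12 * pi * R) powr a = (12 * pi) powr a * R powr a" by (rule powr_mult)
    also have "(4 * pi * R) powr b = (4 * pi) powr b * R powr b" by (rule powr_mult)
    finally have "(4 * pi) powr b * R powr b \<le> C * ((12 * pi) powr a * R powr a)" by simp
    then have "R powr - a * ((4 * pi) powr b * R powr b) \<le> R powr - a * (C * ((12 * pi) powr a * R powr a))"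
      by (intro mult_left_mono) auto
    also have "\<dots> = C * (12 * pi) powr a * (R powr - a * R powr a)" by (simp only: ac_simps)
    also have "R powr - a * R powr a = 1" using R by (simp add: powr_add[symmetric])
    also have "R powr - a * ((4 * pi) powr b * R powr b) = (4 * pi) powr b * R powr (b - a)"
      using powr_add[of R "- a" b] by (simp add: ac_simps)
    finally have "R powr (b - a) \<le> C * (12 * pi) powr a / (4 * pi) powr b" by (simp add: field_simps)
    moreover have "R powr (b - a) = \<delta> powr - (b - a)"
    proof -
      have "R = \<delta> powr - 1" using \<delta> by (simp add: R_def powr_minus_divide)
      then have "R powr (b - a) = (\<delta> powr - 1) powr (b - a)" by (rule arg_cong)
      also have "\<dots> = \<delta> powr (- 1 * (b - a))" by (rule powr_powr)
      finally show ?thesis by simp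
    qed
    ultimately show "\<exists>\<delta>. 0 < \<delta> \<and> \<delta> < d \<and> \<delta> powr - (b - a) \<le> C * (12 * pi) powr a / (4 * pi) powr b"
      using \<delta> by auto
  qed
  then show ?thesis by (simp add: a_def b_def)
qed

text \<open>The annulus of width 2 \<delta> about the circle of radius t has measure of order
  \<delta>, and the means of its indicator are 1 on the disc of radius \<delta>, of measure of order
  \<delta>^2.\<close>

lemma necessary_q_le_2p:
  assumes E: "E \<noteq> {}" "E \<subseteq> {1..2}" and rb: "radially_bounded E p q" and p: "1 \<le> p" and q: "1 \<le> q"
  shows "enn2real (1 / p) \<le> 2 * enn2real (1 / q)"
proof -
  define a b where "a = enn2real (1 / p)" and "b = enn2real (1 / q)"
  have a0: "0 \<le> a" by (simp add: a_def)
  obtain C where C: "0 < C" and test: "\<And>I (S::(real^2) set) c mi mo. I \<in> sets borel \<Longrightarrow> S \<in> sets lborel \<Longrightarrow>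
       emeasure lborel {x::real^2. (norm x)\<^sup>2 \<in> I} = ennreal mi \<Longrightarrow> 0 < mi \<Longrightarrow>
       ennreal mo \<le> emeasure lborel S \<Longrightarrow> 0 < mo \<Longrightarrow> 0 < c \<Longrightarrow>
       (\<And>x. x \<in> S \<Longrightarrow> \<exists>t\<in>E. ennreal c \<le> ennreal (1 / pi) *
          (\<integral>\<^sup>+\<theta>. indicator I ((norm x)\<^sup>2 + t\<^sup>2 - 2 * norm x * t * cos \<theta>) * indicator {0..pi} \<theta> \<partial>lborel)) \<Longrightarrow>
       c * mo powr b \<le> C * mi powr a"
    unfolding a_def b_def by (rule radially_bounded_test[OF rb p q]) blast
  obtain t where "t \<in> E" using E by blast
  with E have t: "t \<in> E" "1 \<le> t" "t \<le> 2" by auto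
  have "a - 2 * b \<le> 0"
  proof (rule exponent_le_0_if_bounded)
    fix d :: real assume "0 < d"
    define \<delta> where "\<delta> = min (d / 2) (1/3)"
    have \<delta>: "0 < \<delta>" "\<delta> < d" "\<delta> \<le> 1/3" using \<open>0 < d\<close> by (auto simp: \<delta>_def)
    have sq: "x\<^sup>2 \<le> y\<^sup>2" if "0 \<le> x" "x \<le> y" for x y :: real using that by (rule power_mono[rotated])
    have "1 * (pi * \<delta>\<^sup>2) powr b \<le> C * (4 * pi * t * \<delta>) powr a"
    proof (rule test[of "{(t - \<delta>)\<^sup>2..(t + \<delta>)\<^sup>2}" "{x. (norm x)\<^sup>2 \<in> {0..\<delta>\<^sup>2}}"])
      have "emeasure lborel {x::real^2. (norm x)\<^sup>2 \<in> {(t - \<delta>)\<^sup>2..(t + \<delta>)\<^sup>2}} = ennreal (pi * ((t + \<delta>)\<^sup>2 - (t - \<delta>)\<^sup>2))"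
        using \<delta> t by (intro emeasure_annulus sq) auto
      also have "pi * ((t + \<delta>)\<^sup>2 - (t - \<delta>)\<^sup>2) = 4 * pi * t * \<delta>" by (simp add: power2_eq_square algebra_simps)
      finally show "emeasure lborel {x::real^2. (norm x)\<^sup>2 \<in> {(t - \<delta>)\<^sup>2..(t + \<delta>)\<^sup>2}} = ennreal (4 * pi * t * \<delta>)" .
      show "ennreal (pi * \<delta>\<^sup>2) \<le> emeasure lborel {x::real^2. (norm x)\<^sup>2 \<in> {0..\<delta>\<^sup>2}}"
        by (subst emeasure_annulus) auto
      fix x :: "real^2" assume x: "x \<in> {x. (norm x)\<^sup>2 \<in> {0..\<delta>\<^sup>2}}"
      then have n: "norm x \<le> \<delta>" using \<delta> by (auto intro: power2_le_imp_le)
      show "\<exists>t'\<in>E. ennreal 1 \<le> ennreal (1 / pi) *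
          (\<integral>\<^sup>+\<theta>. indicator {(t - \<delta>)\<^sup>2..(t + \<delta>)\<^sup>2} ((norm x)\<^sup>2 + t'\<^sup>2 - 2 * norm x * t' * cos \<theta>) * indicator {0..pi} \<theta> \<partial>lborel)"
      proof (intro bexI[OF _ t(1)] full_circle_avg)
        fix \<theta>
        have "(t - \<delta>)\<^sup>2 \<le> (t - norm x)\<^sup>2" "(norm x + t)\<^sup>2 \<le> (t + \<delta>)\<^sup>2"
          using n \<delta> t by (auto intro!: sq)
        then show "(norm x)\<^sup>2 + t\<^sup>2 - 2 * norm x * t * cos \<theta> \<in> {(t - \<delta>)\<^sup>2..(t + \<delta>)\<^sup>2}"
          using law_of_cosines_bounds[of "norm x" t \<theta>] t power2_commute[of t "norm x"] by auto
      qed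
    qed (use \<delta> t in auto)
    also have "C * (4 * pi * t * \<delta>) powr a \<le> C * (8 * pi * \<delta>) powr a"
      using C t \<delta> a0 by (intro mult_left_mono powr_mono2) auto
    also have "(8 * pi * \<delta>) powr a = (8 * pi) powr a * \<delta> powr a" by (rule powr_mult)
    also have "(pi * \<delta>\<^sup>2) powr b = pi powr b * \<delta> powr (2 * b)"
    proof -
      have "\<delta>\<^sup>2 = \<delta> powr 2" using \<delta> by (simp add: powr_numeral)
      then show ?thesis by (simp add: powr_mult powr_powr)
    qed
    finally have "pi powr b * \<delta> powr (2 * b) \<le> C * ((8 * pi) powr a * \<delta> powr a)" by simp
    then have "\<delta> powr - a * (pi powr b * \<delta> powr (2 * b)) \<le> \<delta> powr - a * (C * ((8 * pi) powr a * \<delta> powr a))"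
      by (intro mult_left_mono) auto
    also have "\<dots> = C * (8 * pi) powr a * (\<delta> powr - a * \<delta> powr a)" by simp
    also have "\<delta> powr - a * \<delta> powr a = 1" using \<delta> by (simp add: powr_add[symmetric])
    also have "\<delta> powr - a * (pi powr b * \<delta> powr (2 * b)) = pi powr b * \<delta> powr - (a - 2 * b)"
      using powr_add[of \<delta> "- a" "2 * b"] by (simp add: ac_simps)
    finally have "\<delta> powr - (a - 2 * b) \<le> C * (8 * pi) powr a / pi powr b" by (simp add: field_simps)
    then show "\<exists>\<delta>. 0 < \<delta> \<and> \<delta> < d \<and> \<delta> powr - (a - 2 * b) \<le> C * (8 * pi) powr a / pi powr b"
      using \<delta> by auto
  qed
  then show ?thesis by (simp add: a_def b_def)
qed

text \<open>U is the union of the half-open grid cells of side \<delta> that meet E. They are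
  disjoint, so the measure of U is \<delta> times their number; they cover E, so their number is at
  least the covering number.\<close>

lemma thick_neighbourhood_exists:
  assumes E: "E \<subseteq> {1..2}" and \<delta>: "0 < \<delta>" "\<delta> \<le> 1/2"
  obtains U where "U \<in> sets borel" "U \<subseteq> {1/2..5/2}" "\<And>r. r \<in> U \<Longrightarrow> \<exists>t\<in>E. \<bar>r - t\<bar> \<le> \<delta>"
    "ennreal (\<delta> * real (covering_number E \<delta>)) \<le> emeasure lborel U"
proof -
  define cell where "cell = (\<lambda>i::int. {of_int i * \<delta>..<(of_int i + 1) * \<delta>})"
  define J where "J = {i. cell i \<inter> E \<noteq> {}}"
  have inJ: "i = \<lfloor>x / \<delta>\<rfloor>" if "x \<in> cell i" for i x
  proof -
    have "of_int i \<le> x / \<delta>" "x / \<delta> < of_int i + 1" using that \<delta> by (auto simp: cell_def field_simps)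
    then show ?thesis by (intro floor_unique[symmetric]) auto
  qed
  have cellx: "x \<in> cell \<lfloor>x / \<delta>\<rfloor>" for x
  proof -
    have "of_int \<lfloor>x / \<delta>\<rfloor> \<le> x / \<delta>" "x / \<delta> < of_int \<lfloor>x / \<delta>\<rfloor> + 1" by linarith+
    then have "of_int \<lfloor>x / \<delta>\<rfloor> * \<delta> \<le> x" "x < (of_int \<lfloor>x / \<delta>\<rfloor> + 1) * \<delta>"
      using \<delta> by (simp_all only: pos_le_divide_eq pos_divide_less_eq)
    then show ?thesis by (simp add: cell_def)
  qed
  have "J \<subseteq> {\<lfloor>1 / \<delta>\<rfloor>..\<lfloor>2 / \<delta>\<rfloor>}"
  proof
    fix i assume "i \<in> J"
    then obtain x where x: "x \<in> cell i" "x \<in> E" by (auto simp: J_def)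
    then have "1 \<le> x" "x \<le> 2" using E by auto
    then show "i \<in> {\<lfloor>1 / \<delta>\<rfloor>..\<lfloor>2 / \<delta>\<rfloor>}"
      unfolding inJ[OF x(1)] using \<delta> by (auto intro!: floor_mono divide_right_mono)
  qed
  then have finJ: "finite J" by (rule finite_subset) simp
  have disj: "disjoint_family_on cell J"
    unfolding disjoint_family_on_def
  proof (intro ballI impI)
    fix i j :: int assume "i \<noteq> j"
    show "cell i \<inter> cell j = {}"
    proof (rule ccontr)
      assume "cell i \<inter> cell j \<noteq> {}"
      then obtain x where "x \<in> cell i" "x \<in> cell j" by blast
      then show False using inJ[of x i] inJ[of x j] \<open>i \<noteq> j\<close> by simp
    qed
  qed
  have near: "\<exists>t\<in>E. \<bar>r - t\<bar> \<le> \<delta>" if r: "r \<in> (\<Union>i\<in>J. cell i)" for r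
  proof -
    from r obtain i t where i: "r \<in> cell i" "t \<in> cell i" "t \<in> E" by (auto simp: J_def)
    then have "\<bar>r - t\<bar> \<le> \<delta>" by (auto simp: cell_def abs_le_iff distrib_right)
    then show ?thesis using i by blast
  qed
  show ?thesis
  proof (rule that[of "\<Union>i\<in>J. cell i"])
    show "(\<Union>i\<in>J. cell i) \<in> sets borel" using finJ by (intro sets.finite_UN) (auto simp: cell_def)
    show "(\<Union>i\<in>J. cell i) \<subseteq> {1/2..5/2}"
    proof
      fix r assume "r \<in> (\<Union>i\<in>J. cell i)"
      from near[OF this] obtain t where "t \<in> E" "\<bar>r - t\<bar> \<le> \<delta>" by blast
      moreover have "1 \<le> t" "t \<le> 2" using \<open>t \<in> E\<close> E by auto
      ultimately show "r \<in> {1/2..5/2}" using \<delta> by auto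
    qed
    show "\<exists>t\<in>E. \<bar>r - t\<bar> \<le> \<delta>" if "r \<in> (\<Union>i\<in>J. cell i)" for r using near[OF that] .
    have "covering_number E \<delta> \<le> card ((\<lambda>i. of_int i * \<delta>) ` J)"
    proof (intro covering_number_le subsetI)
      fix x assume "x \<in> E"
      then have "\<lfloor>x / \<delta>\<rfloor> \<in> J" using cellx[of x] by (auto simp: J_def)
      then show "x \<in> (\<Union>a\<in>(\<lambda>i. of_int i * \<delta>) ` J. {a..a + \<delta>})"
        using cellx[of x] by (intro UN_I[of "of_int \<lfloor>x / \<delta>\<rfloor> * \<delta>"]) (auto simp: cell_def distrib_right)
    qed (use finJ in simp)
    also have "\<dots> \<le> card J" by (rule card_image_le[OF finJ])
    finally have "\<delta> * real (covering_number E \<delta>) \<le> real (card J) * \<delta>" using \<delta> by simp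
    then have "ennreal (\<delta> * real (covering_number E \<delta>)) \<le> (\<Sum>i\<in>J. ennreal \<delta>)"
      using \<delta> by (simp add: ennreal_mult[symmetric] ennreal_of_nat_eq_real_of_nat ennreal_leI)
    also have "\<dots> = (\<Sum>i\<in>J. emeasure lborel (cell i))"
      using \<delta> by (intro sum.cong) (auto simp: cell_def algebra_simps)
    also have "\<dots> = emeasure lborel (\<Union>i\<in>J. cell i)"
      using finJ disj by (intro sum_emeasure) (auto simp: cell_def)
    finally show "ennreal (\<delta> * real (covering_number E \<delta>)) \<le> emeasure lborel (\<Union>i\<in>J. cell i)" .
  qed
qed

lemma emeasure_norm_vimage_ge:
  assumes [measurable]: "U \<in> sets borel" and U: "U \<subseteq> {1/2..}" and m: "ennreal m \<le> emeasure lborel U" "0 \<le> m"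
  shows "{x::real^2. norm x \<in> U} \<in> sets lborel" "ennreal (pi * m) \<le> emeasure lborel {x::real^2. norm x \<in> U}"
proof -
  have "(\<lambda>x::real^2. norm x) -` U \<inter> space borel \<in> sets borel" by (rule measurable_sets) measurable
  then show S: "{x::real^2. norm x \<in> U} \<in> sets lborel" by (simp add: vimage_def)
  have "ennreal (pi * m) = ennreal pi * ennreal m" using m by (simp add: ennreal_mult)
  also have "\<dots> \<le> ennreal pi * emeasure lborel U" by (intro mult_left_mono m) auto
  also have "\<dots> = (\<integral>\<^sup>+r. ennreal pi * indicator U r \<partial>lborel)" by (simp add: nn_integral_cmult_indicator)
  also have "\<dots> \<le> (\<integral>\<^sup>+r. ennreal (2 * pi * r) * indicator {0<..} r * indicator U r \<partial>lborel)"
  proof (intro nn_integral_mono)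
    fix r
    show "ennreal pi * indicator U r \<le> ennreal (2 * pi * r) * indicator {0<..} r * indicator U r"
    proof (cases "r \<in> U")
      case True
      then have "1/2 \<le> r" using U by auto
      then have "pi \<le> 2 * pi * r" using pi_gt_zero by (simp add: mult.assoc mult_left_mono)
      then show ?thesis using True \<open>1/2 \<le> r\<close> by (simp add: ennreal_leI)
    qed simp
  qed
  also have "\<dots> = (\<integral>\<^sup>+x. indicator U (norm (x::real^2)) \<partial>lborel)"
    by (rule nn_integral_norm_plane[symmetric]) measurable
  also have "\<dots> = (\<integral>\<^sup>+x. indicator {x::real^2. norm x \<in> U} x \<partial>lborel)"
    by (intro nn_integral_cong) (auto simp: indicator_def)
  also have "\<dots> = emeasure lborel {x::real^2. norm x \<in> U}" using S by simp
  finally show "ennreal (pi * m) \<le> emeasure lborel {x::real^2. norm x \<in> U}" .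
qed

text \<open>The circle of radius t about x passes within \<delta> of the origin and leaves it
  quadratically in the angle; 5 bounds r t.\<close>

lemma small_arc:
  fixes r t \<delta> \<theta> :: real
  assumes r: "r \<in> {1/2..5/2}" and t: "1 \<le> t" "t \<le> 2" and d: "\<bar>r - t\<bar> \<le> \<delta>"
  shows "r\<^sup>2 + t\<^sup>2 - 2 * r * t * cos \<theta> \<le> \<delta>\<^sup>2 + 5 * \<theta>\<^sup>2"
proof -
  have "\<bar>r - t\<bar> \<le> \<bar>\<delta>\<bar>" using d by linarith
  then have "(r - t)\<^sup>2 \<le> \<delta>\<^sup>2" by (simp only: abs_le_square_iff)
  moreover have "r * t * \<theta>\<^sup>2 \<le> 5 * \<theta>\<^sup>2"
    using r t mult_mono[of r "5/2" t 2] by (intro mult_right_mono) auto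
  ultimately show ?thesis using law_of_cosines_bounds(3)[of r t \<theta>] r t by auto
qed

text \<open>The test function is the indicator of the disc of radius 3 \<delta>. If |x| is within
  \<delta> of some t in E, all angles up to \<delta> stay in the disc as \<delta>^2 + 5 \<delta>^2
  \<le> 9 \<delta>^2, so the mean is at least \<delta> / pi. Such x fill a set of measure at least
  pi \<delta> N.\<close>

lemma covering_number_test:
  assumes E: "E \<noteq> {}" "E \<subseteq> {1..2}" and rb: "radially_bounded E p q" and p: "1 \<le> p" and q: "1 \<le> q"
    and a: "a = enn2real (1 / p)" and b: "b = enn2real (1 / q)"
  obtains K where "0 < K" "\<And>\<delta>. 0 < \<delta> \<Longrightarrow> \<delta> \<le> 1/2 \<Longrightarrow> real (covering_number E \<delta>) powr b \<le> K * \<delta> powr (2 * a - 1 - b)"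
proof -
  obtain C where C: "0 < C" and test: "\<And>I (S::(real^2) set) c mi mo. I \<in> sets borel \<Longrightarrow> S \<in> sets lborel \<Longrightarrow>
       emeasure lborel {x::real^2. (norm x)\<^sup>2 \<in> I} = ennreal mi \<Longrightarrow> 0 < mi \<Longrightarrow>
       ennreal mo \<le> emeasure lborel S \<Longrightarrow> 0 < mo \<Longrightarrow> 0 < c \<Longrightarrow>
       (\<And>x. x \<in> S \<Longrightarrow> \<exists>t\<in>E. ennreal c \<le> ennreal (1 / pi) *
          (\<integral>\<^sup>+\<theta>. indicator I ((norm x)\<^sup>2 + t\<^sup>2 - 2 * norm x * t * cos \<theta>) * indicator {0..pi} \<theta> \<partial>lborel)) \<Longrightarrow>
       c * mo powr b \<le> C * mi powr a"
    unfolding a b by (rule radially_bounded_test[OF rb p q]) blast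
  define K where "K = C * (9 * pi) powr a * pi / pi powr b"
  show ?thesis
  proof (rule that[of K])
    show "0 < K" using C by (simp add: K_def)
    fix \<delta> :: real assume \<delta>: "0 < \<delta>" "\<delta> \<le> 1/2"
    let ?N = "real (covering_number E \<delta>)"
    have N: "1 \<le> ?N" using covering_number_pos[OF E \<delta>(1)] by simp
    obtain U where U: "U \<in> sets borel" "U \<subseteq> {1/2..5/2}" "\<And>r. r \<in> U \<Longrightarrow> \<exists>t\<in>E. \<bar>r - t\<bar> \<le> \<delta>"
      "ennreal (\<delta> * ?N) \<le> emeasure lborel U"
      using thick_neighbourhood_exists[OF E(2) \<delta>] by blast
    have U': "U \<subseteq> {1/2..}" using U(2) by auto
    have "(\<delta> / pi) * (pi * (\<delta> * ?N)) powr b \<le> C * (pi * (9 * \<delta>\<^sup>2 - 0)) powr a"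
    proof (rule test[of "{0..9 * \<delta>\<^sup>2}" "{x::real^2. norm x \<in> U}"])
      show "emeasure lborel {x::real^2. (norm x)\<^sup>2 \<in> {0..9 * \<delta>\<^sup>2}} = ennreal (pi * (9 * \<delta>\<^sup>2 - 0))"
        by (rule emeasure_annulus) auto
      show "{x::real^2. norm x \<in> U} \<in> sets lborel" "ennreal (pi * (\<delta> * ?N)) \<le> emeasure lborel {x::real^2. norm x \<in> U}"
        using emeasure_norm_vimage_ge[OF U(1) U' U(4)] \<delta> by auto
      show "0 < pi * (\<delta> * ?N)" using \<delta> N by simp
      fix x :: "real^2" assume x: "x \<in> {x. norm x \<in> U}"
      then obtain t where t: "t \<in> E" "\<bar>norm x - t\<bar> \<le> \<delta>" using U(3) by blast
      have t': "1 \<le> t" "t \<le> 2" using t E by auto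
      have xr: "norm x \<in> {1/2..5/2}" using x U(2) by auto
      have "ennreal (\<delta> / pi) = ennreal (1 / pi) * ennreal \<delta>" using \<delta> by (simp add: ennreal_mult[symmetric])
      also have "ennreal \<delta> = (\<integral>\<^sup>+\<theta>. indicator {0..\<delta>} \<theta> \<partial>lborel)" using \<delta> by simp
      also have "\<dots> \<le> (\<integral>\<^sup>+\<theta>. indicator {0..9 * \<delta>\<^sup>2} ((norm x)\<^sup>2 + t\<^sup>2 - 2 * norm x * t * cos \<theta>) * indicator {0..pi} \<theta> \<partial>lborel)"
      proof (intro nn_integral_mono)
        fix \<theta>
        show "indicator {0..\<delta>} \<theta> \<le> (indicator {0..9 * \<delta>\<^sup>2} ((norm x)\<^sup>2 + t\<^sup>2 - 2 * norm x * t * cos \<theta>) * indicator {0..pi} \<theta> :: ennreal)"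
        proof (cases "\<theta> \<in> {0..\<delta>}")
          case True
          have "(norm x)\<^sup>2 + t\<^sup>2 - 2 * norm x * t * cos \<theta> \<le> \<delta>\<^sup>2 + 5 * \<theta>\<^sup>2" by (rule small_arc[OF xr t' t(2)])
          also have "\<theta>\<^sup>2 \<le> \<delta>\<^sup>2" using True by (intro power_mono) auto
          finally have "(norm x)\<^sup>2 + t\<^sup>2 - 2 * norm x * t * cos \<theta> \<le> 9 * \<delta>\<^sup>2" using zero_le_power2[of \<delta>] by linarith
          moreover have "0 \<le> (norm x)\<^sup>2 + t\<^sup>2 - 2 * norm x * t * cos \<theta>"
            by (rule order_trans[OF zero_le_power2 law_of_cosines_bounds(1)]) (use t' in auto)
          moreover have "\<theta> \<le> pi" using True \<delta> pi_ge_two by auto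
          ultimately show ?thesis using True by simp
        qed simp
      qed
      finally have "ennreal (\<delta> / pi) \<le> ennreal (1 / pi) *
          (\<integral>\<^sup>+\<theta>. indicator {0..9 * \<delta>\<^sup>2} ((norm x)\<^sup>2 + t\<^sup>2 - 2 * norm x * t * cos \<theta>) * indicator {0..pi} \<theta> \<partial>lborel)"
        by (simp add: mult_left_mono)
      then show "\<exists>t\<in>E. ennreal (\<delta> / pi) \<le> ennreal (1 / pi) *
          (\<integral>\<^sup>+\<theta>. indicator {0..9 * \<delta>\<^sup>2} ((norm x)\<^sup>2 + t\<^sup>2 - 2 * norm x * t * cos \<theta>) * indicator {0..pi} \<theta> \<partial>lborel)"
        using t(1) by blast
    qed (use \<delta> in auto)
    also have "(pi * (9 * \<delta>\<^sup>2 - 0)) powr a = (9 * pi) powr a * \<delta> powr (2 * a)"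
    proof -
      have "pi * (9 * \<delta>\<^sup>2 - 0) = (9 * pi) * \<delta> powr 2" using \<delta> by (simp add: powr_numeral)
      then have "(pi * (9 * \<delta>\<^sup>2 - 0)) powr a = ((9 * pi) * \<delta> powr 2) powr a" by (rule arg_cong)
      also have "\<dots> = (9 * pi) powr a * (\<delta> powr 2) powr a" by (rule powr_mult)
      finally show ?thesis by (simp only: powr_powr)
    qed
    also have "(pi * (\<delta> * ?N)) powr b = pi powr b * (\<delta> powr b * ?N powr b)" by (simp only: powr_mult)
    finally have le: "\<delta> / pi * (pi powr b * (\<delta> powr b * ?N powr b)) \<le> C * ((9 * pi) powr a * \<delta> powr (2 * a))" .
    have "?N powr b = (\<delta> / pi * (pi powr b * (\<delta> powr b * ?N powr b))) * (pi / pi powr b * (1 / (\<delta> * \<delta> powr b)))"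
      using \<delta> by (simp add: field_simps)
    also have "\<dots> \<le> (C * ((9 * pi) powr a * \<delta> powr (2 * a))) * (pi / pi powr b * (1 / (\<delta> * \<delta> powr b)))"
      using \<delta> by (intro mult_right_mono le) auto
    also have "\<dots> = K * (\<delta> powr (2 * a) / (\<delta> * \<delta> powr b))" by (simp add: K_def)
    also have "\<delta> powr (2 * a) / (\<delta> * \<delta> powr b) = \<delta> powr (2 * a - 1 - b)"
      using \<delta> by (simp add: powr_diff)
    finally show "?N powr b \<le> K * \<delta> powr (2 * a - 1 - b)" .
  qed
qed

text \<open>For c < \<beta> the count is at least \<delta>^-c at arbitrarily small scales, which
  decides the sign of an exponent; then c tends to \<beta>.\<close>

lemma necessary_dimension:
  assumes E: "E \<noteq> {}" "E \<subseteq> {1..2}" and rb: "radially_bounded E p q" and p: "1 \<le> p" and q: "1 \<le> q"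
    and a: "a = enn2real (1 / p)" and b: "b = enn2real (1 / q)" and beta: "ereal \<beta> = upper_minkowski_dim E"
  shows "2 * a - 1 \<le> (1 - \<beta>) * b"
proof -
  obtain K where K: "0 < K" "\<And>\<delta>. 0 < \<delta> \<Longrightarrow> \<delta> \<le> 1/2 \<Longrightarrow> real (covering_number E \<delta>) powr b \<le> K * \<delta> powr (2 * a - 1 - b)"
    using covering_number_test[OF E rb p q a b] by blast
  have b0: "0 \<le> b" by (simp add: b)
  have *: "2 * a - 1 - b + c * b \<le> 0" if c: "c < \<beta>" for c
  proof (rule exponent_le_0_if_bounded)
    fix d :: real assume d: "0 < d"
    have "ereal c < upper_minkowski_dim E" using c by (simp flip: beta)
    from covering_number_ge_if_lt_dim[OF E this, of "min d (1/2)"] d obtain \<delta> where \<delta>: "0 < \<delta>" "\<delta> < min d (1/2)"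
      "\<delta> powr - c \<le> real (covering_number E \<delta>)" by auto
    have "\<delta> powr (- c * b) = (\<delta> powr - c) powr b" by (simp add: powr_powr)
    also have "\<dots> \<le> real (covering_number E \<delta>) powr b" using \<delta> b0 by (intro powr_mono2) auto
    also have "\<dots> \<le> K * \<delta> powr (2 * a - 1 - b)" using \<delta> by (intro K) auto
    finally have "\<delta> powr (- c * b) * \<delta> powr - (2 * a - 1 - b) \<le> K * \<delta> powr (2 * a - 1 - b) * \<delta> powr - (2 * a - 1 - b)"
      by (intro mult_right_mono) auto
    also have "\<dots> = K" using \<delta> by (simp only: mult.assoc powr_add[symmetric]) simp
    also have "\<delta> powr (- c * b) * \<delta> powr - (2 * a - 1 - b) = \<delta> powr - (2 * a - 1 - b + c * b)"
      by (simp add: powr_add[symmetric] algebra_simps)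
    finally show "\<exists>\<delta>. 0 < \<delta> \<and> \<delta> < d \<and> \<delta> powr - (2 * a - 1 - b + c * b) \<le> K" using \<delta> by auto
  qed
  have "2 * a - 1 - b + \<beta> * b \<le> 0"
  proof (rule field_le_epsilon)
    fix e :: real assume e: "0 < e"
    \<comment> \<open>Dividing by b + 1 instead of b covers q = \<infinity>, where b = 0.\<close>
    have "2 * a - 1 - b + (\<beta> - e / (b + 1)) * b \<le> 0" using e b0 by (intro *) simp
    moreover have "e / (b + 1) * b \<le> e" using e b0 by (simp add: field_simps)
    ultimately show "2 * a - 1 - b + \<beta> * b \<le> 0 + e" by (simp add: algebra_simps)
  qed
  then show ?thesis by (simp add: algebra_simps)
qed

lemma SUP_finite_if_le_half:
  assumes E: "E \<noteq> {}" "E \<subseteq> {1..2}" and d: "0 < d" "d \<le> 1/2" and w0: "\<And>\<delta>. 0 < \<delta> \<Longrightarrow> \<delta> < 1 \<Longrightarrow> 0 \<le> w \<delta>"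
    and w1: "\<And>\<delta>. d < \<delta> \<Longrightarrow> \<delta> < 1 \<Longrightarrow> w \<delta> \<le> M"
    and le: "\<And>\<delta>. 0 < \<delta> \<Longrightarrow> \<delta> \<le> d \<Longrightarrow> w \<delta> * real (covering_number E \<delta>) \<le> K"
  shows "(SUP \<delta>\<in>{0<..<1}. ereal (w \<delta> * real (covering_number E \<delta>))) < \<infinity>"
proof (rule SUP_finite_if_le)
  fix \<delta> :: real assume \<delta>: "\<delta> \<in> {0<..<1}"
  show "w \<delta> * real (covering_number E \<delta>) \<le> max K (M * real (covering_number E d))"
  proof (cases "\<delta> \<le> d")
    case True
    then show ?thesis using le[of \<delta>] \<delta> by simp
  next
    case False
    then have "w \<delta> * real (covering_number E \<delta>) \<le> M * real (covering_number E d)"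
      using \<delta> d w0[of \<delta>] w1[of \<delta>] covering_number_mono[OF order_refl E(2) d(1), of \<delta>]
      by (intro mult_mono) auto
    then show ?thesis by simp
  qed
qed

text \<open>On the line the disc test reads N^b \<le> K \<delta>^(-\<beta> b), and the b-th root
  bounds \<delta>^\<beta> N.\<close>

lemma necessary_critical_line:
  assumes E: "E \<noteq> {}" "E \<subseteq> {1..2}" and rb: "radially_bounded E p q" and p: "1 \<le> p" and q: "1 \<le> q"
    and a: "a = enn2real (1 / p)" and b: "b = enn2real (1 / q)" "0 < b" and beta: "0 \<le> \<beta>"
    and line: "2 * a - 1 = (1 - \<beta>) * b"
  shows "(SUP \<delta>\<in>{0<..<1}. ereal (\<delta> powr \<beta> * real (covering_number E \<delta>))) < \<infinity>"
proof -
  obtain K where K: "0 < K" "\<And>\<delta>. 0 < \<delta> \<Longrightarrow> \<delta> \<le> 1/2 \<Longrightarrow> real (covering_number E \<delta>) powr b \<le> K * \<delta> powr (2 * a - 1 - b)"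
    using covering_number_test[OF E rb p q a b(1)] by blast
  show ?thesis
  proof (rule SUP_finite_if_le_half[OF E, of "1/2" _ 1])
    fix \<delta> :: real assume \<delta>: "0 < \<delta>" "\<delta> \<le> 1/2"
    let ?N = "real (covering_number E \<delta>)"
    have e: "2 * a - 1 - b = - \<beta> * b" using line by (simp add: algebra_simps)
    have "?N = (?N powr b) powr (1 / b)" using b by (simp add: powr_powr)
    also have "\<dots> \<le> (K * \<delta> powr (- \<beta> * b)) powr (1 / b)"
      using K(2)[OF \<delta>] b unfolding e by (intro powr_mono2) auto
    also have "\<dots> = K powr (1 / b) * (\<delta> powr (- \<beta> * b)) powr (1 / b)" by (rule powr_mult)
    also have "(\<delta> powr (- \<beta> * b)) powr (1 / b) = \<delta> powr - \<beta>" using b by (simp add: powr_powr)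
    finally have "\<delta> powr \<beta> * ?N \<le> \<delta> powr \<beta> * (K powr (1 / b) * \<delta> powr - \<beta>)" by (intro mult_left_mono) auto
    also have "\<dots> = K powr (1 / b) * (\<delta> powr \<beta> * \<delta> powr - \<beta>)" by simp
    also have "\<delta> powr \<beta> * \<delta> powr - \<beta> = 1" using \<delta> by (simp only: powr_add[symmetric]) simp
    finally show "\<delta> powr \<beta> * ?N \<le> K powr (1 / b)" by simp
  next
    fix \<delta> :: real assume "1/2 < \<delta>" "\<delta> < 1"
    then show "\<delta> powr \<beta> \<le> 1" using beta by (intro powr_le1) auto
  qed auto
qed

lemma nn_integral_inverse_affine:
  assumes "0 < \<delta>" "0 \<le> L"
  shows "(\<integral>\<^sup>+\<theta>. ennreal (1 / (\<delta> + 3 * \<theta>)) * indicator {0..L} \<theta> \<partial>lborel) = ennreal (ln ((\<delta> + 3 * L) / \<delta>) / 3)"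
proof -
  have "(\<integral>\<^sup>+\<theta>. ennreal (1 / (\<delta> + 3 * \<theta>)) * indicator {0..L} \<theta> \<partial>lborel) = ennreal (ln (\<delta> + 3 * L) / 3 - ln (\<delta> + 3 * 0) / 3)"
    using assms by (intro nn_integral_FTC_Icc) (auto intro!: derivative_eq_intros simp: field_simps)
  then show ?thesis using assms by (simp add: ln_div diff_divide_distrib)
qed

text \<open>1 / |x| on the unit disc, cut at height 1 / \<delta>, has squared L^2 norm at most of
  order L = ln (1 / \<delta>). Where |x| is within \<delta> of E, the circle at angle \<theta> is
  within \<delta> + 3 \<theta> of the origin, so the mean is at least of order L. This gives
  \<delta> N of order at most L^(-q/2), and L^(-q/2) \<le> 1 / L as q \<ge> 2.\<close>

lemma necessary_L2:
  assumes E: "E \<noteq> {}" "E \<subseteq> {1..2}" and rb: "radially_bounded E 2 (ennreal q)" and q: "2 \<le> q"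
  shows "(SUP \<delta>\<in>{0<..<1}. ereal (\<delta> * ln (1 / \<delta>) * real (covering_number E \<delta>))) < \<infinity>"
proof -
  obtain C0 where C0: "\<And>f. f \<in> radial_Lp 2 \<Longrightarrow>
      Lp_norm lborel (ennreal q) (circle_maximal E f) \<le> ennreal C0 * Lp_norm lborel 2 (\<lambda>x. ennreal (norm (f x)))"
    using rb unfolding radially_bounded_def by blast
  define C where "C = max C0 1"
  have C: "0 < C" by (simp add: C_def)
  have two: "(2::ennreal) = ennreal 2" by simp
  have ln4: "1 < ln (4::real)"
  proof -
    have "exp 1 < (4::real)" using exp_le by linarith
    then have "ln (exp 1) < ln (4::real)" by (subst ln_less_cancel_iff) auto
    then show ?thesis by simp
  qed
  define K where "K = (C * (6 * pi) * (3 * pi) powr (1/2)) powr q / pi"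
  show ?thesis
  \<comment> \<open>\<delta> \<le> 1/4 gives L \<ge> ln 4 > 1 and, for angles up to 1/6, keeps
    \<delta> + 3 \<theta> inside the unit disc.\<close>
  proof (rule SUP_finite_if_le_half[OF E, of "1/4" _ "ln 4" K])
    fix \<delta> :: real assume \<delta>: "0 < \<delta>" "\<delta> \<le> 1/4"
    let ?N = "real (covering_number E \<delta>)"
    define L where "L = ln (1 / \<delta>)"
    have "ln 4 \<le> L" using \<delta> unfolding L_def by (subst ln_le_cancel_iff) (auto simp: field_simps)
    then have L: "1 < L" using ln4 by linarith
    have N: "1 \<le> ?N" using covering_number_pos[OF E \<delta>(1)] by simp
    obtain U where U: "U \<in> sets borel" "U \<subseteq> {1/2..5/2}" "\<And>r. r \<in> U \<Longrightarrow> \<exists>t\<in>E. \<bar>r - t\<bar> \<le> \<delta>"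
      "ennreal (\<delta> * ?N) \<le> emeasure lborel U"
      using thick_neighbourhood_exists[OF E(2), of \<delta>] \<delta> by auto
    have U': "U \<subseteq> {1/2..}" using U(2) by auto
    define g where "g = (\<lambda>v::real. indicator {..1} v * (1 / max \<delta> (sqrt v)))"
    have gm[measurable]: "g \<in> borel_measurable borel" unfolding g_def by measurable
    have g0: "0 \<le> g v" for v using \<delta> by (simp add: g_def)
    have gM: "g v \<le> 1 / \<delta>" for v using \<delta> by (auto simp: g_def indicator_def intro!: divide_left_mono)
    let ?f = "\<lambda>x::real^2. complex_of_real (g ((norm x)\<^sup>2))"
    have "(\<integral>\<^sup>+x. ennreal ((g ((norm (x::real^2))\<^sup>2)) powr 2) \<partial>lborel) = (\<integral>\<^sup>+v. ennreal pi * indicator {0<..} v * ennreal (g v powr 2) \<partial>lborel)"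
      by (rule nn_integral_norm_sq_plane) measurable
    also have "\<dots> \<le> (\<integral>\<^sup>+v. ennreal pi * (ennreal (1 / \<delta>\<^sup>2) * indicator {0..\<delta>\<^sup>2} v + ennreal (1 / v) * indicator {\<delta>\<^sup>2..1} v) \<partial>lborel)"
    proof (intro nn_integral_mono)
      fix v :: real
      show "ennreal pi * indicator {0<..} v * ennreal (g v powr 2)
        \<le> ennreal pi * (ennreal (1 / \<delta>\<^sup>2) * indicator {0..\<delta>\<^sup>2} v + ennreal (1 / v) * indicator {\<delta>\<^sup>2..1} v)"
      proof (cases "0 < v \<and> v \<le> 1")
        case True
        have gv: "g v powr 2 = 1 / (max \<delta> (sqrt v))\<^sup>2" using True \<delta> g0[of v] by (simp add: g_def powr_numeral power_divide)
        show ?thesis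
        proof (cases "v \<le> \<delta>\<^sup>2")
          case le: True
          then have "sqrt v \<le> \<delta>" using \<delta> by (intro real_le_lsqrt) auto
          then have "g v powr 2 = 1 / \<delta>\<^sup>2" unfolding gv by (simp add: max_absorb1)
          then show ?thesis using True le by (simp add: distrib_left)
        next
          case gt: False
          then have "\<delta> \<le> sqrt v" by (intro real_le_rsqrt) auto
          then have "g v powr 2 = 1 / v" unfolding gv using True by (simp add: max_absorb2)
          then show ?thesis using True gt by (simp add: distrib_left)
        qed
      qed (auto simp: g_def indicator_def)
    qed
    also have "\<dots> = ennreal pi * ((\<integral>\<^sup>+v. ennreal (1 / \<delta>\<^sup>2) * indicator {0..\<delta>\<^sup>2} v \<partial>lborel) + (\<integral>\<^sup>+v. ennreal (1 / v) * indicator {\<delta>\<^sup>2..1} v \<partial>lborel))"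
      by (subst nn_integral_cmult, measurable, subst nn_integral_add) auto
    also have "(\<integral>\<^sup>+v. ennreal (1 / \<delta>\<^sup>2) * indicator {0..\<delta>\<^sup>2} v \<partial>lborel) = ennreal 1"
      using \<delta> by (simp add: nn_integral_cmult_indicator ennreal_mult[symmetric])
    also have "(\<integral>\<^sup>+v. ennreal (1 / v) * indicator {\<delta>\<^sup>2..1} v \<partial>lborel) = ennreal (ln 1 - ln (\<delta>\<^sup>2))"
    proof (rule nn_integral_FTC_Icc[where F = ln and f = "\<lambda>v. 1 / v"])
      fix v :: real assume "v \<in> {\<delta>\<^sup>2..1}"
      then have "\<delta>\<^sup>2 \<le> v" "v \<le> 1" by auto
      moreover have "0 < \<delta>\<^sup>2" using \<delta> by simp
      ultimately have "0 < v" by linarith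
      then show "(ln has_real_derivative 1 / v) (at v)" "0 \<le> 1 / v" by (auto intro!: derivative_eq_intros)
    qed (use \<delta> in \<open>auto simp: power_le_one\<close>)
    also have "ln 1 - ln (\<delta>\<^sup>2) = 2 * L" using \<delta> by (simp add: L_def ln_div ln_realpow)
    also have "ennreal pi * (ennreal 1 + ennreal (2 * L)) = ennreal (pi * (1 + 2 * L))"
    proof -
      have "ennreal 1 + ennreal (2 * L) = ennreal (1 + 2 * L)" using L by (intro ennreal_plus[symmetric]) auto
      moreover have "ennreal pi * ennreal (1 + 2 * L) = ennreal (pi * (1 + 2 * L))"
        using L by (intro ennreal_mult[symmetric]) auto
      ultimately show ?thesis by (simp only:)
    qed
    also have "\<dots> \<le> ennreal (3 * pi * L)" using L by (intro ennreal_leI) (simp add: algebra_simps)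
    finally have I: "(\<integral>\<^sup>+x. ennreal ((g ((norm (x::real^2))\<^sup>2)) powr 2) \<partial>lborel) \<le> ennreal (3 * pi * L)" .
    have "Lp_norm lborel 2 (\<lambda>x. ennreal (norm (?f x))) = ennreal_powr (\<integral>\<^sup>+x. ennreal ((g ((norm (x::real^2))\<^sup>2)) powr 2) \<partial>lborel) (1/2)"
      unfolding two using g0 by (subst Lp_norm_real) (auto simp: ennreal_powr_ennreal)
    also have "\<dots> \<le> ennreal_powr (ennreal (3 * pi * L)) (1/2)" by (intro ennreal_powr_mono I) auto
    also have "\<dots> = ennreal ((3 * pi * L) powr (1/2))" using L by (intro ennreal_powr_ennreal) auto
    finally have N2: "Lp_norm lborel 2 (\<lambda>x. ennreal (norm (?f x))) \<le> ennreal ((3 * pi * L) powr (1/2))" .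
    have fL: "?f \<in> radial_Lp 2"
      unfolding radial_Lp_def using order.strict_trans1[OF N2, of \<infinity>] by (auto simp: radial_profile)
    have q1: "1 \<le> ennreal q" using q by (simp add: ennreal_1[symmetric] del: ennreal_1)
    have eq: "enn2real (1 / ennreal q) = 1 / q"
      using q divide_ennreal[of 1 q] by simp
    have "ennreal (L / (6 * pi) * (pi * (\<delta> * ?N)) powr enn2real (1 / ennreal q)) \<le> Lp_norm lborel (ennreal q) (circle_maximal E ?f)"
    proof (rule Lp_norm_ge[OF q1, of "{x::real^2. norm x \<in> U}"])
      show "{x::real^2. norm x \<in> U} \<in> sets lborel" "ennreal (pi * (\<delta> * ?N)) \<le> emeasure lborel {x::real^2. norm x \<in> U}"
        using emeasure_norm_vimage_ge[OF U(1) U' U(4)] \<delta> by auto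
      show "0 < pi * (\<delta> * ?N)" using \<delta> N by simp
      show "0 < L / (6 * pi)" using L by simp
      fix x :: "real^2" assume x: "x \<in> {x. norm x \<in> U}"
      then obtain t where t: "t \<in> E" "\<bar>norm x - t\<bar> \<le> \<delta>" using U(3) by blast
      have t': "1 \<le> t" "t \<le> 2" using t E by auto
      have xr: "norm x \<in> {1/2..5/2}" using x U(2) by auto
      \<comment> \<open>The quotient is at least 1 / (2 \<delta>), and this is at least
        \<delta>^(-1/2) because \<delta> \<le> 1/4.\<close>
      have "L / 2 \<le> ln ((\<delta> + 3 * (1/6)) / \<delta>)"
      proof -
        have "L / 2 = ln (sqrt (1 / \<delta>))" using \<delta> by (simp add: L_def ln_sqrt)
        also have "\<dots> \<le> ln ((\<delta> + 3 * (1/6)) / \<delta>)"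
        proof (subst ln_le_cancel_iff)
          have "1 \<le> 1/2 * sqrt (1 / \<delta>)"
          proof -
            have "2 \<le> sqrt (1 / \<delta>)" using \<delta> by (intro real_le_rsqrt) (simp add: field_simps)
            then show ?thesis by simp
          qed
          then have "1 * sqrt (1 / \<delta>) \<le> (1/2 * sqrt (1 / \<delta>)) * sqrt (1 / \<delta>)" using \<delta> by (intro mult_right_mono) auto
          also have "\<dots> = 1 / (2 * \<delta>)" using \<delta> by simp
          also have "\<dots> \<le> (\<delta> + 3 * (1/6)) / \<delta>" using \<delta> by (simp add: field_simps)
          finally show "sqrt (1 / \<delta>) \<le> (\<delta> + 3 * (1/6)) / \<delta>" by simp
        qed (use \<delta> in auto)
        finally show ?thesis .
      qed
      then have "ennreal (L / (6 * pi)) \<le> ennreal (1 / pi) * ennreal (ln ((\<delta> + 3 * (1/6)) / \<delta>) / 3)"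
        by (subst ennreal_mult''[symmetric]) (use L in \<open>auto intro!: ennreal_leI simp: field_simps\<close>)
      also have "ennreal (ln ((\<delta> + 3 * (1/6)) / \<delta>) / 3) = (\<integral>\<^sup>+\<theta>. ennreal (1 / (\<delta> + 3 * \<theta>)) * indicator {0..1/6} \<theta> \<partial>lborel)"
        using \<delta> by (intro nn_integral_inverse_affine[symmetric]) auto
      also have "\<dots> \<le> (\<integral>\<^sup>+\<theta>. ennreal (g ((norm x)\<^sup>2 + t\<^sup>2 - 2 * norm x * t * cos \<theta>)) * indicator {0..pi} \<theta> \<partial>lborel)"
      proof (intro nn_integral_mono)
        fix \<theta>
        show "ennreal (1 / (\<delta> + 3 * \<theta>)) * indicator {0..1/6} \<theta>
          \<le> ennreal (g ((norm x)\<^sup>2 + t\<^sup>2 - 2 * norm x * t * cos \<theta>)) * indicator {0..pi} \<theta>"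
        proof (cases "\<theta> \<in> {0..1/6}")
          case True
          let ?v = "(norm x)\<^sup>2 + t\<^sup>2 - 2 * norm x * t * cos \<theta>"
          have "?v \<le> \<delta>\<^sup>2 + 5 * \<theta>\<^sup>2" by (rule small_arc[OF xr t' t(2)])
          also have "\<dots> \<le> (\<delta> + 3 * \<theta>)\<^sup>2"
            using True \<delta> by (simp add: power2_eq_square algebra_simps)
          finally have v: "?v \<le> (\<delta> + 3 * \<theta>)\<^sup>2" .
          have s1: "\<delta> + 3 * \<theta> \<le> 1" "0 < \<delta> + 3 * \<theta>" using True \<delta> by auto
          have "(\<delta> + 3 * \<theta>)\<^sup>2 \<le> 1" using s1 by (intro power_le_one) auto
          then have v1: "?v \<le> 1" using v by linarith
          have "sqrt ?v \<le> \<delta> + 3 * \<theta>" using v s1 by (intro real_le_lsqrt) auto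
          then have "max \<delta> (sqrt ?v) \<le> \<delta> + 3 * \<theta>" using True by simp
          then have "1 / (\<delta> + 3 * \<theta>) \<le> 1 / max \<delta> (sqrt ?v)" using \<delta> by (intro divide_left_mono mult_pos_pos) (auto simp: s1 less_max_iff_disj)
          also have "\<dots> = g ?v" using v1 by (simp add: g_def)
          finally have "ennreal (1 / (\<delta> + 3 * \<theta>)) \<le> ennreal (g ?v)" by (rule ennreal_leI)
          moreover have "\<theta> \<le> pi" using True pi_ge_two by auto
          ultimately show ?thesis using True by simp
        qed simp
      qed
      also have "ennreal (1 / pi) * \<dots> \<le> circle_maximal E ?f x"
        by (rule circle_maximal_profile_ge[OF gm g0 gM t(1)])
      finally show "ennreal (L / (6 * pi)) \<le> circle_maximal E ?f x" by (simp add: mult_left_mono)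
    qed
    also have "\<dots> \<le> ennreal C0 * Lp_norm lborel 2 (\<lambda>x. ennreal (norm (?f x)))" by (rule C0[OF fL])
    also have "\<dots> \<le> ennreal C * ennreal ((3 * pi * L) powr (1/2))"
      by (intro mult_mono N2 ennreal_leI) (auto simp: C_def)
    also have "\<dots> = ennreal (C * (3 * pi * L) powr (1/2))" using C by (simp add: ennreal_mult)
    finally have "L / (6 * pi) * (pi * (\<delta> * ?N)) powr (1 / q) \<le> C * (3 * pi * L) powr (1/2)"
      unfolding eq using C by (subst (asm) ennreal_le_iff) auto
    then have "(pi * (\<delta> * ?N)) powr (1 / q) \<le> (C * (6 * pi)) * (3 * pi * L) powr (1/2) / L"
      using L by (simp add: field_simps)
    also have "(C * (6 * pi)) * (3 * pi * L) powr (1/2) / L = C * (6 * pi) * (3 * pi) powr (1/2) * L powr (- 1/2)"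
    proof -
      have "L powr (1/2) / L = L powr (1/2 - 1)" using L by (simp only: powr_diff) simp
      then show ?thesis using powr_mult[of "3 * pi" L "1/2"] by (simp add: mult.assoc flip: times_divide_eq_right)
    qed
    finally have "((pi * (\<delta> * ?N)) powr (1 / q)) powr q \<le> (C * (6 * pi) * (3 * pi) powr (1/2) * L powr (- 1/2)) powr q"
      using q by (intro powr_mono2) auto
    also have "((pi * (\<delta> * ?N)) powr (1 / q)) powr q = pi * (\<delta> * ?N)"
      using q \<delta> by (simp add: powr_powr)
    also have "(C * (6 * pi) * (3 * pi) powr (1/2) * L powr (- 1/2)) powr q = (K * pi) * L powr (- q / 2)"
      unfolding powr_mult[of _ "L powr (- 1/2)"] powr_powr by (simp add: K_def)
    also have "\<dots> \<le> (K * pi) * L powr - 1"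
      using L q C by (intro mult_left_mono powr_mono) (auto simp: K_def)
    also have "L powr - 1 = 1 / L" using L by (simp add: powr_minus_divide)
    finally have "pi * (\<delta> * ?N) \<le> K * pi * (1 / L)" .
    then have "\<delta> * L * ?N \<le> K" using L by (simp add: field_simps)
    then show "\<delta> * ln (1 / \<delta>) * ?N \<le> K" by (simp add: L_def)
  next
    fix \<delta> :: real assume \<delta>: "1/4 < \<delta>" "\<delta> < 1"
    have "ln (1 / \<delta>) \<le> ln 4" using \<delta> by (subst ln_le_cancel_iff) (auto simp: field_simps)
    moreover have "0 \<le> ln (1 / \<delta>)" using \<delta> by (simp add: ln_div)
    ultimately show "\<delta> * ln (1 / \<delta>) \<le> ln 4" using \<delta> mult_mono[of \<delta> 1 "ln (1 / \<delta>)" "ln 4"] by simp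
  qed (auto simp: ln_div intro!: mult_nonneg_nonpos)
qed

section \<open>The type set\<close>

text \<open>For x \<noteq> 0 the mean has a density in v of mass pi / pi = 1. An almost everywhere
  bound for f is one for its profile, and the exceptional null set in v is the same for all
  t.\<close>

lemma radially_bounded_infinity:
  assumes E: "\<And>t. t \<in> E \<Longrightarrow> 0 < t"
  shows "radially_bounded E \<infinity> \<infinity>"
  unfolding radially_bounded_def
proof (intro exI[of _ 1] ballI)
  fix f assume "f \<in> radial_Lp \<infinity>"
  then have f: "f \<in> borel_measurable borel" "radial f" by (auto simp: radial_Lp_def)
  note measurable_profile[OF f(1), measurable]
  let ?\<phi> = "profile f"
  have "Inf {c. AE x in lborel. circle_maximal E f x \<le> c} \<le> Inf {c. AE x in lborel. ennreal (norm (f x)) \<le> c}"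
  proof (intro Inf_superset_mono subsetI CollectI)
    fix c assume "c \<in> {c. AE x in lborel. ennreal (norm (f x)) \<le> c}"
    then have ae: "AE x in lborel. ennreal (?\<phi> ((norm (x::real^2))\<^sup>2)) \<le> c" by (simp add: norm_eq_profile[OF f(2)])
    have "(\<integral>\<^sup>+v. ennreal pi * indicator {0<..} v * indicator {v. c < ennreal (?\<phi> v)} v \<partial>lborel)
       = (\<integral>\<^sup>+x. indicator {v. c < ennreal (?\<phi> v)} ((norm (x::real^2))\<^sup>2) \<partial>lborel)"
      by (rule nn_integral_norm_sq_plane[symmetric]) measurable
    also have "\<dots> = 0"
    proof (subst nn_integral_0_iff_AE)
      show "AE x in lborel. indicator {v. c < ennreal (?\<phi> v)} ((norm (x::real^2))\<^sup>2) = (0::ennreal)"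
        using ae by eventually_elim (simp add: indicator_def not_less)
    qed measurable
    finally have "AE v in lborel. ennreal pi * indicator {0<..} v * indicator {v. c < ennreal (?\<phi> v)} v = 0"
      by (subst (asm) nn_integral_0_iff_AE) measurable
    then have ae_v: "AE v in lborel. 0 < v \<longrightarrow> ennreal (?\<phi> v) \<le> c"
      by eventually_elim (auto simp: indicator_def not_less split: if_splits)
    have "circle_maximal E f x \<le> c" if x: "x \<noteq> 0" for x
    proof -
      have "circle_maximal E f x \<le> (SUP t\<in>E. \<integral>\<^sup>+y. ennreal (norm (f (x + t *\<^sub>R y))) \<partial>circle_measure)"
        by (rule circle_maximal_le[OF f(1)])
      also have "\<dots> \<le> c"
      proof (rule SUP_least)
        fix t assume t: "t \<in> E"
        have "(\<integral>\<^sup>+v. ennreal (circle_kernel t (norm x) v * ?\<phi> v) \<partial>lborel) \<le> (\<integral>\<^sup>+v. ennreal (circle_kernel t (norm x) v) * c \<partial>lborel)"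
        proof (intro nn_integral_mono_AE)
          show "AE v in lborel. ennreal (circle_kernel t (norm x) v * ?\<phi> v) \<le> ennreal (circle_kernel t (norm x) v) * c"
            using ae_v
          proof eventually_elim
            fix v assume v: "0 < v \<longrightarrow> ennreal (?\<phi> v) \<le> c"
            show "ennreal (circle_kernel t (norm x) v * ?\<phi> v) \<le> ennreal (circle_kernel t (norm x) v) * c"
            proof (cases "v \<in> {(norm x - t)\<^sup>2<..<(norm x + t)\<^sup>2}")
              case True
              then have "0 < v" using zero_le_power2[of "norm x - t"] by (simp only: greaterThanLessThan_iff) linarith
              then show ?thesis using v circle_kernel_nonneg by (simp add: ennreal_mult profile_nonneg mult_left_mono)
            qed (simp add: circle_kernel_def)
          qed
        qed
        also have "\<dots> = ennreal pi * c"
          using x E[OF t] by (simp add: nn_integral_multc nn_integral_circle_kernel_total)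
        finally have "ennreal (1 / pi) * (\<integral>\<^sup>+v. ennreal (circle_kernel t (norm x) v * ?\<phi> v) \<partial>lborel) \<le> ennreal (1 / pi) * (ennreal pi * c)"
          by (intro mult_left_mono) auto
        also have "\<dots> = c" by (simp add: mult.assoc[symmetric] ennreal_mult[symmetric])
        finally show "(\<integral>\<^sup>+y. ennreal (norm (f (x + t *\<^sub>R y))) \<partial>circle_measure) \<le> c"
          using x E[OF t] by (simp add: nn_integral_circle_profile[OF f])
      qed
      finally show ?thesis .
    qed
    moreover have "AE x in lborel. x \<notin> {0::real^2}" by (intro AE_not_in finite_imp_null_set_lborel) auto
    ultimately show "AE x in lborel. circle_maximal E f x \<le> c" by (auto elim: eventually_mono)
  qed
  then show "Lp_norm lborel \<infinity> (circle_maximal E f) \<le> ennreal 1 * Lp_norm lborel \<infinity> (\<lambda>x. ennreal (norm (f x)))"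
    by (simp add: Lp_norm_def)
qed

text \<open>\<open>a\<close> and \<open>b\<close> are the reciprocals of the exponents.\<close>

definition strongly_bounded :: "real set \<Rightarrow> real \<Rightarrow> real \<Rightarrow> bool" where
  "strongly_bounded E a b \<longleftrightarrow> 0 < a \<and> a \<le> 1 \<and> 0 < b \<and> b \<le> 1 \<and> kernel_bound E circle_kernel (1 / a) (1 / b)"

lemma radially_bounded_if_strongly_bounded:
  assumes "strongly_bounded E a b" "E \<subseteq> {1..2}"
  shows "radially_bounded E (ennreal (1 / a)) (ennreal (1 / b))"
proof (rule radially_bounded_if_kernel_bound)
  show "0 < t" if "t \<in> E" for t using that assms(2) by (auto dest!: subsetD)
qed (use assms in \<open>auto simp: strongly_bounded_def\<close>)

section \<open>Membership and convexity of the type set\<close>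

lemma radial_type_setI:
  assumes s: "strongly_bounded E a b" and E: "E \<subseteq> {1..2}"
  shows "(a, b) \<in> radial_type_set E"
proof -
  have ab: "0 < a" "a \<le> 1" "0 < b" "b \<le> 1" using s by (auto simp: strongly_bounded_def)
  have inv: "enn2real (1 / ennreal (1 / c)) = c" if "0 < c" for c
    using that divide_ennreal[of 1 "1 / c"] by simp
  have ge_1: "1 \<le> ennreal (1 / c)" if "0 < c" "c \<le> 1" for c
    using that by (simp add: ennreal_1[symmetric] del: ennreal_1)
  have "(a, b) = (enn2real (1 / ennreal (1 / a)), enn2real (1 / ennreal (1 / b)))" using ab by (simp only: inv)
  then show ?thesis
    unfolding radial_type_set_def using ge_1 ab radially_bounded_if_strongly_bounded[OF s E] by blast
qed

lemma zero_in_radial_type_set: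
  assumes "E \<subseteq> {1..2}"
  shows "(0, 0) \<in> radial_type_set E"
proof -
  have "radially_bounded E \<infinity> \<infinity>" using assms by (intro radially_bounded_infinity) force
  then show ?thesis unfolding radial_type_set_def
    by (auto intro!: exI[of _ "\<infinity>::ennreal"] simp: ennreal_divide_top)
qed

lemma strongly_bounded_scale:
  assumes s: "strongly_bounded E a b" and E: "E \<subseteq> {1..2}" and \<theta>: "0 < \<theta>" "\<theta> \<le> 1"
  shows "strongly_bounded E (\<theta> * a) (\<theta> * b)"
proof (cases "\<theta> = 1")
  case False
  have "kernel_bound E circle_kernel (1 / a / \<theta>) (1 / b / \<theta>)"
    by (rule kernel_bound_circle_scale) (use s E \<theta> False in \<open>force simp: strongly_bounded_def\<close>)+
  then show ?thesis using s \<theta>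
    by (auto simp: strongly_bounded_def mult_le_one mult.commute)
qed (use s in simp)

lemma strongly_bounded_interpolate:
  assumes s0: "strongly_bounded E a0 b0" and s1: "strongly_bounded E a1 b1" and \<theta>: "0 \<le> \<theta>" "\<theta> \<le> 1"
  shows "strongly_bounded E ((1 - \<theta>) * a0 + \<theta> * a1) ((1 - \<theta>) * b0 + \<theta> * b1)"
proof (cases "\<theta> = 0 \<or> \<theta> = 1")
  case False
  then have \<theta>': "0 < \<theta>" "\<theta> < 1" using \<theta> by auto
  have ab: "0 < a0" "a0 \<le> 1" "0 < b0" "b0 \<le> 1" "0 < a1" "a1 \<le> 1" "0 < b1" "b1 \<le> 1"
    using s0 s1 by (auto simp: strongly_bounded_def)
  let ?a = "(1 - \<theta>) * a0 + \<theta> * a1" and ?b = "(1 - \<theta>) * b0 + \<theta> * b1"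
  have pos: "0 < ?a" "0 < ?b" using ab \<theta>' by (auto intro!: add_pos_pos)
  have "kernel_bound E circle_kernel (1 / ?a) (1 / ?b)"
    by (rule kernel_bound_interpolate[of E _ "1 / a0" "1 / b0" "1 / a1" "1 / b1" _ _ \<theta>])
      (use s0 s1 ab pos \<theta>' circle_kernel_nonneg in \<open>auto simp: strongly_bounded_def\<close>)
  moreover have "?a \<le> 1" "?b \<le> 1" using ab \<theta>' by (auto intro!: convex_bound_le)
  ultimately show ?thesis using pos by (simp add: strongly_bounded_def)
qed (use s0 s1 in auto)

text \<open>The origin is not a point of \<open>strongly_bounded\<close>, so convex combinations
  with it are written as an interpolated point scaled by v + w.\<close>

lemma strongly_bounded_cone:
  assumes s0: "strongly_bounded E a0 b0" and s1: "strongly_bounded E a1 b1" and E: "E \<subseteq> {1..2}"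
    and vw: "0 \<le> v" "0 \<le> w" "0 < v + w" "v + w \<le> 1"
  shows "strongly_bounded E (v * a0 + w * a1) (v * b0 + w * b1)"
proof -
  let ?\<theta> = "w / (v + w)"
  have 1: "1 - ?\<theta> = v / (v + w)" using vw by (simp add: field_simps)
  have "strongly_bounded E ((v + w) * ((1 - ?\<theta>) * a0 + ?\<theta> * a1)) ((v + w) * ((1 - ?\<theta>) * b0 + ?\<theta> * b1))"
    using vw by (intro strongly_bounded_scale[OF _ E] strongly_bounded_interpolate s0 s1) auto
  moreover have "(v + w) * ((1 - ?\<theta>) * x + ?\<theta> * y) = v * x + w * y" for x y
    unfolding 1 using vw by (simp add: distrib_left)
  ultimately show ?thesis by simp
qed

text \<open>For fixed p the bounds at q = p and q = 2 p are interpolated; \<theta> solves the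
  equation for 1 / q.\<close>

lemma strongly_bounded_gt_2:
  assumes E: "E \<subseteq> {1..2}" and p: "2 < p" and pq: "p \<le> q" "q \<le> 2 * p"
  shows "strongly_bounded E (1 / p) (1 / q)"
proof -
  have s: "strongly_bounded E (1 / p) (1 / p)" "strongly_bounded E (1 / p) (1 / (2 * p))"
    using kernel_bound_gt_2[OF E p, of p] kernel_bound_gt_2[OF E p, of "2 * p"] p by (auto simp: strongly_bounded_def)
  define \<theta> where "\<theta> = 2 - 2 * p / q"
  have \<theta>: "0 \<le> \<theta>" "\<theta> \<le> 1" using p pq by (auto simp: \<theta>_def field_simps)
  have "(1 - \<theta>) * (1 / p) + \<theta> * (1 / (2 * p)) = 1 / q" using p pq by (simp add: \<theta>_def field_simps)
  moreover have "(1 - \<theta>) * (1 / p) + \<theta> * (1 / p) = 1 / p" using p by (simp add: field_simps)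
  ultimately show ?thesis using strongly_bounded_interpolate[OF s \<theta>] by simp
qed

text \<open>At p = q = 1 + b the number q (2/p - 1) has exactly the critical value 1 - b. For small
  r the global count is enough, because q/p = 1 < 2 - b. If b = 0, then p = 1 and E is
  finite.\<close>

lemma strongly_bounded_diagonal:
  assumes E: "E \<subseteq> {1..2}" and b: "covering_bound E b" "0 \<le> b" "b < 1"
  shows "strongly_bounded E (1 / (1 + b)) (1 / (1 + b))"
proof (cases "b = 0")
  case True
  then have "finite E" using finite_if_covering_bound_0[OF E] b by simp
  then have "kernel_bound E circle_kernel 1 1" by (rule kernel_bound_finite) (use E in force)
  then show ?thesis using True by (simp add: strongly_bounded_def)
next
  case False
  have "kernel_bound E circle_kernel (1 + b) (1 + b)"
  proof (rule kernel_bound_lt_2[OF E _ _ _ b(1,3) _ local_covering_bound_global[OF E b(1)]])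
    have e: "(1 + b) * (2 / (1 + b) - 1) = 1 - b" using b by (simp add: field_simps)
    show "(1 + b) * (2 / (1 + b) - 1) \<le> 1 - b" "(1 + b) * (2 / (1 + b) - 1) / 2 < 1 - b"
      unfolding e using b by auto
  qed (use b False in auto)
  then show ?thesis using b by (simp add: strongly_bounded_def)
qed

text \<open>For q = 2 p the number q (2/p - 1) is 4 - 2 p. So the critical condition is 3 + b \<le>
  2 p, and the condition on the local exponent is A < p - 1, with loss l = 0.\<close>

lemma strongly_bounded_endpoint:
  assumes E: "E \<subseteq> {1..2}" and p: "1 < p" "p < 2" and b: "covering_bound E b" "b < 1" "3 + b \<le> 2 * p"
    and gamma: "assouad_dim E < ereal (p - 1)"
  shows "strongly_bounded E (1 / p) (1 / p / 2)"
proof -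
  obtain A where A: "assouad_dim E < ereal A" "ereal A < ereal (p - 1)" using ereal_dense2[OF gamma] by blast
  have e: "2 * p * (2 / p - 1) = 4 - 2 * p" using p by (simp add: field_simps)
  have "kernel_bound E circle_kernel p (2 * p)"
    by (rule kernel_bound_lt_2[OF E p _ b(1,2) _ assouad_dimD(2)[OF E A(1)]]) (use p b A in \<open>auto simp: e\<close>)
  then show ?thesis using p by (simp add: strongly_bounded_def mult.commute)
qed

text \<open>For p > 1 + \<gamma> the number 2 p - 3 exceeds 2\<gamma> - 1 \<ge> \<beta>, so it is a
  covering exponent, and the critical condition of the endpoint bound holds with equality. If
  \<gamma> \<ge> 1, then x < 1/2, which is the range p > 2.\<close>

lemma strongly_bounded_P4:
  assumes E: "E \<noteq> {}" "E \<subseteq> {1..2}" and beta: "ereal \<beta> = upper_minkowski_dim E" and gamma: "ereal \<gamma> = assouad_dim E"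
    and \<beta>\<gamma>: "1 \<le> 2 * \<gamma> - \<beta>" and x: "0 < x" "x < 1 / (1 + \<gamma>)"
  shows "strongly_bounded E x (x / 2)"
proof -
  have "0 \<le> \<beta>" using upper_minkowski_dim_nonneg[OF E] by (simp flip: beta)
  have "\<beta> \<le> \<gamma>" using minkowski_le_assouad[OF E] by (simp flip: beta gamma)
  have px: "1 + \<gamma> < 1 / x" using x \<open>0 \<le> \<beta>\<close> \<open>\<beta> \<le> \<gamma>\<close> by (simp add: field_simps)
  show ?thesis
  proof (cases "\<gamma> < 1")
    case False
    then have "2 < 1 / x" using px by linarith
    then have "strongly_bounded E (1 / (1 / x)) (1 / (2 * (1 / x)))"
      using x by (intro strongly_bounded_gt_2 E) auto
    then show ?thesis by simp
  next
    case True
    \<comment> \<open>For \<gamma> < 1 the cap (3 + \<gamma>) / 2 lies between 1 + \<gamma> and 2.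
      If 1 / x exceeds it, the point is reached by scaling.\<close>
    define p where "p = min (1 / x) ((3 + \<gamma>) / 2)"
    have p: "1 + \<gamma> < p" "p < 2" "p \<le> 1 / x" using px True by (auto simp: p_def min_less_iff_disj)
    have "upper_minkowski_dim E < ereal (2 * p - 3)" using p \<beta>\<gamma> by (simp flip: beta)
    then have cb: "covering_bound E (2 * p - 3)" by (rule covering_bound_if_gt_dim[OF E])
    have "strongly_bounded E (1 / p) (1 / p / 2)"
      using p \<open>0 \<le> \<beta>\<close> \<open>\<beta> \<le> \<gamma>\<close> by (intro strongly_bounded_endpoint[OF E(2) _ _ cb]) (auto simp flip: gamma)
    from strongly_bounded_scale[OF this E(2), of "x * p"]
    have "strongly_bounded E (x * p * (1 / p)) (x * p * (1 / p / 2))"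
      using p x \<open>0 \<le> \<beta>\<close> \<open>\<beta> \<le> \<gamma>\<close> by (simp add: field_simps)
    then show ?thesis using p \<open>0 \<le> \<beta>\<close> \<open>\<beta> \<le> \<gamma>\<close> by simp
  qed
qed

text \<open>Here \<kappa> must exceed (1 - \<beta>) / 2 = 1 - \<gamma>, while the Assouad count asks
  for \<kappa> < 1 - \<gamma>. A share \<theta> of the global count lowers the local exponent below
  \<gamma> at the price of the loss l = \<theta> \<beta>, affordable since a / b = q / p <
  2.\<close>

lemma strongly_bounded_critical_line:
  assumes E: "E \<noteq> {}" "E \<subseteq> {1..2}" and beta: "ereal \<beta> = upper_minkowski_dim E" and gamma: "ereal \<gamma> = assouad_dim E"
    and \<beta>\<gamma>: "2 * \<gamma> - \<beta> = 1" "\<beta> < 1" and cb: "covering_bound E \<beta>"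
    and ab: "b \<le> a" "a < 2 * b" and line: "2 * a - 1 = (1 - \<beta>) * b"
  shows "strongly_bounded E a b"
proof -
  have \<beta>0: "0 \<le> \<beta>" using upper_minkowski_dim_nonneg[OF E] by (simp flip: beta)
  have b0: "0 < b" using ab by linarith
  show ?thesis
  proof (cases "a = b")
    case True
    then have "a * (1 + \<beta>) = 1" using line by (simp add: algebra_simps)
    then have "a = 1 / (1 + \<beta>)" using \<beta>0 by (simp add: field_simps)
    then show ?thesis using strongly_bounded_diagonal[OF E(2) cb \<beta>0 \<beta>\<gamma>(2)] True by simp
  next
    case False
    then have "b < a" using ab by simp
    have half: "1 < 2 * a"
    proof -
      have "0 < (1 - \<beta>) * b" using \<beta>\<gamma> b0 by simp
      then show ?thesis using line by linarith
    qed
    have a1: "a < 1"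
    proof -
      have "(1 - \<beta>) * b < (1 - \<beta>) * a" using \<open>b < a\<close> \<beta>\<gamma> by simp
      then have "a * (1 + \<beta>) < 1" using line by (simp add: algebra_simps)
      moreover have "a * 1 \<le> a * (1 + \<beta>)" using \<beta>0 half by (intro mult_left_mono) auto
      ultimately show ?thesis by simp
    qed
    define \<theta> where "\<theta> = min (1/2) ((2 - a / b) / 2)"
    have \<theta>: "0 < \<theta>" "\<theta> < 1" "\<theta> < 2 - a / b" using ab b0 by (auto simp: \<theta>_def field_simps min_def)
    \<comment> \<open>The Assouad dimension gives local bounds only above \<gamma>; this excess
      leaves the mixed exponent \<gamma> - \<theta> e, strictly below \<gamma>.\<close>
    define e where "e = \<theta> * (\<gamma> - \<beta>)"
    have gb: "0 < \<gamma> - \<beta>" "1 - \<gamma> = (1 - \<beta>) / 2" using \<beta>\<gamma> by auto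
    have e: "0 < e" using \<theta> gb by (simp add: e_def)
    have "assouad_dim E < ereal (\<gamma> + e)" using e by (simp flip: gamma)
    then have "local_covering_bound E (\<gamma> + e) 0" by (rule assouad_dimD(2)[OF E(2)])
    from local_covering_bound_interpolate[OF this local_covering_bound_global[OF E(2) cb] \<theta>(1,2)]
    have loc: "local_covering_bound E ((1 - \<theta>) * (\<gamma> + e) + \<theta> * \<beta>) (\<theta> * \<beta>)" by simp
    have q: "1 / b * (2 / (1 / a) - 1) = 1 - \<beta>" using line b0 by (simp add: field_simps)
    have "kernel_bound E circle_kernel (1 / a) (1 / b)"
    proof (rule kernel_bound_lt_2[OF E(2) _ _ _ cb \<beta>\<gamma>(2) _ loc])
      show "1 / b * (2 / (1 / a) - 1) \<le> 1 - \<beta>" unfolding q by simp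
      have "(1 - \<theta>) * (\<gamma> + e) + \<theta> * \<beta> = \<gamma> - \<theta> * e" by (simp add: e_def algebra_simps)
      then have "(1 - \<theta>) * (\<gamma> + e) + \<theta> * \<beta> < \<gamma>" using \<theta> e by simp
      then show "1 / b * (2 / (1 / a) - 1) / 2 < 1 - ((1 - \<theta>) * (\<gamma> + e) + \<theta> * \<beta>)"
        unfolding q using gb by linarith
      have "\<theta> * \<beta> \<le> \<theta> * 1" using \<theta> \<beta>\<gamma> by (intro mult_left_mono) auto
      then have "a / b < 2 - \<theta> * \<beta>" using \<theta> by linarith
      then show "1 / b / (1 / a) < 2 - \<theta> * \<beta> \<or> 1 / b = 2 * (1 / a) \<and> \<theta> * \<beta> = 0" by simp
      show "1 < 1 / a" "1 / a < 2" "1 / a \<le> 1 / b" using a1 half \<open>b < a\<close> b0 by (auto simp: field_simps)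
    qed
    then show ?thesis using a1 half \<open>b < a\<close> b0 by (simp add: strongly_bounded_def)
  qed
qed

text \<open>Barycentric coordinates of (a, b): (1 + \<beta>) (2 b - a) at P2 and (3 + \<beta>) (a -
  b) at P3. Their sum 2 a - (1 - \<beta>) b is 1 on the side between these vertices.\<close>

lemma type_triangle_combination:
  fixes a b \<beta> :: real
  assumes \<beta>: "0 \<le> \<beta>"
  shows "(3 + \<beta>) * (a - b) + (1 + \<beta>) * (2 * b - a) = 2 * a - (1 - \<beta>) * b"
    "(1 + \<beta>) * (2 * b - a) * (1 / (1 + \<beta>)) + (3 + \<beta>) * (a - b) * (2 / (3 + \<beta>)) = a"
    "(1 + \<beta>) * (2 * b - a) * (1 / (1 + \<beta>)) + (3 + \<beta>) * (a - b) * (1 / (3 + \<beta>)) = b"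
proof -
  have nz: "1 + \<beta> \<noteq> 0" "3 + \<beta> \<noteq> 0" using \<beta> by auto
  show "(3 + \<beta>) * (a - b) + (1 + \<beta>) * (2 * b - a) = 2 * a - (1 - \<beta>) * b"
    by (simp add: algebra_simps)
  have "(1 + \<beta>) * y * (1 / (1 + \<beta>)) = y" "(3 + \<beta>) * y * (2 / (3 + \<beta>)) = 2 * y" "(3 + \<beta>) * y * (1 / (3 + \<beta>)) = y" for y
    using nz by simp_all
  then show "(1 + \<beta>) * (2 * b - a) * (1 / (1 + \<beta>)) + (3 + \<beta>) * (a - b) * (2 / (3 + \<beta>)) = a"
    "(1 + \<beta>) * (2 * b - a) * (1 / (1 + \<beta>)) + (3 + \<beta>) * (a - b) * (1 / (3 + \<beta>)) = b"
    by simp_all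
qed

section \<open>The triangle and its critical side as inequalities\<close>

lemma type_triangle_iff:
  assumes \<beta>: "0 \<le> (\<beta>::real)"
  shows "(a, b) \<in> convex hull {(0, 0), (1 / (1 + \<beta>), 1 / (1 + \<beta>)), (2 / (3 + \<beta>), 1 / (3 + \<beta>))}
    \<longleftrightarrow> b \<le> a \<and> a \<le> 2 * b \<and> 2 * a - 1 \<le> (1 - \<beta>) * b" (is "?L \<longleftrightarrow> ?R")
proof
  assume ?L
  then obtain u v w where uvw: "0 \<le> u" "0 \<le> v" "0 \<le> w" "u + v + w = 1"
    and ab: "a = v * (1 / (1 + \<beta>)) + w * (2 / (3 + \<beta>))" "b = v * (1 / (1 + \<beta>)) + w * (1 / (3 + \<beta>))"
    unfolding convex_hull_3 by auto
  define x y where "x = v * (1 / (1 + \<beta>))" and "y = w * (1 / (3 + \<beta>))"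
  have xy: "0 \<le> x" "0 \<le> y" "a = x + 2 * y" "b = x + y" using uvw \<beta> ab by (auto simp: x_def y_def)
  have "x * (1 + \<beta>) = v" "y * (3 + \<beta>) = w" using \<beta> by (auto simp: x_def y_def)
  then have "x * (1 + \<beta>) + y * (3 + \<beta>) \<le> 1" using uvw by linarith
  then show ?R using xy by (simp add: algebra_simps)
next
  assume R: ?R
  let ?v = "(1 + \<beta>) * (2 * b - a)" and ?w = "(3 + \<beta>) * (a - b)"
  have "0 \<le> ?v" "0 \<le> ?w" using R \<beta> by auto
  moreover have "?v + ?w \<le> 1" using R type_triangle_combination(1)[OF \<beta>, of a b] by linarith
  ultimately show ?L
    unfolding convex_hull_3 using type_triangle_combination(2,3)[OF \<beta>, of b a]
    by (intro CollectI exI[of _ "1 - ?v - ?w"] exI[of _ ?v] exI[of _ ?w]) auto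
qed

lemma type_edge_iff:
  assumes \<beta>: "0 \<le> (\<beta>::real)"
  shows "(a, b) \<in> closed_segment (1 / (1 + \<beta>), 1 / (1 + \<beta>)) (2 / (3 + \<beta>), 1 / (3 + \<beta>))
    \<longleftrightarrow> b \<le> a \<and> a \<le> 2 * b \<and> 2 * a - 1 = (1 - \<beta>) * b" (is "?L \<longleftrightarrow> ?R")
proof
  assume ?L
  then obtain w where w: "0 \<le> w" "w \<le> 1"
    and ab: "a = (1 - w) * (1 / (1 + \<beta>)) + w * (2 / (3 + \<beta>))" "b = (1 - w) * (1 / (1 + \<beta>)) + w * (1 / (3 + \<beta>))"
    unfolding closed_segment_def by auto
  define x y where "x = (1 - w) * (1 / (1 + \<beta>))" and "y = w * (1 / (3 + \<beta>))"
  have xy: "0 \<le> x" "0 \<le> y" "a = x + 2 * y" "b = x + y" using w \<beta> ab by (auto simp: x_def y_def)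
  have "x * (1 + \<beta>) = 1 - w" "y * (3 + \<beta>) = w" using \<beta> by (auto simp: x_def y_def)
  then have "x * (1 + \<beta>) + y * (3 + \<beta>) = 1" using w by linarith
  then show ?R using xy by (simp add: algebra_simps)
next
  assume R: ?R
  let ?v = "(1 + \<beta>) * (2 * b - a)" and ?w = "(3 + \<beta>) * (a - b)"
  have vw: "0 \<le> ?v" "0 \<le> ?w" using R \<beta> by auto
  moreover have "?v + ?w = 1" using R type_triangle_combination(1)[OF \<beta>, of a b] by linarith
  ultimately have v: "1 - ?w = ?v" "?w \<le> 1" by linarith+
  show ?L
    unfolding closed_segment_def using type_triangle_combination(2,3)[OF \<beta>, of b a] vw v
    by (intro CollectI exI[of _ ?w]) auto
qed

lemma radial_type_set_necessary:
  assumes E: "E \<noteq> {}" "E \<subseteq> {1..2}" and beta: "ereal \<beta> = upper_minkowski_dim E" and T: "(a, b) \<in> radial_type_set E"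
  shows "b \<le> a" "a \<le> 2 * b" "2 * a - 1 \<le> (1 - \<beta>) * b"
    "2 * a - 1 = (1 - \<beta>) * b \<Longrightarrow> (SUP \<delta>\<in>{0<..<1}. ereal (\<delta> powr \<beta> * real (covering_number E \<delta>))) < \<infinity>"
proof -
  obtain p q where pq: "1 \<le> p" "1 \<le> q" "radially_bounded E p q" and ab: "a = enn2real (1 / p)" "b = enn2real (1 / q)"
    using T unfolding radial_type_set_def by auto
  show 1: "b \<le> a" unfolding ab by (rule necessary_q_ge_p[OF E pq(3,1,2)])
  show 2: "a \<le> 2 * b" unfolding ab by (rule necessary_q_le_2p[OF E pq(3,1,2)])
  show "2 * a - 1 \<le> (1 - \<beta>) * b" by (rule necessary_dimension[OF E pq(3,1,2) ab beta])
  have \<beta>0: "0 \<le> \<beta>" using upper_minkowski_dim_nonneg[OF E] by (simp flip: beta)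
  assume line: "2 * a - 1 = (1 - \<beta>) * b"
  have "0 \<le> b" by (simp add: ab)
  \<comment> \<open>b = 0 would force a = 0, but 2 a = 1 on the line.\<close>
  have "b \<noteq> 0" using line 1 2 by auto
  then have "0 < b" using \<open>0 \<le> b\<close> by simp
  then show "(SUP \<delta>\<in>{0<..<1}. ereal (\<delta> powr \<beta> * real (covering_number E \<delta>))) < \<infinity>"
    by (rule necessary_critical_line[OF E pq(3,1,2) ab _ \<beta>0 line])
qed

theorem theorem1p4:
  fixes E :: "real set" and \<beta> \<gamma> :: real
    and P1 P2 P3 P4 :: "real \<times> real" and \<Delta> :: "(real \<times> real) set"
  assumes E: "E \<noteq> {}" "E \<subseteq> {1..2}"
    and beta: "ereal \<beta> = upper_minkowski_dim E"
    and gamma: "ereal \<gamma> = assouad_dim E"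
    and P1: "P1 = (0, 0)"
    and P2: "P2 = (1 / (1 + \<beta>), 1 / (1 + \<beta>))"
    and P3: "P3 = (2 / (3 + \<beta>), 1 / (3 + \<beta>))"
    and P4: "P4 = (1 / (1 + \<gamma>), 1 / (2 * (1 + \<gamma>)))"
    and Delta: "\<Delta> = convex hull {P1, P2, P3}"
  shows
    "(2 * \<gamma> - \<beta> < 1 \<longrightarrow>
        (radial_type_set E = \<Delta> \<longleftrightarrow>
         (SUP \<delta>\<in>{0<..<1}. ereal (\<delta> powr \<beta> * real (covering_number E \<delta>))) < \<infinity>)) \<and>
     (2 * \<gamma> - \<beta> = 1 \<and> \<beta> < 1 \<and>
        (SUP \<delta>\<in>{0<..<1/2}. ereal (\<delta> powr \<beta> * real (covering_number E \<delta>))) < \<infinity> \<longrightarrow>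
        \<Delta> - {P3} \<subseteq> radial_type_set E \<and> radial_type_set E \<subseteq> \<Delta>) \<and>
     (2 * \<gamma> - \<beta> = 1 \<and>
        (SUP \<delta>\<in>{0<..<1}. ereal (\<delta> powr \<beta> * real (covering_number E \<delta>))) = \<infinity> \<longrightarrow>
        radial_type_set E = \<Delta> - closed_segment P2 P3) \<and>
     (2 * \<gamma> - \<beta> > 1 \<longrightarrow>
        closed_segment P1 P4 - {P4} \<subseteq> radial_type_set E) \<and>
     (\<beta> = 1 \<and>
        (SUP \<delta>\<in>{0<..<1}. ereal (\<delta> * ln (1 / \<delta>) * real (covering_number E \<delta>))) = \<infinity> \<longrightarrow>
        (\<forall>p q :: ennreal. 1 \<le> p \<and> 1 \<le> q \<longrightarrow>
           (radially_bounded E p q \<longleftrightarrow> 2 < p \<and> p \<le> q \<and> q \<le> 2 * p)))"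
proof -
  let ?T = "radial_type_set E"
  let ?S = "\<lambda>d. SUP \<delta>\<in>{0<..<d}. ereal (\<delta> powr \<beta> * real (covering_number E \<delta>))"
  have \<beta>0: "0 \<le> \<beta>" using upper_minkowski_dim_nonneg[OF E] by (simp flip: beta)
  have \<beta>\<gamma>: "\<beta> \<le> \<gamma>" using minkowski_le_assouad[OF E] by (simp flip: beta gamma)
  have tri: "(a, b) \<in> \<Delta> \<longleftrightarrow> b \<le> a \<and> a \<le> 2 * b \<and> 2 * a - 1 \<le> (1 - \<beta>) * b" for a b
    unfolding Delta P1 P2 P3 by (rule type_triangle_iff[OF \<beta>0])
  have edge: "(a, b) \<in> closed_segment P2 P3 \<longleftrightarrow> b \<le> a \<and> a \<le> 2 * b \<and> 2 * a - 1 = (1 - \<beta>) * b" for a b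
    unfolding P2 P3 by (rule type_edge_iff[OF \<beta>0])
  have necessary: "?T \<subseteq> \<Delta>"
    using radial_type_set_necessary[OF E beta] by (auto simp: tri)
  have not_edge: "?S 1 < \<infinity>" if "(a, b) \<in> ?T" "(a, b) \<in> closed_segment P2 P3" for a b
    using radial_type_set_necessary(4)[OF E beta that(1)] that(2) by (simp add: edge)

  \<comment> \<open>At P3 one has p = (3 + \<beta>) / 2, and 2\<gamma> - \<beta> < 1 says \<gamma> <
    p - 1. The cone from the origin over P2 and P3 fills \<Delta>. For the converse, P2 lies on the
    critical side.\<close>
  have part1: "?T = \<Delta> \<longleftrightarrow> ?S 1 < \<infinity>" if lt: "2 * \<gamma> - \<beta> < 1"
  proof
    assume "?T = \<Delta>"
    moreover have "P2 \<in> \<Delta>" unfolding Delta by (intro hull_inc) auto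
    moreover have "P2 \<in> closed_segment P2 P3" by simp
    ultimately show "?S 1 < \<infinity>" using not_edge by (cases P2) auto
  next
    assume "?S 1 < \<infinity>"
    then have cb: "covering_bound E \<beta>" by (rule covering_bound_if_SUP_finite[OF E(2) _ \<beta>0, rotated]) simp
    have \<beta>1: "\<beta> < 1" using lt \<beta>\<gamma> by linarith
    have s2: "strongly_bounded E (1 / (1 + \<beta>)) (1 / (1 + \<beta>))"
      by (rule strongly_bounded_diagonal[OF E(2) cb \<beta>0 \<beta>1])
    define p where "p = (3 + \<beta>) / 2"
    have "strongly_bounded E (1 / p) (1 / p / 2)"
    proof (rule strongly_bounded_endpoint[OF E(2) _ _ cb \<beta>1])
      show "assouad_dim E < ereal (p - 1)" using lt by (simp add: p_def field_simps flip: gamma)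
    qed (use \<beta>0 \<beta>1 in \<open>auto simp: p_def\<close>)
    moreover have "1 / p = 2 / (3 + \<beta>)" "1 / p / 2 = 1 / (3 + \<beta>)" using \<beta>0 by (simp_all add: p_def field_simps)
    ultimately have s3: "strongly_bounded E (2 / (3 + \<beta>)) (1 / (3 + \<beta>))" by (simp only:)
    have "\<Delta> \<subseteq> ?T"
    proof
      fix z assume "z \<in> \<Delta>"
      then obtain u v w where uvw: "0 \<le> u" "0 \<le> v" "0 \<le> w" "u + v + w = 1"
        and z: "z = (v * (1 / (1 + \<beta>)) + w * (2 / (3 + \<beta>)), v * (1 / (1 + \<beta>)) + w * (1 / (3 + \<beta>)))"
        unfolding Delta P1 P2 P3 convex_hull_3 by auto
      show "z \<in> ?T"
      proof (cases "v + w = 0")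
        case True
        then have "v = 0" "w = 0" using uvw by auto
        then show ?thesis using zero_in_radial_type_set[OF E(2)] by (simp add: z)
      next
        case False
        then show ?thesis unfolding z using uvw
          by (intro radial_type_setI[OF strongly_bounded_cone[OF s2 s3 E(2)] E(2)]) auto
      qed
    qed
    then show "?T = \<Delta>" using necessary by blast
  qed

  \<comment> \<open>As 2\<gamma> - \<beta> = 1, P4 coincides with P3, so the side q = 2 p is known
    up to that vertex. Every other point with b > 0 is scaled radially onto the critical
    side.\<close>
  have part2: "\<Delta> - {P3} \<subseteq> ?T" if eq: "2 * \<gamma> - \<beta> = 1" and \<beta>1: "\<beta> < 1" and fin: "?S (1/2) < \<infinity>"
  proof
    have cb: "covering_bound E \<beta>" by (rule covering_bound_if_SUP_finite[OF E(2) _ \<beta>0 fin]) simp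
    fix z assume "z \<in> \<Delta> - {P3}"
    then obtain a b where z: "z = (a, b)" and ab: "b \<le> a" "a \<le> 2 * b" "2 * a - 1 \<le> (1 - \<beta>) * b" and n3: "(a, b) \<noteq> P3"
      by (cases z) (auto simp: tri)
    show "z \<in> ?T"
    proof (cases "b = 0")
      case True
      then show ?thesis using ab z zero_in_radial_type_set[OF E(2)] by simp
    next
      case False
      then have b: "0 < b" using ab by linarith
      show ?thesis
      proof (cases "a = 2 * b")
        case True
        have "a * (3 + \<beta>) \<le> 2" using ab True by (simp add: algebra_simps)
        moreover have "a * (3 + \<beta>) \<noteq> 2"
        proof
          assume "a * (3 + \<beta>) = 2"
          then have "(a, b) = P3" using True \<beta>0 by (auto simp: P3 field_simps)
          then show False using n3 by simp
        qed
        ultimately have "a < 2 / (3 + \<beta>)" using \<beta>0 by (simp add: field_simps)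
        also have "2 / (3 + \<beta>) = 1 / (1 + \<gamma>)" using eq \<beta>0 \<beta>\<gamma> by (simp add: field_simps)
        finally have "strongly_bounded E a (a / 2)"
          using b True eq by (intro strongly_bounded_P4[OF E beta gamma]) auto
        then show ?thesis unfolding z using True by (intro radial_type_setI E) simp
      next
        case False
        \<comment> \<open>The linear form that is 1 on the critical side; division by it is the
          radial projection.\<close>
        define \<theta> where "\<theta> = 2 * a - (1 - \<beta>) * b"
        have \<theta>: "0 < \<theta>" "\<theta> \<le> 1"
        proof -
          have "0 \<le> \<beta> * b" using \<beta>0 b by simp
          then show "0 < \<theta>" using ab b by (simp add: \<theta>_def algebra_simps)
          show "\<theta> \<le> 1" using ab by (simp add: \<theta>_def)
        qed
        have "strongly_bounded E (a / \<theta>) (b / \<theta>)"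
        proof (rule strongly_bounded_critical_line[OF E beta gamma eq \<beta>1 cb])
          show "b / \<theta> \<le> a / \<theta>" using ab \<theta> by (simp add: divide_right_mono)
          show "a / \<theta> < 2 * (b / \<theta>)" using ab \<theta> False by (simp add: divide_strict_right_mono)
          have "2 * (a / \<theta>) - (1 - \<beta>) * (b / \<theta>) = (2 * a - (1 - \<beta>) * b) / \<theta>" by (simp add: diff_divide_distrib)
          also have "\<dots> = 1" using \<theta> by (simp flip: \<theta>_def)
          finally show "2 * (a / \<theta>) - 1 = (1 - \<beta>) * (b / \<theta>)" by simp
        qed
        from strongly_bounded_scale[OF this E(2) \<theta>] show ?thesis
          unfolding z using \<theta> by (intro radial_type_setI E) simp
      qed
    qed
  qed

  \<comment> \<open>The infinite supremum removes the closed critical side. Any other point with b >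
    0 lies on the corresponding side of a triangle shrunk by s < 1, whose vertices are reached with
    covering exponents strictly above \<beta>.\<close>
  have part3: "?T = \<Delta> - closed_segment P2 P3" if eq: "2 * \<gamma> - \<beta> = 1" and inf: "?S 1 = \<infinity>"
  proof
    show "?T \<subseteq> \<Delta> - closed_segment P2 P3"
      using necessary not_edge inf by fastforce
    \<comment> \<open>Below P2 there is room for a covering exponent b > \<beta>; if \<beta> \<ge>
      1, the point has p > 2.\<close>
    have diag: "strongly_bounded E x x" if x: "0 < x" "x < 1 / (1 + \<beta>)" for x
    proof (cases "\<beta> < 1")
      case True
      define b where "b = min ((1 + \<beta>) / 2) (1 / x - 1)"
      have b: "\<beta> < b" "b < 1" "b \<le> 1 / x - 1" using True x \<beta>0 by (auto simp: b_def field_simps min_def)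
      have "covering_bound E b" using b by (intro covering_bound_if_gt_dim[OF E]) (simp flip: beta)
      then have s: "strongly_bounded E (1 / (1 + b)) (1 / (1 + b))"
        using b \<beta>0 by (intro strongly_bounded_diagonal E) auto
      have "x * (1 + b) \<le> 1" using b x by (simp add: field_simps)
      with strongly_bounded_scale[OF s E(2), of "x * (1 + b)"] show ?thesis using b \<beta>0 x by simp
    next
      case False
      then have "x * 1 \<le> x * \<beta>" using x by (intro mult_left_mono) auto
      moreover have "x * (1 + \<beta>) < 1" using x \<beta>0 by (simp add: field_simps)
      ultimately have "x * 2 < 1" by (simp only: distrib_left)
      then have "2 < 1 / x" using x by (simp add: field_simps)
      with strongly_bounded_gt_2[OF E(2), of "1 / x" "1 / x"] show ?thesis using x by simp
    qed
    show "\<Delta> - closed_segment P2 P3 \<subseteq> ?T"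
    proof
      fix z assume "z \<in> \<Delta> - closed_segment P2 P3"
      then obtain a b where z: "z = (a, b)" and ab: "b \<le> a" "a \<le> 2 * b" "2 * a - 1 < (1 - \<beta>) * b"
        by (cases z) (auto simp: tri edge)
      show "z \<in> ?T"
      proof (cases "b = 0")
        case True
        then show ?thesis using ab z zero_in_radial_type_set[OF E(2)] by simp
      next
        case False
        then have b: "0 < b" using ab by linarith
        let ?v = "(1 + \<beta>) * (2 * b - a)" and ?w = "(3 + \<beta>) * (a - b)"
        have vw: "0 \<le> ?v" "0 \<le> ?w" using ab \<beta>0 by auto
        define s where "s = ?v + ?w"
        have s: "s = 2 * a - (1 - \<beta>) * b" using type_triangle_combination(1)[OF \<beta>0, of a b] by (simp add: s_def)
        have s01: "0 < s" "s < 1"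
        proof -
          have "0 \<le> \<beta> * b" using \<beta>0 b by simp
          then show "0 < s" using ab b by (simp add: s algebra_simps)
          show "s < 1" using ab by (simp add: s)
        qed
        have s2: "strongly_bounded E (s * (1 / (1 + \<beta>))) (s * (1 / (1 + \<beta>)))"
          using s01 \<beta>0 mult_strict_right_mono[of s 1 "1 / (1 + \<beta>)"] by (intro diag) auto
        have s3: "strongly_bounded E (s * (2 / (3 + \<beta>))) (s * (2 / (3 + \<beta>)) / 2)"
        proof (rule strongly_bounded_P4[OF E beta gamma])
          have "1 / (1 + \<gamma>) = 2 / (3 + \<beta>)" using eq \<beta>0 \<beta>\<gamma> by (simp add: field_simps)
          then show "s * (2 / (3 + \<beta>)) < 1 / (1 + \<gamma>)"
            using s01 \<beta>0 mult_strict_right_mono[of s 1 "2 / (3 + \<beta>)"] by auto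
        qed (use s01 \<beta>0 eq in auto)
        have cancel: "y / s * (s * z) = y * z" for y z using s01 by simp
        have halve: "s * (2 / (3 + \<beta>)) / 2 = s * (1 / (3 + \<beta>))" using \<beta>0 by (simp add: field_simps)
        have "strongly_bounded E (?v / s * (s * (1 / (1 + \<beta>))) + ?w / s * (s * (2 / (3 + \<beta>))))
            (?v / s * (s * (1 / (1 + \<beta>))) + ?w / s * (s * (2 / (3 + \<beta>)) / 2))"
        proof (rule strongly_bounded_cone[OF s2 s3 E(2)])
          have "?v / s + ?w / s = 1" using s01 by (simp add: s_def flip: add_divide_distrib)
          then show "0 < ?v / s + ?w / s" "?v / s + ?w / s \<le> 1" by auto
        qed (use vw s01 in auto)
        also have "?v / s * (s * (1 / (1 + \<beta>))) + ?w / s * (s * (2 / (3 + \<beta>))) = a"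
          by (simp only: cancel type_triangle_combination(2)[OF \<beta>0])
        also have "?v / s * (s * (1 / (1 + \<beta>))) + ?w / s * (s * (2 / (3 + \<beta>)) / 2) = b"
          by (simp only: halve cancel type_triangle_combination(3)[OF \<beta>0])
        finally show ?thesis unfolding z by (intro radial_type_setI E)
      qed
    qed
  qed

  \<comment> \<open>The coordinates of P4 have ratio 2, so the segment lies on q = 2 p; u = 0 is the
    pair of infinite exponents.\<close>
  have part4: "closed_segment P1 P4 - {P4} \<subseteq> ?T" if gt: "2 * \<gamma> - \<beta> > 1"
  proof
    fix z assume "z \<in> closed_segment P1 P4 - {P4}"
    then obtain u where u: "0 \<le> u" "u \<le> 1" and z': "z = (1 - u) *\<^sub>R P1 + u *\<^sub>R P4" and n4: "z \<noteq> P4"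
      unfolding closed_segment_def by blast
    have z: "z = (u * (1 / (1 + \<gamma>)), u * (1 / (1 + \<gamma>)) / 2)" by (simp add: z' P1 P4)
    have "u \<noteq> 1" using n4 by (auto simp: z P4)
    show "z \<in> ?T"
    proof (cases "u = 0")
      case True
      then show ?thesis using z zero_in_radial_type_set[OF E(2)] by simp
    next
      case False
      have "strongly_bounded E (u * (1 / (1 + \<gamma>))) (u * (1 / (1 + \<gamma>)) / 2)"
        using gt u False \<open>u \<noteq> 1\<close> \<beta>0 \<beta>\<gamma> by (intro strongly_bounded_P4[OF E beta gamma]) (auto simp: divide_strict_right_mono)
      then show ?thesis unfolding z by (intro radial_type_setI E)
    qed
  qed

  \<comment> \<open>For \<beta> = 1 the general necessary conditions read p \<ge> 2 and p \<le> q
    \<le> 2 p; the value p = 2 is excluded by the logarithmic test.\<close>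
  have part5: "radially_bounded E p q \<longleftrightarrow> 2 < p \<and> p \<le> q \<and> q \<le> 2 * p"
    if \<beta>1: "\<beta> = 1" and inf: "(SUP \<delta>\<in>{0<..<1}. ereal (\<delta> * ln (1 / \<delta>) * real (covering_number E \<delta>))) = \<infinity>"
      and pq: "1 \<le> p" "1 \<le> q" for p q :: ennreal
  proof
    assume rb: "radially_bounded E p q"
    have T: "(enn2real (1 / p), enn2real (1 / q)) \<in> ?T" using rb pq unfolding radial_type_set_def by blast
    note nec = radial_type_set_necessary(1-3)[OF E beta T]
    from pq(1) show "2 < p \<and> p \<le> q \<and> q \<le> 2 * p"
    proof (cases rule: enn2real_inverse_exponent)
      case p: 1
      from pq(2) show ?thesis
      proof (cases rule: enn2real_inverse_exponent)
        case 1
        then show ?thesis using p by (simp add: ennreal_mult_top)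
      next
        case (2 q0)
        then show ?thesis using nec p by simp
      qed
    next
      case p: (2 p0)
      from pq(2) show ?thesis
      proof (cases rule: enn2real_inverse_exponent)
        case 1
        then show ?thesis using nec p by simp
      next
        case q: (2 q0)
        have "1 / q0 \<le> 1 / p0" "1 / p0 \<le> 2 * (1 / q0)" "2 * (1 / p0) - 1 \<le> 0"
          using nec p q by (auto simp: \<beta>1)
        then have 1: "p0 \<le> q0" "q0 \<le> 2 * p0" "2 \<le> p0" using p(1) q(1) by (auto simp: field_simps)
        have "p0 \<noteq> 2"
        proof
          assume "p0 = 2"
          then have "radially_bounded E 2 (ennreal q0)" using rb p q by simp
          from necessary_L2[OF E this] 1 \<open>p0 = 2\<close> show False using inf by simp
        qed
        then have "2 < p0" using 1 by simp
        have two: "(2::ennreal) = ennreal 2" by simp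
        have "2 * ennreal p0 = ennreal (2 * p0)" using p(1) unfolding two by (subst ennreal_mult) auto
        moreover have "2 < ennreal p0" using \<open>2 < p0\<close> unfolding two by (subst ennreal_less_iff) auto
        ultimately show ?thesis using 1 p q by (simp add: ennreal_leI)
      qed
    qed
  next
    assume R: "2 < p \<and> p \<le> q \<and> q \<le> 2 * p"
    show "radially_bounded E p q"
    proof (cases p)
      case top
      then have "q = \<infinity>" using R by (simp add: top_unique)
      then show ?thesis using top radially_bounded_infinity[of E] E by force
    next
      case (real p0)
      have two: "(2::ennreal) = ennreal 2" by simp
      have t: "2 * p = ennreal (2 * p0)" using real unfolding two by (simp add: ennreal_mult)
      then obtain q0 where q0: "0 \<le> q0" "q = ennreal q0" using R by (cases q) (auto simp: top_unique)
      have "2 < p0" using R real unfolding two by (simp add: ennreal_less_iff)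
      moreover have "p0 \<le> q0" using R real q0 by simp
      moreover have "q0 \<le> 2 * p0"
      proof -
        have "ennreal q0 \<le> ennreal (2 * p0)" using R unfolding t q0 by blast
        then show ?thesis using real by (subst (asm) ennreal_le_iff) auto
      qed
      ultimately have "strongly_bounded E (1 / p0) (1 / q0)" by (rule strongly_bounded_gt_2[OF E(2)])
      from radially_bounded_if_strongly_bounded[OF this E(2)] show ?thesis using real q0 by simp
    qed
  qed

  show ?thesis using part1 part2 part3 part4 part5 necessary by blast
qed

end
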